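(* Let $\mathsf{k}$ be an infinite field and $B$ an $n\times n$ nilpotent matrix over $\mathsf{k}$ with Jordan partition $P$. Then $\min(Q(P))=\min(\lambda_U(P))=\min(\lambda(P))=\mu(P)$, where $\min$ of a partition denotes its smallest (positive) part.
   Context: The partition $Q(P)$. Let $\mathsf{k}$ be an infinite field, $P$ a partition of $n$, and $B=J_P$ the $n\times n$ nilpotent Jordan matrix with Jordan block partition $P$. Let $\mathcal{C}_B=\{A\in \mathrm{Mat}_n(\mathsf{k}): AB=BA\}$ and $\mathcal{N}_B=\{A\in\mathcal{C}_B: A^n=0\}$. $\mathcal{N}_B$ is an irreducible algebraic variety, and $Q(P)$ is the Jordan type of a generic element of $\mathcal{N}_B$, i.e. the unique partition of $n$ that is the Jordan type of all elements of some nonempty Zariski-open subset of $\mathcal{N}_B$. Partitions and poset. Write a partition as $P=(p_s^{n_s},\dots,p_1^{n_1})$ with $p_s>\cdots>p_1\ge 1$ and $n_i\ge 1$, where $n_i$ is the multiplicity of the part $p_i$. The poset $\mathcal{D}_P$ has as elements the triples $(u,p_i,k)$ with $1\le i\le s$, $1\le u\le p_i$, $1\le k\le n_i$. Its order is the partial order with the following covering relations: $(v,p_j,\ell)$ covers $(u,p_i,k)$ if and only if one of the following holds: ($\alpha$) $j=i+1$, $v=u+p_{i+1}-p_i$, $\ell=1$, $k=n_i$; ($\beta$) $j=i-1$, $v=u$, $\ell=1$, $k=n_i$; ($e$) $j=i$, $v=u$, $\ell=k+1$; ($\omega$) $j=i$, neither $p_i+1$ nor $p_i-1$ is a part of $P$,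 $v=u+1$, $\ell=1$, $k=n_i$. The partition $\lambda(P)$. $\lambda(P)=(\lambda_1,\lambda_2,\dots)$ with $\lambda_k=c_k-c_{k-1}$, where $c_k$ is the maximum cardinality of a union of $k$ chains in $\mathcal{D}_P$ (and $c_0=0$). $U$-chains and $\lambda_U(P)$. For a positive integer $m$ and a set $A=\{a_1,a_1+1,\dots,a_m,a_m+1\}\subset\mathbb{N}$ with $a_1<a_1+1<a_2<a_2+1<\cdots<a_m<a_m+1$, the $m$-$U$-chain is $U_A=\bigcup_{i=1}^m S_{A;i}$, where $$S_{A;i}=\{(u,p,k)\in\mathcal{D}_P : p\in\{a_i,a_i+1\},\ i\le u\le p-i+1\}\cup\{(u,p,k)\in\mathcal{D}_P : p>a_i+1,\ u\in\{i,p-i+1\}\}.$$ Let $u_0=0$ and, for $k\ge1$, let $u_k$ be the maximum cardinality of a $k$-$U$-chain in $\mathcal{D}_P$. Then $\lambda_U(P)=(\lambda_{U,1},\lambda_{U,2},\dots)$ with $\lambda_{U,k}=u_k-u_{k-1}$. It has exactly $r(P)$ (nonzero) parts (with $r(P)$ defined below), and $\min(\lambda_U(P))=\lambda_{U,r(P)}$. The number $r(P)$. A partition is almost rectangular if its largest and smallest parts differ by at most $1$. $r(P)$ is the minimum number of almost rectangular subpartitions in a decomposition of $P$ as a union (multiset union of parts) of almost rectangular subpartitions. The invariant $\mu(P)$. An $s$-spread (or spread) is a partition $P=(p_s^{n_s},\dots,p_1^{n_1})$ with $p_1>0$, $p_{i+1}=p_i+1$ for $1\le i<s$, and $n_i>0$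 for all $i$; then $r(P)=\lceil s/2\rceil$. For an $s$-spread with smallest part $p=p_1$, put $n_{s+1}=0$ and $\mu(P)=\min\{p\,n_{2i-1}+(p+1)\,n_{2j} : 1\le i\le j\le r(P)\}$. For an arbitrary partition write $P=P_\ell\cup\cdots\cup P_1$ where each $P_k$ is a spread and the largest part of $P_k$ is at most the smallest part of $P_{k+1}$ minus $2$. With $\bar r_k=\sum_{i=1}^{k-1} r(P_i)$, define $\mu(P)=\min\{\mu(P_k-2\bar r_k): 1\le k\le \ell\}$, where $P-c$ denotes the partition obtained from $P$ by subtracting $c$ from each part. *)

theory Defs
  imports "Jordan_Normal_Form.Jordan_Normal_Form" "HOL-Library.Multiset"
begin

text \<open>
  A partition is the multiset of its (positive) parts; the multiplicity of the part \<open>p\<close> is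
  \<open>count P p\<close>.  Partitions given by differences of a numerical invariant
  are sequences \<open>nat \<Rightarrow> nat\<close>, indexed from 1 and eventually zero.
\<close>

definition min_part :: "nat multiset \<Rightarrow> nat" where
  "min_part P = Min (set_mset P)"

definition min_part_seq :: "(nat \<Rightarrow> nat) \<Rightarrow> nat" where
  "min_part_seq f = Min {f k | k. 1 \<le> k \<and> 0 < f k}"


section \<open>The generic Jordan type in the nilpotent commutator\<close>

definition nilpotent_mat :: "'a::semiring_1 mat \<Rightarrow> bool" where
  "nilpotent_mat B \<longleftrightarrow> square_mat B \<and> (\<exists>m. B ^\<^sub>m m = 0\<^sub>m (dim_row B) (dim_row B))"

text \<open>
  Since \<open>jordan_nf\<close> requires block sizes to be nonzero, all parts of \<open>P\<close> are positive and sum up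
  to the size of the matrix.
\<close>

definition has_jordan_type :: "'a::semiring_1 mat \<Rightarrow> nat multiset \<Rightarrow> bool" where
  "has_jordan_type A P \<longleftrightarrow> (\<exists>ps. mset ps = P \<and> jordan_nf A (map (\<lambda>p. (p, 0)) ps))"

definition nilpotent_jordan_matrix :: "nat multiset \<Rightarrow> 'a::semiring_1 mat" where
  "nilpotent_jordan_matrix P =
     jordan_matrix (map (\<lambda>p. (p, 0)) (rev (sorted_list_of_multiset P)))"

definition commutator_mats :: "'a::semiring_1 mat \<Rightarrow> 'a mat set" where
  "commutator_mats B = {A \<in> carrier_mat (dim_row B) (dim_row B). A * B = B * A}"

definition nilpotent_commutator :: "'a::semiring_1 mat \<Rightarrow> 'a mat set" where
  "nilpotent_commutator B =
     {A \<in> commutator_mats B. A ^\<^sub>m (dim_row B) = 0\<^sub>m (dim_row B) (dim_row B)}"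

text \<open>Functions on \<open>n \<times> n\<close> matrices that are polynomial in the matrix entries.\<close>

inductive polynomial_mat_function :: "nat \<Rightarrow> ('a::comm_semiring_1 mat \<Rightarrow> 'a) \<Rightarrow> bool"
  for n :: nat where
  const: "polynomial_mat_function n (\<lambda>_. c)"
| entry: "i < n \<Longrightarrow> j < n \<Longrightarrow> polynomial_mat_function n (\<lambda>A. A $$ (i, j))"
| add: "polynomial_mat_function n f \<Longrightarrow> polynomial_mat_function n g \<Longrightarrow>
    polynomial_mat_function n (\<lambda>A. f A + g A)"
| mult: "polynomial_mat_function n f \<Longrightarrow> polynomial_mat_function n g \<Longrightarrow>
    polynomial_mat_function n (\<lambda>A. f A * g A)"

text \<open>
  \<open>U\<close> is open in the subspace topology that \<open>X\<close> inherits from the Zariski topology on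
  \<open>n \<times> n\<close> matrices: its complement in \<open>X\<close> is the common zero locus of a set of polynomials.
\<close>

definition zariski_open_in :: "nat \<Rightarrow> 'a::comm_semiring_1 mat set \<Rightarrow> 'a mat set \<Rightarrow> bool" where
  "zariski_open_in n X U \<longleftrightarrow>
     (\<exists>F. (\<forall>f\<in>F. polynomial_mat_function n f) \<and> U = X - {A \<in> X. \<forall>f\<in>F. f A = 0})"

text \<open>The partition \<open>Q(P)\<close>; the field is passed as a type argument.\<close>

definition generic_partition :: "'a::field itself \<Rightarrow> nat multiset \<Rightarrow> nat multiset" where
  "generic_partition _ P =
     (THE Q. \<exists>U. zariski_open_in (sum_mset P)
                   (nilpotent_commutator (nilpotent_jordan_matrix P :: 'a mat)) U \<and>
                 U \<noteq> {} \<and> (\<forall>A\<in>U. has_jordan_type A Q))"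


section \<open>The poset \<open>D\<^sub>P\<close> and the partition \<open>\<lambda>(P)\<close>\<close>

definition poset_elems :: "nat multiset \<Rightarrow> (nat \<times> nat \<times> nat) set" where
  "poset_elems P = {(u, p, k). p \<in># P \<and> 1 \<le> u \<and> u \<le> p \<and> 1 \<le> k \<and> k \<le> count P p}"

text \<open>\<open>q\<close> is the next larger part after \<open>p\<close>, i.e. \<open>p = p\<^sub>i\<close> and \<open>q = p\<^bsub>i+1\<^esub>\<close> for some \<open>i\<close>.\<close>

definition next_part :: "nat multiset \<Rightarrow> nat \<Rightarrow> nat \<Rightarrow> bool" where
  "next_part P p q \<longleftrightarrow> p \<in># P \<and> q \<in># P \<and> p < q \<and> \<not> (\<exists>r. r \<in># P \<and> p < r \<and> r < q)"

text \<open>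
  The pairs \<open>((u, p, k), (v, q, l))\<close> such that \<open>(v, q, l)\<close> covers \<open>(u, p, k)\<close>; the four disjuncts
  are the relations \<open>\<alpha>\<close>, \<open>\<beta>\<close>, \<open>e\<close> and \<open>\<omega>\<close>.  In the last one, \<open>p - 1\<close> is never a
  truncated difference, since parts are positive.
\<close>

definition poset_covers :: "nat multiset \<Rightarrow> ((nat \<times> nat \<times> nat) \<times> (nat \<times> nat \<times> nat)) set" where
  "poset_covers P =
     {((u, p, k), (v, q, l)) | u p k v q l.
        (u, p, k) \<in> poset_elems P \<and> (v, q, l) \<in> poset_elems P \<and>
        (next_part P p q \<and> v = u + (q - p) \<and> l = 1 \<and> k = count P p \<or>
         next_part P q p \<and> v = u \<and> l = 1 \<and> k = count P p \<or>
         q = p \<and> v = u \<and> l = k + 1 \<or>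
         q = p \<and> p + 1 \<notin># P \<and> p - 1 \<notin># P \<and> v = u + 1 \<and> l = 1 \<and> k = count P p)}"

definition poset_order :: "nat multiset \<Rightarrow> ((nat \<times> nat \<times> nat) \<times> (nat \<times> nat \<times> nat)) set" where
  "poset_order P = Restr ((poset_covers P)\<^sup>*) (poset_elems P)"

text \<open>
  Elements of \<open>Chains (poset_order P)\<close> are subsets of \<open>poset_elems P\<close>.  The chains
  \<open>C i\<close> may be empty or coincide, so \<open>max_chain_union P k\<close> is monotone in \<open>k\<close> and the
  subtraction below does not truncate.
\<close>

definition max_chain_union :: "nat multiset \<Rightarrow> nat \<Rightarrow> nat" where
  "max_chain_union P k =
     Max {card (\<Union>i<k. C i) | C. \<forall>i<k. C i \<in> Chains (poset_order P)}"

definition lambda_part :: "nat multiset \<Rightarrow> nat \<Rightarrow> nat" where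
  "lambda_part P k = max_chain_union P k - max_chain_union P (k - 1)"


section \<open>\<open>U\<close>-chains and \<open>\<lambda>\<^sub>U(P)\<close>\<close>

text \<open>
  The set \<open>A\<close> is given by the function \<open>a\<close> with values \<open>a 1, \<dots>, a m\<close>.  The condition
  \<open>u + i = p + 1\<close> expresses \<open>u = p - i + 1\<close> over the integers, and \<open>u + i \<le> p + 1\<close>
  likewise expresses \<open>u \<le> p - i + 1\<close>.
\<close>

definition U_chain_level :: "nat multiset \<Rightarrow> (nat \<Rightarrow> nat) \<Rightarrow> nat \<Rightarrow> (nat \<times> nat \<times> nat) set" where
  "U_chain_level P a i =
     {(u, p, k). (u, p, k) \<in> poset_elems P \<and> p \<in> {a i, a i + 1} \<and> i \<le> u \<and> u + i \<le> p + 1} \<union>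
     {(u, p, k). (u, p, k) \<in> poset_elems P \<and> p > a i + 1 \<and> (u = i \<or> u + i = p + 1)}"

definition U_chain :: "nat multiset \<Rightarrow> nat \<Rightarrow> (nat \<Rightarrow> nat) \<Rightarrow> (nat \<times> nat \<times> nat) set" where
  "U_chain P m a = (\<Union>i\<in>{1..m}. U_chain_level P a i)"

text \<open>
  For \<open>m = 0\<close> this is 0.  It is monotone in \<open>m\<close>: values of \<open>a\<close> beyond the largest part
  contribute empty levels.
\<close>

definition max_U_chain :: "nat multiset \<Rightarrow> nat \<Rightarrow> nat" where
  "max_U_chain P m =
     Max {card (U_chain P m a) | a. \<forall>i. 1 \<le> i \<and> i < m \<longrightarrow> a i + 1 < a (i + 1)}"

definition lambda_U_part :: "nat multiset \<Rightarrow> nat \<Rightarrow> nat" where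
  "lambda_U_part P k = max_U_chain P k - max_U_chain P (k - 1)"


section \<open>The invariants \<open>r(P)\<close> and \<open>\<mu>(P)\<close>\<close>

definition almost_rectangular :: "nat multiset \<Rightarrow> bool" where
  "almost_rectangular P \<longleftrightarrow> (\<forall>p\<in>#P. \<forall>q\<in>#P. p \<le> q + 1)"

definition r_index :: "nat multiset \<Rightarrow> nat" where
  "r_index P =
     (LEAST m. \<exists>Ps. length Ps = m \<and> (\<forall>R\<in>set Ps. almost_rectangular R) \<and> sum_list Ps = P)"

definition spread :: "nat multiset \<Rightarrow> bool" where
  "spread P \<longleftrightarrow> (\<exists>p s. 0 < p \<and> 1 \<le> s \<and> set_mset P = {p..<p + s})"

text \<open>
  With smallest part \<open>p\<close>, the multiplicity \<open>n\<^sub>i\<close> is \<open>count P (p + i - 1)\<close>, which also gives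
  \<open>n\<^bsub>s+1\<^esub> = 0\<close>.
\<close>

definition mu_spread :: "nat multiset \<Rightarrow> nat" where
  "mu_spread P =
     (let p = Min (set_mset P); n = (\<lambda>i. count P (p + i - 1))
      in Min {p * n (2 * i - 1) + (p + 1) * n (2 * j) | i j. 1 \<le> i \<and> i \<le> j \<and> j \<le> r_index P})"

text \<open>
  The list \<open>[P\<^sub>1, \<dots>, P\<^sub>l]\<close> of the spreads making up \<open>P\<close>, in order of increasing parts.  It is
  unique, as its entries are the restrictions of \<open>P\<close> to the maximal intervals of its set of parts.
\<close>

definition spread_decomposition :: "nat multiset \<Rightarrow> nat multiset list" where
  "spread_decomposition P =
     (THE Ps. (\<forall>R\<in>set Ps. spread R) \<and> sum_list Ps = P \<and>
        successively (\<lambda>R S. Max (set_mset R) + 2 \<le> Min (set_mset S)) Ps)"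

text \<open>
  List positions start at 0, so \<open>Ps ! k\<close> is \<open>P\<^bsub>k+1\<^esub>\<close>.  The subtraction of \<open>2 * (\<Sum>i<k. \<dots>)\<close>
  does not truncate, and leaves positive parts: an \<open>s\<close>-spread \<open>R\<close> satisfies
  \<open>2 * r_index R \<le> s + 1\<close>, and between consecutive spreads at least one value is skipped.
\<close>

definition mu :: "nat multiset \<Rightarrow> nat" where
  "mu P =
     (let Ps = spread_decomposition P
      in Min {mu_spread (image_mset (\<lambda>p. p - 2 * (\<Sum>i<k. r_index (Ps ! i))) (Ps ! k)) | k.
                k < length Ps})"

end

theory Submission
  imports Defs "Jordan_Normal_Form.Jordan_Normal_Form_Existence"
begin

text \<open>
  All four numbers are the value of one minimal cut.  Cover the parts of \<open>P\<close> greedily from below by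
  pairs of consecutive values \<open>a t, a t + 1\<close>, where \<open>t\<close> runs from 1 to \<open>r\<close>.  In level \<open>t\<close> the part \<open>a t\<close>
  keeps \<open>lanes t = a t + 2 - 2 * t\<close> rows.  For two levels with equally many lanes, the rows of the lower value at
  the first and of the upper value at the second form a cut, and \<open>min_cut\<close> is the size of the smallest cut.

  For \<open>\<mu>\<close> this is a matter of unfolding (\<open>greedy_cover_mu\<close>): the levels inside one spread have equally many
  lanes, and a cut across spreads is never better than one inside.

  For \<open>\<lambda>\<close> and \<open>\<lambda>\<^sub>U\<close>, shifting the pairs of a minimal cut by one gives \<open>r - 1\<close> levels missing only the
  cut, while a weighting of the poset shows that \<open>r - 1\<close> chains always miss at least that many elements
  (\<open>chain_union_le\<close>, \<open>max_union_last\<close>).  That earlier parts are at least as large is seen for \<open>\<lambda>\<^sub>U\<close> by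
  adding levels (\<open>U_chain_gain\<close>), and for \<open>\<lambda>\<close> by recognising \<open>\<lambda>\<close> as the generic Jordan type of the matrices
  supported on the strict order (\<open>lambda_part_sorted\<close>).

  For \<open>Q(P)\<close>, Jordan types are read off from bordered determinants: \<open>defect A m d\<close> says that
  \<open>z - A\<close> can be bordered by \<open>m\<close> rows and columns so that \<open>z\<^sup>d\<close> occurs in the determinant, and the least
  such \<open>d\<close> is the sum of all but the \<open>m\<close> largest Jordan blocks.  On an irreducible family the least defects are attained
  simultaneously on an open set (\<open>generic_jordan_type\<close>), and the nilpotent commutator is irreducible since its
  elements are conjugate, inside the commutator, to matrices supported on the strict order
  (\<open>nilcomm_irreducible\<close>).  Such matrices obey the bound by chains.  Conversely, for a U-chain of
  \<open>m\<close> levels there is a commuting nilpotent matrix whose defect is the number of elements outside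
  (\<open>level_defect\<close>): its determinant contains the term of a permutation that follows one path per level,
  and weights on some of the edges prevent cancellation, because a permutation along the same arcs that
  uses the weighted edges equally often is the same one (\<open>rerouting_unique\<close>).  Hence \<open>Q(P)\<close> has \<open>r\<close> parts, and the last one
  is \<open>min_cut\<close>.
\<close>

section \<open>Bordered determinants\<close>

text \<open>
  Adding the variable to the first \<open>n\<close> diagonal entries only, so that the border stays constant.
\<close>

definition zdiag :: "nat \<Rightarrow> 'a::comm_ring_1 mat \<Rightarrow> 'a poly mat" where
  "zdiag n N = mat (dim_row N) (dim_row N)
     (\<lambda>(i, j). if i = j \<and> i < n then [:N $$ (i, j), 1:] else [:N $$ (i, j):])"

text \<open>
  Bordering \<open>z - A\<close> by \<open>m\<close> extra rows and columns of constants gives a polynomial in \<open>z\<close>.  Which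
  degrees can occur measures how much of \<open>A\<close> is left after a perturbation of rank \<open>m\<close>: for nilpotent
  \<open>A\<close> the least one is the sum of all but the \<open>m\<close> largest Jordan blocks.  The condition is the
  nonvanishing of a polynomial in the entries of \<open>A\<close> once the border is chosen, which makes
  it usable for generic matrices.
\<close>

definition defect :: "'a::comm_ring_1 mat \<Rightarrow> nat \<Rightarrow> nat \<Rightarrow> bool" where
  "defect A m d \<longleftrightarrow> (\<exists>N \<in> carrier_mat (dim_row A + m) (dim_row A + m).
     (\<forall>i<dim_row A. \<forall>j<dim_row A. N $$ (i, j) = - A $$ (i, j)) \<and>
     coeff (det (zdiag (dim_row A) N)) d \<noteq> 0)"

lemma zdiag_carrier [simp]: "N \<in> carrier_mat k k \<Longrightarrow> zdiag n N \<in> carrier_mat k k"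
  by (simp add: zdiag_def)

lemma coeff_signof_mult: "coeff (signof p * q) d = signof p * (coeff q d :: 'a::comm_ring_1)"
  by (cases "sign p = 1") (auto simp: sign_def)

lemma prod_const_pCons: "(\<Prod>i\<in>I. [:c i:]) = [:(\<Prod>i\<in>I. c i) :: 'a::comm_ring_1:]"
  by (induction I rule: infinite_finite_induct) auto

lemma coeff_prod_fixed:
  fixes c :: "'b \<Rightarrow> 'a::comm_ring_1"
  assumes "finite I"
  shows "coeff (\<Prod>i\<in>I. if i \<in> F then [:0, 1:] else [:c i:]) d
       = (if card (I \<inter> F) = d then \<Prod>i\<in>I - F. c i else 0)"
proof -
  have "(\<Prod>i\<in>I. if i \<in> F then [:0, 1:] else [:c i:])
      = (\<Prod>i\<in>I \<inter> F. [:0, 1:]) * (\<Prod>i\<in>I - F. [:c i:])"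
    using prod.If_cases[OF assms, of "\<lambda>i. i \<in> F" "\<lambda>_. [:0,1:]" "\<lambda>i. [:c i:]"]
    by (simp add: Diff_eq Int_def Compl_eq)
  also have "\<dots> = monom (\<Prod>i\<in>I - F. c i) (card (I \<inter> F))"
    by (simp add: prod_const_pCons monom_altdef mult.commute)
  finally show ?thesis by simp
qed

text \<open>
  In the Leibniz expansion a fixed point \<open>i < n\<close> of the permutation contributes exactly one factor
  \<open>z\<close>, since the diagonal vanishes there; all other factors are constants.
\<close>

lemma coeff_det_zdiag:
  fixes N :: "'a::comm_ring_1 mat"
  assumes N: "N \<in> carrier_mat k k" and diag: "\<And>i. i < n \<Longrightarrow> N $$ (i, i) = 0" and "n \<le> k"
  shows "coeff (det (zdiag n N)) d =
    (\<Sum>p | p permutes {0..<k} \<and> card {i. i < n \<and> p i = i} = d.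
       signof p * (\<Prod>i | i < k \<and> \<not> (i < n \<and> p i = i). N $$ (i, p i)))"
proof -
  have "coeff (det (zdiag n N)) d =
    (\<Sum>p | p permutes {0..<k}. signof p * coeff (\<Prod>i = 0..<k. zdiag n N $$ (i, p i)) d)"
    using N by (simp add: det_def'[of _ k] coeff_sum coeff_signof_mult)
  also have "\<dots> = (\<Sum>p | p permutes {0..<k}. if card {i. i < n \<and> p i = i} = d then
       signof p * (\<Prod>i | i < k \<and> \<not> (i < n \<and> p i = i). N $$ (i, p i)) else 0)"
  proof (rule sum.cong[OF refl])
    fix p assume "p \<in> {p. p permutes {0..<k}}"
    hence p: "p permutes {0..<k}" by simp
    have "(\<Prod>i = 0..<k. zdiag n N $$ (i, p i)) =
      (\<Prod>i\<in>{0..<k}. if i \<in> {i. i < n \<and> p i = i} then [:0, 1:] else [:N $$ (i, p i):])"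
      using permutes_in_image[OF p] N diag by (intro prod.cong) (auto simp: zdiag_def)
    moreover have "{0..<k} \<inter> {i. i < n \<and> p i = i} = {i. i < n \<and> p i = i}" using \<open>n \<le> k\<close> by auto
    moreover have "{0..<k} - {i. i < n \<and> p i = i} = {i. i < k \<and> \<not> (i < n \<and> p i = i)}" by auto
    ultimately show "signof p * coeff (\<Prod>i = 0..<k. zdiag n N $$ (i, p i)) d =
      (if card {i. i < n \<and> p i = i} = d then
       signof p * (\<Prod>i | i < k \<and> \<not> (i < n \<and> p i = i). N $$ (i, p i)) else 0)"
      by (simp only: coeff_prod_fixed[OF finite_atLeastLessThan] if_distrib[of "(*) (signof p)"] mult_zero_right)
  qed
  also have "\<dots> = (\<Sum>p | p permutes {0..<k} \<and> card {i. i < n \<and> p i = i} = d.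
       signof p * (\<Prod>i | i < k \<and> \<not> (i < n \<and> p i = i). N $$ (i, p i)))"
    using finite_permutations[of "{0..<k}"]
    by (simp add: sum.If_cases Int_def)
  finally show ?thesis .
qed

lemma map_mat_const_mult:
  fixes A B :: "'a::comm_ring_1 mat"
  assumes "A \<in> carrier_mat n k" "B \<in> carrier_mat k l"
  shows "map_mat (\<lambda>a. [:a:]) (A * B) = map_mat (\<lambda>a. [:a:]) A * map_mat (\<lambda>a. [:a:]) B"
  by (rule map_poly_mult[OF assms])

lemma zdiag_alt:
  assumes "N \<in> carrier_mat (n + m) (n + m)"
  shows "zdiag n N = map_mat (\<lambda>a. [:a:]) N +
    [:0, 1:] \<cdot>\<^sub>m map_mat (\<lambda>a. [:a:]) (four_block_mat (1\<^sub>m n) (0\<^sub>m n m) (0\<^sub>m m n) (0\<^sub>m m m))"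
  using assms by (intro eq_matI) (auto simp: zdiag_def)

text \<open>
  A change of basis on the first \<open>n\<close> coordinates is absorbed into the border.
\<close>

lemma defect_similar_le:
  fixes A B :: "'a::comm_ring_1 mat"
  assumes "similar_mat A B" "defect B m d"
  shows "defect A m d"
proof -
  from similar_matD[OF assms(1)] obtain n P Q where
    carr: "{A, B, P, Q} \<subseteq> carrier_mat n n" and PQ: "P * Q = 1\<^sub>m n" "Q * P = 1\<^sub>m n" and
    AB: "A = P * B * Q" by auto
  have c[simp]: "A \<in> carrier_mat n n" "B \<in> carrier_mat n n" "P \<in> carrier_mat n n" "Q \<in> carrier_mat n n"
    using carr by auto
  let ?c = "map_mat (\<lambda>a::'a. [:a:])"
  from assms(2) obtain N where N: "N \<in> carrier_mat (n + m) (n + m)"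
    and NB: "\<forall>i<n. \<forall>j<n. N $$ (i, j) = - B $$ (i, j)" and d: "coeff (det (zdiag n N)) d \<noteq> 0"
    using c by (auto simp: defect_def)
  obtain N1 N2 N3 N4 where sb: "split_block N n n = (N1, N2, N3, N4)" by (metis prod_cases4)
  have N1: "N1 \<in> carrier_mat n n" "N2 \<in> carrier_mat n m" "N3 \<in> carrier_mat m n" "N4 \<in> carrier_mat m m"
    and Nb: "N = four_block_mat N1 N2 N3 N4"
    using split_block[OF sb, of m m] N by auto
  have N1B: "N1 = - B"
  proof (rule eq_matI)
    fix i j assume ij: "i < dim_row (- B)" "j < dim_col (- B)"
    hence "N $$ (i, j) = - B $$ (i, j)" using NB carrier_matD[OF c(2)] by auto
    thus "N1 $$ (i, j) = (- B) $$ (i, j)" using ij N1 carrier_matD[OF c(2)] by (auto simp: Nb)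
  qed (use N1 carrier_matD[OF c(2)] in auto)
  define S where "S = four_block_mat P (0\<^sub>m n m) (0\<^sub>m m n) (1\<^sub>m m)"
  define T where "T = four_block_mat Q (0\<^sub>m n m) (0\<^sub>m m n) (1\<^sub>m m)"
  define E :: "'a mat" where "E = four_block_mat (1\<^sub>m n) (0\<^sub>m n m) (0\<^sub>m m n) (0\<^sub>m m m)"
  have cc[simp]: "S \<in> carrier_mat (n+m) (n+m)" "T \<in> carrier_mat (n+m) (n+m)" "E \<in> carrier_mat (n+m) (n+m)"
    by (auto simp: S_def T_def E_def)
  have z0[simp]: "P * 0\<^sub>m n m = 0\<^sub>m n m" "Q * 0\<^sub>m n m = 0\<^sub>m n m" "0\<^sub>m m n * P = 0\<^sub>m m n" "0\<^sub>m m n * Q = 0\<^sub>m m n"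
    using right_mult_zero_mat[OF c(3)] right_mult_zero_mat[OF c(4)]
      left_mult_zero_mat[OF c(3)] left_mult_zero_mat[OF c(4)] by auto
  have ST: "S * T = 1\<^sub>m (n + m)" unfolding S_def T_def
    by (subst mult_four_block_mat[of _ n n _ m _ m]) (auto simp: PQ)
  define N' where "N' = S * N * T"
  have N'c: "N' \<in> carrier_mat (n+m) (n+m)"
    unfolding N'_def by (intro mult_carrier_mat[of _ _ "n+m"] cc N)
  have "S * E = four_block_mat P (0\<^sub>m n m) (0\<^sub>m m n) (0\<^sub>m m m)" unfolding S_def E_def
    by (subst mult_four_block_mat[of _ n n _ m _ m])
       (auto simp: right_mult_one_mat[OF c(3)] right_add_zero_mat[OF c(3)])
  hence "S * E * T = four_block_mat P (0\<^sub>m n m) (0\<^sub>m m n) (0\<^sub>m m m) * T" by simp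
  also have "\<dots> = E" unfolding T_def E_def
    by (subst mult_four_block_mat[of _ n n _ m _ m]) (auto simp: PQ)
  finally have SET: "S * E * T = E" .
  have N1': "N2 \<in> carrier_mat n m" "N3 \<in> carrier_mat m n" using N1 by auto
  have "S * N = four_block_mat (P * N1) (P * N2) N3 N4" unfolding S_def Nb using N1
    by (subst mult_four_block_mat[of _ n n _ m _ m])
       (auto intro!: cong_four_block_mat right_add_zero_mat[of _ n n] right_add_zero_mat[of _ n m] mult_carrier_mat[of _ n n])
  hence "N' = four_block_mat (P * N1) (P * N2) N3 N4 * T" unfolding N'_def by simp
  also have "\<dots> = four_block_mat (P * N1 * Q) (P * N2) (N3 * Q) N4" unfolding T_def using N1
    by (subst mult_four_block_mat[of _ n n _ m _ m])
       (auto intro!: cong_four_block_mat right_add_zero_mat[of _ n n] right_add_zero_mat[of _ m n] mult_carrier_mat[of _ _ n]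
           simp: carrier_matD[OF c(3)])
  finally have "N' = four_block_mat (P * N1 * Q) (P * N2) (N3 * Q) N4" .
  moreover have "P * N1 * Q = - A"
    using carrier_matD[OF c(2)] carrier_matD[OF c(3)] carrier_matD[OF c(4)] by (simp add: N1B AB)
  ultimately have N'top: "N' $$ (i, j) = - A $$ (i, j)" if "i < n" "j < n" for i j
    using that N1(4) carrier_matD[OF c(1)] by simp
  have z: "zdiag n N' = ?c S * zdiag n N * ?c T"
  proof -
    have k: "?c S \<in> carrier_mat (n+m) (n+m)" "?c T \<in> carrier_mat (n+m) (n+m)"
      "?c N \<in> carrier_mat (n+m) (n+m)" "?c E \<in> carrier_mat (n+m) (n+m)"
      "[:0, 1:] \<cdot>\<^sub>m ?c E \<in> carrier_mat (n+m) (n+m)" using N by auto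
    note k2 = mult_carrier_mat[OF k(1) k(3)] mult_carrier_mat[OF k(1) k(4)]
    have "?c S * zdiag n N * ?c T = ?c S * (?c N + [:0, 1:] \<cdot>\<^sub>m ?c E) * ?c T"
      by (simp add: zdiag_alt[OF N] E_def)
    also have "\<dots> = (?c S * ?c N + [:0, 1:] \<cdot>\<^sub>m (?c S * ?c E)) * ?c T"
      by (simp only: mult_add_distrib_mat[OF k(1,3,5)] mult_smult_distrib[OF k(1,4)])
    also have "\<dots> = ?c S * ?c N * ?c T + [:0, 1:] \<cdot>\<^sub>m (?c S * ?c E * ?c T)"
      by (simp only: add_mult_distrib_mat[OF k2(1) smult_carrier_mat[OF k2(2)] k(2)]
          mult_smult_assoc_mat[OF k2(2) k(2)])
    also have "\<dots> = ?c N' + [:0, 1:] \<cdot>\<^sub>m ?c E"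
      unfolding N'_def
      by (subst SET[symmetric], simp only: map_mat_const_mult[OF mult_carrier_mat[OF cc(1) N] cc(2)]
          map_mat_const_mult[OF mult_carrier_mat[OF cc(1) cc(3)] cc(2)]
          map_mat_const_mult[OF cc(1) N] map_mat_const_mult[OF cc(1) cc(3)])
    also have "\<dots> = zdiag n N'" by (simp add: zdiag_alt[OF N'c] E_def)
    finally show ?thesis ..
  qed
  have cS: "?c S \<in> carrier_mat (n+m) (n+m)" "?c T \<in> carrier_mat (n+m) (n+m)" by auto
  have "det (?c S) * det (?c T) = det (?c S * ?c T)" using det_mult[OF cS] by simp
  also have "\<dots> = det (?c (1\<^sub>m (n+m)))" by (subst map_mat_const_mult[symmetric, OF cc(1,2)]) (simp add: ST)
  also have "?c (1\<^sub>m (n+m)) = 1\<^sub>m (n+m)" by (rule eq_matI) auto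
  finally have dST: "det (?c S) * det (?c T) = 1" by simp
  have "det (zdiag n N') = det (?c S) * det (zdiag n N) * det (?c T)"
    unfolding z by (simp only: det_mult[OF mult_carrier_mat[OF cS(1) zdiag_carrier[OF N]] cS(2)]
        det_mult[OF cS(1) zdiag_carrier[OF N]])
  also have "\<dots> = det (zdiag n N)" using dST by (metis mult.commute mult.left_commute mult.right_neutral)
  finally have "coeff (det (zdiag n N')) d \<noteq> 0" using d by simp
  thus ?thesis using N'c N'top carrier_matD[OF c(1)] unfolding defect_def by (intro bexI[of _ N']) auto
qed

lemma defect_similar:
  fixes A B :: "'a::comm_ring_1 mat"
  assumes "similar_mat A B"
  shows "defect A m d \<longleftrightarrow> defect B m d"
  using defect_similar_le[OF assms] defect_similar_le[OF similar_mat_sym[OF assms]] by blast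

text \<open>
  A nonzero term of the coefficient is a permutation with \<open>d\<close> fixed points among the first \<open>n\<close>
  indices.  The support of \<open>A\<close> is acyclic, so every other cycle runs through the border; cutting the
  cycles at the \<open>m\<close> border vertices leaves at most \<open>m\<close> paths, and transitivity makes each of them a
  chain.
\<close>

lemma defect_path_cover:
  fixes A :: "'a::idom mat"
  assumes A: "A \<in> carrier_mat n n"
    and supp: "\<And>i j. i < n \<Longrightarrow> j < n \<Longrightarrow> A $$ (i, j) \<noteq> 0 \<Longrightarrow> lt i j"
    and trans: "\<And>i j k. i < n \<Longrightarrow> j < n \<Longrightarrow> k < n \<Longrightarrow> lt i j \<Longrightarrow> lt j k \<Longrightarrow> lt i k"
    and h: "\<And>i j. i < n \<Longrightarrow> j < n \<Longrightarrow> lt i j \<Longrightarrow> h i < (h j :: nat)"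
    and d: "defect A m d"
  shows "d \<le> n \<and> (\<exists>C. (\<forall>t<m. C t \<subseteq> {..<n} \<and> (\<forall>x\<in>C t. \<forall>y\<in>C t. x = y \<or> lt x y \<or> lt y x)) \<and>
           card (\<Union>t<m. C t) = n - d)"
proof -
  have dimA: "dim_row A = n" using A by auto
  from d obtain N where N: "N \<in> carrier_mat (n + m) (n + m)"
    and NA: "\<And>i j. i < n \<Longrightarrow> j < n \<Longrightarrow> N $$ (i, j) = - A $$ (i, j)"
    and cf: "coeff (det (zdiag n N)) d \<noteq> 0"
    unfolding defect_def dimA by auto
  have diag: "N $$ (i, i) = 0" if "i < n" for i
    using NA[OF that that] supp[OF that that] h[OF that that] by auto
  have "\<exists>p. p permutes {0..<n+m} \<and> card {i. i < n \<and> p i = i} = d \<and>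
     (\<Prod>i | i < n+m \<and> \<not> (i < n \<and> p i = i). N $$ (i, p i)) \<noteq> 0"
  proof (rule ccontr)
    assume "\<not> ?thesis"
    hence "(\<Sum>p | p permutes {0..<n+m} \<and> card {i. i < n \<and> p i = i} = d.
       signof p * (\<Prod>i | i < n+m \<and> \<not> (i < n \<and> p i = i). N $$ (i, p i))) = 0"
      by (intro sum.neutral) auto
    moreover have "coeff (det (zdiag n N)) d = (\<Sum>p | p permutes {0..<n+m} \<and> card {i. i < n \<and> p i = i} = d.
       signof p * (\<Prod>i | i < n+m \<and> \<not> (i < n \<and> p i = i). N $$ (i, p i)))"
      by (rule coeff_det_zdiag[OF N diag]) auto
    ultimately show False using cf by simp
  qed
  then obtain p where p: "p permutes {0..<n+m}" and pd: "card {i. i < n \<and> p i = i} = d"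
    and nz: "(\<Prod>i | i < n+m \<and> \<not> (i < n \<and> p i = i). N $$ (i, p i)) \<noteq> 0" by blast
  have inj: "p i = p j \<longleftrightarrow> i = j" for i j using permutes_inj[OF p] by (auto simp: inj_def)
  have edge: "lt i (p i)" if "i < n" "p i < n" "p i \<noteq> i" for i
  proof -
    have "i < n + m" using that by simp
    moreover have "finite {i. i < n + m \<and> \<not> (i < n \<and> p i = i)}" by simp
    ultimately have "\<forall>a \<in> {i. i < n + m \<and> \<not> (i < n \<and> p i = i)}. N $$ (a, p a) \<noteq> 0"
      using nz by (metis (mono_tags, lifting) prod_zero)
    hence "N $$ (i, p i) \<noteq> 0" using that by force
    thus ?thesis using NA[OF that(1,2)] supp that by auto
  qed
  define S where "S = {i. i < n \<and> p i \<noteq> i}"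
  define C where "C t = {(p ^^ s) (n + t) | s. 0 < s \<and> (\<forall>s'\<in>{1..s}. (p ^^ s') (n + t) < n)}" for t
  have nofix: "p ((p ^^ s) (n + t)) \<noteq> (p ^^ s) (n + t)" if "(p ^^ s) (n + t) < n" for s t
  proof
    assume *: "p ((p ^^ s) (n + t)) = (p ^^ s) (n + t)"
    have "(p ^^ s) (p (n + t)) = (p ^^ s) (n + t)" using * by (metis funpow_swap1)
    hence pt: "p (n + t) = n + t" using inj_fn[OF permutes_inj[OF p], of s] by (auto simp: inj_def)
    have "(p ^^ s) (n + t) = n + t" by (induction s) (auto simp: pt)
    thus False using that by simp
  qed
  have C_sub: "C t \<subseteq> S" for t using nofix by (auto simp: C_def S_def Ball_def)
  have chain: "lt ((p ^^ s) (n + t)) ((p ^^ s2) (n + t))"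
    if "0 < s" "s < s2" "\<forall>s'\<in>{1..s2}. (p ^^ s') (n + t) < n" for s s2 t
    using that(2,3)
  proof (induction s2)
    case (Suc s2)
    have lts: "(p ^^ s2) (n + t) < n" "(p ^^ Suc s2) (n + t) < n" "(p ^^ s) (n + t) < n"
    proof -
      have *: "1 \<le> s' \<Longrightarrow> s' \<le> Suc s2 \<Longrightarrow> (p ^^ s') (n + t) < n" for s'
        using Suc.prems(2) by (meson atLeastAtMost_iff)
      show "(p ^^ s2) (n + t) < n" using Suc.prems(1) that(1) by (intro *) auto
      show "(p ^^ Suc s2) (n + t) < n" by (intro *) auto
      show "(p ^^ s) (n + t) < n" using Suc.prems(1) that(1) by (intro *) auto
    qed
    have e: "lt ((p ^^ s2) (n + t)) ((p ^^ Suc s2) (n + t))"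
      using edge[of "(p ^^ s2) (n + t)"] lts nofix[of s2 t] by auto
    show ?case
    proof (cases "s = s2")
      case False
      thus ?thesis using Suc trans[OF lts(3,1,2)] e by auto
    qed (use e in auto)
  qed simp
  have S_sub: "i \<in> S \<Longrightarrow> \<exists>t<m. i \<in> C t" for i
  proof (induction "h i" arbitrary: i rule: less_induct)
    case less
    define j where "j = inv_into UNIV p i"
    have pj: "p j = i" unfolding j_def using permutes_inverses[OF p] by simp
    have i: "i < n" "p i \<noteq> i" using less.prems by (auto simp: S_def)
    have jnm: "j < n + m" using permutes_in_image[OF p, of j] pj i by auto
    have ji: "j \<noteq> i" using i pj by auto
    show ?case
    proof (cases "j < n")
      case False
      define t where "t = j - n"
      have "i \<in> C t" unfolding C_def using pj i False
        by (intro CollectI exI[of _ 1]) (auto simp: t_def)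
      moreover have "t < m" using jnm False by (auto simp: t_def)
      ultimately show ?thesis by blast
    next
      case True
      have "lt j i" using edge[OF True] pj i ji by auto
      hence "h j < h i" using h True i by auto
      moreover have "j \<in> S" using True ji pj by (auto simp: S_def)
      ultimately obtain t where t: "t < m" "j \<in> C t" using less.hyps by blast
      then obtain s where s: "j = (p ^^ s) (n + t)" "0 < s" "\<forall>s'\<in>{1..s}. (p ^^ s') (n + t) < n"
        by (auto simp: C_def)
      have "i = (p ^^ Suc s) (n + t)" using pj s by simp
      moreover have "\<forall>s'\<in>{1..Suc s}. (p ^^ s') (n + t) < n"
        using s(3) i calculation by (auto simp: le_Suc_eq)
      ultimately have "i \<in> C t" unfolding C_def by blast
      thus ?thesis using t by blast
    qed
  qed
  have U: "(\<Union>t<m. C t) = S" using C_sub S_sub by blast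
  have "S = {..<n} - {i. i < n \<and> p i = i}" by (auto simp: S_def)
  hence cS: "card S = n - d" using pd by (simp add: card_Diff_subset subset_iff)
  have "d \<le> n" using pd card_mono[of "{..<n}" "{i. i < n \<and> p i = i}"] by auto
  moreover have "\<forall>t<m. C t \<subseteq> {..<n} \<and> (\<forall>x\<in>C t. \<forall>y\<in>C t. x = y \<or> lt x y \<or> lt y x)"
  proof (intro allI impI conjI ballI)
    fix t show "C t \<subseteq> {..<n}" by (auto simp: C_def Ball_def)
    fix x y assume "x \<in> C t" "y \<in> C t"
    then obtain s s' where "x = (p ^^ s) (n + t)" "0 < s" "\<forall>s'\<in>{1..s}. (p ^^ s') (n + t) < n"
      "y = (p ^^ s') (n + t)" "0 < s'" "\<forall>s\<in>{1..s'}. (p ^^ s) (n + t) < n" by (auto simp: C_def)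
    thus "x = y \<or> lt x y \<or> lt y x" using chain by (cases s s' rule: linorder_cases) auto
  qed
  ultimately show ?thesis using U cS by (intro conjI exI[of _ C]) auto
qed

text \<open>
  A border for which only one permutation contributes: no cancellation can occur.
\<close>

lemma defect_unique_permutation:
  fixes A :: "'a::idom mat"
  assumes A: "A \<in> carrier_mat n n" and N: "N \<in> carrier_mat (n + m) (n + m)"
    and NA: "\<And>i j. i < n \<Longrightarrow> j < n \<Longrightarrow> N $$ (i, j) = - A $$ (i, j)"
    and diag: "\<And>i. i < n \<Longrightarrow> A $$ (i, i) = 0"
    and p0: "p0 permutes {0..<n+m}"
    and p0nz: "\<And>i. i < n + m \<Longrightarrow> \<not> (i < n \<and> p0 i = i) \<Longrightarrow> N $$ (i, p0 i) \<noteq> 0"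
    and uniq: "\<And>p. p permutes {0..<n+m} \<Longrightarrow>
      (\<And>i. i < n + m \<Longrightarrow> \<not> (i < n \<and> p i = i) \<Longrightarrow> N $$ (i, p i) \<noteq> 0) \<Longrightarrow> p = p0"
  shows "defect A m (card {i. i < n \<and> p0 i = i})"
proof -
  let ?d = "card {i. i < n \<and> p0 i = i}"
  let ?f = "\<lambda>p. signof p * (\<Prod>i | i < n+m \<and> \<not> (i < n \<and> p i = i). N $$ (i, p i))"
  have diagN: "N $$ (i, i) = 0" if "i < n" for i using NA[OF that that] diag[OF that] by simp
  have "coeff (det (zdiag n N)) ?d =
    (\<Sum>p | p permutes {0..<n+m} \<and> card {i. i < n \<and> p i = i} = ?d. ?f p)"
    by (rule coeff_det_zdiag[OF N diagN]) auto
  also have "\<dots> = (\<Sum>p\<in>{p0}. ?f p)"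
  proof (rule sum.mono_neutral_right)
    show "finite {p. p permutes {0..<n+m} \<and> card {i. i < n \<and> p i = i} = ?d}"
      using finite_permutations[of "{0..<n+m}"] by simp
    show "\<forall>p\<in>{p. p permutes {0..<n+m} \<and> card {i. i < n \<and> p i = i} = ?d} - {p0}. ?f p = 0"
    proof
      fix p assume "p \<in> {p. p permutes {0..<n+m} \<and> card {i. i < n \<and> p i = i} = ?d} - {p0}"
      hence "p permutes {0..<n+m}" "p \<noteq> p0" by auto
      with uniq have "\<exists>i. i < n + m \<and> \<not> (i < n \<and> p i = i) \<and> N $$ (i, p i) = 0" by blast
      hence "(\<Prod>i | i < n+m \<and> \<not> (i < n \<and> p i = i). N $$ (i, p i)) = 0"
        by (intro prod_zero) auto
      thus "?f p = 0" by simp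
    qed
  qed (use p0 in auto)
  also have "\<dots> \<noteq> 0" using p0nz by (auto simp: sign_def)
  finally show ?thesis unfolding defect_def using A N NA by auto
qed

text \<open>
  The paths of \<open>s\<close> inside \<open>K\<close> are closed up through border vertices, one for each starting point.
  The only permutation that can then contribute is the one following these paths and fixing everything
  outside \<open>K\<close>.
\<close>

lemma defect_partial_injection:
  fixes A :: "'a::idom mat"
  assumes A: "A \<in> carrier_mat n n"
    and ent: "\<And>i j. i < n \<Longrightarrow> j < n \<Longrightarrow> A $$ (i, j) = (if i \<in> S \<and> j = s i then 1 else 0)"
    and S: "S \<subseteq> {..<n}" "s ` S \<subseteq> {..<n}" "inj_on s S"
    and h: "\<And>i. i \<in> S \<Longrightarrow> h i < (h (s i) :: nat)"
    and K: "K \<subseteq> {..<n}" "\<And>i. i \<in> S \<Longrightarrow> i \<in> K \<longleftrightarrow> s i \<in> K"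
    and m: "card (K - s ` S) \<le> m"
  shows "defect A m (n - card K)"
proof -
  have finK: "finite K" using K(1) finite_subset by blast
  define c where "c = card (K - s ` S)"
  have sSK: "s ` S \<inter> K = s ` (S \<inter> K)" using K(2) by auto
  have "card (K - s ` S) = card K - card (s ` (S \<inter> K))"
    using finK sSK by (metis Diff_Int2 Diff_Int_distrib2 Int_absorb Int_commute card_Diff_subset_Int finite_Int)
  also have "card (s ` (S \<inter> K)) = card (S \<inter> K)" using S(3) by (meson card_image inf_le1 inj_on_subset)
  also have "card K - card (S \<inter> K) = card (K - S)"
    using finK by (metis card_Diff_subset_Int finite_Int inf_commute)
  finally have cE: "card (K - S) = c" by (simp add: c_def)
  obtain e where e: "bij_betw e (K - S) {n..<n+c}"
    using finite_same_card_bij[of "K - S" "{n..<n+c}"] finK cE by auto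
  obtain g where g: "bij_betw g {n..<n+c} (K - s ` S)"
    using finite_same_card_bij[of "{n..<n+c}" "K - s ` S"] finK c_def by auto
  have cm: "c \<le> m" using m c_def by simp
  define N where "N = mat (n + m) (n + m) (\<lambda>(i, j).
     if i < n \<and> j < n then - A $$ (i, j)
     else if i < n then (if i \<in> K - S \<and> j = e i then 1 else 0)
     else if i < n + c then (if j = g i then 1 else 0)
     else if j = i then 1 else 0)"
  define p0 where "p0 i = (if i \<in> K \<inter> S then s i else if i \<in> K then e i
     else if n \<le> i \<and> i < n + c then g i else i)" for i
  have er: "i \<in> K - S \<Longrightarrow> n \<le> e i \<and> e i < n + c" for i using bij_betwE[OF e] by auto
  have gr: "n \<le> i \<Longrightarrow> i < n + c \<Longrightarrow> g i \<in> K - s ` S" for i using bij_betwE[OF g] by auto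
  have Kn: "i \<in> K \<Longrightarrow> i < n" for i using K(1) by auto
  have bij1: "bij_betw p0 (K \<inter> S) (K \<inter> s ` S)"
  proof -
    have "bij_betw s (K \<inter> S) (K \<inter> s ` S)"
      using sSK S(3) by (auto simp: bij_betw_def inj_on_def)
    thus ?thesis by (rule bij_betw_cong[THEN iffD1, rotated]) (auto simp: p0_def)
  qed
  have bij2: "bij_betw p0 (K - S) {n..<n+c}"
    by (rule bij_betw_cong[THEN iffD1, OF _ e]) (auto simp: p0_def)
  have bij3: "bij_betw p0 {n..<n+c} (K - s ` S)"
    by (rule bij_betw_cong[THEN iffD1, OF _ g]) (use Kn in \<open>force simp: p0_def\<close>)
  have bij4: "bij_betw p0 ((K \<inter> S) \<union> (K - S) \<union> {n..<n+c}) ((K \<inter> s ` S) \<union> {n..<n+c} \<union> (K - s ` S))"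
    using Kn by (intro bij_betw_combine bij1 bij2 bij3) (auto dest: Kn)
  have "(K \<inter> S) \<union> (K - S) \<union> {n..<n+c} = K \<union> {n..<n+c}"
    "(K \<inter> s ` S) \<union> {n..<n+c} \<union> (K - s ` S) = K \<union> {n..<n+c}" by auto
  hence bij5: "bij_betw p0 (K \<union> {n..<n+c}) (K \<union> {n..<n+c})" using bij4 by simp
  have "p0 permutes (K \<union> {n..<n+c})"
    using bij5 by (rule bij_imp_permutes) (auto simp: p0_def)
  hence p0: "p0 permutes {0..<n+m}"
    by (rule permutes_subset) (use K(1) cm in auto)
  have p0fix: "i < n \<Longrightarrow> p0 i = i \<longleftrightarrow> i \<notin> K" for i
    using h[of i] er[of i] by (force simp: p0_def)
  have fixset: "{i. i < n \<and> p0 i = i} = {..<n} - K" using p0fix by auto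
  have sn: "i \<in> S \<Longrightarrow> s i < n" for i using S by auto
  have "defect A m (card {i. i < n \<and> p0 i = i})"
  proof (rule defect_unique_permutation[OF A _ _ _ p0])
    show "N \<in> carrier_mat (n + m) (n + m)" by (simp add: N_def)
    show "N $$ (i, j) = - A $$ (i, j)" if "i < n" "j < n" for i j using that by (simp add: N_def)
    show "A $$ (i, i) = 0" if "i < n" for i
      using that ent[OF that that] h[of i] by (metis less_irrefl)
  next
    fix i assume i: "i < n + m" "\<not> (i < n \<and> p0 i = i)"
    show "N $$ (i, p0 i) \<noteq> 0"
    proof (cases "i < n")
      case True
      hence iK: "i \<in> K" using i p0fix by auto
      show ?thesis
      proof (cases "i \<in> S")
        case True
        thus ?thesis using iK sn[OF True] Kn[OF iK] ent[of i "s i"] by (simp add: p0_def N_def)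
      next
        case False
        thus ?thesis using iK er[of i] Kn[OF iK] cm by (simp add: p0_def N_def)
      qed
    next
      case False
      thus ?thesis using i gr[of i] Kn[of "g i"] Kn[of i] cm
        by (auto simp: p0_def N_def)
    qed
  next
    fix p assume p: "p permutes {0..<n+m}"
      and nz: "\<And>i. i < n + m \<Longrightarrow> \<not> (i < n \<and> p i = i) \<Longrightarrow> N $$ (i, p i) \<noteq> 0"
    have pin: "i < n + m \<Longrightarrow> p i < n + m" for i using permutes_in_image[OF p, of i] by simp
    have inj: "p i = p j \<longleftrightarrow> i = j" for i j using permutes_inj[OF p] by (auto simp: inj_def)
    have border: "p i = p0 i" if i: "n \<le> i" "i < n + m" for i
    proof (cases "i < n + c")
      case True
      hence "p i = g i" using nz[of i] i pin[of i] by (auto simp: N_def split: if_splits)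
      thus ?thesis using True i Kn by (force simp: p0_def)
    next
      case False
      hence "p i = i" using nz[of i] i pin[of i] by (auto simp: N_def split: if_splits)
      thus ?thesis using False i Kn by (force simp: p0_def)
    qed
    have inv: "\<exists>j<n+m. p j = i" if "i < n + m" for i
      using permutes_surj[OF p] permutes_in_image[OF p] that
      by (metis atLeast0LessThan lessThan_iff permutes_inverses(1)[OF p])
    have edge: "(i \<in> S \<and> p i = s i) \<or> (i \<in> K - S \<and> p i = e i)" if "i < n" "p i \<noteq> i" for i
      using nz[of i] that pin[of i] ent[of i "p i"] by (auto simp: N_def split: if_splits)
    have inK: "i \<in> K \<Longrightarrow> p i = p0 i" for i
    proof (induction "h i" arbitrary: i rule: less_induct)
      case less
      have i: "i < n" using Kn less by auto
      have "p i \<noteq> i"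
      proof (cases "i \<in> s ` S")
        case True
        then obtain i' where i': "i' \<in> S" "i = s i'" by auto
        have i'K: "i' \<in> K" using K(2)[OF i'(1)] i'(2) less.prems by simp
        have hi': "h i' < h i" using h[OF i'(1)] i'(2) by simp
        have "p i' = p0 i'" by (rule less.hyps[OF hi' i'K])
        moreover have "p0 i' = s i'" using i'(1) i'K by (simp add: p0_def)
        ultimately have "p i' = i" using i'(2) by simp
        moreover have "i' \<noteq> i" using hi' by auto
        ultimately show ?thesis using inj[of i i'] by metis
      next
        case False
        then obtain j where j: "n \<le> j" "j < n + c" "g j = i"
          proof -
          have "i \<in> g ` {n..<n+c}" using bij_betw_imp_surj_on[OF g] less.prems False by simp
          thus ?thesis using that by auto
        qed
        have "p j = g j" using border[of j] j cm Kn[of j] by (auto simp: p0_def)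
        thus ?thesis using inj[of i j] j i by auto
      qed
      with edge[OF i] have e1: "(i \<in> S \<and> p i = s i) \<or> (i \<in> K - S \<and> p i = e i)" by blast
      have "p0 i = (if i \<in> S then s i else e i)" using less.prems by (simp add: p0_def)
      with e1 show ?case by (metis Diff_iff)
    qed
    have outK: "i < n \<Longrightarrow> i \<notin> K \<Longrightarrow> p i = i" for i
    proof (induction "h i" arbitrary: i rule: less_induct)
      case less
      show ?case
      proof (rule ccontr)
        assume ne: "p i \<noteq> i"
        obtain j where j: "j < n + m" "p j = i" using inv[of i] less.prems by auto
        have ji: "j \<noteq> i" using ne j by auto
        have jn: "j < n"
        proof (rule ccontr)
          assume "\<not> j < n"
          hence "p0 j = i" using border[of j] j by auto
          thus False using gr[of j] less.prems \<open>\<not> j < n\<close> by (auto simp: p0_def split: if_splits dest: Kn)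
        qed
        have jS: "j \<in> S \<and> i = s j \<or> (j \<in> K - S \<and> i = e j)" using edge[OF jn] j ji by auto
        hence "j \<in> S" "i = s j" using er[of j] less.prems by auto
        hence "j \<notin> K" "h j < h i" using K(2) less.prems h by auto
        hence "p j = j" using less.hyps jn by auto
        thus False using j ji by simp
      qed
    qed
    show "p = p0"
    proof
      fix i
      show "p i = p0 i"
      proof (cases "i < n")
        case True
        thus ?thesis using inK[of i] outK[of i] p0fix[OF True] by metis
      next
        case False
        show ?thesis
        proof (cases "i < n + m")
          case True
          thus ?thesis using border False by auto
        next
          case f2: False
          hence "p i = i" "p0 i = i" using permutes_not_in[OF p, of i] permutes_not_in[OF p0, of i] by auto
          thus ?thesis by simp
        qed
      qed
    qed
  qed
  moreover have "card ({..<n} - K) = n - card K" using finK K(1) by (simp add: card_Diff_subset)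
  ultimately show ?thesis unfolding fixset by simp
qed

section \<open>Jordan types are determined by defects\<close>

definition tail_sum :: "nat list \<Rightarrow> nat \<Rightarrow> nat" where
  "tail_sum ps m = sum_list (drop m ps)"

fun block_of :: "nat list \<Rightarrow> nat \<Rightarrow> nat" where
  "block_of [] i = 0"
| "block_of (p # ps) i = (if i < p then 0 else Suc (block_of ps (i - p)))"

abbreviation nil_jordan :: "nat list \<Rightarrow> 'a::comm_ring_1 mat" where
  "nil_jordan ps \<equiv> jordan_matrix (map (\<lambda>p. (p, 0)) ps)"

lemma fst_comp_pair [simp]: "fst \<circ> (\<lambda>p. (p, c)) = (\<lambda>p. p)"
  by auto

lemma nil_jordan_carrier: "nil_jordan ps \<in> carrier_mat (sum_list ps) (sum_list ps)"
  using jordan_matrix_carrier[of "map (\<lambda>p. (p, 0)) ps"] by simp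

lemma nil_jordan_index:
  "i < sum_list ps \<Longrightarrow> j < sum_list ps \<Longrightarrow>
   nil_jordan ps $$ (i, j) = (if j = Suc i \<and> block_of ps i = block_of ps j then 1 else 0)"
proof (induction ps arbitrary: i j)
  case (Cons p ps)
  show ?case
    using Cons.prems Cons.IH[of "i - p" "j - p"]
    by (auto simp: jordan_matrix_Cons Suc_diff_le)
qed simp

lemma block_of_less: "i < sum_list ps \<Longrightarrow> block_of ps i < length ps"
  by (induction ps arbitrary: i) auto

lemma card_block: "b < length ps \<Longrightarrow> card {i. i < sum_list ps \<and> block_of ps i = b} = ps ! b"
proof (induction ps arbitrary: b)
  case (Cons p ps)
  show ?case
  proof (cases b)
    case 0
    have "{i. i < sum_list (p # ps) \<and> block_of (p # ps) i = b} = {..<p}" using 0 by auto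
    thus ?thesis using 0 by simp
  next
    case (Suc c)
    have "{i. i < sum_list (p # ps) \<and> block_of (p # ps) i = b} =
       (\<lambda>i. i + p) ` {i. i < sum_list ps \<and> block_of ps i = c}"
    proof (intro equalityI subsetI)
      fix i assume "i \<in> {i. i < sum_list (p # ps) \<and> block_of (p # ps) i = b}"
      thus "i \<in> (\<lambda>i. i + p) ` {i. i < sum_list ps \<and> block_of ps i = c}"
        using Suc by (intro image_eqI[of _ _ "i - p"]) (auto split: if_splits)
    qed (use Suc in auto)
    moreover have "card ((\<lambda>i. i + p) ` {i. i < sum_list ps \<and> block_of ps i = c}) = ps ! c"
      using Cons Suc by (subst card_image) auto
    ultimately show ?thesis using Suc by simp
  qed
qed simp

lemma card_blocks:
  assumes "B \<subseteq> {..<length ps}"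
  shows "card {i. i < sum_list ps \<and> block_of ps i \<in> B} = (\<Sum>b\<in>B. ps ! b)"
proof -
  have "{i. i < sum_list ps \<and> block_of ps i \<in> B} = (\<Union>b\<in>B. {i. i < sum_list ps \<and> block_of ps i = b})"
    by auto
  also have "card \<dots> = (\<Sum>b\<in>B. card {i. i < sum_list ps \<and> block_of ps i = b})"
    using assms by (intro card_UN_disjoint) (auto intro: finite_subset)
  also have "\<dots> = (\<Sum>b\<in>B. ps ! b)" using assms by (intro sum.cong) (auto simp: card_block)
  finally show ?thesis .
qed

lemma sum_list_take_nth: "m \<le> length ps \<Longrightarrow> (\<Sum>b<m. ps ! b) = sum_list (take m (ps::nat list))"
  by (simp add: sum_list_sum_nth atLeast0LessThan)

text \<open>
  The first \<open>m\<close> entries of a decreasing list are at least as large in total as any other \<open>m\<close>.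
\<close>

lemma sum_largest:
  assumes "sorted_wrt (\<ge>) ps" "B \<subseteq> {..<length ps}" "card B \<le> m"
  shows "(\<Sum>b\<in>B. ps ! b) + tail_sum ps m \<le> sum_list (ps::nat list)"
proof (cases "m \<le> length ps")
  case True
  have finB: "finite B" using assms finite_subset by blast
  let ?M = "{..<m}"
  have "(\<Sum>b\<in>B - ?M. ps ! b) \<le> (\<Sum>b\<in>?M - B. ps ! b)"
  proof (cases "B - ?M = {}")
    case False
    hence ml: "m < length ps" using assms(2) by fastforce
    have "(\<Sum>b\<in>B - ?M. ps ! b) \<le> (\<Sum>b\<in>B - ?M. ps ! m)"
    proof (rule sum_mono)
      fix b assume b: "b \<in> B - ?M"
      thus "ps ! b \<le> ps ! m" using assms(2) sorted_wrt_nth_less[OF assms(1), of m b]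
        by (cases "b = m") auto
    qed
    also have "\<dots> = card (B - ?M) * ps ! m" by simp
    also have "\<dots> \<le> card (?M - B) * ps ! m"
    proof (rule mult_right_mono)
      have "card (B - ?M) = card B - card (B \<inter> ?M)" using finB by (simp add: card_Diff_subset_Int)
      moreover have "card (?M - B) = m - card (B \<inter> ?M)"
        by (subst card_Diff_subset_Int) (auto simp: Int_commute)
      ultimately show "card (B - ?M) \<le> card (?M - B)" using assms(3) by simp
    qed simp
    also have "\<dots> = (\<Sum>b\<in>?M - B. ps ! m)" by simp
    also have "\<dots> \<le> (\<Sum>b\<in>?M - B. ps ! b)"
      using sorted_wrt_nth_less[OF assms(1)] ml by (intro sum_mono) auto
    finally show ?thesis .
  qed (metis sum.empty zero_le)
  moreover have "(\<Sum>b\<in>B. ps ! b) = (\<Sum>b\<in>B - ?M. ps ! b) + (\<Sum>b\<in>B \<inter> ?M. ps ! b)"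
    using finB by (subst sum.union_disjoint[symmetric]) (auto intro!: sum.cong)
  moreover have "(\<Sum>b<m. ps ! b) = (\<Sum>b\<in>?M - B. ps ! b) + (\<Sum>b\<in>B \<inter> ?M. ps ! b)"
    by (subst sum.union_disjoint[symmetric]) (use finB in \<open>auto intro!: sum.cong\<close>)
  ultimately have "(\<Sum>b\<in>B. ps ! b) \<le> sum_list (take m ps)" using True by (simp add: sum_list_take_nth)
  moreover have "sum_list ps = sum_list (take m ps) + sum_list (drop m ps)"
    by (metis append_take_drop_id sum_list_append)
  ultimately show ?thesis by (simp add: tail_sum_def)
next
  case False
  have "(\<Sum>b\<in>B. ps ! b) \<le> (\<Sum>b<length ps. ps ! b)" using assms by (intro sum_mono2) auto
  thus ?thesis using False by (simp add: tail_sum_def sum_list_take_nth)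
qed

lemma sum_nth_permuted:
  assumes "mset qs = mset ps"
  obtains p where "p permutes {..<length ps}" "length qs = length ps" "\<And>b. b < length ps \<Longrightarrow> qs ! b = ps ! p b"
proof -
  from mset_eq_permutation[OF assms] obtain p where p: "p permutes {..<length ps}" "permute_list p ps = qs" by blast
  show ?thesis using p by (intro that[of p]) (auto simp: permute_list_nth)
qed

text \<open>
  A chain in the support order of a Jordan matrix stays within one block, so \<open>m\<close> chains cover at
  most the \<open>m\<close> largest blocks.
\<close>

lemma defect_nil_jordan_lower:
  assumes "sorted_wrt (\<ge>) qs" "mset qs = mset ps" "defect (nil_jordan ps :: 'a::idom mat) m d"
  shows "tail_sum qs m \<le> d"
proof -
  obtain p where p: "p permutes {..<length ps}" "length qs = length ps"
    "\<And>b. b < length ps \<Longrightarrow> qs ! b = ps ! p b" using sum_nth_permuted[OF assms(2)] by blast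
  let ?n = "sum_list ps" and ?J = "nil_jordan ps :: 'a mat"
  define lt where "lt i j \<longleftrightarrow> i < j \<and> block_of ps i = block_of ps j" for i j
  have "d \<le> ?n \<and> (\<exists>C. (\<forall>t<m. C t \<subseteq> {..<?n} \<and> (\<forall>x\<in>C t. \<forall>y\<in>C t. x = y \<or> lt x y \<or> lt y x)) \<and>
           card (\<Union>t<m. C t) = ?n - d)"
    by (rule defect_path_cover[OF nil_jordan_carrier _ _ _ assms(3), where h = id])
       (auto simp: lt_def nil_jordan_index split: if_splits)
  then obtain C where dn: "d \<le> ?n" and
    C0: "\<forall>t<m. C t \<subseteq> {..<?n} \<and> (\<forall>x\<in>C t. \<forall>y\<in>C t. x = y \<or> lt x y \<or> lt y x)"
    and card: "card (\<Union>t<m. C t) = ?n - d" by blast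
  have C1: "C t \<subseteq> {..<?n}" if "t < m" for t using C0 that by blast
  have C2: "block_of ps x = block_of ps y" if "t < m" "x \<in> C t" "y \<in> C t" for t x y
  proof -
    have "x = y \<or> lt x y \<or> lt y x" using C0 that by blast
    thus ?thesis by (auto simp: lt_def)
  qed
  note C = C1 C2
  define B where "B = block_of ps ` (\<Union>t<m. C t)"
  have Bsub: "B \<subseteq> {..<length ps}" 
  proof
    fix b assume "b \<in> B"
    then obtain t x where "t < m" "x \<in> C t" "b = block_of ps x" by (auto simp: B_def)
    thus "b \<in> {..<length ps}" using C(1) block_of_less by blast
  qed
  have "B \<subseteq> (\<lambda>t. block_of ps (SOME x. x \<in> C t)) ` {..<m}"
  proof
    fix b assume "b \<in> B"
    then obtain t x where t: "t < m" "x \<in> C t" "b = block_of ps x" by (auto simp: B_def)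
    hence "(SOME x. x \<in> C t) \<in> C t" by (metis someI)
    from C(2)[OF t(1,2) this] have "b = block_of ps (SOME x. x \<in> C t)" using t(3) by simp
    thus "b \<in> (\<lambda>t. block_of ps (SOME x. x \<in> C t)) ` {..<m}" using t(1) by auto
  qed
  hence "card B \<le> m" by (metis card_image_le card_lessThan card_mono finite_imageI finite_lessThan le_trans)
  define B' where "B' = {b. b < length ps \<and> p b \<in> B}"
  have pB': "p ` B' = B"
  proof
    show "B \<subseteq> p ` B'"
    proof
      fix b assume b: "b \<in> B"
      have "b \<in> p ` {..<length ps}" using b Bsub permutes_image[OF p(1)] by auto
      thus "b \<in> p ` B'" using b by (auto simp: B'_def)
    qed
  qed (auto simp: B'_def)
  have injB': "inj_on p B'" using permutes_inj[OF p(1)] by (meson inj_on_subset subset_UNIV)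
  have "card B' \<le> m" using \<open>card B \<le> m\<close> card_image[OF injB'] pB' by simp
  moreover have "(\<Sum>b\<in>B. ps ! b) = (\<Sum>b\<in>B'. qs ! b)"
    unfolding pB'[symmetric] sum.reindex[OF injB'] o_def
    by (intro sum.cong) (auto simp: p(3) B'_def)
  moreover have "sum_list qs = ?n" using assms(2) by (metis sum_mset_sum_list)
  moreover have "B' \<subseteq> {..<length qs}" using p(2) by (auto simp: B'_def)
  ultimately have "(\<Sum>b\<in>B. ps ! b) + tail_sum qs m \<le> ?n"
    using sum_largest[OF assms(1), of B' m] by simp
  moreover have "card (\<Union>t<m. C t) \<le> card {i. i < ?n \<and> block_of ps i \<in> B}"
    using C(1) by (intro card_mono) (auto simp: B_def)
  ultimately show ?thesis using card card_blocks[OF Bsub] dn by linarith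
qed

lemma block_of_Suc: "Suc i < sum_list ps \<Longrightarrow> 0 \<notin> set ps \<Longrightarrow>
   block_of ps (Suc i) = block_of ps i \<or> block_of ps (Suc i) = Suc (block_of ps i)"
proof (induction ps arbitrary: i)
  case (Cons p ps)
  show ?case
  proof (cases "Suc i < p")
    case False
    show ?thesis
    proof (cases "i < p")
      case True
      hence "Suc i = p" using False by simp
      moreover have "ps \<noteq> []" using Cons.prems calculation by auto
      ultimately show ?thesis using Cons.prems by (cases ps) auto
    next
      case False
      hence "Suc i - p = Suc (i - p)" by simp
      thus ?thesis using Cons False by auto
    qed
  qed auto
qed simp

text \<open>
  Take \<open>K\<close> to be the union of the \<open>m\<close> largest blocks, each of which is a single path.
\<close>

lemma defect_nil_jordan_tail:
  assumes "0 \<notin> set ps" "mset qs = mset ps"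
  shows "defect (nil_jordan ps :: 'a::idom mat) m (tail_sum qs m)"
proof -
  let ?n = "sum_list ps"
  obtain p where p: "p permutes {..<length ps}" "length qs = length ps"
    "\<And>b. b < length ps \<Longrightarrow> qs ! b = ps ! p b" using sum_nth_permuted[OF assms(2)] by blast
  define B where "B = p ` {..<min m (length ps)}"
  have injp: "inj_on p X" for X using permutes_inj[OF p(1)] by (meson inj_on_subset subset_UNIV)
  have cB: "card B \<le> m" "finite B" 
  proof -
    have "card B = min m (length ps)" unfolding B_def by (simp add: card_image[OF injp])
    thus "card B \<le> m" by simp
    show "finite B" by (simp add: B_def)
  qed
  have Bsub: "B \<subseteq> {..<length ps}" 
    unfolding B_def by (metis image_mono lessThan_subset_iff min.cobounded2 permutes_image[OF p(1)])
  define S where "S = {i. Suc i < ?n \<and> block_of ps (Suc i) = block_of ps i}"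
  define K where "K = {i. i < ?n \<and> block_of ps i \<in> B}"
  have inc: "0 < i \<Longrightarrow> i < ?n \<Longrightarrow> i \<notin> Suc ` S \<Longrightarrow> block_of ps i = Suc (block_of ps (i - 1))" for i
  proof -
    assume i: "0 < i" "i < ?n" "i \<notin> Suc ` S"
    then obtain k where k: "i = Suc k" by (cases i) auto
    hence "k \<notin> S" using i by blast
    hence "block_of ps (Suc k) \<noteq> block_of ps k" using i k unfolding S_def by blast
    thus "block_of ps i = Suc (block_of ps (i - 1))"
      using block_of_Suc[of k ps] i(2) assms(1) unfolding k by simp
  qed
  have mono: "i \<le> j \<Longrightarrow> j < ?n \<Longrightarrow> block_of ps i \<le> block_of ps j" for i j
  proof (induction j)
    case (Suc j)
    show ?case
    proof (cases "i = Suc j")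
      case False
      hence "block_of ps i \<le> block_of ps j" using Suc by simp
      thus ?thesis using block_of_Suc[of j ps] Suc.prems assms(1) by linarith
    qed simp
  qed simp
  have "inj_on (block_of ps) (K - Suc ` S)"
  proof -
    have "block_of ps i \<noteq> block_of ps j" if "i < j" "j \<in> K - Suc ` S" for i j
    proof -
      have "block_of ps j = Suc (block_of ps (j - 1))" using that by (intro inc) (auto simp: K_def)
      moreover have "block_of ps i \<le> block_of ps (j - 1)" using that by (intro mono) (auto simp: K_def)
      ultimately show ?thesis by simp
    qed
    thus ?thesis unfolding inj_on_def by (metis linorder_neqE_nat)
  qed
  moreover have "block_of ps ` (K - Suc ` S) \<subseteq> B" by (auto simp: K_def)
  ultimately have cm: "card (K - Suc ` S) \<le> m"
    using cB by (metis card_inj_on_le le_trans)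
  have "defect (nil_jordan ps :: 'a mat) m (?n - card K)"
  proof (rule defect_partial_injection[OF nil_jordan_carrier, where S = S and s = Suc and h = id])
    show "nil_jordan ps $$ (i, j) = (if i \<in> S \<and> j = Suc i then 1 else 0)"
      if "i < ?n" "j < ?n" for i j using that by (auto simp: nil_jordan_index S_def)
  qed (use cm in \<open>auto simp: S_def K_def\<close>)
  moreover have "card K = (\<Sum>b<min m (length ps). qs ! b)"
    unfolding K_def card_blocks[OF Bsub] unfolding B_def sum.reindex[OF injp] o_def
    by (intro sum.cong) (auto simp: p(3))
  moreover have "(\<Sum>b<min m (length ps). qs ! b) = sum_list (take m qs)"
    using p(2) by (subst sum_list_take_nth) (auto simp: min_def)
  moreover have "?n = sum_list qs" using assms(2) by (metis sum_mset_sum_list)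
  moreover have "sum_list qs = sum_list (take m qs) + tail_sum qs m"
    unfolding tail_sum_def by (metis append_take_drop_id sum_list_append)
  ultimately show ?thesis by simp
qed

text \<open>
  Decreasing lists make \<open>tail_sum\<close> the sum of all but the \<open>m\<close> largest parts.
\<close>

definition jordan_list :: "'a::comm_ring_1 mat \<Rightarrow> nat list \<Rightarrow> bool" where
  "jordan_list A qs \<longleftrightarrow> sorted_wrt (\<ge>) qs \<and> 0 \<notin> set qs \<and> has_jordan_type A (mset qs)"

lemma has_jordan_type_imp_jordan_list:
  assumes "has_jordan_type A Q"
  shows "jordan_list A (rev (sorted_list_of_multiset Q))"
proof -
  obtain ps where ps: "mset ps = Q" "jordan_nf A (map (\<lambda>p. (p, 0)) ps)"
    using assms by (auto simp: has_jordan_type_def)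
  hence "0 \<notin># Q" by (force simp: jordan_nf_def)
  thus ?thesis using assms
    by (auto simp: jordan_list_def sorted_wrt_rev sorted_sorted_list_of_multiset)
qed

text \<open>
  The least defect for each \<open>m\<close> is a complete invariant of the Jordan type, as its differences are
  the parts.
\<close>

lemma jordan_list_defect:
  fixes A :: "'a::idom mat"
  assumes "jordan_list A qs"
  shows "defect A m (tail_sum qs m)" "defect A m d \<Longrightarrow> tail_sum qs m \<le> d" "dim_row A = sum_list qs"
proof -
  obtain ps where ps: "mset ps = mset qs" "jordan_nf A (map (\<lambda>p. (p, 0)) ps)"
    using assms by (auto simp: has_jordan_type_def jordan_list_def)
  have sim: "similar_mat A (nil_jordan ps)" using ps by (auto simp: jordan_nf_def)
  have "0 \<notin> set ps" using assms ps(1) by (metis jordan_list_def set_mset_mset)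
  thus "defect A m (tail_sum qs m)"
    unfolding defect_similar[OF sim] by (rule defect_nil_jordan_tail[OF _ ps(1)[symmetric]])
  have "sorted_wrt (\<ge>) qs" using assms unfolding jordan_list_def by blast
  thus "defect A m d \<Longrightarrow> tail_sum qs m \<le> d"
    unfolding defect_similar[OF sim] by (rule defect_nil_jordan_lower[OF _ ps(1)[symmetric]])
  obtain n P Q where "{A, nil_jordan ps, P, Q} \<subseteq> carrier_mat n n" using similar_matD[OF sim] by blast
  hence "A \<in> carrier_mat n n" "(nil_jordan ps :: 'a mat) \<in> carrier_mat n n" by blast+
  from carrier_matD(1)[OF this(1)] carrier_matD(1)[OF this(2)]
  have "dim_row A = dim_row (nil_jordan ps :: 'a mat)" by (rule trans[OF _ sym])
  also have "\<dots> = sum_list ps" using carrier_matD(1)[OF nil_jordan_carrier] .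
  finally have "dim_row A = sum_list ps" .
  thus "dim_row A = sum_list qs" using ps(1) by (metis sum_mset_sum_list)
qed

lemma tail_sums_eq_imp_eq:
  assumes "\<And>m. tail_sum ps m = tail_sum qs m" "0 \<notin> set ps" "0 \<notin> set qs"
  shows "ps = qs"
proof -
  have zero: "tail_sum xs m = 0 \<longleftrightarrow> length xs \<le> m" if "0 \<notin> set xs" for xs m
  proof -
    have "\<forall>x\<in>set (drop m xs). x \<noteq> 0" using that by (metis in_set_dropD)
    hence "tail_sum xs m = 0 \<longleftrightarrow> drop m xs = []"
      unfolding tail_sum_def sum_list_eq_0_iff by (metis list.set_intros(1) neq_Nil_conv empty_iff list.set(1))
    thus ?thesis by simp
  qed
  have len: "length ps = length qs"
  proof (rule antisym)
    have "tail_sum ps (length qs) = 0" using assms(1)[of "length qs"] zero[OF assms(3), of "length qs"] by simp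
    thus "length ps \<le> length qs" using zero[OF assms(2)] by blast
    have "tail_sum qs (length ps) = 0" using assms(1)[of "length ps"] zero[OF assms(2), of "length ps"] by simp
    thus "length qs \<le> length ps" using zero[OF assms(3)] by blast
  qed
  have step: "tail_sum xs m = xs ! m + tail_sum xs (Suc m)" if "m < length xs" for xs m
    using that by (simp add: tail_sum_def Cons_nth_drop_Suc[symmetric])
  show ?thesis
  proof (rule nth_equalityI[OF len])
    fix m assume "m < length ps"
    thus "ps ! m = qs ! m" using step[of m ps] step[of m qs] assms(1) len by simp
  qed
qed

lemma jordan_list_unique:
  fixes A :: "'a::idom mat"
  assumes "jordan_list A ps" "jordan_list A qs"
  shows "ps = qs"
proof (rule tail_sums_eq_imp_eq)
  fix m
  have "tail_sum ps m \<le> tail_sum qs m"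
    by (rule jordan_list_defect(2)[OF assms(1)], rule jordan_list_defect(1)[OF assms(2)])
  moreover have "tail_sum qs m \<le> tail_sum ps m"
    by (rule jordan_list_defect(2)[OF assms(2)], rule jordan_list_defect(1)[OF assms(1)])
  ultimately show "tail_sum ps m = tail_sum qs m" by simp
next
  show "0 \<notin> set ps" using assms(1) unfolding jordan_list_def by blast
  show "0 \<notin> set qs" using assms(2) unfolding jordan_list_def by blast
qed

section \<open>Generic Jordan types\<close>

lemma polynomial_mat_function_sum:
  assumes "\<And>x. x \<in> S \<Longrightarrow> polynomial_mat_function n (f x)"
  shows "polynomial_mat_function n (\<lambda>A. \<Sum>x\<in>S. f x A)"
  using assms
proof (induction S rule: infinite_finite_induct)
  case (insert x S)
  have "polynomial_mat_function n (f x)" "polynomial_mat_function n (\<lambda>A. \<Sum>x\<in>S. f x A)"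
    using insert by simp_all
  from polynomial_mat_function.add[OF this] show ?case using insert.hyps by simp
qed (simp_all add: polynomial_mat_function.const)

lemma polynomial_mat_function_prod:
  assumes "\<And>x. x \<in> S \<Longrightarrow> polynomial_mat_function n (f x)"
  shows "polynomial_mat_function n (\<lambda>A. \<Prod>x\<in>S. f x A)"
  using assms
proof (induction S rule: infinite_finite_induct)
  case (insert x S)
  have "polynomial_mat_function n (f x)" "polynomial_mat_function n (\<lambda>A. \<Prod>x\<in>S. f x A)"
    using insert by simp_all
  from polynomial_mat_function.mult[OF this] show ?case using insert.hyps by simp
qed (simp_all add: polynomial_mat_function.const)

text \<open>
  Polynomials in \<open>z\<close> whose coefficients are polynomial functions of a matrix; closed under the
  operations that build a determinant.
\<close>

definition poly_family :: "nat \<Rightarrow> ('a::comm_ring_1 mat \<Rightarrow> 'a poly) \<Rightarrow> bool" where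
  "poly_family n F \<longleftrightarrow> (\<forall>d. polynomial_mat_function n (\<lambda>A. coeff (F A) d))"

lemma poly_family_mult:
  assumes "poly_family n F" "poly_family n G"
  shows "poly_family n (\<lambda>A. F A * G A)"
  unfolding poly_family_def coeff_mult
proof
  fix d show "polynomial_mat_function n (\<lambda>A. \<Sum>i\<le>d. coeff (F A) i * coeff (G A) (d - i))"
  proof (rule polynomial_mat_function_sum)
    fix i show "polynomial_mat_function n (\<lambda>A. coeff (F A) i * coeff (G A) (d - i))"
      using assms by (intro polynomial_mat_function.mult[of n "\<lambda>A. coeff (F A) i"]) (simp_all add: poly_family_def)
  qed
qed

lemma poly_family_const: "poly_family n (\<lambda>_. c)"
  unfolding poly_family_def by (intro allI polynomial_mat_function.const)

lemma poly_family_prod: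
  assumes "\<And>x. x \<in> S \<Longrightarrow> poly_family n (f x)"
  shows "poly_family n (\<lambda>A. \<Prod>x\<in>S. f x A)"
  using assms
proof (induction S rule: infinite_finite_induct)
  case (insert x S)
  have "poly_family n (f x)" "poly_family n (\<lambda>A. \<Prod>x\<in>S. f x A)" using insert by simp_all
  from poly_family_mult[OF this] show ?case using insert.hyps by simp
qed (simp_all add: poly_family_const)

lemma poly_family_sum:
  assumes "\<And>x. x \<in> S \<Longrightarrow> poly_family n (f x)"
  shows "poly_family n (\<lambda>A. \<Sum>x\<in>S. f x A)"
  unfolding poly_family_def coeff_sum
proof
  fix d show "polynomial_mat_function n (\<lambda>A. \<Sum>x\<in>S. coeff (f x A) d)"
    using assms by (intro polynomial_mat_function_sum) (simp add: poly_family_def)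
qed

lemma poly_family_pCons:
  assumes "polynomial_mat_function n g"
  shows "poly_family n (\<lambda>A. [:g A:])" "poly_family n (\<lambda>A. [:g A, c:])"
proof -
  show "poly_family n (\<lambda>A. [:g A:])" unfolding poly_family_def
  proof
    fix d show "polynomial_mat_function n (\<lambda>A. coeff [:g A:] d)"
      using assms by (cases d) (simp_all add: polynomial_mat_function.const)
  qed
  show "poly_family n (\<lambda>A. [:g A, c:])" unfolding poly_family_def
  proof
    fix d show "polynomial_mat_function n (\<lambda>A. coeff [:g A, c:] d)"
      using assms by (cases d) (simp_all add: polynomial_mat_function.const)
  qed
qed

definition set_corner :: "nat \<Rightarrow> 'a::comm_ring_1 mat \<Rightarrow> 'a mat \<Rightarrow> 'a mat" where
  "set_corner n N A = mat (dim_row N) (dim_col N) (\<lambda>(i, j). if i < n \<and> j < n then - A $$ (i, j) else N $$ (i, j))"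

lemma polynomial_defect_coeff:
  assumes "N \<in> carrier_mat (n + m) (n + m)"
  shows "polynomial_mat_function n (\<lambda>A::'a::comm_ring_1 mat. coeff (det (zdiag n (set_corner n N A))) d)"
proof -
  have c: "zdiag n (set_corner n N A) \<in> carrier_mat (n + m) (n + m)" for A
    using assms by (auto simp: zdiag_def set_corner_def)
  have neg: "polynomial_mat_function n (\<lambda>A::'a mat. - A $$ (i, j))" if "i < n" "j < n" for i j
    using polynomial_mat_function.mult[OF polynomial_mat_function.const[of n "-1::'a"]
        polynomial_mat_function.entry[OF that]] by simp
  have "poly_family n (\<lambda>A. zdiag n (set_corner n N A) $$ (i, j))" if "i < n + m" "j < n + m" for i j
  proof -
    have e: "zdiag n (set_corner n N A) $$ (i, j) =
      (if i = j \<and> i < n then [:- A $$ (i, j), 1:] else if i < n \<and> j < n then [:- A $$ (i, j):] else [:N $$ (i, j):])" for A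
      using that assms by (auto simp: zdiag_def set_corner_def)
    consider "i = j" "i < n" | "\<not> (i = j \<and> i < n)" "i < n" "j < n" | "\<not> (i < n \<and> j < n)" by blast
    thus ?thesis
    proof cases
      case 1
      thus ?thesis using e poly_family_pCons(2)[OF neg, of i j 1] by simp
    next
      case 2
      hence "zdiag n (set_corner n N A) $$ (i, j) = [:- A $$ (i, j):]" for A using e by auto
      thus ?thesis using poly_family_pCons(1)[OF neg, of i j] 2 by simp
    next
      case 3
      hence "zdiag n (set_corner n N A) $$ (i, j) = [:N $$ (i, j):]" for A using e by auto
      thus ?thesis by (simp add: poly_family_const)
    qed
  qed
  hence ent: "poly_family n (\<lambda>A. zdiag n (set_corner n N A) $$ (i, p i))"
    if "p permutes {0..<n+m}" "i \<in> {0..<n+m}" for p i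
    using permutes_in_image[OF that(1), of i] that(2) by simp
  have "poly_family n (\<lambda>A. det (zdiag n (set_corner n N A)))"
    unfolding det_def'[OF c]
  proof (rule poly_family_sum)
    fix p assume "p \<in> {p. p permutes {0..<n+m}}"
    hence "poly_family n (\<lambda>A. \<Prod>i = 0..<n+m. zdiag n (set_corner n N A) $$ (i, p i))"
      by (intro poly_family_prod ent) simp_all
    from poly_family_mult[OF poly_family_const this]
    show "poly_family n (\<lambda>A. signof p * (\<Prod>i = 0..<n+m. zdiag n (set_corner n N A) $$ (i, p i)))" .
  qed
  thus ?thesis by (simp add: poly_family_def)
qed

text \<open>
  Irreducibility in the Zariski topology: two nonempty open subsets meet.  It is enough to say so for
  the basic open sets, where a single polynomial does not vanish.
\<close>

definition poly_irreducible :: "nat \<Rightarrow> 'a::comm_ring_1 mat set \<Rightarrow> bool" where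
  "poly_irreducible n X \<longleftrightarrow> X \<noteq> {} \<and> X \<subseteq> carrier_mat n n \<and>
     (\<forall>f g. polynomial_mat_function n f \<longrightarrow> polynomial_mat_function n g \<longrightarrow>
        (\<exists>A\<in>X. f A \<noteq> 0) \<longrightarrow> (\<exists>A\<in>X. g A \<noteq> 0) \<longrightarrow> (\<exists>A\<in>X. f A \<noteq> 0 \<and> g A \<noteq> 0))"

lemma poly_irreducibleD:
  assumes "poly_irreducible n X" "polynomial_mat_function n f" "polynomial_mat_function n g"
    "\<exists>A\<in>X. f A \<noteq> 0" "\<exists>A\<in>X. g A \<noteq> 0"
  shows "\<exists>A\<in>X. f A \<noteq> 0 \<and> g A \<noteq> 0"
  using assms unfolding poly_irreducible_def by blast

lemma poly_irreducible_prod: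
  fixes f :: "'b \<Rightarrow> 'a::idom mat \<Rightarrow> 'a"
  assumes "poly_irreducible n X" "finite S"
    "\<And>x. x \<in> S \<Longrightarrow> polynomial_mat_function n (f x)" "\<And>x. x \<in> S \<Longrightarrow> \<exists>A\<in>X. f x A \<noteq> 0"
  shows "\<exists>A\<in>X. (\<Prod>x\<in>S. f x A) \<noteq> 0"
  using assms(2-4)
proof (induction S)
  case empty
  have "X \<noteq> {}" using assms(1) unfolding poly_irreducible_def by blast
  thus ?case by auto
next
  case (insert x S)
  have "polynomial_mat_function n (f x)" "polynomial_mat_function n (\<lambda>A. \<Prod>x\<in>S. f x A)"
    using insert.prems(1) by (auto intro: polynomial_mat_function_prod)
  moreover have "\<exists>A\<in>X. f x A \<noteq> 0" using insert.prems(2) by blast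
  moreover have "\<exists>A\<in>X. (\<Prod>x\<in>S. f x A) \<noteq> 0" using insert.prems by (intro insert.IH) auto
  ultimately have "\<exists>A\<in>X. f x A \<noteq> 0 \<and> (\<Prod>x\<in>S. f x A) \<noteq> 0"
    by (rule poly_irreducibleD[OF assms(1)])
  thus ?case using insert.hyps by (auto simp: mult_eq_0_iff)
qed

definition min_defect :: "'a::comm_ring_1 mat set \<Rightarrow> nat \<Rightarrow> nat" where
  "min_defect X m = (LEAST d. \<exists>A\<in>X. defect A m d)"

text \<open>
  For each \<open>m\<close> the least defect on \<open>X\<close> is attained on a nonempty open set.  Only the \<open>m\<close> up to \<open>n\<close>
  matter, and irreducibility lets the finitely many open sets meet; on the intersection all defects,
  and with them the Jordan type, are determined.  Any other open set with constant type meets this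
  one.
\<close>

lemma generic_jordan_type:
  fixes X :: "'a::idom mat set"
  assumes irr: "poly_irreducible n X" and jt: "\<And>A. A \<in> X \<Longrightarrow> \<exists>Q. has_jordan_type A Q"
  obtains qs U where "sorted_wrt (\<ge>) qs" "0 \<notin> set qs" "sum_list qs = n"
    "\<And>m. tail_sum qs m = min_defect X m"
    "zariski_open_in n X U" "U \<noteq> {}" "\<And>A. A \<in> U \<Longrightarrow> jordan_list A qs"
    "\<And>U' Q. zariski_open_in n X U' \<Longrightarrow> U' \<noteq> {} \<Longrightarrow> (\<And>A. A \<in> U' \<Longrightarrow> has_jordan_type A Q) \<Longrightarrow> Q = mset qs"
proof -
  have jl: "\<exists>qs. jordan_list A qs" if "A \<in> X" for A
    using jt[OF that] has_jordan_type_imp_jordan_list by blast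
  have Xc: "A \<in> X \<Longrightarrow> A \<in> carrier_mat n n" for A using irr by (auto simp: poly_irreducible_def)
  have Xne: "X \<noteq> {}" using irr by (auto simp: poly_irreducible_def)
  have ex: "\<exists>A\<in>X. defect A m (min_defect X m)" for m
  proof -
    obtain A where "A \<in> X" using Xne by auto
    moreover obtain qs where "jordan_list A qs" using jl calculation by auto
    ultimately show ?thesis unfolding min_defect_def
      by (intro LeastI[of "\<lambda>d. \<exists>A\<in>X. defect A m d" "tail_sum qs m"]) (auto dest: jordan_list_defect(1))
  qed
  have le: "min_defect X m \<le> d" if "A \<in> X" "defect A m d" for A m d
    unfolding min_defect_def using that by (intro Least_le) auto
  have "\<exists>N. N \<in> carrier_mat (n + m) (n + m) \<and>
      (\<exists>A\<in>X. coeff (det (zdiag n (set_corner n N A))) (min_defect X m) \<noteq> 0)" for m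
  proof -
    obtain A where A: "A \<in> X" "defect A m (min_defect X m)" using ex by blast
    then obtain N where N: "N \<in> carrier_mat (n + m) (n + m)"
      "\<forall>i<n. \<forall>j<n. N $$ (i, j) = - A $$ (i, j)" "coeff (det (zdiag n N)) (min_defect X m) \<noteq> 0"
      using carrier_matD[OF Xc[OF A(1)]] by (auto simp: defect_def)
    have "set_corner n N A = N" using N(1,2) by (intro eq_matI) (auto simp: set_corner_def)
    hence "coeff (det (zdiag n (set_corner n N A))) (min_defect X m) \<noteq> 0" using N(3) by metis
    thus ?thesis using N(1) A(1) by blast
  qed
  then obtain N where N: "\<And>m. N m \<in> carrier_mat (n + m) (n + m)"
    "\<And>m. \<exists>A\<in>X. coeff (det (zdiag n (set_corner n (N m) A))) (min_defect X m) \<noteq> 0" by metis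
  define f where "f m A = coeff (det (zdiag n (set_corner n (N m) A))) (min_defect X m)" for m A
  define F where "F A = (\<Prod>m\<in>{..n}. f m A)" for A
  have fpoly: "polynomial_mat_function n (f m)" for m
    unfolding f_def using polynomial_defect_coeff[OF N(1)] by simp
  have Fpoly: "polynomial_mat_function n F" unfolding F_def
    by (intro polynomial_mat_function_prod fpoly)
  obtain A0 where A0: "A0 \<in> X" "F A0 \<noteq> 0"
    using poly_irreducible_prod[OF irr, of "{..n}" f] fpoly N(2) unfolding F_def f_def by blast
  have tails: "tail_sum qs m = min_defect X m" if A: "A \<in> X" "F A \<noteq> 0" "jordan_list A qs" for A qs m
  proof (rule antisym)
    show "min_defect X m \<le> tail_sum qs m" using le[OF A(1) jordan_list_defect(1)[OF A(3)]] .
    show "tail_sum qs m \<le> min_defect X m"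
    proof (cases "m \<le> n")
      case True
      hence "f m A \<noteq> 0" using A(2) unfolding F_def by (auto simp: prod_zero_iff)
      hence "defect A m (min_defect X m)"
        unfolding defect_def f_def using N(1)[of m] carrier_matD[OF Xc[OF A(1)]]
        by (intro bexI[of _ "set_corner n (N m) A"]) (auto simp: set_corner_def)
      thus ?thesis using jordan_list_defect(2)[OF A(3)] by blast
    next
      case False
      have "0 \<notin> set qs" using A(3) unfolding jordan_list_def by blast
      hence "length qs \<le> sum_list qs"
        by (induction qs) auto
      hence "length qs \<le> m" using False jordan_list_defect(3)[OF A(3)] carrier_matD[OF Xc[OF A(1)]] by simp
      thus ?thesis by (simp add: tail_sum_def)
    qed
  qed
  obtain qs where qs: "jordan_list A0 qs" using jl A0 by blast
  define U where "U = {A \<in> X. F A \<noteq> 0}"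
  have Uj: "jordan_list A qs" if AU: "A \<in> U" for A
  proof -
    obtain ps where ps: "jordan_list A ps" using jl[of A] AU U_def by blast
    have "ps = qs" using tails[of A ps] tails[OF A0 qs] AU ps qs
      by (intro tail_sums_eq_imp_eq) (auto simp: U_def jordan_list_def)
    thus ?thesis using ps by simp
  qed
  show ?thesis
  proof (rule that[of qs U])
    show "sorted_wrt (\<ge>) qs" "0 \<notin> set qs" using qs by (auto simp: jordan_list_def)
    show "sum_list qs = n" using jordan_list_defect(3)[OF qs] Xc[OF A0(1)] by simp
    show "tail_sum qs m = min_defect X m" for m by (rule tails[OF A0 qs])
    show "zariski_open_in n X U" unfolding zariski_open_in_def U_def
      by (intro exI[of _ "{F}"]) (use Fpoly in auto)
    show "U \<noteq> {}" using A0 by (auto simp: U_def)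
    show "jordan_list A qs" if "A \<in> U" for A by (rule Uj[OF that])
    fix U' Q assume U': "zariski_open_in n X U'" "U' \<noteq> {}" "\<And>A. A \<in> U' \<Longrightarrow> has_jordan_type A Q"
    from U'(1) obtain G where G: "\<forall>g\<in>G. polynomial_mat_function n g"
      "U' = X - {A \<in> X. \<forall>g\<in>G. g A = 0}" by (auto simp: zariski_open_in_def)
    from U'(2) G obtain g A1 where g: "g \<in> G" "A1 \<in> X" "g A1 \<noteq> 0" by blast
    obtain A where A: "A \<in> X" "F A \<noteq> 0" "g A \<noteq> 0"
      using poly_irreducibleD[OF irr Fpoly, of g] G(1) g A0 by blast
    have "has_jordan_type A Q" using A g(1) G(2) U'(3) by blast
    hence "rev (sorted_list_of_multiset Q) = qs"
      using has_jordan_type_imp_jordan_list jordan_list_unique Uj[of A] A U_def by blast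
    thus "Q = mset qs" by (metis mset_rev mset_sorted_list_of_multiset)
  qed
qed

section \<open>The order of the poset in closed form\<close>

text \<open>
  The strict order of the poset.  The two inequalities say that \<open>u\<close> does not decrease and
  \<open>p - u\<close> does not increase; nonzero entries of a matrix commuting with the Jordan matrix obey them too
  (\<open>comm_support\<close>).
\<close>

fun elem_less :: "nat \<times> nat \<times> nat \<Rightarrow> nat \<times> nat \<times> nat \<Rightarrow> bool" where
  "elem_less (u, p, k) (v, q, l) \<longleftrightarrow> u \<le> v \<and> u + q \<le> v + p \<and> (p = q \<and> u = v \<longrightarrow> k < l)"

lemma elem_less_trans: "elem_less x y \<Longrightarrow> elem_less y z \<Longrightarrow> elem_less x z"
  by (cases x; cases y; cases z) auto

lemma elem_less_irrefl: "\<not> elem_less x x"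
  by (cases x) auto

lemma poset_elems_iff: "(u, p, k) \<in> poset_elems P \<longleftrightarrow> 1 \<le> u \<and> u \<le> p \<and> 1 \<le> k \<and> k \<le> count P p"
proof
  assume *: "1 \<le> u \<and> u \<le> p \<and> 1 \<le> k \<and> k \<le> count P p"
  hence "0 < count P p" by linarith
  thus "(u, p, k) \<in> poset_elems P" using * by (auto simp: poset_elems_def)
qed (auto simp: poset_elems_def)

lemma poset_elems_part: "(u, p, k) \<in> poset_elems P \<Longrightarrow> p \<in># P"
  by (simp add: poset_elems_def)

lemma finite_poset_elems [simp]: "finite (poset_elems P)"
proof (rule finite_subset)
  show "poset_elems P \<subseteq> (\<Union>p\<in>set_mset P. {..p} \<times> {p} \<times> {..count P p})"
    by (auto simp: poset_elems_def)
qed auto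

text \<open>
  A rank function, used to turn acyclicity into induction on numbers.
\<close>

definition elem_height :: "nat multiset \<Rightarrow> nat \<times> nat \<times> nat \<Rightarrow> nat" where
  "elem_height P x = card {y \<in> poset_elems P. elem_less y x}"

lemma elem_height_less:
  assumes "x \<in> poset_elems P" "elem_less x y"
  shows "elem_height P x < elem_height P y"
  unfolding elem_height_def
proof (rule psubset_card_mono)
  show "{z \<in> poset_elems P. elem_less z x} \<subset> {z \<in> poset_elems P. elem_less z y}"
    using assms elem_less_trans[OF _ assms(2)] elem_less_irrefl[of x] by blast
qed simp

lemma elem_height_bound: "x \<in> poset_elems P \<Longrightarrow> elem_height P x < card (poset_elems P)"
  unfolding elem_height_def using elem_less_irrefl[of x]
  by (intro psubset_card_mono) (simp, blast)

context fixes P :: "nat multiset" begin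

private abbreviation "reach \<equiv> (poset_covers P)\<^sup>*"

lemma reach_copy:
  assumes "(u, p, k) \<in> poset_elems P" "k \<le> l" "l \<le> count P p"
  shows "((u, p, k), (u, p, l)) \<in> reach"
  using assms(2,3)
proof (induction l rule: dec_induct)
  case (step m)
  hence "((u, p, m), (u, p, Suc m)) \<in> poset_covers P"
    using assms(1) by (auto simp: poset_covers_def poset_elems_iff)
  thus ?case using step by (meson Suc_leD rtrancl.rtrancl_into_rtrancl)
qed simp

lemma reach_cover:
  assumes "(u, p, k) \<in> poset_elems P" "(v, q, 1) \<in> poset_elems P"
    "next_part P p q \<and> v = u + (q - p) \<or> next_part P q p \<and> v = u \<or>
     q = p \<and> p + 1 \<notin># P \<and> p - 1 \<notin># P \<and> v = u + 1"
  shows "((u, p, k), (v, q, 1)) \<in> reach"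
proof -
  have "((u, p, k), (u, p, count P p)) \<in> reach" using assms(1) by (intro reach_copy) (auto simp: poset_elems_iff)
  moreover have "((u, p, count P p), (v, q, 1)) \<in> poset_covers P"
    using assms poset_elems_part[OF assms(1)] by (auto simp: poset_covers_def poset_elems_iff)
  ultimately show ?thesis by (rule rtrancl.rtrancl_into_rtrancl)
qed

text \<open>
  Moving one step along a part: directly by \<open>\<omega>\<close> when the part is isolated, and otherwise through
  the neighbouring part by one \<open>\<alpha>\<close> and one \<open>\<beta>\<close>.
\<close>

lemma reach_shift_one:
  assumes "(u, p, k) \<in> poset_elems P" "u < p"
  shows "((u, p, k), (u + 1, p, 1)) \<in> reach"
proof -
  have p: "p \<in># P" using assms(1) by (rule poset_elems_part)
  consider "p + 1 \<in># P" | "p - 1 \<in># P" | "p + 1 \<notin># P" "p - 1 \<notin># P" by blast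
  thus ?thesis
  proof cases
    case 1
    have "((u, p, k), (u + 1, p + 1, 1)) \<in> reach"
      using assms 1 p by (intro reach_cover) (auto simp: poset_elems_iff next_part_def)
    moreover have "((u + 1, p + 1, 1), (u + 1, p, 1)) \<in> reach"
      using assms 1 p by (intro reach_cover) (auto simp: poset_elems_iff next_part_def)
    ultimately show ?thesis by (rule rtrancl_trans)
  next
    case 2
    have "((u, p, k), (u, p - 1, 1)) \<in> reach"
      using assms 2 p by (intro reach_cover) (auto simp: poset_elems_iff next_part_def)
    moreover have "((u, p - 1, 1), (u + 1, p, 1)) \<in> reach"
      using assms 2 p by (intro reach_cover) (auto simp: poset_elems_iff next_part_def)
    ultimately show ?thesis by (rule rtrancl_trans)
  next
    case 3
    show ?thesis using assms 3 p by (intro reach_cover) (auto simp: poset_elems_iff)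
  qed
qed

lemma reach_shift:
  assumes "(u, p, k) \<in> poset_elems P" "(v, p, l) \<in> poset_elems P" "u < v \<or> u = v \<and> k \<le> l"
  shows "((u, p, k), (v, p, l)) \<in> reach"
proof (cases "u = v")
  case True
  thus ?thesis using assms by (auto intro!: reach_copy simp: poset_elems_iff)
next
  case False
  hence "Suc u \<le> v" using assms by auto
  hence "v \<le> p \<Longrightarrow> ((u, p, k), (v, p, 1)) \<in> reach"
  proof (induction v rule: dec_induct)
    case base
    thus ?case using reach_shift_one[OF assms(1)] by simp
  next
    case (step v)
    have "((v, p, 1), (v + 1, p, 1)) \<in> reach"
      using step assms poset_elems_part[OF assms(1)] by (intro reach_shift_one) (auto simp: poset_elems_iff)
    thus ?case using step by (metis Suc_eq_plus1 Suc_leD rtrancl_trans)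
  qed
  moreover have "((v, p, 1), (v, p, l)) \<in> reach"
    using assms(2) poset_elems_part[OF assms(2)] by (intro reach_copy) (auto simp: poset_elems_iff)
  moreover have "v \<le> p" using assms(2) by (simp add: poset_elems_iff)
  ultimately show ?thesis by (metis rtrancl_trans)
qed

lemma reach_down:
  "(u, p, k) \<in> poset_elems P \<Longrightarrow> q \<in># P \<Longrightarrow> u \<le> q \<Longrightarrow> q < p \<Longrightarrow> ((u, p, k), (u, q, 1)) \<in> reach"
proof (induction p arbitrary: k rule: less_induct)
  case (less p)
  define p' where "p' = Max {r \<in> set_mset P. r < p}"
  have fin: "finite {r \<in> set_mset P. r < p}" by simp
  have ne: "{r \<in> set_mset P. r < p} \<noteq> {}" using less.prems by auto
  have p': "p' \<in># P" "p' < p" "q \<le> p'"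
    using Max_in[OF fin ne] Max_ge[OF fin, of q] less.prems unfolding p'_def by auto
  have np: "next_part P p' p"
    using p' poset_elems_part[OF less.prems(1)] Max_ge[OF fin] unfolding next_part_def p'_def
    by (auto simp: not_less)
  have el: "(u, p', 1) \<in> poset_elems P" using less.prems p' by (auto simp: poset_elems_iff Suc_le_eq)
  have s: "((u, p, k), (u, p', 1)) \<in> reach" using less.prems(1) el np by (intro reach_cover) auto
  show ?case
  proof (cases "p' = q")
    case False
    hence "((u, p', 1), (u, q, 1)) \<in> reach" using less p' el by auto
    thus ?thesis using s by (rule rtrancl_trans[rotated])
  qed (use s in auto)
qed

lemma reach_up:
  "(u, p, k) \<in> poset_elems P \<Longrightarrow> q \<in># P \<Longrightarrow> p < q \<Longrightarrow> ((u, p, k), (u + (q - p), q, 1)) \<in> reach"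
proof (induction "q - p" arbitrary: u p k rule: less_induct)
  case less
  define p' where "p' = Min {r \<in> set_mset P. p < r}"
  have fin: "finite {r \<in> set_mset P. p < r}" by simp
  have ne: "{r \<in> set_mset P. p < r} \<noteq> {}" using less.prems by auto
  have p': "p' \<in># P" "p < p'" "p' \<le> q"
    using Min_in[OF fin ne] Min_le[OF fin, of q] less.prems unfolding p'_def by auto
  have np: "next_part P p p'"
  proof -
    have "p' \<le> r" if "r \<in># P" "p < r" for r using Min_le[OF fin, of r] that unfolding p'_def by auto
    hence "\<not> (\<exists>r. r \<in># P \<and> p < r \<and> r < p')" by (metis not_le)
    thus ?thesis using p' poset_elems_part[OF less.prems(1)] unfolding next_part_def by blast
  qed
  have el: "(u + (p' - p), p', 1) \<in> poset_elems P" using less.prems p' by (auto simp: poset_elems_iff Suc_le_eq)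
  have s: "((u, p, k), (u + (p' - p), p', 1)) \<in> reach" using less.prems(1) el np by (intro reach_cover) auto
  show ?case
  proof (cases "p' = q")
    case False
    hence "((u + (p' - p), p', 1), (u + (p' - p) + (q - p'), q, 1)) \<in> reach"
      using less.prems p' el by (intro less.hyps) auto
    moreover have "u + (p' - p) + (q - p') = u + (q - p)" using p' by simp
    ultimately show ?thesis using s by (metis rtrancl_trans)
  qed (use s in auto)
qed

lemma elem_less_imp_reach:
  assumes "x \<in> poset_elems P" "y \<in> poset_elems P" "elem_less x y"
  shows "(x, y) \<in> reach"
proof -
  obtain u p k v q l where xy: "x = (u, p, k)" "y = (v, q, l)" by (metis prod_cases3)
  have el: "(u, p, k) \<in> poset_elems P" "(v, q, l) \<in> poset_elems P" and le: "u \<le> v" "u + q \<le> v + p"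
    "p = q \<Longrightarrow> u = v \<Longrightarrow> k < l" using assms xy by auto
  have q: "q \<in># P" using el(2) by (rule poset_elems_part)
  have *: "1 \<le> count P q" using q by (simp add: Suc_le_eq)
  consider "p = q" | "q < p" | "p < q" by linarith
  thus ?thesis
  proof cases
    case 1
    thus ?thesis using reach_shift[of u p k v l] el le xy by (cases "u = v") auto
  next
    case 2
    have el2: "(u, q, 1) \<in> poset_elems P" using el le * by (auto simp: poset_elems_iff)
    have "((u, p, k), (u, q, 1)) \<in> reach" using reach_down[OF el(1) q _ 2] el2 by (auto simp: poset_elems_iff)
    moreover have "((u, q, 1), (v, q, l)) \<in> reach"
      using el el2 le by (intro reach_shift) (auto simp: poset_elems_iff)
    ultimately show ?thesis using xy by (metis rtrancl_trans)
  next
    case 3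
    have el2: "(u + (q - p), q, 1) \<in> poset_elems P" using el le * 3 by (auto simp: poset_elems_iff)
    have "((u, p, k), (u + (q - p), q, 1)) \<in> reach" using reach_up[OF el(1) q 3] .
    moreover have "((u + (q - p), q, 1), (v, q, l)) \<in> reach"
      using el el2 le 3 by (intro reach_shift) (auto simp: poset_elems_iff)
    ultimately show ?thesis using xy by (metis rtrancl_trans)
  qed
qed

lemma cover_imp_elem_less: "(x, y) \<in> poset_covers P \<Longrightarrow> elem_less x y"
  by (auto simp: poset_covers_def next_part_def)

lemma reach_imp_elem_less: "(x, y) \<in> reach \<Longrightarrow> x = y \<or> elem_less x y"
  by (induction rule: rtrancl_induct) (auto dest: cover_imp_elem_less elem_less_trans)

text \<open>
  Elements related in the closed form are joined by moving through the parts one at a time and shifting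
  within a part.
\<close>

lemma poset_order_iff:
  "(x, y) \<in> poset_order P \<longleftrightarrow> x \<in> poset_elems P \<and> y \<in> poset_elems P \<and> (x = y \<or> elem_less x y)"
  unfolding poset_order_def using elem_less_imp_reach reach_imp_elem_less by blast

end

lemma Chains_poset_order:
  "C \<in> Chains (poset_order P) \<longleftrightarrow> C \<subseteq> poset_elems P \<and> (\<forall>x\<in>C. \<forall>y\<in>C. x = y \<or> elem_less x y \<or> elem_less y x)"
  unfolding Chains_def poset_order_iff by (auto simp: subset_iff)

section \<open>A weighting that bounds unions of chains\<close>

text \<open>
  Think of \<open>x\<close> as occupying the interval from \<open>s x\<close> of length \<open>f x\<close>.  Along a chain these intervals
  are disjoint and increasing, and all lie in \<open>[0, b]\<close>.
\<close>

lemma chain_weight_le: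
  fixes s f :: "'b \<Rightarrow> real" and h :: "'b \<Rightarrow> nat"
  assumes "finite C" "\<And>x y. x \<in> C \<Longrightarrow> y \<in> C \<Longrightarrow> x = y \<or> lt x y \<or> lt y x"
    "\<And>x y. x \<in> C \<Longrightarrow> y \<in> C \<Longrightarrow> lt x y \<Longrightarrow> s x + f x \<le> s y \<and> h x < h y"
    "\<And>x. x \<in> C \<Longrightarrow> s x + f x \<le> b" "\<And>x. x \<in> C \<Longrightarrow> 0 \<le> s x" "0 \<le> b"
  shows "sum f C \<le> b"
  using assms
proof (induction "card C" arbitrary: C b)
  case 0
  thus ?case by simp
next
  case (Suc c)
  have "C \<noteq> {}" using Suc by auto
  then obtain m where m: "m \<in> C" "\<And>x. x \<in> C \<Longrightarrow> h x \<le> h m"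
    using Max_in[of "h ` C"] Max_ge[of "h ` C"] Suc.prems(1) by (metis (no_types, lifting) finite_imageI image_iff image_is_empty)
  have below: "lt x m" if "x \<in> C - {m}" for x
    using Suc.prems(2)[of x m] Suc.prems(3)[of m x] m that by fastforce
  have "sum f (C - {m}) \<le> s m"
  proof (rule Suc.hyps(1))
    show "c = card (C - {m})" using Suc.hyps(2) Suc.prems(1) m(1) by simp
    show "s x + f x \<le> s m" if "x \<in> C - {m}" for x
      using Suc.prems(3)[of x m] below[OF that] that m(1) by auto
  qed (use Suc.prems m(1) in auto)
  thus ?case using Suc.prems(4)[OF m(1)] sum.remove[OF Suc.prems(1) m(1), of f] by simp
qed

lemma sum_UN_nonneg_le:
  fixes f :: "'b \<Rightarrow> real"
  assumes "finite I" "\<And>i. i \<in> I \<Longrightarrow> finite (A i)" "\<And>i x. i \<in> I \<Longrightarrow> x \<in> A i \<Longrightarrow> 0 \<le> f x"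
  shows "sum f (\<Union>i\<in>I. A i) \<le> (\<Sum>i\<in>I. sum f (A i))"
  using assms
proof (induction I)
  case (insert i I)
  have "sum f (A i \<union> (\<Union>i\<in>I. A i)) \<le> sum f (A i) + sum f (\<Union>i\<in>I. A i)"
    using insert.prems insert.hyps by (subst sum.union_inter[symmetric]) (auto intro!: sum_nonneg)
  also have "\<dots> \<le> sum f (A i) + (\<Sum>i\<in>I. sum f (A i))" using insert by auto
  finally show ?case using insert.hyps by simp
qed simp

text \<open>
  Linear programming duality: \<open>m\<close> chains pick up at most \<open>m * F\<close> of the total weight
  \<open>(m + 1) * F\<close>, and every element has weight at most 1, so at least \<open>F\<close> elements are missed.
\<close>

lemma chain_union_bound:
  fixes s f :: "nat \<times> nat \<times> nat \<Rightarrow> real" and F :: real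
  assumes W: "W \<subseteq> poset_elems P"
    and f: "\<And>x. x \<in> W \<Longrightarrow> 0 \<le> f x \<and> f x \<le> 1 \<and> 0 \<le> s x \<and> s x + f x \<le> F"
    and mono: "\<And>x y. x \<in> W \<Longrightarrow> y \<in> W \<Longrightarrow> elem_less x y \<Longrightarrow> s x + f x \<le> s y"
    and total: "sum f W = real (Suc m) * F" and F: "0 \<le> F"
    and C: "\<And>i. i < m \<Longrightarrow> C i \<in> Chains (poset_order P)"
  shows "card (\<Union>i<m. C i) + F \<le> card (poset_elems P)"
proof -
  let ?U = "\<Union>i<m. C i"
  have UD: "?U \<subseteq> poset_elems P" using C by (auto simp: Chains_poset_order)
  have finW: "finite W" using W by (rule finite_subset) simp
  have one: "sum f (C i \<inter> W) \<le> F" if "i < m" for i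
  proof (rule chain_weight_le[where lt = elem_less and s = s and h = "elem_height P"])
    show "x = y \<or> elem_less x y \<or> elem_less y x" if "x \<in> C i \<inter> W" "y \<in> C i \<inter> W" for x y
      using C[OF \<open>i < m\<close>] that unfolding Chains_poset_order by blast
    show "s x + f x \<le> s y \<and> elem_height P x < elem_height P y"
      if "x \<in> C i \<inter> W" "y \<in> C i \<inter> W" "elem_less x y" for x y
      using mono[of x y] elem_height_less[of x P y] that W by blast
  qed (use finW f F in auto)
  have "sum f (?U \<inter> W) \<le> (\<Sum>i<m. sum f (C i \<inter> W))"
  proof -
    have "?U \<inter> W = (\<Union>i\<in>{..<m}. C i \<inter> W)" by auto
    moreover have "sum f (\<Union>i\<in>{..<m}. C i \<inter> W) \<le> (\<Sum>i<m. sum f (C i \<inter> W))"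
      by (rule sum_UN_nonneg_le) (use finW f in auto)
    ultimately show ?thesis by simp
  qed
  also have "\<dots> \<le> (\<Sum>i<m. F)" using one by (intro sum_mono) auto
  finally have "sum f (?U \<inter> W) \<le> real m * F" by simp
  moreover have "sum f W = sum f (?U \<inter> W) + sum f (W - ?U)"
    using finW by (metis Int_commute sum.Int_Diff)
  ultimately have "F \<le> sum f (W - ?U)" using total by (simp add: algebra_simps)
  also have "\<dots> \<le> (\<Sum>x\<in>W - ?U. 1)" using f by (intro sum_mono) auto
  also have "\<dots> = card (W - ?U)" by simp
  also have "\<dots> \<le> card (poset_elems P - ?U)" using W by (intro of_nat_mono card_mono) auto
  also have "\<dots> = real (card (poset_elems P)) - real (card ?U)"
  proof -
    have "finite ?U" using UD by (rule finite_subset) simp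
    moreover have "card ?U \<le> card (poset_elems P)" using UD by (intro card_mono) auto
    ultimately show ?thesis using UD by (simp add: card_Diff_subset of_nat_diff)
  qed
  finally show ?thesis by simp
qed

text \<open>
  The parts are covered by \<open>r\<close> pairs of consecutive values, chosen greedily from below, so that the
  lower value of each pair is a part.  These are the almost rectangular pieces of a shortest
  decomposition.
\<close>

locale greedy_cover =
  fixes P :: "nat multiset" and a :: "nat \<Rightarrow> nat" and r :: nat
  assumes r_pos: "1 \<le> r"
    and a_part: "\<And>t. 1 \<le> t \<Longrightarrow> t \<le> r \<Longrightarrow> a t \<in># P"
    and gap: "\<And>t. 1 \<le> t \<Longrightarrow> t < r \<Longrightarrow> a t + 1 < a (Suc t)"
    and covered: "\<And>p. p \<in># P \<Longrightarrow> \<exists>t. 1 \<le> t \<and> t \<le> r \<and> (p = a t \<or> p = a t + 1)"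
    and parts_pos: "0 \<notin># P"
begin

lemma gap_le: "1 \<le> t \<Longrightarrow> t \<le> t' \<Longrightarrow> t' \<le> r \<Longrightarrow> a t + 2 * (t' - t) \<le> a t'"
proof (induction t')
  case (Suc t')
  show ?case
  proof (cases "t = Suc t'")
    case False
    thus ?thesis using Suc gap[of t'] by (auto simp: Suc_diff_le)
  qed simp
qed simp

lemma a_lower: "1 \<le> t \<Longrightarrow> t \<le> r \<Longrightarrow> 2 * t \<le> a t + 1"
  using gap_le[of 1 t] a_part[of 1] parts_pos r_pos by (cases "a 1") auto

text \<open>
  The number of rows \<open>u\<close> of the part \<open>a t\<close> left in level \<open>t\<close> after the \<open>t - 1\<close> lower levels have taken
  theirs at either end.
\<close>

definition lanes :: "nat \<Rightarrow> nat" where "lanes t = a t + 2 - 2 * t"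

lemma lanes_eq: "1 \<le> t \<Longrightarrow> t \<le> r \<Longrightarrow> a t + 2 = lanes t + 2 * t"
  using a_lower[of t] by (simp add: lanes_def)

lemma lanes_pos: "1 \<le> t \<Longrightarrow> t \<le> r \<Longrightarrow> 1 \<le> lanes t"
  using a_lower[of t] by (simp add: lanes_def)

lemma lanes_mono: "1 \<le> t \<Longrightarrow> t \<le> t' \<Longrightarrow> t' \<le> r \<Longrightarrow> lanes t \<le> lanes t'"
  using gap_le[of t t'] lanes_eq[of t] lanes_eq[of t'] by linarith

text \<open>
  The number of elements left out by a configuration with one level less: the rows of
  level \<open>t\<close> in part \<open>a t\<close> and those of level \<open>t'\<close> in part \<open>a t' + 1\<close>.
\<close>

definition cut_value :: "nat \<Rightarrow> nat \<Rightarrow> nat" where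
  "cut_value t t' = lanes t * count P (a t) + (lanes t + 1) * count P (a t' + 1)"

definition cut_values :: "nat set" where
  "cut_values = {cut_value t t' | t t'. 1 \<le> t \<and> t \<le> t' \<and> t' \<le> r \<and> lanes t = lanes t'}"

definition min_cut :: nat where "min_cut = Min cut_values"

lemma finite_cut_values: "finite cut_values"
  by (rule finite_subset[of _ "(\<lambda>(t, t'). cut_value t t') ` ({..r} \<times> {..r})"])
     (auto simp: cut_values_def)

lemma cut_values_nonempty: "cut_values \<noteq> {}"
  using r_pos by (auto simp: cut_values_def)

lemma min_cut_le: "1 \<le> t \<Longrightarrow> t \<le> t' \<Longrightarrow> t' \<le> r \<Longrightarrow> lanes t = lanes t' \<Longrightarrow> min_cut \<le> cut_value t t'"
  unfolding min_cut_def using finite_cut_values by (intro Min_le) (auto simp: cut_values_def)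

lemma min_cut_attained:
  obtains t t' where "1 \<le> t" "t \<le> t'" "t' \<le> r" "lanes t = lanes t'" "min_cut = cut_value t t'"
  using Min_in[OF finite_cut_values cut_values_nonempty] unfolding min_cut_def[symmetric]
  by (auto simp: cut_values_def)

lemma min_cut_pos: "1 \<le> min_cut"
proof -
  obtain t t' where t: "1 \<le> t" "t \<le> t'" "t' \<le> r" "min_cut = cut_value t t'"
    by (rule min_cut_attained) auto
  have "1 \<le> count P (a t)" using a_part[of t] t by (simp add: Suc_le_eq)
  moreover have "1 \<le> lanes t" using lanes_pos t by simp
  ultimately have "1 \<le> lanes t * count P (a t)" by (simp add: Suc_le_eq)
  thus ?thesis unfolding t(4) cut_value_def by linarith
qed

definition F :: real where "F = real min_cut"

text \<open>
  The weighting gives each row of the part \<open>a t\<close> the total \<open>delta t\<close> and each row of \<open>a t + 1\<close> the total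
  \<open>eps t\<close>, where \<open>rho t = delta t + eps t\<close> is the period along the level and
  \<open>lanes t * rho t + eps t = F\<close> makes each level weigh \<open>F\<close>.  The conditions \<open>0 \<le> eps t\<close> and
  \<open>delta t \<le> count P (a t)\<close> are the upper bounds on \<open>rho t\<close> collected here; intervals of
  different levels fit together when \<open>rho\<close> is nonincreasing.
\<close>

definition hi :: "nat \<Rightarrow> real" where
  "hi t = min (F / lanes t) ((F + count P (a t)) / (lanes t + 1))"

definition rho :: "nat \<Rightarrow> real" where "rho t = Min (hi ` {1..t})"

definition eps :: "nat \<Rightarrow> real" where "eps t = F - lanes t * rho t"

definition delta :: "nat \<Rightarrow> real" where "delta t = (lanes t + 1) * rho t - F"

lemma F_nonneg: "0 \<le> F" by (simp add: F_def)

text \<open>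
  The two expressions on the left are the lower bounds on \<open>rho t'\<close> that come from \<open>0 \<le> delta t'\<close> and
  \<open>eps t' \<le> count P (a t' + 1)\<close>.  They are compatible with the upper bounds at earlier levels:
  for equal lanes this is the inequality \<open>min_cut \<le> cut_value t t'\<close>, and for different ones it holds
  because one more lane compensates any multiplicity.
\<close>

lemma lower_le_hi:
  assumes "1 \<le> t" "t \<le> t'" "t' \<le> r"
  shows "F / (lanes t' + 1) \<le> hi t" "(F - count P (a t' + 1)) / lanes t' \<le> hi t"
proof -
  have L: "1 \<le> lanes t" "lanes t \<le> lanes t'" using lanes_pos lanes_mono assms by auto
  have 1: "F / (lanes t' + 1) \<le> F / lanes t" using L F_nonneg by (intro divide_left_mono) auto
  have "F / (lanes t' + 1) \<le> F / (lanes t + 1)" using L F_nonneg by (intro divide_left_mono) auto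
  also have "\<dots> \<le> (F + count P (a t)) / (lanes t + 1)" by (intro divide_right_mono) auto
  finally show "F / (lanes t' + 1) \<le> hi t" using 1 by (simp add: hi_def)
  have "(F - count P (a t' + 1)) / lanes t' \<le> F / lanes t'" by (intro divide_right_mono) auto
  also have "\<dots> \<le> F / lanes t" using L F_nonneg by (intro divide_left_mono) auto
  finally have 2: "(F - count P (a t' + 1)) / lanes t' \<le> F / lanes t" .
  have "(F - count P (a t' + 1)) / lanes t' \<le> (F + count P (a t)) / (lanes t + 1)"
  proof (cases "lanes t = lanes t'")
    case True
    have "F \<le> real (cut_value t t')" unfolding F_def using min_cut_le[OF assms True] by simp
    hence "F * lanes t + F \<le> lanes t * F + lanes t * count P (a t) + (lanes t + 1) * count P (a t' + 1)"
      by (simp add: cut_value_def algebra_simps)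
    hence "(F - count P (a t' + 1)) * (lanes t + 1) \<le> (F + count P (a t)) * lanes t"
      by (simp add: algebra_simps)
    moreover have "0 < real (lanes t)" using L by simp
    ultimately show ?thesis unfolding True[symmetric]
      by (simp add: divide_simps del: of_nat_Suc)
  next
    case False
    hence "lanes t + 1 \<le> lanes t'" using L by simp
    hence "F / lanes t' \<le> F / (lanes t + 1)" using L F_nonneg by (intro divide_left_mono) auto
    moreover have "(F - count P (a t' + 1)) / lanes t' \<le> F / lanes t'" by (intro divide_right_mono) auto
    moreover have "F / (lanes t + 1) \<le> (F + count P (a t)) / (lanes t + 1)" by (intro divide_right_mono) auto
    ultimately show ?thesis by linarith
  qed
  thus "(F - count P (a t' + 1)) / lanes t' \<le> hi t" using 2 by (simp add: hi_def)
qed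

lemma rho_antimono: "1 \<le> t \<Longrightarrow> t \<le> t' \<Longrightarrow> rho t' \<le> rho t"
  unfolding rho_def by (intro Min_antimono) auto

lemma rho_bounds:
  assumes "1 \<le> t" "t \<le> r"
  shows "0 \<le> rho t" "0 \<le> eps t" "eps t \<le> count P (a t + 1)" "0 \<le> delta t" "delta t \<le> count P (a t)"
    "eps t + delta t = rho t" "lanes t * rho t + eps t = F"
proof -
  have L: "0 < real (lanes t)" using lanes_pos[OF assms] by simp
  have "rho t \<le> hi t" unfolding rho_def using assms by (intro Min_le) auto
  hence up: "rho t \<le> F / lanes t" "rho t \<le> (F + count P (a t)) / (lanes t + 1)" by (auto simp: hi_def)
  have "rho t \<in> hi ` {1..t}" unfolding rho_def using assms by (intro Min_in) auto
  then obtain i where i: "1 \<le> i" "i \<le> t" "rho t = hi i" by auto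
  have lo: "F / (lanes t + 1) \<le> rho t" "(F - count P (a t + 1)) / lanes t \<le> rho t"
    using lower_le_hi[OF i(1,2) assms(2)] i(3) by auto
  show "0 \<le> eps t" using up(1) L by (simp add: eps_def field_simps)
  show "delta t \<le> count P (a t)" using up(2) L by (simp add: delta_def field_simps)
  show "0 \<le> delta t" using lo(1) L by (simp add: delta_def field_simps)
  show "eps t \<le> count P (a t + 1)" using lo(2) L by (simp add: eps_def field_simps)
  have "0 \<le> F / (lanes t + 1)" using F_nonneg by simp
  thus "0 \<le> rho t" using lo(1) by linarith
  show "eps t + delta t = rho t" "lanes t * rho t + eps t = F" by (simp_all add: eps_def delta_def algebra_simps)
qed

definition layer :: "nat \<Rightarrow> nat" where
  "layer p = (SOME t. 1 \<le> t \<and> t \<le> r \<and> (p = a t \<or> p = a t + 1))"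

lemma layer_unique:
  assumes "1 \<le> t" "t \<le> r" "p = a t \<or> p = a t + 1" "1 \<le> t'" "t' \<le> r" "p = a t' \<or> p = a t' + 1"
  shows "t = t'"
  using assms gap_le[of t t'] gap_le[of t' t] by (cases t t' rule: linorder_cases) auto

lemma layer_eq: "1 \<le> t \<Longrightarrow> t \<le> r \<Longrightarrow> p = a t \<or> p = a t + 1 \<Longrightarrow> layer p = t"
  unfolding layer_def by (rule some_equality, blast) (metis layer_unique)

lemma layer: "p \<in># P \<Longrightarrow> 1 \<le> layer p \<and> layer p \<le> r \<and> (p = a (layer p) \<or> p = a (layer p) + 1)"
  using covered[of p] layer_eq by metis

definition lane_len :: "nat \<Rightarrow> real" where
  "lane_len p = (if p = a (layer p) then delta (layer p) else eps (layer p))"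

definition lane_start :: "nat \<Rightarrow> nat \<Rightarrow> real" where
  "lane_start u p = (real u - real (layer p)) * rho (layer p) + (if p = a (layer p) then eps (layer p) else 0)"

definition weight :: "nat \<times> nat \<times> nat \<Rightarrow> real" where
  "weight = (\<lambda>(u, p, k). lane_len p / count P p)"

definition start :: "nat \<times> nat \<times> nat \<Rightarrow> real" where
  "start = (\<lambda>(u, p, k). lane_start u p + (real k - 1) * (lane_len p / count P p))"

definition laned :: "(nat \<times> nat \<times> nat) set" where
  "laned = {(u, p, k). (u, p, k) \<in> poset_elems P \<and> layer p \<le> u \<and> u + layer p \<le> p + 1}"

lemma lane_len: "p \<in># P \<Longrightarrow> 0 \<le> lane_len p \<and> lane_len p \<le> count P p"
  using layer[of p] rho_bounds[of "layer p"] by (auto simp: lane_len_def)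

lemma start_weight:
  "start (u, p, k) + weight (u, p, k) = lane_start u p + real k * (lane_len p / count P p)"
proof -
  have "lane_start u p + (real k - 1) * x + x = lane_start u p + real k * x" for x :: real
    by (simp add: algebra_simps)
  thus ?thesis by (simp only: start_def weight_def split)
qed

lemma start_end:
  assumes "(u, p, k) \<in> laned"
  shows "lane_start u p \<le> start (u, p, k)"
    "start (u, p, k) + weight (u, p, k) \<le> lane_start u p + lane_len p"
    "0 \<le> weight (u, p, k)" "weight (u, p, k) \<le> 1"
proof -
  have el: "p \<in># P" "1 \<le> k" "k \<le> count P p"
    using assms by (auto simp: laned_def poset_elems_def)
  have l: "0 \<le> lane_len p" "lane_len p \<le> count P p" using lane_len[OF el(1)] by auto
  have c: "0 < real (count P p)" using el by simp
  show w0: "0 \<le> weight (u, p, k)" using l by (simp add: weight_def)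
  show "weight (u, p, k) \<le> 1" using l c by (simp add: weight_def)
  have "0 \<le> (real k - 1) * (lane_len p / count P p)" using el(2) l by (intro mult_nonneg_nonneg) auto
  thus "lane_start u p \<le> start (u, p, k)" by (simp add: start_def)
  have "real k * (lane_len p / count P p) \<le> count P p * (lane_len p / count P p)"
    using el(3) l by (intro mult_right_mono) auto
  also have "\<dots> = lane_len p" using c by simp
  finally show "start (u, p, k) + weight (u, p, k) \<le> lane_start u p + lane_len p"
    by (simp only: start_weight)
qed

text \<open>
  Within a level rows alternate between the two parts of the pair and each starts where the previous
  one ends.  Between levels it matters that \<open>rho\<close> is nonincreasing: downwards the offset from the first
  row grows, upwards the offset from the last row shrinks, and every level ends at \<open>F\<close>.
\<close>

lemma lane_order:
  assumes p: "p \<in># P" and q: "q \<in># P" and u: "layer p \<le> u" "u + layer p \<le> p + 1"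
    and v: "layer q \<le> v" "v + layer q \<le> q + 1"
    and le: "u \<le> v" "u + q \<le> v + p" and ne: "(u, p) \<noteq> (v, q)"
  shows "lane_start u p + lane_len p \<le> lane_start v q"
proof -
  define t where "t = layer p"
  define t' where "t' = layer q"
  have t: "1 \<le> t" "t \<le> r" "p = a t \<or> p = a t + 1" using layer[OF p] by (auto simp: t_def)
  have t': "1 \<le> t'" "t' \<le> r" "q = a t' \<or> q = a t' + 1" using layer[OF q] by (auto simp: t'_def)
  define o1 where "o1 = u - t"
  define o2 where "o2 = v - t'"
  define b1 where "b1 = p + 1 - t - u"
  define b2 where "b2 = q + 1 - t' - v"
  have uo: "u = o1 + t" "v = o2 + t'" using u v by (auto simp: o1_def o2_def t_def t'_def)
  have po: "p + 1 = b1 + 2 * t + o1" "q + 1 = b2 + 2 * t' + o2"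
    using u v uo by (auto simp: b1_def b2_def t_def t'_def)
  have lat: "layer (a t) = t" using layer_eq[OF t(1,2)] by blast
  have lat': "layer (a t') = t'" using layer_eq[OF t'(1,2)] by blast
  note R = rho_bounds[OF t(1,2)] note R' = rho_bounds[OF t'(1,2)]
  have e1: "lane_start u p + lane_len p = (if p = a t then (real o1 + 1) * rho t else real o1 * rho t + eps t)"
    using R(6) by (simp add: lane_start_def lane_len_def t_def[symmetric] lat uo(1) algebra_simps)
  have s2: "lane_start v q = real o2 * rho t' + (if q = a t' then eps t' else 0)"
    by (simp add: lane_start_def t'_def[symmetric] lat' uo(2))
  have Lb: "lanes t = (if p = a t then o1 + b1 + 1 else o1 + b1)"
    using po(1) lanes_eq[OF t(1,2)] t(3) by auto
  have Lb': "lanes t' = (if q = a t' then o2 + b2 + 1 else o2 + b2)"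
    using po(2) lanes_eq[OF t'(1,2)] t'(3) by auto
  consider "t = t'" | "t' < t" | "t < t'" by linarith
  thus ?thesis
  proof cases
    case 1
    show ?thesis
    proof (cases "p = q")
      case True
      hence "o1 + 1 \<le> o2" using le ne uo 1 by auto
      hence "(real o1 + 1) * rho t \<le> real o2 * rho t" using R(1) by (intro mult_right_mono) auto
      moreover have "eps t \<le> rho t" using R by linarith
      ultimately show ?thesis unfolding e1 s2 using 1 True R(2) by (auto simp: algebra_simps)
    next
      case False
      show ?thesis
      proof (cases "p = a t")
        case True
        hence "q = p + 1" using False t' 1 by auto
        hence "o1 + 1 \<le> o2" using le uo 1 by auto
        hence "(real o1 + 1) * rho t \<le> real o2 * rho t" using R(1) by (intro mult_right_mono) auto
        thus ?thesis unfolding e1 s2 using 1 True R(2) by auto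
      next
        case pn: False
        hence "q = a t'" using False t t' 1 by auto
        moreover have "real o1 * rho t \<le> real o2 * rho t"
          using R(1) le uo 1 by (intro mult_right_mono) auto
        ultimately show ?thesis unfolding e1 s2 using 1 pn by auto
      qed
    qed
  next
    case 2
    have "lane_start u p + lane_len p \<le> (real o1 + 1) * rho t"
      unfolding e1 using R by (auto simp: algebra_simps)
    also have "\<dots> \<le> (real o1 + 1) * rho t'" using rho_antimono[of t' t] 2 t' by (intro mult_left_mono) auto
    also have "\<dots> \<le> real o2 * rho t'"
      using R'(1) le uo 2 by (intro mult_right_mono) auto
    also have "\<dots> \<le> lane_start v q" unfolding s2 using R'(2) by auto
    finally show ?thesis .
  next
    case 3
    have "b2 + 1 \<le> b1" using le uo po 3 by linarith
    have "F - lane_start v q \<le> (real b2 + 1) * rho t'"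
      unfolding s2 using R'(7) R'(4) R'(6) by (auto simp: Lb' algebra_simps split: if_splits)
    also have "\<dots> \<le> (real b2 + 1) * rho t" using rho_antimono[of t t'] 3 t by (intro mult_left_mono) auto
    also have "\<dots> \<le> real b1 * rho t" using \<open>b2 + 1 \<le> b1\<close> R(1) by (intro mult_right_mono) auto
    also have "\<dots> \<le> F - (lane_start u p + lane_len p)"
      unfolding e1 using R(7) R(2) by (auto simp: Lb algebra_simps split: if_splits)
    finally show ?thesis by linarith
  qed
qed

lemma lane_end_le:
  assumes p: "p \<in># P" and u: "layer p \<le> u" "u + layer p \<le> p + 1"
  shows "0 \<le> lane_start u p" "lane_start u p + lane_len p \<le> F"
proof -
  define t where "t = layer p"
  have t: "1 \<le> t" "t \<le> r" "p = a t \<or> p = a t + 1" using layer[OF p] by (auto simp: t_def)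
  have lat: "layer (a t) = t" using layer_eq[OF t(1,2)] by blast
  note R = rho_bounds[OF t(1,2)]
  define o1 where "o1 = u - t"
  have uo: "u = o1 + t" using u by (auto simp: o1_def t_def)
  show "0 \<le> lane_start u p" using R by (simp add: lane_start_def t_def[symmetric] lat uo)
  have Lb: "if p = a t then o1 + 1 \<le> lanes t else o1 \<le> lanes t"
    using u lanes_eq[OF t(1,2)] t(3) uo by (auto simp: t_def[symmetric])
  have "lane_start u p + lane_len p = (if p = a t then (real o1 + 1) * rho t else real o1 * rho t + eps t)"
    using R(6) by (simp add: lane_start_def lane_len_def t_def[symmetric] lat uo(1) algebra_simps)
  also have "\<dots> \<le> lanes t * rho t + eps t"
  proof (cases "p = a t")
    case True
    hence "(real o1 + 1) * rho t \<le> lanes t * rho t" using Lb R(1) by (intro mult_right_mono) auto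
    thus ?thesis using True R(2) by auto
  next
    case False
    hence "real o1 * rho t \<le> lanes t * rho t" using Lb R(1) by (intro mult_right_mono) auto
    thus ?thesis using False by auto
  qed
  finally show "lane_start u p + lane_len p \<le> F" using R(7) by simp
qed

text \<open>
  Level \<open>t\<close> has \<open>lanes t\<close> rows of the part \<open>a t\<close> and one more of \<open>a t + 1\<close>.
\<close>

lemma total_weight: "sum weight laned = real r * F"
proof -
  define W1 where "W1 t = {t..a t + 1 - t} \<times> {a t} \<times> {1..count P (a t)}" for t
  define W2 where "W2 t = {t..a t + 2 - t} \<times> {a t + 1} \<times> {1..count P (a t + 1)}" for t
  have W: "laned = (\<Union>t\<in>{1..r}. W1 t \<union> W2 t)"
  proof (intro equalityI subsetI)
    fix x assume "x \<in> laned"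
    then obtain u p k where x: "x = (u, p, k)" "(u, p, k) \<in> poset_elems P" "layer p \<le> u" "u + layer p \<le> p + 1"
      by (auto simp: laned_def)
    have "1 \<le> layer p \<and> layer p \<le> r \<and> (p = a (layer p) \<or> p = a (layer p) + 1)"
      using layer poset_elems_part[OF x(2)] by blast
    thus "x \<in> (\<Union>t\<in>{1..r}. W1 t \<union> W2 t)"
      using x by (intro UN_I[of "layer p"]) (auto simp: W1_def W2_def poset_elems_iff)
  next
    fix x assume "x \<in> (\<Union>t\<in>{1..r}. W1 t \<union> W2 t)"
    then obtain t where t: "1 \<le> t" "t \<le> r" and x: "x \<in> W1 t \<union> W2 t" by auto
    have l: "layer (a t) = t" "layer (Suc (a t)) = t" using layer_eq[OF t] by auto
    show "x \<in> laned" using x l t a_lower[OF t]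
      by (auto simp: W1_def W2_def laned_def poset_elems_iff)
  qed
  have one: "sum weight (W1 t \<union> W2 t) = F" if t: "1 \<le> t" "t \<le> r" for t
  proof -
    note R = rho_bounds[OF t]
    have l: "layer (a t) = t" "layer (Suc (a t)) = t" using layer_eq[OF t] by auto
    have "sum weight (W1 t \<union> W2 t) = sum weight (W1 t) + sum weight (W2 t)"
      by (rule sum.union_disjoint) (auto simp: W1_def W2_def)
    also have "sum weight (W1 t) = (\<Sum>x\<in>W1 t. delta t / count P (a t))"
      by (intro sum.cong) (auto simp: W1_def weight_def lane_len_def l)
    also have "\<dots> = lanes t * delta t"
    proof -
      have "card (W1 t) = lanes t * count P (a t)"
        using lanes_eq[OF t] a_lower[OF t] by (simp add: W1_def card_cartesian_product lanes_def mult_2)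
      thus ?thesis using a_part[OF t] by (simp add: count_eq_zero_iff)
    qed
    also have "sum weight (W2 t) = (\<Sum>x\<in>W2 t. eps t / count P (a t + 1))"
      by (intro sum.cong) (auto simp: W2_def weight_def lane_len_def l)
    also have "\<dots> = (lanes t + 1) * eps t"
    proof -
      have "card (W2 t) = (lanes t + 1) * count P (a t + 1)"
        using lanes_eq[OF t] a_lower[OF t] by (simp add: W2_def card_cartesian_product lanes_def Suc_diff_le mult_2)
      hence "(\<Sum>x\<in>W2 t. eps t / count P (a t + 1)) =
          (lanes t + 1) * (count P (a t + 1) * (eps t / count P (a t + 1)))"
        by (simp only: sum_constant of_nat_mult mult.assoc)
      also have "count P (a t + 1) * (eps t / count P (a t + 1)) = eps t"
      proof (cases "real (count P (a t + 1)) = 0")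
        case True
        hence "eps t = 0" using R(2,3) by linarith
        thus ?thesis by simp
      next
        case False
        thus ?thesis by (metis nonzero_mult_div_cancel_left times_divide_eq_right)
      qed
      finally show ?thesis .
    qed
    also have "lanes t * delta t + (lanes t + 1) * eps t = F"
      by (simp add: delta_def eps_def algebra_simps)
    finally show ?thesis .
  qed
  have "sum weight laned = (\<Sum>t\<in>{1..r}. sum weight (W1 t \<union> W2 t))" unfolding W
  proof (rule sum.UNION_disjoint)
    show "\<forall>i\<in>{1..r}. \<forall>j\<in>{1..r}. i \<noteq> j \<longrightarrow> (W1 i \<union> W2 i) \<inter> (W1 j \<union> W2 j) = {}"
    proof (intro ballI impI)
      fix i j assume ij: "i \<in> {1..r}" "j \<in> {1..r}" "i \<noteq> j"
      have "x \<notin> W1 j \<union> W2 j" if x: "x \<in> W1 i \<union> W2 i" for x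
      proof
        assume "x \<in> W1 j \<union> W2 j"
        moreover obtain u p k where "x = (u, p, k)" by (metis prod_cases3)
        ultimately have "p = a i \<or> p = a i + 1" "p = a j \<or> p = a j + 1"
          using x by (auto simp: W1_def W2_def)
        thus False using layer_unique[of i p j] ij by auto
      qed
      thus "(W1 i \<union> W2 i) \<inter> (W1 j \<union> W2 j) = {}" by blast
    qed
  qed (auto simp: W1_def W2_def)
  thus ?thesis using one by simp
qed

theorem chain_union_le:
  assumes "\<And>i. i < r - 1 \<Longrightarrow> C i \<in> Chains (poset_order P)"
  shows "card (\<Union>i<r - 1. C i) + min_cut \<le> card (poset_elems P)"
proof -
  have "card (\<Union>i<r - 1. C i) + F \<le> card (poset_elems P)"
  proof (rule chain_union_bound[where W = laned and f = weight and s = start])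
    show "laned \<subseteq> poset_elems P" by (auto simp: laned_def)
    show "0 \<le> weight x \<and> weight x \<le> 1 \<and> 0 \<le> start x \<and> start x + weight x \<le> F" if "x \<in> laned" for x
    proof -
      obtain u p k where x: "x = (u, p, k)" by (metis prod_cases3)
      have "p \<in># P" "layer p \<le> u" "u + layer p \<le> p + 1"
        using that x by (auto simp: laned_def poset_elems_def)
      from lane_end_le[OF this] show ?thesis using start_end[of u p k] that x by auto
    qed
    show "start x + weight x \<le> start y" if xy: "x \<in> laned" "y \<in> laned" "elem_less x y" for x y
    proof -
      obtain u p k v q l where x: "x = (u, p, k)" "y = (v, q, l)" by (metis prod_cases3)
      have p: "p \<in># P" "layer p \<le> u" "u + layer p \<le> p + 1" "q \<in># P" "layer q \<le> v" "v + layer q \<le> q + 1"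
        using xy x by (auto simp: laned_def poset_elems_def)
      show ?thesis
      proof (cases "(u, p) = (v, q)")
        case True
        hence "k < l" using xy(3) x by auto
        hence "real k * (lane_len p / count P p) \<le> (real l - 1) * (lane_len p / count P p)"
          using lane_len[OF p(1)] by (intro mult_right_mono) auto
        thus ?thesis using True x start_weight[of u p k] by (simp add: start_def)
      next
        case False
        have "lane_start u p + lane_len p \<le> lane_start v q"
          using xy(3) x False by (intro lane_order p) auto
        thus ?thesis using start_end[of u p k] start_end[of v q l] xy x by force
      qed
    qed
    show "sum weight laned = real (Suc (r - 1)) * F" using total_weight r_pos by simp
    show "0 \<le> F" by (rule F_nonneg)
  qed (use assms in auto)
  thus ?thesis by (simp add: F_def)
qed

end

section \<open>The last parts of \<open>\<lambda>\<close> and \<open>\<lambda>\<^sub>U\<close>\<close>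

lemma finite_chain_union_cards:
  "finite {card (\<Union>i<k. C i) | C. \<forall>i<k. C i \<in> Chains (poset_order P)}"
proof (rule finite_subset)
  show "{card (\<Union>i<k. C i) | C. \<forall>i<k. C i \<in> Chains (poset_order P)} \<subseteq> {..card (poset_elems P)}"
    by (auto simp: Chains_poset_order intro!: card_mono)
qed simp

lemma card_le_max_chain_union:
  "(\<And>i. i < k \<Longrightarrow> C i \<in> Chains (poset_order P)) \<Longrightarrow> card (\<Union>i<k. C i) \<le> max_chain_union P k"
  unfolding max_chain_union_def by (intro Max_ge finite_chain_union_cards) auto

lemma max_chain_union_attained:
  obtains C where "\<And>i. i < k \<Longrightarrow> C i \<in> Chains (poset_order P)" "max_chain_union P k = card (\<Union>i<k. C i)"
proof -
  have "{card (\<Union>i<k. C i) | C. \<forall>i<k. C i \<in> Chains (poset_order P)} \<noteq> {}"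
    by (auto intro!: exI[of _ "\<lambda>_. {}"] simp: Chains_def)
  from Max_in[OF finite_chain_union_cards this] show ?thesis
    unfolding max_chain_union_def[symmetric] using that by auto
qed

lemma max_chain_union_le: "max_chain_union P k \<le> card (poset_elems P)"
proof -
  obtain C where C: "\<And>i. i < k \<Longrightarrow> C i \<in> Chains (poset_order P)" "max_chain_union P k = card (\<Union>i<k. C i)"
    by (rule max_chain_union_attained[of k P]) blast
  have "(\<Union>i<k. C i) \<subseteq> poset_elems P" using C(1) by (auto simp: Chains_poset_order)
  thus ?thesis unfolding C(2) by (intro card_mono) auto
qed

definition spaced :: "nat \<Rightarrow> (nat \<Rightarrow> nat) \<Rightarrow> bool" where
  "spaced m b \<longleftrightarrow> (\<forall>i. 1 \<le> i \<and> i < m \<longrightarrow> b i + 1 < b (i + 1))"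

lemma spaced_gap: "spaced m b \<Longrightarrow> 1 \<le> i \<Longrightarrow> i \<le> j \<Longrightarrow> j \<le> m \<Longrightarrow> b i + 2 * (j - i) \<le> b j"
proof (induction j)
  case (Suc j)
  show ?case
  proof (cases "i = Suc j")
    case False
    hence "b i + 2 * (j - i) \<le> b j" using Suc by simp
    moreover have "b j + 1 < b (Suc j)" using Suc.prems False by (auto simp: spaced_def)
    ultimately show ?thesis using False Suc.prems by (simp add: Suc_diff_le)
  qed simp
qed simp

lemma spaced_less: "spaced m b \<Longrightarrow> 1 \<le> i \<Longrightarrow> i < j \<Longrightarrow> j \<le> m \<Longrightarrow> b i + 1 < b j"
  using spaced_gap[of m b i j] by linarith

lemma spaced_mono: "spaced m b \<Longrightarrow> 1 \<le> i \<Longrightarrow> i \<le> j \<Longrightarrow> j \<le> m \<Longrightarrow> b i \<le> b j"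
  using spaced_gap[of m b i j] by linarith

text \<open>
  The number of pairs below a part decides which rows near its two ends are covered.
\<close>

lemma mem_U_chain_iff:
  assumes "spaced m b"
  shows "(u, p, k) \<in> U_chain P m b \<longleftrightarrow> (u, p, k) \<in> poset_elems P \<and>
    (\<exists>i. 1 \<le> i \<and> i \<le> m \<and> (p = b i \<or> p = b i + 1 \<or> b i + 1 < p \<and> (u \<le> i \<or> p + 1 \<le> u + i)))"
    (is "?l \<longleftrightarrow> ?r")
proof
  assume ?l
  then obtain i where i: "1 \<le> i" "i \<le> m" "(u, p, k) \<in> U_chain_level P b i" by (auto simp: U_chain_def)
  thus ?r unfolding U_chain_level_def by (auto intro!: exI[of _ i])
next
  assume r: ?r
  then obtain i where i: "1 \<le> i" "i \<le> m" and
    c: "p = b i \<or> p = b i + 1 \<or> b i + 1 < p \<and> (u \<le> i \<or> p + 1 \<le> u + i)" by auto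
  have el: "(u, p, k) \<in> poset_elems P" using r by simp
  hence u: "1 \<le> u" "u \<le> p" by (auto simp: poset_elems_iff)
  have less: "b j + 1 < p" if "1 \<le> j" "j < i" for j
    using spaced_less[OF assms, of j i] that i c by linarith
  have "\<exists>j. 1 \<le> j \<and> j \<le> m \<and> (u, p, k) \<in> U_chain_level P b j"
  proof -
    consider "p = b i \<or> p = b i + 1" "i \<le> u" "u + i \<le> p + 1" | "u < i" | "p + 1 < u + i"
      | "b i + 1 < p" "u = i \<or> u + i = p + 1" using c by linarith
    thus ?thesis
    proof cases
      case 1
      thus ?thesis using i el by (intro exI[of _ i]) (auto simp: U_chain_level_def)
    next
      case 2
      thus ?thesis using i el less[of u] u by (intro exI[of _ u]) (auto simp: U_chain_level_def)
    next
      case 3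
      thus ?thesis using i el less[of "p + 1 - u"] u by (intro exI[of _ "p + 1 - u"]) (auto simp: U_chain_level_def)
    next
      case 4
      thus ?thesis using i el by (intro exI[of _ i]) (auto simp: U_chain_level_def)
    qed
  qed
  thus ?l by (auto simp: U_chain_def)
qed

lemma U_chain_subset: "U_chain P m b \<subseteq> poset_elems P"
  by (auto simp: U_chain_def U_chain_level_def)

lemma U_chain_level_chain:
  assumes "spaced m b" "1 \<le> i" "i \<le> m"
  shows "U_chain_level P b i \<in> Chains (poset_order P)"
  unfolding Chains_poset_order
proof (intro conjI ballI)
  show "U_chain_level P b i \<subseteq> poset_elems P" by (auto simp: U_chain_level_def)
  have bi: "2 * i \<le> b i + 2" using spaced_gap[OF assms(1), of 1 i] assms by simp
  fix x y assume xy: "x \<in> U_chain_level P b i" "y \<in> U_chain_level P b i"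
  obtain u p k v q l where e: "x = (u, p, k)" "y = (v, q, l)" by (metis prod_cases3)
  have *: "(p = b i \<or> p = b i + 1) \<and> i \<le> u \<and> u + i \<le> p + 1 \<or> p > b i + 1 \<and> (u = i \<or> u + i = p + 1)"
    "(q = b i \<or> q = b i + 1) \<and> i \<le> v \<and> v + i \<le> q + 1 \<or> q > b i + 1 \<and> (v = i \<or> v + i = q + 1)"
    using xy e by (auto simp: U_chain_level_def)
  have "u \<le> v \<and> u + q \<le> v + p \<or> v \<le> u \<and> v + p \<le> u + q" 
  proof (rule ccontr)
    assume "\<not> ?thesis"
    hence "v < u \<or> v + p < u + q" "u < v \<or> u + q < v + p" by linarith+
    with * bi show False by (elim disjE conjE; linarith)
  qed
  thus "x = y \<or> elem_less x y \<or> elem_less y x" unfolding e by auto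
qed

lemma finite_U_chain_cards: "finite {card (U_chain P m a) | a. spaced m a}"
proof (rule finite_subset)
  show "{card (U_chain P m a) | a. spaced m a} \<subseteq> {..card (poset_elems P)}"
    by (auto intro!: card_mono U_chain_subset)
qed simp

lemma max_U_chain_alt: "max_U_chain P m = Max {card (U_chain P m a) | a. spaced m a}"
  by (simp add: max_U_chain_def spaced_def)

lemma card_le_max_U_chain: "spaced m b \<Longrightarrow> card (U_chain P m b) \<le> max_U_chain P m"
  unfolding max_U_chain_alt by (intro Max_ge finite_U_chain_cards) auto

lemma max_U_chain_attained:
  obtains b where "spaced m b" "max_U_chain P m = card (U_chain P m b)"
proof -
  have "{card (U_chain P m a) | a. spaced m a} \<noteq> {}"
    by (auto intro!: exI[of _ "\<lambda>i. 2 * i"] simp: spaced_def)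
  from Max_in[OF finite_U_chain_cards this] show ?thesis
    unfolding max_U_chain_alt[symmetric] using that by auto
qed

lemma max_U_chain_le_max_chain_union: "max_U_chain P m \<le> max_chain_union P m"
proof -
  obtain b where b: "spaced m b" "max_U_chain P m = card (U_chain P m b)" by (rule max_U_chain_attained)
  have "U_chain P m b = (\<Union>i<m. U_chain_level P b (Suc i))"
  proof -
    have "{1..m} = Suc ` {..<m}" by (simp add: image_Suc_lessThan)
    thus ?thesis unfolding U_chain_def by simp
  qed
  moreover have "card (\<Union>i<m. U_chain_level P b (Suc i)) \<le> max_chain_union P m"
    by (rule card_le_max_chain_union, rule U_chain_level_chain[OF b(1)]) simp_all
  ultimately show ?thesis unfolding b(2) by simp
qed

lemma min_part_seqI:
  assumes "\<And>k. 1 \<le> k \<Longrightarrow> k \<le> r \<Longrightarrow> v \<le> f k" "\<And>k. r < k \<Longrightarrow> f k = 0" "f r = v" "0 < v" "1 \<le> r"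
  shows "min_part_seq f = v"
  unfolding min_part_seq_def
proof (rule Min_eqI)
  have "{f k |k. 1 \<le> k \<and> 0 < f k} \<subseteq> f ` {1..r}"
  proof
    fix y assume "y \<in> {f k |k. 1 \<le> k \<and> 0 < f k}"
    then obtain k where k: "y = f k" "1 \<le> k" "0 < f k" by blast
    hence "k \<le> r" using assms(2)[of k] by (cases "r < k") auto
    thus "y \<in> f ` {1..r}" using k by auto
  qed
  thus "finite {f k |k. 1 \<le> k \<and> 0 < f k}" by (rule finite_subset) simp
  show "v \<le> y" if y: "y \<in> {f k |k. 1 \<le> k \<and> 0 < f k}" for y
  proof -
    obtain k where k: "y = f k" "1 \<le> k" "0 < f k" using y by blast
    thus ?thesis using assms(1)[of k] assms(2)[of k] by (cases "k \<le> r") auto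
  qed
  show "v \<in> {f k |k. 1 \<le> k \<and> 0 < f k}" using assms(3-5) by auto
qed

context greedy_cover begin

lemma card_lane_part:
  "card ({t..p + 1 - t} \<times> {p} \<times> {1..count P p}) = (p + 2 - 2 * t) * count P p"
proof -
  have "Suc (Suc p - t) - t = Suc (Suc p) - 2 * t" by arith
  thus ?thesis by (simp add: card_cartesian_product)
qed

definition cut_elems :: "nat \<Rightarrow> nat \<Rightarrow> (nat \<times> nat \<times> nat) set" where
  "cut_elems t t' = {t..a t + 1 - t} \<times> {a t} \<times> {1..count P (a t)} \<union>
     {t'..a t' + 2 - t'} \<times> {a t' + 1} \<times> {1..count P (a t' + 1)}"

lemma finite_cut_elems: "finite (cut_elems t t')"
  by (simp add: cut_elems_def)

lemma card_cut_elems: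
  assumes "1 \<le> t" "t \<le> t'" "t' \<le> r" "lanes t = lanes t'"
  shows "card (cut_elems t t') = cut_value t t'"
proof -
  have "a t \<noteq> a t' + 1" using gap_le[OF assms(1-3)] by linarith
  hence "card (cut_elems t t') = card ({t..a t + 1 - t} \<times> {a t} \<times> {1..count P (a t)}) +
      card ({t'..a t' + 1 + 1 - t'} \<times> {a t' + 1} \<times> {1..count P (a t' + 1)})"
    unfolding cut_elems_def by (subst card_Un_disjoint) auto
  also have "\<dots> = cut_value t t'"
  proof -
    have "a t' + 1 + 2 - 2 * t' = lanes t + 1" using assms(4) a_lower[of t'] assms by (simp add: lanes_def)
    moreover have "a t + 2 - 2 * t = lanes t" by (simp add: lanes_def)
    ultimately show ?thesis unfolding card_lane_part cut_value_def by (simp only:)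
  qed
  finally show ?thesis .
qed

lemma same_lanes_consecutive:
  assumes "1 \<le> t" "t \<le> i" "i \<le> t'" "t' \<le> r" "lanes t = lanes t'"
  shows "a i = a t + 2 * (i - t)"
proof -
  have "lanes i = lanes t" using lanes_mono[of t i] lanes_mono[of i t'] assms by simp
  thus ?thesis using lanes_eq[of t] lanes_eq[of i] assms by simp
qed

lemma spaced_a: "m \<le> r \<Longrightarrow> spaced m a"
  using gap by (auto simp: spaced_def)

text \<open>
  Between \<open>t\<close> and \<open>t'\<close> the greedy pairs follow each other without a gap, as the lanes are equal.
  Shifting these pairs up by one lets \<open>t' - t\<close> pairs do the work of \<open>t' - t + 1\<close>, and only the lowest and
  the highest of the values lose their middle rows.
\<close>

lemma U_chain_missing_cut:
  assumes "1 \<le> t" "t \<le> t'" "t' \<le> r" "lanes t = lanes t'"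
  shows "\<exists>b. spaced (r - 1) b \<and> poset_elems P \<subseteq> U_chain P (r - 1) b \<union> cut_elems t t' \<and>
    (\<forall>i. 1 \<le> i \<and> i \<le> r - 1 \<longrightarrow> (b i \<in># P \<or> b i + 1 \<in># P) \<and> 2 * i \<le> b i + 1)"
proof -
  define b where "b i = (if i < t then a i else if i < t' then a i + 1 else a (i + 1))" for i
  have cons: "a (i + 1) = a i + 2" if "t \<le> i" "i < t'" for i
    using same_lanes_consecutive[of t i t'] same_lanes_consecutive[of t "i + 1" t'] assms that by simp
  have sp: "spaced (r - 1) b" unfolding spaced_def
  proof (intro allI impI)
    fix i assume i: "1 \<le> i \<and> i < r - 1"
    have "a i + 1 < a (i + 1)" "a (i + 1) + 1 < a (i + 2)" using gap[of i] gap[of "i + 1"] i by auto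
    thus "b i + 1 < b (i + 1)" by (auto simp: b_def)
  qed
  have sub: "x \<in> U_chain P (r - 1) b \<union> cut_elems t t'" if x: "x \<in> poset_elems P" for x
  proof -
    obtain u p k where e: "x = (u, p, k)" by (metis prod_cases3)
    have u: "1 \<le> u" "u \<le> p" "1 \<le> k" "k \<le> count P p" using x by (auto simp: e poset_elems_iff)
    have memI: "x \<in> U_chain P (r - 1) b"
      if "1 \<le> i" "i \<le> r - 1" "p = b i \<or> p = b i + 1 \<or> b i + 1 < p \<and> (u \<le> i \<or> p + 1 \<le> u + i)" for i
      unfolding e mem_U_chain_iff[OF sp] using x that e by blast
    obtain i where i: "1 \<le> i" "i \<le> r" "p = a i \<or> p = a i + 1"
      using covered[OF poset_elems_part[OF x[unfolded e]]] by blast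
    have "i < t \<or> t' < i \<or> t < i \<and> i \<le> t' \<and> p = a i \<or> t \<le> i \<and> i < t' \<and> p = a i + 1 \<or>
        p = a t \<or> p = a t' + 1"
      using i(3)
    proof
      assume "p = a i" thus ?thesis by (cases "i = t") (simp_all, linarith)
    next
      assume "p = a i + 1" thus ?thesis by (cases "i = t'") (simp_all, linarith)
    qed
    then consider "i < t" | "t' < i" | "t < i" "i \<le> t'" "p = a i" | "t \<le> i" "i < t'" "p = a i + 1"
      | "p = a t" | "p = a t' + 1" by blast
    thus ?thesis
    proof cases
      case 1
      have "b i = a i" using 1 by (simp add: b_def)
      hence "x \<in> U_chain P (r - 1) b" using 1 i assms(2,3) by (intro memI[of i]) auto
      thus ?thesis by simp
    next
      case 2
      obtain j where j: "i = Suc j" using 2 by (cases i) auto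
      have "b j = a i" using 2 assms(2) by (simp add: b_def j)
      hence "x \<in> U_chain P (r - 1) b" using 2 i assms(1,2) j by (intro memI[of j]) auto
      thus ?thesis by simp
    next
      case 3
      obtain j where j: "i = Suc j" using 3 by (cases i) auto
      have "b j = a j + 1" using 3 j by (simp add: b_def)
      moreover have "a (j + 1) = a j + 2" using 3 j by (intro cons) simp_all
      ultimately have "p = b j + 1" using 3 j by simp
      hence "x \<in> U_chain P (r - 1) b" using 3 j assms(1,3) by (intro memI[of j]) auto
      thus ?thesis by simp
    next
      case 4
      have "b i = a i + 1" using 4 by (simp add: b_def)
      hence "x \<in> U_chain P (r - 1) b" using 4 i assms(3) by (intro memI[of i]) auto
      thus ?thesis by simp
    next
      case 5
      show ?thesis
      proof (cases "t \<le> u \<and> u + t \<le> p + 1")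
        case True
        thus ?thesis using u 5 by (auto simp: e cut_elems_def)
      next
        case False
        hence t1: "1 < t" using u by auto
        have "b (t - 1) = a (t - 1)" using t1 by (auto simp: b_def)
        moreover have "a (t - 1) + 1 < a t" using gap[of "t - 1"] t1 assms by simp
        moreover have "u \<le> t - 1 \<or> p + 1 \<le> u + (t - 1)" using False t1 by arith
        moreover have "1 \<le> t - 1" "t - 1 \<le> r - 1" using t1 assms by auto
        ultimately have "x \<in> U_chain P (r - 1) b" using 5 by (intro memI[of "t - 1"]) auto
        thus ?thesis by simp
      qed
    next
      case 6
      show ?thesis
      proof (cases "t' \<le> u \<and> u + t' \<le> p + 1")
        case True
        thus ?thesis using u 6 by (auto simp: e cut_elems_def)
      next
        case False
        hence t1: "1 < t'" using u by auto
        have "b (t' - 1) \<le> a (t' - 1) + 1" using t1 assms by (auto simp: b_def)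
        moreover have "a (t' - 1) + 1 < a t'" using gap[of "t' - 1"] t1 assms by simp
        moreover have "u \<le> t' - 1 \<or> p + 1 \<le> u + (t' - 1)" using False t1 by arith
        moreover have "1 \<le> t' - 1" "t' - 1 \<le> r - 1" using t1 assms by auto
        ultimately have "x \<in> U_chain P (r - 1) b" using 6 by (intro memI[of "t' - 1"]) auto
        thus ?thesis by simp
      qed
    qed
  qed
  have meet: "b i \<in># P \<or> b i + 1 \<in># P" if "1 \<le> i" "i \<le> r - 1" for i
  proof -
    have "a i \<in># P" by (rule a_part) (use that in simp_all)
    moreover have "a (i + 1) \<in># P" by (rule a_part) (use that in simp_all)
    moreover have "b i + 1 = a (i + 1)" if "t \<le> i" "i < t'" using cons[OF that] that by (simp add: b_def)
    moreover have "b i = a i \<or> b i = a (i + 1)" if "\<not> (t \<le> i \<and> i < t')" using that by (auto simp: b_def)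
    ultimately show ?thesis by metis
  qed
  show ?thesis
  proof (intro exI[of _ b] conjI allI impI)
    show "spaced (r - 1) b" by (rule sp)
    show "poset_elems P \<subseteq> U_chain P (r - 1) b \<union> cut_elems t t'" by (rule subsetI) (rule sub)
    fix i assume i: "1 \<le> i \<and> i \<le> r - 1"
    show "b i \<in># P \<or> b i + 1 \<in># P" using i by (intro meet) simp_all
    have "2 * i \<le> a i + 1" "2 * (i + 1) \<le> a (i + 1) + 1" by (rule a_lower; use i in linarith)+
    thus "2 * i \<le> b i + 1" by (auto simp: b_def)
  qed
qed

lemma U_chain_a: "U_chain P r a = poset_elems P"
proof
  show "poset_elems P \<subseteq> U_chain P r a"
  proof
    fix x assume x: "x \<in> poset_elems P"
    obtain u p k where e: "x = (u, p, k)" by (metis prod_cases3)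
    have el: "(u, p, k) \<in> poset_elems P" using x e by simp
    obtain i where i: "1 \<le> i" "i \<le> r" "p = a i \<or> p = a i + 1"
      using covered[OF poset_elems_part[OF el]] by blast
    show "x \<in> U_chain P r a" unfolding e mem_U_chain_iff[OF spaced_a[OF order_refl]]
    proof (intro conjI exI[of _ i])
      show "p = a i \<or> p = a i + 1 \<or> a i + 1 < p \<and> (u \<le> i \<or> p + 1 \<le> u + i)" using i(3) by metis
    qed (use el i in simp_all)
  qed
qed (rule U_chain_subset)

lemma max_U_chain_full: "r \<le> m \<Longrightarrow> max_U_chain P m = card (poset_elems P)"
proof (rule antisym)
  assume m: "r \<le> m"
  define b where "b i = (if i \<le> r then a i else a r + 2 * i)" for i
  have sp: "spaced m b" unfolding spaced_def
  proof (intro allI impI)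
    fix i assume i: "1 \<le> i \<and> i < m"
    consider "i < r" | "i = r" | "r < i" by linarith
    thus "b i + 1 < b (i + 1)"
    proof cases
      case 1
      thus ?thesis using gap[of i] i by (simp add: b_def)
    qed (simp_all add: b_def)
  qed
  have "poset_elems P \<subseteq> U_chain P m b"
  proof
    fix x assume x: "x \<in> poset_elems P"
    obtain u p k where e: "x = (u, p, k)" by (metis prod_cases3)
    obtain i where i: "1 \<le> i" "i \<le> r" "p = a i \<or> p = a i + 1"
      using covered[OF poset_elems_part[OF x[unfolded e]]] by blast
    show "x \<in> U_chain P m b" unfolding e mem_U_chain_iff[OF sp]
    proof (intro conjI exI[of _ i])
      show "(u, p, k) \<in> poset_elems P" using x e by simp
      show "p = b i \<or> p = b i + 1 \<or> b i + 1 < p \<and> (u \<le> i \<or> p + 1 \<le> u + i)"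
        using i by (auto simp: b_def)
    qed (use i m in simp_all)
  qed
  hence "card (poset_elems P) \<le> card (U_chain P m b)"
    by (intro card_mono finite_subset[OF U_chain_subset]) auto
  thus "card (poset_elems P) \<le> max_U_chain P m" using card_le_max_U_chain[OF sp, of P] by simp
  show "max_U_chain P m \<le> card (poset_elems P)"
    using max_U_chain_le_max_chain_union max_chain_union_le le_trans by blast
qed

lemma max_chain_union_full: "r \<le> m \<Longrightarrow> max_chain_union P m = card (poset_elems P)"
  using max_U_chain_le_max_chain_union[of P m] max_chain_union_le[of P m] max_U_chain_full[of m] by simp

lemma max_chain_union_cut: "max_chain_union P (r - 1) + min_cut \<le> card (poset_elems P)"
proof -
  obtain C where C: "\<And>i. i < r - 1 \<Longrightarrow> C i \<in> Chains (poset_order P)"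
    "max_chain_union P (r - 1) = card (\<Union>i<r - 1. C i)" by (rule max_chain_union_attained[of "r - 1" P]) blast
  thus ?thesis using chain_union_le by simp
qed

lemma max_U_chain_cut: "card (poset_elems P) \<le> max_U_chain P (r - 1) + min_cut"
proof -
  obtain t t' where t: "1 \<le> t" "t \<le> t'" "t' \<le> r" "lanes t = lanes t'" "min_cut = cut_value t t'"
    by (rule min_cut_attained)
  obtain b where b: "spaced (r - 1) b" "poset_elems P \<subseteq> U_chain P (r - 1) b \<union> cut_elems t t'"
    using U_chain_missing_cut[OF t(1-4)] by blast
  have "finite (U_chain P (r - 1) b)" by (rule finite_subset[OF U_chain_subset]) simp
  hence "card (poset_elems P) \<le> card (U_chain P (r - 1) b) + card (cut_elems t t')"
    using card_mono[OF _ b(2)] card_Un_le[of "U_chain P (r - 1) b" "cut_elems t t'"] finite_cut_elems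
    by (meson finite_UnI le_trans)
  thus ?thesis using card_le_max_U_chain[OF b(1), of P] card_cut_elems[OF t(1-4)] t(5) by simp
qed

text \<open>
  The weighting bounds chains from above, the shifted pairs bound U-chains from below, and a U-chain is a
  union of chains; so all three numbers agree.
\<close>

lemma max_union_last:
  "max_chain_union P (r - 1) + min_cut = card (poset_elems P)"
  "max_U_chain P (r - 1) + min_cut = card (poset_elems P)"
  using max_chain_union_cut max_U_chain_cut max_U_chain_le_max_chain_union[of P "r - 1"] by linarith+

text \<open>
  Adding a level to a configuration that has fewer than \<open>r\<close>.  Let \<open>t'\<close> be the first index at
  which the configuration has run ahead of the greedy pairs or has ended, and \<open>t\<close> the start of the run of
  pairs shifted up by one that leads to it.  Undoing
  the shift on this run makes room for one more pair, and the elements gained are those of a cut.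
\<close>

lemma U_chain_gain:
  assumes b: "spaced m b" and m: "m < r"
  shows "\<exists>b'. spaced (Suc m) b' \<and> card (U_chain P m b) + min_cut \<le> card (U_chain P (Suc m) b')"
proof -
  define t' where "t' = (LEAST i. 1 \<le> i \<and> (m < i \<or> a i + 1 < b i))"
  have t'1: "1 \<le> t' \<and> (m < t' \<or> a t' + 1 < b t')" unfolding t'_def
    by (rule LeastI[of _ "Suc m"]) auto
  have t'm: "t' \<le> Suc m" unfolding t'_def by (rule Least_le) auto
  have below: "i \<le> m \<and> b i \<le> a i + 1" if "1 \<le> i" "i < t'" for i
    using not_less_Least[of i "\<lambda>i. 1 \<le> i \<and> (m < i \<or> a i + 1 < b i)"] that unfolding t'_def by auto
  let ?Q = "\<lambda>t. 1 \<le> t \<and> (\<forall>i. t \<le> i \<and> i < t' \<longrightarrow> b i = a i + 1 \<and> a (i + 1) = a i + 2)"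
  define t where "t = (LEAST t. ?Q t)"
  have t1: "?Q t" unfolding t_def by (rule LeastI[of ?Q t']) (use t'1 in auto)
  have tt': "t \<le> t'" unfolding t_def by (rule Least_le) (use t'1 in auto)
  have run: "b i = a i + 1" "a (i + 1) = a i + 2" if "t \<le> i" "i < t'" for i using t1 that by auto
  have t'r: "t' \<le> r" using t'm m by simp
  have before: "b (t - 1) + 1 < a t" if t_gt: "1 < t"
  proof -
    have nQ: "\<not> ?Q (t - 1)" using not_less_Least[of "t - 1" ?Q] t_gt unfolding t_def[symmetric] by auto
    have "1 \<le> t - 1" using t_gt by simp
    then obtain i where i: "t - 1 \<le> i" "i < t'" "\<not> (b i = a i + 1 \<and> a (i + 1) = a i + 2)"
      using nQ by blast
    hence "i = t - 1" using run[of i] by (cases "t \<le> i") auto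
    hence n: "\<not> (b (t - 1) = a (t - 1) + 1 \<and> a t = a (t - 1) + 2)" using i(3) t_gt by auto
    have "b (t - 1) \<le> a (t - 1) + 1" using below[of "t - 1"] t_gt tt' by auto
    moreover have "a (t - 1) + 1 < a t" using gap[of "t - 1"] t_gt tt' t'r by auto
    ultimately show ?thesis using n by linarith
  qed
  have arith: "a i = a t + 2 * (i - t)" if "t \<le> i" "i \<le> t'" for i
    using that
  proof (induction i rule: dec_induct)
    case (step i)
    have "a (Suc i) = a i + 2" using run(2)[of i] step by simp
    thus ?case using step by (simp add: Suc_diff_le)
  qed simp
  have "a t' = a t + 2 * (t' - t)" by (rule arith) (use tt' in auto)
  hence lanes: "lanes t = lanes t'" using tt' by (simp add: lanes_def)
  define b' where "b' i = (if i < t then b i else if i \<le> t' then a i else b (i - 1))" for i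
  have sp: "spaced (Suc m) b'" unfolding spaced_def
  proof (intro allI impI)
    fix i assume i: "1 \<le> i \<and> i < Suc m"
    consider "i + 1 < t" | "i + 1 = t" | "t \<le> i" "i < t'" | "i = t'" | "t' < i" using tt' by linarith
    thus "b' i + 1 < b' (i + 1)"
    proof cases
      case 1
      thus ?thesis using b i tt' t'm by (auto simp: b'_def spaced_def)
    next
      case 2
      thus ?thesis using before i tt' by (auto simp: b'_def)
    next
      case 3
      thus ?thesis using gap[of i] i m t'r by (auto simp: b'_def)
    next
      case 4
      thus ?thesis using t'1 i tt' by (auto simp: b'_def)
    next
      case 5
      obtain j where j: "i = Suc j" using i by (cases i) auto
      have "b j + 1 < b (j + 1)" using b i t'1 5 j by (auto simp: spaced_def)
      thus ?thesis using 5 tt' j by (auto simp: b'_def)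
    qed
  qed
  have sub: "U_chain P m b \<subseteq> U_chain P (Suc m) b'"
  proof
    fix x assume x: "x \<in> U_chain P m b"
    obtain u p k where e: "x = (u, p, k)" by (metis prod_cases3)
    obtain i where i: "1 \<le> i" "i \<le> m" "(u, p, k) \<in> poset_elems P"
      "p = b i \<or> p = b i + 1 \<or> b i + 1 < p \<and> (u \<le> i \<or> p + 1 \<le> u + i)"
      using x unfolding e mem_U_chain_iff[OF b] by blast
    have memI: "x \<in> U_chain P (Suc m) b'"
      if "1 \<le> j" "j \<le> Suc m" "p = b' j \<or> p = b' j + 1 \<or> b' j + 1 < p \<and> (u \<le> j \<or> p + 1 \<le> u + j)" for j
      unfolding e mem_U_chain_iff[OF sp] using i(3) that by blast
    consider "i < t" | "t \<le> i" "i < t'" | "t' \<le> i" by linarith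
    thus "x \<in> U_chain P (Suc m) b'"
    proof cases
      case 1
      thus ?thesis using memI[of i] i by (auto simp: b'_def)
    next
      case 2
      have "b' i = a i" "b' (i + 1) = a i + 2" using run[of i] 2 by (auto simp: b'_def)
      thus ?thesis using memI[of i] memI[of "i + 1"] i run(1)[OF 2] by auto
    next
      case 3
      have "b' (i + 1) = b i" using 3 tt' by (auto simp: b'_def)
      thus ?thesis using memI[of "i + 1"] i by auto
    qed
  qed
  have cut_in: "cut_elems t t' \<subseteq> U_chain P (Suc m) b'"
  proof
    fix x assume x: "x \<in> cut_elems t t'"
    obtain u p k where e: "x = (u, p, k)" by (metis prod_cases3)
    have el: "(u, p, k) \<in> poset_elems P"
      using x t1 t'1 by (auto simp: e cut_elems_def poset_elems_iff)
    have "p = b' t \<or> p = b' t' + 1" using x tt' by (auto simp: e cut_elems_def b'_def)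
    thus "x \<in> U_chain P (Suc m) b'" unfolding e mem_U_chain_iff[OF sp]
      using el t1 t'1 tt' t'm by (metis le_trans)
  qed
  have cut_out: "cut_elems t t' \<inter> U_chain P m b = {}"
  proof (rule ccontr)
    assume "cut_elems t t' \<inter> U_chain P m b \<noteq> {}"
    then obtain u p k where x: "(u, p, k) \<in> cut_elems t t'" "(u, p, k) \<in> U_chain P m b"
      by (metis IntE equals0I prod_cases3)
    obtain i where i: "1 \<le> i" "i \<le> m"
      "p = b i \<or> p = b i + 1 \<or> b i + 1 < p \<and> (u \<le> i \<or> p + 1 \<le> u + i)"
      using x(2) unfolding mem_U_chain_iff[OF b] by blast
    have big: "a t' + 1 < b i" if "t' \<le> i"
      using spaced_mono[OF b, of t' i] t'1 i that by auto
    consider "p = a t" "t \<le> u" "u + t \<le> p + 1" "1 \<le> k" "k \<le> count P (a t)"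
      | "p = a t' + 1" "t' \<le> u" "u + t' \<le> p + 1" using x(1) t1 t'1
      by (auto simp: cut_elems_def)
    thus False
    proof cases
      case 1
      consider "i < t" | "t \<le> i" "i < t'" | "t' \<le> i" by linarith
      thus False
      proof cases
        case a: 1
        have "b i \<le> b (t - 1)" using spaced_mono[OF b, of i "t - 1"] i a below[of "t - 1"] tt' by auto
        hence "b i + 1 < a t" using before a i by auto
        thus False using i a 1 by auto
      next
        case a: 2
        have "a t \<le> a i" using gap_le[of t i] t1 a t'r by auto
        thus False using run(1)[OF a] i 1 by auto
      next
        case 3
        have "a t \<le> a t'" using gap_le[of t t'] t1 tt' t'r by auto
        thus False using big[OF 3] i 1 by auto
      qed
    next
      case 2
      show False
      proof (cases "i < t'")
        case True
        have "b i \<le> a i + 1" using below[of i] True i by auto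
        moreover have "a i + 1 < a t'" using gap_le[of i t'] True i t'r by auto
        ultimately show False using i True 2 by auto
      next
        case False
        thus False using big i 2 by auto
      qed
    qed
  qed
  have "card (U_chain P m b) + cut_value t t' = card (U_chain P m b \<union> cut_elems t t')"
    using cut_out card_cut_elems[of t t'] t1 tt' t'r lanes finite_cut_elems
    by (subst card_Un_disjoint) (auto intro: finite_subset[OF U_chain_subset])
  also have "\<dots> \<le> card (U_chain P (Suc m) b')"
    using sub cut_in by (intro card_mono finite_subset[OF U_chain_subset]) auto
  finally have "card (U_chain P m b) + min_cut \<le> card (U_chain P (Suc m) b')"
    using min_cut_le[of t t'] t1 tt' t'r lanes by simp
  thus ?thesis using sp by blast
qed

lemma max_U_chain_Suc: "m < r \<Longrightarrow> max_U_chain P m + min_cut \<le> max_U_chain P (Suc m)"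
proof -
  assume m: "m < r"
  obtain b where b: "spaced m b" "max_U_chain P m = card (U_chain P m b)" by (rule max_U_chain_attained)
  obtain b' where "spaced (Suc m) b'" "card (U_chain P m b) + min_cut \<le> card (U_chain P (Suc m) b')"
    using U_chain_gain[OF b(1) m] by blast
  thus ?thesis using b(2) card_le_max_U_chain[of "Suc m" b' P] by simp
qed

theorem min_lambda_U: "min_part_seq (lambda_U_part P) = min_cut"
proof (rule min_part_seqI)
  fix k assume k: "1 \<le> k" "k \<le> r"
  hence "max_U_chain P (k - 1) + min_cut \<le> max_U_chain P (Suc (k - 1))" by (intro max_U_chain_Suc) simp
  moreover have "Suc (k - 1) = k" using k by simp
  ultimately show "min_cut \<le> lambda_U_part P k" unfolding lambda_U_part_def by simp
next
  fix k assume k: "r < k"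
  have "max_U_chain P k = card (poset_elems P)" "max_U_chain P (k - 1) = card (poset_elems P)"
    by (rule max_U_chain_full, use k in simp)+
  thus "lambda_U_part P k = 0" unfolding lambda_U_part_def by simp
next
  have "max_U_chain P r = card (poset_elems P)" by (rule max_U_chain_full) simp
  thus "lambda_U_part P r = min_cut" unfolding lambda_U_part_def using max_union_last(2) by linarith
next
  show "0 < min_cut" using min_cut_pos by simp
  show "1 \<le> r" by (rule r_pos)
qed

end

section \<open>The invariant \<open>\<mu>\<close> as a minimal cut\<close>

lemma almost_rectangular_pieces:
  "set_mset R \<subseteq> {p..<p + 2 * c} \<Longrightarrow>
   \<exists>Ps. length Ps = c \<and> (\<forall>S\<in>set Ps. almost_rectangular S) \<and> sum_list Ps = R"
proof (induction c arbitrary: R p)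
  case 0
  thus ?case by simp
next
  case (Suc c)
  let ?A = "filter_mset (\<lambda>x. x < p + 2) R" and ?B = "filter_mset (\<lambda>x. \<not> x < p + 2) R"
  have "set_mset ?B \<subseteq> {p + 2..<p + 2 + 2 * c}" using Suc.prems by auto
  then obtain Ps where Ps: "length Ps = c" "\<forall>S\<in>set Ps. almost_rectangular S" "sum_list Ps = ?B"
    using Suc.IH by blast
  have "almost_rectangular ?A" unfolding almost_rectangular_def
  proof (intro ballI)
    fix x y assume "x \<in># ?A" "y \<in># ?A"
    hence "x < p + 2" "p \<le> y" using Suc.prems by auto
    thus "x \<le> y + 1" by simp
  qed
  moreover have "R = ?A + ?B" by (rule multiset_partition)
  ultimately show ?case using Ps by (intro exI[of _ "?A # Ps"]) auto
qed

text \<open>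
  Every other value of the interval needs a piece of its own.
\<close>

lemma r_index_spread:
  assumes "set_mset R = {p..<p + s}"
  shows "r_index R = (s + 1) div 2"
  unfolding r_index_def
proof (rule Least_equality)
  have "set_mset R \<subseteq> {p..<p + 2 * ((s + 1) div 2)}" using assms by auto
  thus "\<exists>Ps. length Ps = (s + 1) div 2 \<and> (\<forall>S\<in>set Ps. almost_rectangular S) \<and> sum_list Ps = R"
    by (rule almost_rectangular_pieces)
next
  fix c assume "\<exists>Ps. length Ps = c \<and> (\<forall>S\<in>set Ps. almost_rectangular S) \<and> sum_list Ps = R"
  then obtain Ps where Ps: "length Ps = c" "\<forall>S\<in>set Ps. almost_rectangular S" "sum_list Ps = R" by blast
  have "\<exists>j<c. p + 2 * i \<in># Ps ! j" if "i < (s + 1) div 2" for i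
  proof -
    have "p + 2 * i \<in> set_mset (sum_list Ps)" unfolding Ps(3) assms using that by auto
    then obtain S where "S \<in> set Ps" "p + 2 * i \<in># S" unfolding set_mset_sum_list by blast
    thus ?thesis using Ps(1) by (metis in_set_conv_nth)
  qed
  then obtain f where f: "\<And>i. i < (s + 1) div 2 \<Longrightarrow> f i < c \<and> p + 2 * i \<in># Ps ! f i" by metis
  have "inj_on f {..<(s + 1) div 2}"
  proof (rule inj_onI)
    fix i j assume ij: "i \<in> {..<(s + 1) div 2}" "j \<in> {..<(s + 1) div 2}" "f i = f j"
    have ar: "almost_rectangular (Ps ! f i)" using Ps(1,2) f[of i] ij by simp
    have m: "p + 2 * i \<in># Ps ! f i" "p + 2 * j \<in># Ps ! f i" using f[of i] f[of j] ij by auto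
    have "p + 2 * i \<le> p + 2 * j + 1" "p + 2 * j \<le> p + 2 * i + 1"
      using ar m unfolding almost_rectangular_def by blast+
    thus "i = j" by linarith
  qed
  hence "card {..<(s + 1) div 2} \<le> card {..<c}" by (rule card_inj_on_le) (use f in auto)
  thus "(s + 1) div 2 \<le> c" by simp
qed

definition spread_list :: "nat multiset list \<Rightarrow> bool" where
  "spread_list Ps \<longleftrightarrow> (\<forall>R\<in>set Ps. spread R) \<and>
     successively (\<lambda>R S. Max (set_mset R) + 2 \<le> Min (set_mset S)) Ps"

text \<open>
  The first gap above the smallest part, where the first spread ends.
\<close>

definition spread_end :: "nat multiset \<Rightarrow> nat" where
  "spread_end P = (LEAST x. Min (set_mset P) \<le> x \<and> x \<notin># P)"

lemma spread_nonempty: "spread R \<Longrightarrow> R \<noteq> {#}"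
  by (auto simp: spread_def)

lemma spread_end:
  assumes "P \<noteq> {#}"
  shows "spread_end P \<notin># P" "Min (set_mset P) < spread_end P"
    "Min (set_mset P) \<le> x \<Longrightarrow> x < spread_end P \<Longrightarrow> x \<in># P"
proof -
  let ?Q = "\<lambda>x. Min (set_mset P) \<le> x \<and> x \<notin># P"
  have mem: "Min (set_mset P) \<in># P" using assms by (intro Min_in) auto
  have "x \<le> Max (set_mset P)" if "x \<in># P" for x using that by simp
  hence "Suc (Max (set_mset P)) \<notin># P" by (metis Suc_n_not_le_n)
  moreover have "Min (set_mset P) \<le> Suc (Max (set_mset P))" using mem by (meson Max_ge finite_set_mset le_SucI)
  ultimately have ex: "?Q (spread_end P)"
    unfolding spread_end_def by (intro LeastI[of ?Q "Suc (Max (set_mset P))"] conjI)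
  thus "spread_end P \<notin># P" by simp
  show "Min (set_mset P) < spread_end P" using ex mem by (metis le_neq_implies_less)
  show "x \<in># P" if "Min (set_mset P) \<le> x" "x < spread_end P"
    using not_less_Least[of x ?Q] that unfolding spread_end_def by blast
qed

lemma spread_list_later:
  "spread_list (R # Ps) \<Longrightarrow> S \<in> set Ps \<Longrightarrow> Max (set_mset R) + 2 \<le> Min (set_mset S)"
proof (induction Ps arbitrary: R)
  case (Cons T Ps)
  have RT: "Max (set_mset R) + 2 \<le> Min (set_mset T)" "spread_list (T # Ps)" using Cons.prems by (auto simp: spread_list_def)
  show ?case
  proof (cases "S = T")
    case False
    hence "Max (set_mset T) + 2 \<le> Min (set_mset S)" using Cons.IH[OF RT(2)] Cons.prems by simp
    moreover have "T \<noteq> {#}" using RT(2) spread_nonempty by (auto simp: spread_list_def)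
    hence "Min (set_mset T) \<le> Max (set_mset T)" by simp
    ultimately show ?thesis using RT by linarith
  qed (use RT in simp)
qed simp

text \<open>
  The first spread is determined by \<open>P\<close>, which gives uniqueness by induction.
\<close>

lemma spread_list_head:
  assumes "spread_list (R # Ps)" "sum_list (R # Ps) = P"
  shows "R = filter_mset (\<lambda>x. x < spread_end P) P" "sum_list Ps = filter_mset (\<lambda>x. \<not> x < spread_end P) P"
proof -
  obtain p s where ps: "0 < p" "1 \<le> s" "set_mset R = {p..<p + s}" using assms(1) by (auto simp: spread_list_def spread_def)
  have Rmax: "Max (set_mset R) = p + s - 1" unfolding ps(3) using ps(2) by (intro Max_eqI) auto
  have later: "p + s + 1 \<le> x" if x: "x \<in># sum_list Ps" for x
  proof -
    obtain S where S: "S \<in> set Ps" "x \<in># S" using x unfolding set_mset_sum_list by blast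
    have "Max (set_mset R) + 2 \<le> Min (set_mset S)" by (rule spread_list_later[OF assms(1) S(1)])
    also have "\<dots> \<le> x" using S(2) by simp
    finally show ?thesis using Rmax ps(2) by simp
  qed
  have Pe: "P = R + sum_list Ps" using assms(2) by simp
  have mn: "Min (set_mset P) = p"
  proof (rule Min_eqI)
    show "p \<in> set_mset P" unfolding Pe using ps by simp
    fix y assume "y \<in> set_mset P"
    hence "y \<in># R \<or> y \<in># sum_list Ps" unfolding Pe by (simp only: union_iff)
    thus "p \<le> y"
    proof
      assume "y \<in># sum_list Ps"
      thus ?thesis using later[of y] by linarith
    qed (simp add: ps(3))
  qed simp
  have "spread_end P = p + s" unfolding spread_end_def mn
  proof (rule Least_equality)
    have "p + s \<notin># R" "p + s \<notin># sum_list Ps" using later[of "p + s"] by (auto simp only: ps(3)) auto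
    thus "p \<le> p + s \<and> p + s \<notin># P" unfolding Pe by (simp only: union_iff) simp
    fix y assume "p \<le> y \<and> y \<notin># P"
    hence "p \<le> y" "y \<notin># R" unfolding Pe by (simp_all only: union_iff) blast+
    thus "p + s \<le> y" by (simp add: ps(3))
  qed
  moreover have "filter_mset (\<lambda>x. x < p + s) R = R" using ps(3) by (intro filter_mset_eq_conv[THEN iffD2] conjI) auto
  moreover have "filter_mset (\<lambda>x. x < p + s) (sum_list Ps) = {#}"
    unfolding filter_mset_eq_mempty_iff
  proof (intro allI impI)
    show "\<not> x < p + s" if "x \<in># sum_list Ps" for x using later[OF that] by simp
  qed
  moreover have "filter_mset (\<lambda>x. \<not> x < p + s) R = {#}" using ps(3) by (intro filter_mset_eq_conv[THEN iffD2] conjI) auto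
  moreover have "filter_mset (\<lambda>x. \<not> x < p + s) (sum_list Ps) = sum_list Ps"
  proof (rule filter_mset_eq_conv[THEN iffD2], intro conjI ballI)
    show "\<not> x < p + s" if "x \<in># sum_list Ps" for x using later[OF that] by simp
  qed simp_all
  ultimately show "R = filter_mset (\<lambda>x. x < spread_end P) P" "sum_list Ps = filter_mset (\<lambda>x. \<not> x < spread_end P) P"
    unfolding Pe by simp_all
qed

lemma spread_list_Cons: "spread_list (R # Ps) \<Longrightarrow> spread_list Ps"
  by (cases Ps) (auto simp: spread_list_def)

lemma spread_list_empty: "spread_list Ps \<Longrightarrow> sum_list Ps = {#} \<longleftrightarrow> Ps = []"
  by (cases Ps) (auto simp: spread_list_def dest: spread_nonempty)

lemma spread_list_unique:
  "spread_list Ps \<Longrightarrow> spread_list Qs \<Longrightarrow> sum_list Ps = sum_list Qs \<Longrightarrow> Ps = Qs"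
proof (induction Ps arbitrary: Qs)
  case Nil
  thus ?case using spread_list_empty[of Qs] by simp
next
  case (Cons R Ps)
  have "Qs \<noteq> []" using Cons.prems spread_list_empty[OF Cons.prems(1)] by auto
  then obtain S Ss where Qs: "Qs = S # Ss" by (cases Qs) auto
  have sum: "sum_list (S # Ss) = sum_list (R # Ps)" using Cons.prems(3) unfolding Qs by (rule sym)
  have SSs: "spread_list (S # Ss)" using Cons.prems(2) unfolding Qs .
  note 1 = spread_list_head[OF Cons.prems(1) refl] and 2 = spread_list_head[OF SSs sum]
  have "R = S" by (rule trans[OF 1(1) 2(1)[symmetric]])
  moreover have "Ps = Ss"
    by (rule Cons.IH[OF spread_list_Cons[OF Cons.prems(1)] spread_list_Cons[OF SSs] trans[OF 1(2) 2(2)[symmetric]]])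
  ultimately show ?case unfolding Qs by simp
qed

lemma spread_list_exists:
  "0 \<notin># P \<Longrightarrow> \<exists>Ps. spread_list Ps \<and> sum_list Ps = P"
proof (induction "size P" arbitrary: P rule: less_induct)
  case less
  show ?case
  proof (cases "P = {#}")
    case True
    thus ?thesis by (intro exI[of _ "[]"]) (simp add: spread_list_def)
  next
    case False
    define p where "p = Min (set_mset P)"
    define e where "e = spread_end P"
    note se = spread_end[OF False, folded p_def e_def]
    have pP: "p \<in># P" unfolding p_def using False by (intro Min_in) auto
    define R where "R = filter_mset (\<lambda>x. x < e) P"
    define T where "T = filter_mset (\<lambda>x. \<not> x < e) P"
    have PRT: "P = R + T" unfolding R_def T_def by (rule multiset_partition)
    have pmin: "p \<le> x" if "x \<in># P" for x unfolding p_def using that by simp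
    have Rset: "set_mset R = {p..<p + (e - p)}"
    proof (intro equalityI subsetI)
      fix x assume "x \<in> set_mset R"
      hence "x \<in># P" "x < e" by (simp_all add: R_def)
      thus "x \<in> {p..<p + (e - p)}" using pmin[of x] by simp
    next
      fix x assume "x \<in> {p..<p + (e - p)}"
      hence "p \<le> x" "x < e" by auto
      thus "x \<in> set_mset R" using se(3)[of x] by (simp add: R_def)
    qed
    have "p \<noteq> 0" using pP less.prems by metis
    hence R: "spread R" unfolding spread_def
      using Rset se(2) by (intro exI[of _ p] exI[of _ "e - p"]) simp
    have "0 < size R" using spread_nonempty[OF R] nonempty_has_size by blast
    hence "size T < size P" unfolding PRT by simp
    moreover have "0 \<notin># T" using less.prems by (simp add: T_def)
    ultimately obtain Ts where Ts: "spread_list Ts" "sum_list Ts = T" using less.hyps[of T] by blast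
    have "spread_list (R # Ts)"
    proof (cases Ts)
      case Nil
      thus ?thesis using R by (simp add: spread_list_def)
    next
      case (Cons S Ss)
      have "spread S" using Ts(1) unfolding Cons spread_list_def by simp
      hence "S \<noteq> {#}" by (rule spread_nonempty)
      hence "Min (set_mset S) \<in># S" by (intro Min_in) auto
      moreover have "T = S + sum_list Ss" using Ts(2) unfolding Cons by simp
      ultimately have "Min (set_mset S) \<in># T" by (simp only: union_iff simp_thms)
      hence "Min (set_mset S) \<in># P" "\<not> Min (set_mset S) < e" unfolding T_def by simp_all
      hence "e + 1 \<le> Min (set_mset S)" using se(1) by (metis Suc_eq_plus1 Suc_leI linorder_neqE_nat)
      moreover have "Max (set_mset R) = e - 1" unfolding Rset using se(2) by (intro Max_eqI) auto
      ultimately have "Max (set_mset R) + 2 \<le> Min (set_mset S)" using se(2) by simp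
      thus ?thesis using R Ts(1) unfolding Cons spread_list_def by simp
    qed
    moreover have "sum_list (R # Ts) = P" unfolding PRT using Ts(2) by simp
    ultimately show ?thesis by blast
  qed
qed

lemma spread_decomposition:
  assumes "0 \<notin># P"
  shows "spread_list (spread_decomposition P)" "sum_list (spread_decomposition P) = P"
proof -
  obtain Ps where Ps: "spread_list Ps" "sum_list Ps = P" using spread_list_exists[OF assms] by blast
  have "spread_decomposition P = Ps"
    unfolding spread_decomposition_def
  proof (rule the_equality)
    show "(\<forall>R\<in>set Ps. spread R) \<and> sum_list Ps = P \<and>
        successively (\<lambda>R S. Max (set_mset R) + 2 \<le> Min (set_mset S)) Ps"
      using Ps by (simp add: spread_list_def)
    fix Qs assume "(\<forall>R\<in>set Qs. spread R) \<and> sum_list Qs = P \<and>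
        successively (\<lambda>R S. Max (set_mset R) + 2 \<le> Min (set_mset S)) Qs"
    thus "Qs = Ps" using spread_list_unique[OF _ Ps(1), of Qs] Ps(2) by (simp add: spread_list_def)
  qed
  thus "spread_list (spread_decomposition P)" "sum_list (spread_decomposition P) = P" using Ps by simp_all
qed

text \<open>
  Each spread is cut into consecutive pairs from below; \<open>before k\<close> counts the pairs in earlier spreads, and
  the pairs of all spreads together form a greedy cover.
\<close>

locale spreads =
  fixes Ps :: "nat multiset list"
  assumes sl: "spread_list Ps" and ne: "Ps \<noteq> []"
begin

abbreviation "P \<equiv> sum_list Ps"

definition first :: "nat \<Rightarrow> nat" where "first k = Min (set_mset (Ps ! k))"
definition len :: "nat \<Rightarrow> nat" where "len k = card (set_mset (Ps ! k))"
definition idx :: "nat \<Rightarrow> nat" where "idx k = r_index (Ps ! k)"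
definition before :: "nat \<Rightarrow> nat" where "before k = (\<Sum>i<k. idx i)"
definition r where "r = before (length Ps)"
definition block :: "nat \<Rightarrow> nat" where "block t = (LEAST k. t \<le> before (Suc k))"
definition a :: "nat \<Rightarrow> nat" where "a t = first (block t) + 2 * (t - 1 - before (block t))"

lemma spread_set:
  assumes "k < length Ps"
  shows "set_mset (Ps ! k) = {first k..<first k + len k}" "1 \<le> len k" "1 \<le> first k"
    "Max (set_mset (Ps ! k)) = first k + len k - 1"
proof -
  have "spread (Ps ! k)" using sl assms by (simp add: spread_list_def)
  then obtain p s where ps: "0 < p" "1 \<le> s" "set_mset (Ps ! k) = {p..<p + s}" by (auto simp: spread_def)
  have "first k = p" unfolding first_def ps(3) using ps(2) by (intro Min_eqI) auto
  moreover have "len k = s" unfolding len_def ps(3) by simp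
  moreover have "Max {p..<p + s} = p + s - 1" using ps(2) by (intro Max_eqI) auto
  ultimately show "set_mset (Ps ! k) = {first k..<first k + len k}" "1 \<le> len k" "1 \<le> first k"
    "Max (set_mset (Ps ! k)) = first k + len k - 1" using ps by simp_all
qed

lemma idx_eq: "k < length Ps \<Longrightarrow> idx k = (len k + 1) div 2"
  unfolding idx_def by (rule r_index_spread[OF spread_set(1)])

lemma first_gap: "Suc k < length Ps \<Longrightarrow> first k + len k + 1 \<le> first (Suc k)"
proof -
  assume k: "Suc k < length Ps"
  hence "Max (set_mset (Ps ! k)) + 2 \<le> Min (set_mset (Ps ! Suc k))"
    using sl by (auto simp: spread_list_def successively_conv_nth)
  thus ?thesis using spread_set(2,4)[of k] k unfolding first_def[of "Suc k", symmetric] by simp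
qed

lemma first_gap_far: "i < j \<Longrightarrow> j < length Ps \<Longrightarrow> first i + len i + 1 \<le> first j"
proof (induction j)
  case (Suc j)
  show ?case
  proof (cases "i = j")
    case True
    thus ?thesis using first_gap Suc by simp
  next
    case False
    thus ?thesis using first_gap[of j] Suc by simp
  qed
qed simp

lemma before_Suc: "before (Suc k) = before k + idx k" by (simp add: before_def)

lemma before_mono: "i \<le> j \<Longrightarrow> before i \<le> before j"
  unfolding before_def by (intro sum_mono2) auto

lemma before_less: "k < length Ps \<Longrightarrow> 2 * before k + 1 \<le> first k"
proof (induction k)
  case 0
  thus ?case using spread_set(3)[of 0] by (simp add: before_def)
next
  case (Suc k)
  have "2 * idx k \<le> len k + 1" using idx_eq[of k] Suc.prems by simp
  thus ?case using Suc first_gap[of k] by (simp add: before_Suc)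
qed

lemma lane_mono: "i \<le> j \<Longrightarrow> j < length Ps \<Longrightarrow> first i + 2 * before j \<le> first j + 2 * before i"
proof (induction j)
  case (Suc j)
  show ?case
  proof (cases "i = Suc j")
    case False
    have "2 * idx j \<le> len j + 1" using idx_eq[of j] Suc.prems by simp
    thus ?thesis using Suc first_gap[of j] False by (simp add: before_Suc)
  qed simp
qed simp

lemma block_eq: "1 \<le> i \<Longrightarrow> i \<le> idx k \<Longrightarrow> block (before k + i) = k"
  unfolding block_def
proof (rule Least_equality)
  fix y assume i: "1 \<le> i" and "before k + i \<le> before (Suc y)"
  thus "k \<le> y" using before_mono[of "Suc y" k] by (cases "Suc y \<le> k") auto
qed (simp add: before_Suc)

lemma a_eq: "1 \<le> i \<Longrightarrow> i \<le> idx k \<Longrightarrow> a (before k + i) = first k + 2 * (i - 1)"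
  by (simp add: a_def block_eq)

lemma index_cases:
  assumes "1 \<le> t" "t \<le> r"
  obtains k i where "k < length Ps" "1 \<le> i" "i \<le> idx k" "t = before k + i"
proof -
  have ex: "t \<le> before (Suc (length Ps - 1))" using assms(2) ne by (simp add: r_def)
  hence 1: "t \<le> before (Suc (block t))" unfolding block_def by (rule LeastI)
  have "block t \<le> length Ps - 1" unfolding block_def using ex by (rule Least_le)
  moreover have "0 < length Ps" using ne by simp
  ultimately have bl: "block t < length Ps" by linarith
  have bt: "before (block t) < t"
  proof (cases "block t")
    case 0
    thus ?thesis using assms by (simp add: before_def)
  next
    case (Suc k)
    thus ?thesis using not_less_Least[of k "\<lambda>k. t \<le> before (Suc k)"] unfolding block_def[symmetric] by simp
  qed
  show ?thesis by (rule that[OF bl, of "t - before (block t)"]) (use 1 bt in \<open>auto simp: before_Suc\<close>)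
qed

lemma index_le: "k < length Ps \<Longrightarrow> i \<le> idx k \<Longrightarrow> before k + i \<le> r"
  using before_mono[of "Suc k" "length Ps"] by (simp add: r_def before_Suc)

lemma mem_P: "x \<in># P \<longleftrightarrow> (\<exists>k<length Ps. first k \<le> x \<and> x < first k + len k)"
proof -
  have "x \<in># P \<longleftrightarrow> (\<exists>k<length Ps. x \<in># Ps ! k)" unfolding set_mset_sum_list by (metis UN_iff in_set_conv_nth)
  thus ?thesis using spread_set(1) by auto
qed

lemma count_P:
  assumes k: "k < length Ps" and x: "first k \<le> x" "x \<le> first k + len k"
  shows "count P x = count (Ps ! k) x"
proof -
  have other: "count (Ps ! i) x = 0" if "i < length Ps" "i \<noteq> k" for i
  proof -
    have "x \<notin> {first i..<first i + len i}"
    proof (cases "i < k")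
      case True
      thus ?thesis using first_gap_far[OF True k] x by auto
    next
      case False
      hence "k < i" using that by simp
      thus ?thesis using first_gap_far[OF _ that(1), of k] x by auto
    qed
    thus ?thesis using spread_set(1)[OF that(1)] by (simp add: count_eq_zero_iff)
  qed
  have "count P x = (\<Sum>i<length Ps. count (Ps ! i) x)"
    by (simp add: sum_list_sum_nth count_sum atLeast0LessThan)
  also have "\<dots> = (\<Sum>i\<in>{k}. count (Ps ! i) x)"
    by (rule sum.mono_neutral_right) (use k other in auto)
  finally show ?thesis by simp
qed

lemma greedy: "greedy_cover P a r"
proof
  have i0: "1 \<le> idx 0" using idx_eq[of 0] spread_set(2)[of 0] ne by simp
  show "1 \<le> r" using index_le[of 0 "idx 0"] i0 ne by simp
  show "a t \<in># P" if t: "1 \<le> t" "t \<le> r" for t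
  proof -
    obtain k i where k: "k < length Ps" "1 \<le> i" "i \<le> idx k" "t = before k + i" using index_cases[OF t] by metis
    have "2 * (i - 1) < len k" using k idx_eq[OF k(1)] spread_set(2)[OF k(1)] by linarith
    thus ?thesis unfolding mem_P k(4) a_eq[OF k(2,3)] using k(1) by (intro exI[of _ k]) simp
  qed
  show "a t + 1 < a (Suc t)" if t: "1 \<le> t" "t < r" for t
  proof -
    have "t \<le> r" using t by simp
    then obtain k i where k: "k < length Ps" "1 \<le> i" "i \<le> idx k" "t = before k + i" using index_cases[OF t(1)] by metis
    show ?thesis
    proof (cases "i < idx k")
      case True
      have "a (before k + (i + 1)) = first k + 2 * (i + 1 - 1)" by (rule a_eq) (use True in auto)
      thus ?thesis unfolding k(4) a_eq[OF k(2,3)] using k(2) by simp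
    next
      case False
      hence i: "i = idx k" using k by simp
      have "k \<noteq> length Ps - 1"
      proof
        assume "k = length Ps - 1"
        hence "Suc k = length Ps" using k by simp
        hence "t = r" unfolding k(4) i r_def by (metis before_Suc)
        thus False using t by simp
      qed
      hence k': "Suc k < length Ps" using k by simp
      have "1 \<le> idx (Suc k)" using idx_eq[OF k'] spread_set(2)[OF k'] by simp
      hence "a (before (Suc k) + 1) = first (Suc k)" using a_eq[of 1 "Suc k"] by simp
      moreover have "Suc t = before (Suc k) + 1" using k i by (simp add: before_Suc)
      moreover have "2 * idx k \<le> len k + 1" using idx_eq[OF k(1)] by simp
      ultimately show ?thesis using a_eq[OF k(2,3)] first_gap[OF k'] k i by simp
    qed
  qed
  show "\<exists>t. 1 \<le> t \<and> t \<le> r \<and> (x = a t \<or> x = a t + 1)" if xP: "x \<in># P" for x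
  proof -
    obtain k where k: "k < length Ps" "first k \<le> x" "x < first k + len k" using xP[unfolded mem_P] by blast
    define i where "i = (x - first k) div 2 + 1"
    have i1: "1 \<le> i" by (simp add: i_def)
    have i: "1 \<le> i" "i \<le> idx k"
    proof -
      have "x - first k + 1 \<le> len k" using k by linarith
      hence "(x - first k) div 2 + 1 \<le> (len k + 1) div 2" by linarith
      thus "i \<le> idx k" unfolding i_def idx_eq[OF k(1)] .
    qed (rule i1)
    have "x = first k + 2 * (i - 1) \<or> x = first k + 2 * (i - 1) + 1" using k(2) unfolding i_def by linarith
    hence "x = a (before k + i) \<or> x = a (before k + i) + 1" unfolding a_eq[OF i] .
    moreover have "1 \<le> before k + i" using i(1) by simp
    ultimately show ?thesis using index_le[OF k(1) i(2)] by blast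
  qed
  show "0 \<notin># P"
  proof
    assume "0 \<in># P"
    then obtain k where "k < length Ps" "first k \<le> 0" unfolding mem_P by blast
    thus False using spread_set(3)[of k] by simp
  qed
qed

sublocale greedy_cover P a r by (rule greedy)

lemma lanes_block: "k < length Ps \<Longrightarrow> 1 \<le> i \<Longrightarrow> i \<le> idx k \<Longrightarrow> lanes (before k + i) = first k - 2 * before k"
  using before_less[of k] by (simp add: lanes_def a_eq)

text \<open>
  After the shift by \<open>2 * before k\<close> the smallest part of the spread is the common number of lanes of its
  pairs, so the terms of \<open>\<mu>\<close> are the cut values within the spread.  The last pair may stick out by one
  value, where the multiplicity is 0.
\<close>

lemma mu_shifted:
  assumes k: "k < length Ps"
  shows "mu_spread (image_mset (\<lambda>x. x - 2 * before k) (Ps ! k)) =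
    Min {cut_value (before k + i) (before k + j) | i j. 1 \<le> i \<and> i \<le> j \<and> j \<le> idx k}"
proof -
  define c where "c = 2 * before k"
  define Q where "Q = image_mset (\<lambda>x. x - c) (Ps ! k)"
  have cp: "c + 1 \<le> first k" using before_less[OF k] by (simp add: c_def)
  have Qset: "set_mset Q = {first k - c..<first k - c + len k}"
  proof -
    have "(\<lambda>x. x - c) ` {first k..<first k + len k} = {first k - c..<first k - c + len k}"
    proof (intro equalityI subsetI)
      fix y assume y: "y \<in> {first k - c..<first k - c + len k}"
      hence "y + c \<in> {first k..<first k + len k}" using cp by auto
      thus "y \<in> (\<lambda>x. x - c) ` {first k..<first k + len k}" by (intro image_eqI[of _ _ "y + c"]) auto
    qed (use cp in auto)
    thus ?thesis by (simp add: Q_def spread_set(1)[OF k])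
  qed
  have Qmin: "Min (set_mset Q) = first k - c"
    unfolding Qset using spread_set(2)[OF k] by (intro Min_eqI) auto
  have Qidx: "r_index Q = idx k" using r_index_spread[OF Qset] idx_eq[OF k] by simp
  have Qcount: "count Q (first k - c + d) = count P (first k + d)" if d: "d \<le> len k" for d
  proof -
    have "(\<lambda>x. x - c) -` {first k - c + d} \<inter> set_mset (Ps ! k) = {first k + d} \<inter> set_mset (Ps ! k)"
      using cp by (auto simp: spread_set(1)[OF k])
    hence "count Q (first k - c + d) = (\<Sum>x\<in>{first k + d} \<inter> set_mset (Ps ! k). count (Ps ! k) x)"
      by (simp add: Q_def count_image_mset)
    also have "\<dots> = count (Ps ! k) (first k + d)" by (cases "first k + d \<in># Ps ! k") (auto simp: count_eq_zero_iff)
    finally show ?thesis using count_P[OF k, of "first k + d"] d by simp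
  qed
  have "(first k - c) * count Q (first k - c + (2 * i - 1) - 1) + (first k - c + 1) * count Q (first k - c + 2 * j - 1) =
      cut_value (before k + i) (before k + j)" if ij: "1 \<le> i" "i \<le> j" "j \<le> idx k" for i j
  proof -
    have l: "2 * j \<le> len k + 1" using ij idx_eq[OF k] by simp
    have "first k - c + (2 * i - 1) - 1 = first k - c + (2 * (i - 1))" using ij by simp
    moreover have "first k - c + 2 * j - 1 = first k - c + (2 * j - 1)" using ij by simp
    moreover have "a (before k + i) = first k + 2 * (i - 1)" by (rule a_eq) (use ij in simp_all)
    moreover have "a (before k + j) + 1 = first k + (2 * j - 1)" using a_eq[of j k] ij by simp
    moreover have "lanes (before k + i) = first k - c" using lanes_block[OF k, of i] ij by (simp add: c_def)
    moreover have "2 * (i - 1) \<le> len k" "2 * j - 1 \<le> len k" using l ij by linarith+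
    ultimately show ?thesis using Qcount[of "2 * (i - 1)"] Qcount[of "2 * j - 1"] by (simp add: cut_value_def)
  qed
  hence "{(first k - c) * count Q (first k - c + (2 * i - 1) - 1) + (first k - c + 1) * count Q (first k - c + 2 * j - 1)
      | i j. 1 \<le> i \<and> i \<le> j \<and> j \<le> idx k} =
    {cut_value (before k + i) (before k + j) | i j. 1 \<le> i \<and> i \<le> j \<and> j \<le> idx k}"
    by (intro Collect_cong) metis
  thus ?thesis unfolding mu_spread_def Let_def Q_def[symmetric] c_def[symmetric] Qmin Qidx by simp
qed

lemma finite_block_cuts: "finite {cut_value (before k + i) (before k + j) | i j. 1 \<le> i \<and> i \<le> j \<and> j \<le> idx k}"
  by (rule finite_subset[of _ "(\<lambda>(i, j). cut_value (before k + i) (before k + j)) ` ({..idx k} \<times> {..idx k})"]) auto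

text \<open>
  A cut whose ends lie in different spreads needs equal lanes, which forces a minimal gap after a
  spread of odd length.  The last pair of the lower spread then has no upper part, so ending the cut there
  is at least as good.
\<close>

lemma min_blocks:
  "Min {mu_spread (image_mset (\<lambda>x. x - 2 * before k) (Ps ! k)) | k. k < length Ps} = min_cut"
proof (rule antisym)
  let ?M = "\<lambda>k. mu_spread (image_mset (\<lambda>x. x - 2 * before k) (Ps ! k))"
  let ?S = "\<lambda>k. {cut_value (before k + i) (before k + j) | i j. 1 \<le> i \<and> i \<le> j \<and> j \<le> idx k}"
  have fin: "finite {?M k | k. k < length Ps}" by simp
  have nonempty: "{?M k | k. k < length Ps} \<noteq> {}" using ne by auto
  show "min_cut \<le> Min {?M k | k. k < length Ps}"
  proof (rule Min.boundedI[OF fin nonempty])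
    fix y assume "y \<in> {?M k | k. k < length Ps}"
    then obtain k where k: "k < length Ps" "y = Min (?S k)" using mu_shifted by auto
    have "1 \<le> idx k" using idx_eq[OF k(1)] spread_set(2)[OF k(1)] by simp
    hence "?S k \<noteq> {}" by blast
    hence "y \<in> ?S k" unfolding k(2) by (rule Min_in[OF finite_block_cuts])
    then obtain i j where ij: "y = cut_value (before k + i) (before k + j)" "1 \<le> i" "i \<le> j" "j \<le> idx k" by blast
    show "min_cut \<le> y" unfolding ij(1)
      by (rule min_cut_le) (use ij index_le[OF k(1) ij(4)] lanes_block[OF k(1)] in auto)
  qed
  obtain t t' where t: "1 \<le> t" "t \<le> t'" "t' \<le> r" "lanes t = lanes t'" "min_cut = cut_value t t'"
    by (rule min_cut_attained)
  have "t \<le> r" "1 \<le> t'" using t by simp_all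
  then obtain k i k' j where k: "k < length Ps" "1 \<le> i" "i \<le> idx k" "t = before k + i"
    and k': "k' < length Ps" "1 \<le> j" "j \<le> idx k'" "t' = before k' + j"
    using index_cases[OF t(1)] index_cases[OF _ t(3)] by metis
  have inblock: "Min {?M k | k. k < length Ps} \<le> cut_value (before k + i) (before k + l)" if "i \<le> l" "l \<le> idx k" for l
  proof -
    have "Min {?M k | k. k < length Ps} \<le> ?M k" using fin k(1) by (intro Min_le) auto
    also have "\<dots> \<le> cut_value (before k + i) (before k + l)"
      unfolding mu_shifted[OF k(1)] using k(2) that by (intro Min_le finite_block_cuts) blast
    finally show ?thesis .
  qed
  show "Min {?M k | k. k < length Ps} \<le> min_cut"
  proof (cases "k = k'")
    case True
    thus ?thesis using inblock[of j] t k k' by simp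
  next
    case False
    have "k < k'"
    proof (rule ccontr)
      assume "\<not> k < k'"
      hence "before (Suc k') \<le> before k" using False by (intro before_mono) simp
      thus False using t(2) k k' by (simp add: before_Suc)
    qed
    hence sk: "Suc k \<le> k'" "Suc k < length Ps" using k'(1) by simp_all
    have eq: "first k - 2 * before k = first k' - 2 * before k'"
      using t(4) lanes_block[OF k(1-3)] lanes_block[OF k'(1-3)] k(4) k'(4) by simp
    have "first (Suc k) + 2 * before k' \<le> first k' + 2 * before (Suc k)" by (rule lane_mono[OF sk(1) k'(1)])
    hence "first (Suc k) \<le> first k + 2 * idx k"
      using eq before_less[OF k(1)] before_less[OF k'(1)] by (simp add: before_Suc)
    hence full: "2 * idx k = len k + 1" using first_gap[OF sk(2)] idx_eq[OF k(1)] by linarith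
    have "a (before k + idx k) + 1 = first k + len k" using a_eq[of "idx k" k] k full by simp
    moreover have "count P (first k + len k) = 0"
      using count_P[OF k(1), of "first k + len k"] spread_set(1)[OF k(1)] by (simp add: count_eq_zero_iff)
    ultimately have "cut_value t (before k + idx k) \<le> cut_value t t'" by (simp add: cut_value_def)
    thus ?thesis using inblock[of "idx k"] t(5) k by simp
  qed
qed

end

lemma greedy_cover_mu:
  assumes "0 \<notin># P" "P \<noteq> {#}"
  obtains a r where "greedy_cover P a r" "greedy_cover.min_cut P a r = mu P"
proof -
  let ?Ps = "spread_decomposition P"
  note d = spread_decomposition[OF assms(1)]
  interpret S: spreads ?Ps by unfold_locales (use d assms(2) in auto)
  have "mu P = S.min_cut"
    unfolding mu_def Let_def S.min_blocks[symmetric] S.before_def S.idx_def ..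
  thus ?thesis using that S.greedy d(2) by metis
qed

section \<open>Matrices indexed by the poset\<close>

text \<open>
  Rows of equal length are numbered from the last block of the list backwards.
\<close>

fun coord :: "nat list \<Rightarrow> nat \<Rightarrow> nat \<times> nat \<times> nat" where
  "coord [] i = (0, 0, 0)"
| "coord (p # ps) i = (if i < p then (Suc i, p, Suc (count (mset ps) p)) else coord ps (i - p))"

fun up :: "nat \<times> nat \<times> nat \<Rightarrow> nat \<times> nat \<times> nat" where
  "up (u, p, k) = (Suc u, p, k)"

lemma coord_bij: "bij_betw (coord ps) {..<sum_list ps} (poset_elems (mset ps))"
proof (induction ps)
  case Nil
  have "poset_elems {#} = {}" by (auto simp: poset_elems_def)
  thus ?case by (simp add: bij_betw_def)
next
  case (Cons p ps)
  let ?D = "poset_elems (mset ps)" and ?c = "Suc (count (mset ps) p)"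
  have 1: "bij_betw (coord (p # ps)) {..<p} ({1..p} \<times> {p} \<times> {?c})"
    by (rule bij_betw_byWitness[where f' = "\<lambda>(u, p, k). u - 1"]) auto
  have sh: "bij_betw (\<lambda>i. i - p) {p..<p + sum_list ps} {..<sum_list ps}"
    by (rule bij_betw_byWitness[where f' = "\<lambda>i. i + p"]) auto
  have "bij_betw (coord ps \<circ> (\<lambda>i. i - p)) {p..<p + sum_list ps} ?D"
    by (rule bij_betw_trans[OF sh Cons.IH])
  hence 2: "bij_betw (coord (p # ps)) {p..<p + sum_list ps} ?D"
    by (rule bij_betw_cong[THEN iffD1, rotated]) auto
  have dis: "({1..p} \<times> {p} \<times> {?c}) \<inter> ?D = {}" by (auto simp: poset_elems_iff)
  have "bij_betw (coord (p # ps)) ({..<p} \<union> {p..<p + sum_list ps}) (({1..p} \<times> {p} \<times> {?c}) \<union> ?D)"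
    by (rule bij_betw_combine[OF 1 2 dis])
  moreover have "{..<p} \<union> {p..<p + sum_list ps} = {..<sum_list (p # ps)}" by auto
  moreover have "({1..p} \<times> {p} \<times> {?c}) \<union> ?D = poset_elems (mset (p # ps))"
    by (auto simp: poset_elems_iff split: if_splits)
  ultimately show ?case by (simp only:)
qed

lemma coord_in: "i < sum_list ps \<Longrightarrow> coord ps i \<in> poset_elems (mset ps)"
  using bij_betwE[OF coord_bij] by auto

lemma nil_jordan_coord:
  "i < sum_list ps \<Longrightarrow> j < sum_list ps \<Longrightarrow>
   nil_jordan ps $$ (i, j) = (if coord ps j = up (coord ps i) then 1 else 0)"
proof (induction ps arbitrary: i j)
  case (Cons p ps)
  have new: "coord ps i' \<noteq> (u, p, Suc (count (mset ps) p))" if "i' < sum_list ps" for i' u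
    using coord_in[OF that] by (auto simp: poset_elems_iff)
  have new': "up (coord ps i') \<noteq> (u, p, Suc (count (mset ps) p))" if "i' < sum_list ps" for i' u
    using coord_in[OF that] by (cases "coord ps i'") (auto simp: poset_elems_iff)
  have four: "nil_jordan (p # ps) $$ (i, j) =
     (if i < p then if j < p then jordan_block p 0 $$ (i, j) else 0
      else if j < p then 0 else nil_jordan ps $$ (i - p, j - p))"
    using Cons.prems by (auto simp: jordan_matrix_Cons)
  consider "i < p" "j < p" | "i < p" "p \<le> j" | "p \<le> i" "j < p" | "p \<le> i" "p \<le> j" by linarith
  thus ?case
  proof cases
    case 1
    thus ?thesis unfolding four by auto
  next
    case 2
    have "j - p < sum_list ps" using 2 Cons.prems by auto
    thus ?thesis unfolding four using 2 new[of "j - p" "Suc (Suc i)"] by auto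
  next
    case 3
    have "i - p < sum_list ps" using 3 Cons.prems by auto
    thus ?thesis unfolding four using 3 new'[of "i - p" "Suc j"] by auto
  next
    case 4
    have "i - p < sum_list ps" "j - p < sum_list ps" using 4 Cons.prems by auto
    thus ?thesis unfolding four using 4 Cons.IH[of "i - p" "j - p"] by auto
  qed
qed simp

text \<open>
  A nilpotent Jordan matrix whose indices are labelled by the elements of the poset, so that \<open>B\<close> shifts
  along the rows.  Entries are addressed by labels through \<open>ent\<close> and \<open>mk\<close>.
\<close>

locale jordan_coords =
  fixes P :: "nat multiset" and n :: nat and \<phi> :: "nat \<Rightarrow> nat \<times> nat \<times> nat" and B :: "'a::field mat"
  assumes bij: "bij_betw \<phi> {..<n} (poset_elems P)"
    and B: "B \<in> carrier_mat n n"
    and B_entry: "\<And>i j. i < n \<Longrightarrow> j < n \<Longrightarrow> B $$ (i, j) = (if \<phi> j = up (\<phi> i) then 1 else 0)"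
begin

abbreviation "D \<equiv> poset_elems P"

definition \<psi> :: "nat \<times> nat \<times> nat \<Rightarrow> nat" where "\<psi> = the_inv_into {..<n} \<phi>"

lemma phi_in: "i < n \<Longrightarrow> \<phi> i \<in> D"
  using bij_betwE[OF bij] by auto

lemma psi_phi: "i < n \<Longrightarrow> \<psi> (\<phi> i) = i"
  unfolding \<psi>_def using bij by (intro the_inv_into_f_f) (auto simp: bij_betw_def)

lemma phi_psi: "x \<in> D \<Longrightarrow> \<phi> (\<psi> x) = x"
  unfolding \<psi>_def using bij by (intro f_the_inv_into_f) (auto simp: bij_betw_def)

lemma psi_less: "x \<in> D \<Longrightarrow> \<psi> x < n"
  using the_inv_into_into[of \<phi> "{..<n}" x "{..<n}"] bij by (auto simp: \<psi>_def bij_betw_def)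

lemma psi_eq_iff: "x \<in> D \<Longrightarrow> y \<in> D \<Longrightarrow> \<psi> x = \<psi> y \<longleftrightarrow> x = y"
  using phi_psi by metis

lemma phi_eq_iff: "i < n \<Longrightarrow> j < n \<Longrightarrow> \<phi> i = \<phi> j \<longleftrightarrow> i = j"
  using psi_phi by metis

lemma card_D: "card D = n"
  using bij_betw_same_card[OF bij] by simp

definition ent :: "'a mat \<Rightarrow> nat \<times> nat \<times> nat \<Rightarrow> nat \<times> nat \<times> nat \<Rightarrow> 'a" where
  "ent A x y = A $$ (\<psi> x, \<psi> y)"

definition mk :: "(nat \<times> nat \<times> nat \<Rightarrow> nat \<times> nat \<times> nat \<Rightarrow> 'a) \<Rightarrow> 'a mat" where
  "mk f = mat n n (\<lambda>(i, j). f (\<phi> i) (\<phi> j))"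

lemma mk_carrier [simp]: "mk f \<in> carrier_mat n n" by (simp add: mk_def)

lemma ent_mk: "x \<in> D \<Longrightarrow> y \<in> D \<Longrightarrow> ent (mk f) x y = f x y"
  by (simp add: ent_def mk_def psi_less phi_psi)

lemma ent_phi: "i < n \<Longrightarrow> j < n \<Longrightarrow> ent A (\<phi> i) (\<phi> j) = A $$ (i, j)"
  by (simp add: ent_def psi_phi)

lemma ent_eqI:
  assumes "A \<in> carrier_mat n n" "A' \<in> carrier_mat n n" "\<And>x y. x \<in> D \<Longrightarrow> y \<in> D \<Longrightarrow> ent A x y = ent A' x y"
  shows "A = A'"
proof (rule eq_matI)
  fix i j assume ij: "i < dim_row A'" "j < dim_col A'"
  hence "i < n" "j < n" using assms(2) by auto
  thus "A $$ (i, j) = A' $$ (i, j)" using assms(3)[OF phi_in phi_in, of i j] by (simp add: ent_phi)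
qed (use assms in auto)

lemma ent_mult:
  assumes "A \<in> carrier_mat n n" "A' \<in> carrier_mat n n" "x \<in> D" "y \<in> D"
  shows "ent (A * A') x y = (\<Sum>z\<in>D. ent A x z * ent A' z y)"
proof -
  have "ent (A * A') x y = (\<Sum>i\<in>{..<n}. A $$ (\<psi> x, i) * A' $$ (i, \<psi> y))"
    using assms psi_less[OF assms(3)] psi_less[OF assms(4)]
    by (simp add: ent_def scalar_prod_def atLeast0LessThan)
  also have "\<dots> = (\<Sum>i\<in>{..<n}. ent A x (\<phi> i) * ent A' (\<phi> i) y)"
    by (intro sum.cong) (auto simp: ent_def psi_phi)
  also have "\<dots> = (\<Sum>z\<in>D. ent A x z * ent A' z y)"
    by (rule sum.reindex_bij_betw[OF bij])
  finally show ?thesis .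
qed

lemma ent_B: "x \<in> D \<Longrightarrow> y \<in> D \<Longrightarrow> ent B x y = (if y = up x then 1 else 0)"
  by (simp add: ent_def B_entry psi_less phi_psi)

lemma ent_one: "x \<in> D \<Longrightarrow> y \<in> D \<Longrightarrow> ent (1\<^sub>m n) x y = (if x = y then 1 else 0)"
  by (simp add: ent_def psi_less psi_eq_iff)

lemma ent_zero: "x \<in> D \<Longrightarrow> y \<in> D \<Longrightarrow> ent (0\<^sub>m n n) x y = 0"
  by (simp add: ent_def psi_less)

lemma ent_add: "A \<in> carrier_mat n n \<Longrightarrow> A' \<in> carrier_mat n n \<Longrightarrow> x \<in> D \<Longrightarrow> y \<in> D \<Longrightarrow>
  ent (A + A') x y = ent A x y + ent A' x y"
  by (simp add: ent_def psi_less)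

lemma ent_smult: "A \<in> carrier_mat n n \<Longrightarrow> x \<in> D \<Longrightarrow> y \<in> D \<Longrightarrow> ent (c \<cdot>\<^sub>m A) x y = c * ent A x y"
  by (simp add: ent_def psi_less)

subsection \<open>The commutator\<close>

lemma ent_mult_B:
  assumes "A \<in> carrier_mat n n" "x \<in> D" "(v, q, l) \<in> D"
  shows "ent (A * B) x (v, q, l) = (if 1 < v then ent A x (v - 1, q, l) else 0)"
proof -
  have v: "1 \<le> v" and pred: "1 < v \<Longrightarrow> (v - 1, q, l) \<in> D" using assms(3) by (auto simp: poset_elems_iff)
  have "ent (A * B) x (v, q, l) = (\<Sum>z\<in>D. if z = (v - 1, q, l) then (if 1 < v then ent A x z else 0) else 0)"
    unfolding ent_mult[OF assms(1) B assms(2,3)]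
  proof (rule sum.cong[OF refl])
    fix z assume z: "z \<in> D"
    obtain u p k where e: "z = (u, p, k)" by (metis prod_cases3)
    have "1 \<le> u" using z by (simp add: e poset_elems_iff)
    hence "(v, q, l) = up z \<longleftrightarrow> 1 < v \<and> z = (v - 1, q, l)" by (auto simp: e)
    thus "ent A x z * ent B z (v, q, l) = (if z = (v - 1, q, l) then (if 1 < v then ent A x z else 0) else 0)"
      unfolding ent_B[OF z assms(3)] by simp
  qed
  also have "\<dots> = (if 1 < v then ent A x (v - 1, q, l) else 0)"
    using pred by (cases "1 < v") (simp_all add: sum.delta)
  finally show ?thesis .
qed

lemma ent_B_mult:
  assumes "A \<in> carrier_mat n n" "(u, p, k) \<in> D" "y \<in> D"
  shows "ent (B * A) (u, p, k) y = (if u < p then ent A (Suc u, p, k) y else 0)"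
proof -
  have nxt: "(Suc u, p, k) \<in> D \<longleftrightarrow> u < p" using assms(2) by (auto simp: poset_elems_iff)
  have "ent (B * A) (u, p, k) y = (\<Sum>z\<in>D. if z = (Suc u, p, k) then ent A z y else 0)"
    unfolding ent_mult[OF B assms(1-3)]
  proof (rule sum.cong[OF refl])
    fix z assume z: "z \<in> D"
    show "ent B (u, p, k) z * ent A z y = (if z = (Suc u, p, k) then ent A z y else 0)"
      unfolding ent_B[OF assms(2) z] by simp
  qed
  also have "\<dots> = (if u < p then ent A (Suc u, p, k) y else 0)"
    using nxt by (simp add: sum.delta)
  finally show ?thesis .
qed

definition comm :: "'a mat set" where "comm = {A \<in> carrier_mat n n. A * B = B * A}"

text \<open>
  Commuting with the shift means that entries are constant along diagonals, and 0 where a diagonal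
  enters or leaves at the wrong end.
\<close>

lemma comm_iff:
  "A \<in> comm \<longleftrightarrow> A \<in> carrier_mat n n \<and> (\<forall>u p k v q l. (u, p, k) \<in> D \<longrightarrow> (v, q, l) \<in> D \<longrightarrow>
     (if 1 < v then ent A (u, p, k) (v - 1, q, l) else 0) = (if u < p then ent A (Suc u, p, k) (v, q, l) else 0))"
proof -
  have "A * B = B * A \<longleftrightarrow> (\<forall>x\<in>D. \<forall>y\<in>D. ent (A * B) x y = ent (B * A) x y)" if "A \<in> carrier_mat n n"
  proof
    assume "A * B = B * A"
    thus "\<forall>x\<in>D. \<forall>y\<in>D. ent (A * B) x y = ent (B * A) x y" by simp
  next
    assume *: "\<forall>x\<in>D. \<forall>y\<in>D. ent (A * B) x y = ent (B * A) x y"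
    show "A * B = B * A"
      by (rule ent_eqI[OF mult_carrier_mat[OF that B] mult_carrier_mat[OF B that]]) (use * in blast)
  qed
  moreover have "(\<forall>x\<in>D. \<forall>y\<in>D. ent (A * B) x y = ent (B * A) x y) \<longleftrightarrow>
     (\<forall>u p k v q l. (u, p, k) \<in> D \<longrightarrow> (v, q, l) \<in> D \<longrightarrow>
     (if 1 < v then ent A (u, p, k) (v - 1, q, l) else 0) = (if u < p then ent A (Suc u, p, k) (v, q, l) else 0))"
    if A: "A \<in> carrier_mat n n"
  proof -
    have "ent (A * B) (u, p, k) (v, q, l) = ent (B * A) (u, p, k) (v, q, l) \<longleftrightarrow>
       (if 1 < v then ent A (u, p, k) (v - 1, q, l) else 0) = (if u < p then ent A (Suc u, p, k) (v, q, l) else 0)"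
      if "(u, p, k) \<in> D" "(v, q, l) \<in> D" for u p k v q l
      unfolding ent_mult_B[OF A that] ent_B_mult[OF A that] by (rule refl)
    thus ?thesis by (metis prod_cases3)
  qed
  ultimately show ?thesis unfolding comm_def by blast
qed

lemma comm_rule:
  assumes "A \<in> comm" "(u, p, k) \<in> D" "(v, q, l) \<in> D"
  shows "(if 1 < v then ent A (u, p, k) (v - 1, q, l) else 0) = (if u < p then ent A (Suc u, p, k) (v, q, l) else 0)"
  using assms unfolding comm_iff by blast

lemma comm_carrier: "A \<in> comm \<Longrightarrow> A \<in> carrier_mat n n" by (simp add: comm_def)

lemma comm_shift:
  assumes A: "A \<in> comm" and x: "(Suc u, p, k) \<in> D" and y: "(v, q, l) \<in> D" and u: "1 \<le> u"
  shows "ent A (Suc u, p, k) (v, q, l) = (if 1 < v then ent A (u, p, k) (v - 1, q, l) else 0)"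
proof -
  have "(u, p, k) \<in> D" "u < p" using x u by (auto simp: poset_elems_iff)
  from comm_rule[OF A this(1) y] this(2) show ?thesis by simp
qed

lemma comm_toeplitz:
  assumes A: "A \<in> comm"
  shows "(u, p, k) \<in> D \<Longrightarrow> (v, q, l) \<in> D \<Longrightarrow>
    ent A (u, p, k) (v, q, l) = (if u \<le> v then ent A (1, p, k) (v - u + 1, q, l) else 0)"
proof (induction u arbitrary: v)
  case 0
  thus ?case by (simp add: poset_elems_iff)
next
  case (Suc u)
  show ?case
  proof (cases "u = 0")
    case True
    thus ?thesis using Suc.prems by (auto simp: poset_elems_iff)
  next
    case False
    have c: "ent A (Suc u, p, k) (v, q, l) = (if 1 < v then ent A (u, p, k) (v - 1, q, l) else 0)"
      using comm_shift[OF A Suc.prems] False by simp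
    show ?thesis
    proof (cases "1 < v")
      case True
      have "(u, p, k) \<in> D" "(v - 1, q, l) \<in> D" using Suc.prems False True by (auto simp: poset_elems_iff)
      from Suc.IH[OF this] show ?thesis unfolding c using True by auto
    next
      case f: False
      thus ?thesis unfolding c using False by auto
    qed
  qed
qed

text \<open>
  A nonzero entry, pushed along its diagonal, must not run off at the wrong end.
\<close>

lemma comm_support:
  assumes A: "A \<in> comm" and "(u, p, k) \<in> D" "(v, q, l) \<in> D" "ent A (u, p, k) (v, q, l) \<noteq> 0"
  shows "u \<le> v" "u + q \<le> v + p"
proof -
  show "u \<le> v" using comm_toeplitz[OF A assms(2,3)] assms(4) by (auto split: if_splits)
  show "u + q \<le> v + p" using assms(2-)
  proof (induction "p - u" arbitrary: u v)
    case 0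
    hence up: "u = p" by (auto simp: poset_elems_iff)
    show ?case
    proof (rule ccontr)
      assume "\<not> ?thesis"
      hence "(Suc v, q, l) \<in> D" using 0 up by (auto simp: poset_elems_iff)
      moreover have "(p, p, k) \<in> D" using 0 up by simp
      moreover have "1 \<le> v" using 0 by (auto simp: poset_elems_iff)
      ultimately have "ent A (p, p, k) (v, q, l) = 0" using comm_rule[OF A, of p p k "Suc v" q l] by simp
      thus False using 0 up by simp
    qed
  next
    case (Suc d)
    show ?case
    proof (cases "v = q")
      case False
      have "(Suc u, p, k) \<in> D" "(Suc v, q, l) \<in> D" "1 \<le> u" "1 \<le> v"
        using Suc.prems Suc.hyps(2) False by (auto simp: poset_elems_iff)
      moreover from comm_shift[OF A this(1,2,3)] this(4)
      have "ent A (Suc u, p, k) (Suc v, q, l) = ent A (u, p, k) (v, q, l)" by simp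
      ultimately have "Suc u + q \<le> Suc v + p" using Suc.hyps(1)[of "Suc u" "Suc v"] Suc.hyps(2) Suc.prems by simp
      thus ?thesis by simp
    next
      case True
      thus ?thesis using Suc.prems by (auto simp: poset_elems_iff)
    qed
  qed
qed

text \<open>
  The incidence algebra of the poset without its diagonal.
\<close>

definition strict :: "'a mat set" where
  "strict = {A \<in> carrier_mat n n. \<forall>x\<in>D. \<forall>y\<in>D. ent A x y \<noteq> 0 \<longrightarrow> elem_less x y}"

lemma strict_entry: "A \<in> strict \<Longrightarrow> i < n \<Longrightarrow> j < n \<Longrightarrow> A $$ (i, j) \<noteq> 0 \<Longrightarrow> elem_less (\<phi> i) (\<phi> j)"
  unfolding strict_def using phi_in by (auto simp: ent_phi[symmetric])

lemma comm_strictI: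
  assumes A: "A \<in> comm" and diag: "\<And>p k l. (1, p, k) \<in> D \<Longrightarrow> (1, p, l) \<in> D \<Longrightarrow> l \<le> k \<Longrightarrow> ent A (1, p, k) (1, p, l) = 0"
  shows "A \<in> strict"
  unfolding strict_def
proof (intro CollectI conjI ballI impI)
  show "A \<in> carrier_mat n n" using A by (rule comm_carrier)
  fix x y assume xy: "x \<in> D" "y \<in> D" "ent A x y \<noteq> 0"
  obtain u p k v q l where e: "x = (u, p, k)" "y = (v, q, l)" by (metis prod_cases3)
  have "k < l" if "p = q" "u = v"
  proof (rule ccontr)
    assume "\<not> k < l"
    moreover have "ent A (1, p, k) (1, p, l) \<noteq> 0"
      using comm_toeplitz[OF A, of u p k v q l] xy that by (simp add: e)
    moreover have "(1, p, k) \<in> D" "(1, p, l) \<in> D" using xy that by (auto simp: e poset_elems_iff)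
    ultimately show False using diag[of p k l] by simp
  qed
  thus "elem_less x y" using comm_support[OF A, of u p k v q l] xy by (simp add: e)
qed

lemma strict_pow_entry:
  assumes A: "A \<in> strict"
  shows "i < n \<Longrightarrow> j < n \<Longrightarrow> (A ^\<^sub>m m) $$ (i, j) \<noteq> 0 \<Longrightarrow> elem_height P (\<phi> i) + m \<le> elem_height P (\<phi> j)"
proof (induction m arbitrary: j)
  case 0
  have "dim_row A = n" using A by (auto simp: strict_def)
  thus ?case using 0 by (auto split: if_splits)
next
  case (Suc m)
  have Ac: "A \<in> carrier_mat n n" using A by (auto simp: strict_def)
  have "(A ^\<^sub>m Suc m) $$ (i, j) = (\<Sum>k<n. (A ^\<^sub>m m) $$ (i, k) * A $$ (k, j))"
    using Suc.prems Ac pow_carrier_mat[OF Ac, of m] by (simp add: scalar_prod_def atLeast0LessThan)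
  then obtain k where k: "k < n" "(A ^\<^sub>m m) $$ (i, k) \<noteq> 0" "A $$ (k, j) \<noteq> 0"
    using Suc.prems(3) by (metis (no_types, lifting) lessThan_iff mult_eq_0_iff sum.neutral)
  have "elem_height P (\<phi> i) + m \<le> elem_height P (\<phi> k)" using Suc k by blast
  moreover have "elem_height P (\<phi> k) < elem_height P (\<phi> j)"
    using elem_height_less[OF phi_in[OF k(1)] strict_entry[OF A k(1) Suc.prems(2) k(3)]] .
  ultimately show ?case by simp
qed

lemma strict_nilpotent:
  assumes A: "A \<in> strict"
  shows "A ^\<^sub>m n = 0\<^sub>m n n"
proof (rule eq_matI)
  have Ac: "A \<in> carrier_mat n n" using A by (auto simp: strict_def)
  show "dim_row (A ^\<^sub>m n) = dim_row (0\<^sub>m n n)" "dim_col (A ^\<^sub>m n) = dim_col (0\<^sub>m n n)"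
    using pow_carrier_mat[OF Ac, of n] by auto
  fix i j assume "i < dim_row (0\<^sub>m n n)" "j < dim_col (0\<^sub>m n n)"
  hence ij: "i < n" "j < n" by auto
  have "elem_height P (\<phi> j) < n" using elem_height_bound[OF phi_in[OF ij(2)]] card_D by simp
  hence "(A ^\<^sub>m n) $$ (i, j) = 0" using strict_pow_entry[OF A ij, of n] by fastforce
  thus "(A ^\<^sub>m n) $$ (i, j) = 0\<^sub>m n n $$ (i, j)" using ij by simp
qed

lemma strict_line:
  assumes "A \<in> strict" "A' \<in> strict"
  shows "c \<cdot>\<^sub>m A + c' \<cdot>\<^sub>m A' \<in> strict"
proof -
  have c: "A \<in> carrier_mat n n" "A' \<in> carrier_mat n n" using assms by (auto simp: strict_def)
  show ?thesis unfolding strict_def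
  proof (intro CollectI conjI ballI impI)
    fix x y assume xy: "x \<in> D" "y \<in> D" "ent (c \<cdot>\<^sub>m A + c' \<cdot>\<^sub>m A') x y \<noteq> 0"
    hence "c * ent A x y + c' * ent A' x y \<noteq> 0" using c by (simp add: ent_add ent_smult)
    hence "ent A x y \<noteq> 0 \<or> ent A' x y \<noteq> 0" by auto
    thus "elem_less x y" using assms xy unfolding strict_def by blast
  qed (use c in auto)
qed

text \<open>
  Chains of the support order are chains of the poset.
\<close>

lemma strict_defect_chains:
  assumes A: "A \<in> strict" and d: "defect A m d"
  shows "card D \<le> d + max_chain_union P m"
proof -
  have Ac: "A \<in> carrier_mat n n" using A by (auto simp: strict_def)
  define lt where "lt i j = elem_less (\<phi> i) (\<phi> j)" for i j
  have "d \<le> n \<and> (\<exists>C. (\<forall>t<m. C t \<subseteq> {..<n} \<and> (\<forall>x\<in>C t. \<forall>y\<in>C t. x = y \<or> lt x y \<or> lt y x)) \<and>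
           card (\<Union>t<m. C t) = n - d)"
  proof (rule defect_path_cover[OF Ac _ _ _ d, where h = "\<lambda>i. elem_height P (\<phi> i)"])
    show "lt i j" if "i < n" "j < n" "A $$ (i, j) \<noteq> 0" for i j
      using strict_entry[OF A that] by (simp add: lt_def)
    show "lt i k" if "lt i j" "lt j k" for i j k using that elem_less_trans by (auto simp: lt_def)
    show "elem_height P (\<phi> i) < elem_height P (\<phi> j)" if "i < n" "lt i j" for i j
      using elem_height_less[OF phi_in[OF that(1)]] that(2) by (simp add: lt_def)
  qed
  then obtain C where dn: "d \<le> n" and
    C: "\<forall>t<m. C t \<subseteq> {..<n} \<and> (\<forall>x\<in>C t. \<forall>y\<in>C t. x = y \<or> lt x y \<or> lt y x)"
    and card: "card (\<Union>t<m. C t) = n - d" by blast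
  have "\<phi> ` C t \<in> Chains (poset_order P)" if "t < m" for t
    unfolding Chains_poset_order
  proof (intro conjI ballI)
    show "\<phi> ` C t \<subseteq> D" using C that phi_in by blast
    fix x y assume "x \<in> \<phi> ` C t" "y \<in> \<phi> ` C t"
    then obtain i j where ij: "i \<in> C t" "j \<in> C t" "x = \<phi> i" "y = \<phi> j" by blast
    hence "i = j \<or> lt i j \<or> lt j i" using C that by blast
    thus "x = y \<or> elem_less x y \<or> elem_less y x" using ij by (auto simp: lt_def)
  qed
  hence le: "card (\<Union>t<m. \<phi> ` C t) \<le> max_chain_union P m" by (rule card_le_max_chain_union)
  have "(\<Union>t<m. \<phi> ` C t) = \<phi> ` (\<Union>t<m. C t)" by blast
  moreover have "inj_on \<phi> (\<Union>t<m. C t)"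
    by (rule inj_on_subset[OF bij_betw_imp_inj_on[OF bij]]) (use C in blast)
  ultimately have "card (\<Union>t<m. \<phi> ` C t) = n - d" using card card_image by metis
  thus ?thesis using le dn card_D by linarith
qed

end

section \<open>Nilpotent matrices over a field are strictly triangularizable\<close>

definition strictly_upper :: "'a::zero mat \<Rightarrow> bool" where
  "strictly_upper T \<longleftrightarrow> (\<forall>i<dim_row T. \<forall>j\<le>i. T $$ (i, j) = 0)"

lemma basis_through_vector:
  fixes v :: "'a::field vec"
  assumes v: "v \<in> carrier_vec n" "v \<noteq> 0\<^sub>v n"
  obtains W W' where "W \<in> carrier_mat n n" "W' \<in> carrier_mat n n" "W * W' = 1\<^sub>m n" "W' * W = 1\<^sub>m n"
    "col W 0 = v"
proof -
  obtain j0 where j0: "j0 < n" "v $ j0 \<noteq> 0" using v by (metis carrier_vecD eq_vecI index_zero_vec(1) index_zero_vec(2))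
  define \<tau> where "\<tau> c = (if c \<le> j0 then c - 1 else c)" for c :: nat
  have tau: "0 < c \<Longrightarrow> c < n \<Longrightarrow> \<tau> c < n \<and> \<tau> c \<noteq> j0" for c using j0(1) by (auto simp: \<tau>_def)
  have tau_inj: "0 < c \<Longrightarrow> 0 < d \<Longrightarrow> \<tau> c = \<tau> d \<longleftrightarrow> c = d" for c d by (auto simp: \<tau>_def)
  define W where "W = mat n n (\<lambda>(i, c). if c = 0 then v $ i else if i = \<tau> c then 1 else 0)"
  define W' where "W' = mat n n (\<lambda>(c, i). if c = 0 then (if i = j0 then 1 / v $ j0 else 0)
      else (if i = \<tau> c then 1 else 0) - (if i = j0 then v $ (\<tau> c) / v $ j0 else 0))"
  have c: "W \<in> carrier_mat n n" "W' \<in> carrier_mat n n" by (auto simp: W_def W'_def)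
  have W'W: "W' * W = 1\<^sub>m n"
  proof (rule eq_matI)
    fix r s assume rs: "r < dim_row (1\<^sub>m n)" "s < dim_col (1\<^sub>m n)"
    have eq: "(W' * W) $$ (r, s) = (\<Sum>i<n. W' $$ (r, i) * W $$ (i, s))"
      using rs c by (simp add: scalar_prod_def atLeast0LessThan)
    show "(W' * W) $$ (r, s) = 1\<^sub>m n $$ (r, s)"
    proof (cases "r = 0")
      case True
      have "(\<Sum>i<n. W' $$ (r, i) * W $$ (i, s)) = (\<Sum>i<n. if i = j0 then 1 / v $ j0 * W $$ (i, s) else 0)"
        using rs True by (intro sum.cong) (auto simp: W'_def)
      also have "\<dots> = 1 / v $ j0 * W $$ (j0, s)" using j0 by (simp add: sum.delta)
      also have "\<dots> = 1\<^sub>m n $$ (r, s)" using rs True j0 tau[of s] by (auto simp: W_def)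
      finally show ?thesis using eq by simp
    next
      case False
      have "(\<Sum>i<n. W' $$ (r, i) * W $$ (i, s)) =
        (\<Sum>i<n. (if i = \<tau> r then W $$ (i, s) else 0) - (if i = j0 then v $ (\<tau> r) / v $ j0 * W $$ (i, s) else 0))"
        using rs False by (intro sum.cong) (auto simp: W'_def algebra_simps)
      also have "\<dots> = W $$ (\<tau> r, s) - v $ (\<tau> r) / v $ j0 * W $$ (j0, s)"
        using j0 tau[of r] False rs by (simp add: sum_subtractf sum.delta)
      also have "\<dots> = 1\<^sub>m n $$ (r, s)"
        using rs False j0 tau[of s] tau[of r] tau_inj[of r s] by (cases "s = 0") (auto simp: W_def)
      finally show ?thesis using eq by simp
    qed
  qed (use c in auto)
  have "W * W' = 1\<^sub>m n" by (rule mat_mult_left_right_inverse[OF c(2,1) W'W])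
  moreover have "col W 0 = v" using v j0 by (intro eq_vecI) (auto simp: W_def)
  ultimately show ?thesis using that c W'W by blast
qed

lemma nilpotent_kernel_vector:
  fixes A :: "'a::field mat"
  assumes A: "A \<in> carrier_mat n n" and n: "0 < n" and nil: "A ^\<^sub>m k = 0\<^sub>m n n"
  obtains v where "v \<in> carrier_vec n" "v \<noteq> 0\<^sub>v n" "A *\<^sub>v v = 0\<^sub>v n"
proof -
  have "det (A ^\<^sub>m k) = det A ^ k" for k
  proof (induction k)
    case (Suc k)
    thus ?case using det_mult[OF pow_carrier_mat[OF A] A, of k] by simp
  qed (use A in simp)
  hence "det A ^ k = 0" using nil n by (metis det_zero)
  hence "det A = 0" by simp
  thus ?thesis using that det_0_iff_vec_prod_zero_field[OF A] by blast
qed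

text \<open>
  Split off a kernel vector and induct; this works over every field, as 0 is the only
  eigenvalue.
\<close>

lemma nilpotent_triangularizable:
  fixes A :: "'a::field mat"
  assumes "A \<in> carrier_mat n n" "A ^\<^sub>m k = 0\<^sub>m n n"
  shows "\<exists>T P Q. similar_mat_wit A T P Q \<and> strictly_upper T"
  using assms
proof (induction n arbitrary: A)
  case 0
  have "similar_mat_wit A A (1\<^sub>m 0) (1\<^sub>m 0)" by (rule similar_mat_wit_refl[OF 0(1)])
  moreover have "strictly_upper A" using 0(1) by (auto simp: strictly_upper_def)
  ultimately show ?case by blast
next
  case (Suc m)
  obtain v where v: "v \<in> carrier_vec (Suc m)" "v \<noteq> 0\<^sub>v (Suc m)" "A *\<^sub>v v = 0\<^sub>v (Suc m)"
    using nilpotent_kernel_vector[OF Suc.prems(1) _ Suc.prems(2)] by blast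
  obtain W W' where W: "W \<in> carrier_mat (Suc m) (Suc m)" "W' \<in> carrier_mat (Suc m) (Suc m)"
    "W * W' = 1\<^sub>m (Suc m)" "W' * W = 1\<^sub>m (Suc m)" "col W 0 = v"
    using basis_through_vector[OF v(1,2)] by blast
  define A' where "A' = W' * A * W"
  have A'c: "A' \<in> carrier_mat (Suc m) (Suc m)"
    unfolding A'_def by (rule mult_carrier_mat[OF mult_carrier_mat[OF W(2) Suc.prems(1)] W(1)])
  have wit: "similar_mat_wit A' A W' W"
    using W Suc.prems(1) A'c by (intro similar_mat_witI[of _ _ "Suc m"]) (auto simp: A'_def)
  have "col A' 0 = W' *\<^sub>v (A *\<^sub>v col W 0)"
  proof -
    have "A' = W' * (A * W)" unfolding A'_def by (rule assoc_mult_mat[OF W(2) Suc.prems(1) W(1)])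
    hence "col A' 0 = W' *\<^sub>v col (A * W) 0"
      using col_mult2[OF W(2) mult_carrier_mat[OF Suc.prems(1) W(1)], of 0] by simp
    also have "col (A * W) 0 = A *\<^sub>v col W 0" using col_mult2[OF Suc.prems(1) W(1), of 0] by simp
    finally show ?thesis .
  qed
  also have "\<dots> = 0\<^sub>v (Suc m)" using W v by auto
  finally have col0: "A' $$ (i, 0) = 0" if "i < Suc m" for i
    using that A'c by (metis carrier_matD(1) carrier_matD(2) index_col index_zero_vec(1) zero_less_Suc)
  define A2 where "A2 = mat m m (\<lambda>(i, j). A' $$ (Suc i, Suc j))"
  define R where "R = mat 1 m (\<lambda>(i, j). A' $$ (0, Suc j))"
  have A2c: "A2 \<in> carrier_mat m m" by (simp add: A2_def)
  have four: "A' = four_block_mat (0\<^sub>m 1 1) R (0\<^sub>m m 1) A2"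
    using A'c col0 by (intro eq_matI) (auto simp: R_def A2_def)
  have pw: "(A' ^\<^sub>m j) $$ (Suc i, 0) = 0 \<and> (\<forall>l<m. (A' ^\<^sub>m j) $$ (Suc i, Suc l) = (A2 ^\<^sub>m j) $$ (i, l))" if "i < m" for i j
  proof (induction j)
    case 0
    thus ?case using that A'c A2c by auto
  next
    case (Suc j)
    have e: "(A' ^\<^sub>m Suc j) $$ (Suc i, l) = (\<Sum>k<Suc m. (A' ^\<^sub>m j) $$ (Suc i, k) * A' $$ (k, l))" if "l < Suc m" for l
      using that \<open>i < m\<close> A'c pow_carrier_mat[OF A'c, of j] by (simp add: scalar_prod_def atLeast0LessThan)
    have e2: "(A2 ^\<^sub>m Suc j) $$ (i, l) = (\<Sum>k<m. (A2 ^\<^sub>m j) $$ (i, k) * A2 $$ (k, l))" if "l < m" for l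
      using that \<open>i < m\<close> A2c pow_carrier_mat[OF A2c, of j] by (simp add: scalar_prod_def atLeast0LessThan)
    have "(A' ^\<^sub>m Suc j) $$ (Suc i, 0) = 0" unfolding e[OF zero_less_Suc] using col0 by simp
    moreover have "(A' ^\<^sub>m Suc j) $$ (Suc i, Suc l) = (A2 ^\<^sub>m Suc j) $$ (i, l)" if l: "l < m" for l
    proof -
      have "(A' ^\<^sub>m Suc j) $$ (Suc i, Suc l) = (\<Sum>k<m. (A' ^\<^sub>m j) $$ (Suc i, Suc k) * A' $$ (Suc k, Suc l))"
        unfolding e[OF Suc_mono[OF l]] sum.lessThan_Suc_shift using Suc.IH by simp
      also have "\<dots> = (A2 ^\<^sub>m Suc j) $$ (i, l)"
        unfolding e2[OF l] using Suc.IH l by (intro sum.cong) (auto simp: A2_def)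
      finally show ?thesis .
    qed
    ultimately show ?case by blast
  qed
  have A'nil: "A' ^\<^sub>m k = 0\<^sub>m (Suc m) (Suc m)"
    using similar_mat_wit_pow_id[OF wit, of k] Suc.prems(2) W by simp
  have "A2 ^\<^sub>m k = 0\<^sub>m m m"
  proof (rule eq_matI)
    fix i j assume "i < dim_row (0\<^sub>m m m)" "j < dim_col (0\<^sub>m m m)"
    thus "(A2 ^\<^sub>m k) $$ (i, j) = 0\<^sub>m m m $$ (i, j)" using pw[of i k] A'nil by auto
  qed (use pow_carrier_mat[OF A2c, of k] in auto)
  from Suc.IH[OF A2c this] obtain T2 P2 Q2 where T2: "similar_mat_wit A2 T2 P2 Q2" "strictly_upper T2" by blast
  note T2c = similar_mat_witD2[OF A2c T2(1)]
  define T where "T = four_block_mat (0\<^sub>m 1 1) (R * P2) (0\<^sub>m m 1) T2"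
  have one: "similar_mat_wit (0\<^sub>m 1 1) (0\<^sub>m 1 1 :: 'a mat) (1\<^sub>m 1) (1\<^sub>m 1)"
    by (rule similar_mat_wit_refl) simp
  have "similar_mat_wit A' T (four_block_mat (1\<^sub>m 1) (0\<^sub>m 1 m) (0\<^sub>m m 1) P2) (four_block_mat (1\<^sub>m 1) (0\<^sub>m 1 m) (0\<^sub>m m 1) Q2)"
    unfolding four T_def
  proof (rule similar_mat_wit_four_block[OF one T2(1)])
    have "R * P2 * Q2 = R * (P2 * Q2)" using T2c by (intro assoc_mult_mat[of _ 1 m _ m _ m]) (auto simp: R_def)
    also have "\<dots> = R" using T2c by (simp add: R_def)
    finally show "R = 1\<^sub>m 1 * (R * P2) * Q2"
      using T2c by (simp add: left_mult_one_mat[of "R * P2" 1 m] R_def)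
    show "0\<^sub>m m 1 = P2 * 0\<^sub>m m 1 * 1\<^sub>m 1" using T2c by simp
  qed (use T2c A2c in \<open>auto simp: R_def\<close>)
  moreover have "similar_mat_wit A A' W W'" by (rule similar_mat_wit_sym[OF wit])
  ultimately have "\<exists>P Q. similar_mat_wit A T P Q" using similar_mat_wit_trans by blast
  moreover have "strictly_upper T"
    unfolding strictly_upper_def
  proof (intro allI impI)
    fix i j assume ij: "i < dim_row T" "j \<le> i"
    have dT: "dim_row T = Suc m" "dim_row T2 = m" "dim_col T2 = m" using T2c by (auto simp: T_def)
    show "T $$ (i, j) = 0"
    proof (cases "i = 0 \<or> j = 0")
      case True
      thus ?thesis using ij dT by (auto simp: T_def)
    next
      case False
      then obtain i' j' where "i = Suc i'" "j = Suc j'" by (metis not0_implies_Suc)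
      thus ?thesis using ij dT T2(2) by (auto simp: T_def strictly_upper_def)
    qed
  qed
  ultimately show ?case by blast
qed

text \<open>
  The Jordan form of an upper triangular matrix exists over every field.
\<close>

lemma nilpotent_has_jordan_type:
  fixes A :: "'a::field mat"
  assumes A: "A \<in> carrier_mat n n" and nil: "A ^\<^sub>m k = 0\<^sub>m n n"
  shows "\<exists>Q. has_jordan_type A Q"
proof -
  obtain T P Q where T: "similar_mat_wit A T P Q" "strictly_upper T"
    using nilpotent_triangularizable[OF assms] by blast
  have Tc: "T \<in> carrier_mat n n" using similar_mat_witD2[OF A T(1)] by simp
  have ut: "upper_triangular T" using T(2) by (auto simp: strictly_upper_def)
  have sim: "similar_mat A T" using T(1) by (auto simp: similar_mat_def)
  from triangular_to_jnf_vector[OF Tc ut] obtain js where js: "jordan_nf T js" by blast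
  have "char_poly T = (\<Prod>a\<leftarrow>diag_mat T. [:- a, 1:])" by (rule char_poly_upper_triangular[OF Tc ut])
  also have "\<dots> = (\<Prod>a\<leftarrow>map (\<lambda>_. 0) [0..<n]. [:- a, 1:])"
    using T(2) Tc by (intro arg_cong[where f = "\<lambda>l. prod_list (map _ l)"]) (auto simp: diag_mat_def strictly_upper_def)
  also have "\<dots> = [:0, 1:] ^ n" by (simp add: o_def map_replicate_const)
  finally have cp: "char_poly T = [:0, 1:] ^ n" .
  have "snd j = 0" if "j \<in> set js" for j
  proof -
    obtain b a where j: "j = (b, a)" by (cases j)
    have "0 < b" using js that j by (force simp: jordan_nf_def)
    have "[:- a, 1:] ^ b dvd (\<Prod>(b, a)\<leftarrow>js. [:- a, 1:] ^ b)"
      using that j by (intro prod_list_dvd) force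
    hence "[:- a, 1:] ^ b dvd [:0, 1:] ^ n" using jordan_nf_char_poly[OF js] cp by simp
    hence "poly ([:0, 1:] ^ n) a = 0"
      using \<open>0 < b\<close> by (metis dvd_power dvd_trans poly_eq_0_iff_dvd)
    thus ?thesis using j by (simp add: poly_power)
  qed
  hence "map ((\<lambda>p. (p, 0)) \<circ> fst) js = js" by (intro map_idI) (auto simp: prod_eq_iff)
  hence "js = map (\<lambda>p. (p, 0)) (map fst js)" by simp
  moreover have "jordan_nf A js" using js sim unfolding jordan_nf_def by (metis similar_mat_trans)
  ultimately have "has_jordan_type A (mset (map fst js))" unfolding has_jordan_type_def by metis
  thus ?thesis by blast
qed

section \<open>Irreducibility of the nilpotent commutator\<close>

abbreviation eval_mat :: "'a::comm_ring_1 \<Rightarrow> 'a poly mat \<Rightarrow> 'a mat" where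
  "eval_mat t \<equiv> map_mat (\<lambda>p. poly p t)"

lemma poly_comm_ring_hom: "comm_ring_hom (\<lambda>p. poly p t)"
  by unfold_locales auto

lemma polynomial_along_curve:
  fixes W :: "'a::field poly mat"
  assumes W: "W \<in> carrier_mat n n" and f: "polynomial_mat_function n f"
  shows "\<exists>F N. \<forall>t. poly D t \<noteq> 0 \<longrightarrow> f ((1 / poly D t) \<cdot>\<^sub>m eval_mat t W) * poly D t ^ N = poly F t"
  using f
proof induction
  case (const c)
  show ?case by (intro exI[of _ "[:c:]"] exI[of _ 0]) auto
next
  case (entry i j)
  thus ?case using W by (intro exI[of _ "W $$ (i, j)"] exI[of _ 1]) auto
next
  case (add f g)
  then obtain F N G M where FG: "\<forall>t. poly D t \<noteq> 0 \<longrightarrow> f ((1 / poly D t) \<cdot>\<^sub>m eval_mat t W) * poly D t ^ N = poly F t"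
    "\<forall>t. poly D t \<noteq> 0 \<longrightarrow> g ((1 / poly D t) \<cdot>\<^sub>m eval_mat t W) * poly D t ^ M = poly G t" by blast
  show ?case
  proof (intro exI[of _ "F * D ^ M + G * D ^ N"] exI[of _ "N + M"] allI impI)
    fix t assume t: "poly D t \<noteq> 0"
    let ?Y = "(1 / poly D t) \<cdot>\<^sub>m eval_mat t W"
    have "(f ?Y + g ?Y) * poly D t ^ (N + M) =
       (f ?Y * poly D t ^ N) * poly D t ^ M + (g ?Y * poly D t ^ M) * poly D t ^ N"
      by (simp add: power_add algebra_simps)
    also have "\<dots> = poly (F * D ^ M + G * D ^ N) t" using FG t by simp
    finally show "(f ?Y + g ?Y) * poly D t ^ (N + M) = poly (F * D ^ M + G * D ^ N) t" .
  qed
next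
  case (mult f g)
  then obtain F N G M where FG: "\<forall>t. poly D t \<noteq> 0 \<longrightarrow> f ((1 / poly D t) \<cdot>\<^sub>m eval_mat t W) * poly D t ^ N = poly F t"
    "\<forall>t. poly D t \<noteq> 0 \<longrightarrow> g ((1 / poly D t) \<cdot>\<^sub>m eval_mat t W) * poly D t ^ M = poly G t" by blast
  show ?case
  proof (intro exI[of _ "F * G"] exI[of _ "N + M"] allI impI)
    fix t assume t: "poly D t \<noteq> 0"
    let ?Y = "(1 / poly D t) \<cdot>\<^sub>m eval_mat t W"
    have "(f ?Y * g ?Y) * poly D t ^ (N + M) = (f ?Y * poly D t ^ N) * (g ?Y * poly D t ^ M)"
      by (simp add: power_add algebra_simps)
    also have "\<dots> = poly (F * G) t" using FG t by simp
    finally show "(f ?Y * g ?Y) * poly D t ^ (N + M) = poly (F * G) t" .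
  qed
qed

lemma exists_nonroot:
  fixes p :: "'a::field poly"
  assumes "infinite (UNIV :: 'a set)" "p \<noteq> 0"
  shows "\<exists>t. poly p t \<noteq> 0"
proof (rule ccontr)
  assume "\<not> ?thesis"
  hence "{t. poly p t = 0} = UNIV" by auto
  thus False using poly_roots_finite[OF assms(2)] assms(1) by simp
qed

text \<open>
  Two nonvanishing polynomials, restricted to a rational curve through points where they do not vanish,
  are nonzero polynomials in one variable, and over an infinite field they have a common nonroot.
\<close>

lemma poly_irreducible_by_curves:
  fixes X :: "'a::field mat set"
  assumes inf: "infinite (UNIV :: 'a set)" and X: "X \<noteq> {}" "X \<subseteq> carrier_mat n n"
    and curve: "\<And>A A'. A \<in> X \<Longrightarrow> A' \<in> X \<Longrightarrow> \<exists>W D. W \<in> carrier_mat n n \<and> poly D 0 \<noteq> 0 \<and> poly D 1 \<noteq> 0 \<and>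
      (1 / poly D 0) \<cdot>\<^sub>m eval_mat 0 W = A \<and> (1 / poly D 1) \<cdot>\<^sub>m eval_mat 1 W = A' \<and>
      (\<forall>t. poly D t \<noteq> 0 \<longrightarrow> (1 / poly D t) \<cdot>\<^sub>m eval_mat t W \<in> X)"
  shows "poly_irreducible n X"
  unfolding poly_irreducible_def
proof (intro conjI allI impI X)
  fix f g :: "'a mat \<Rightarrow> 'a"
  assume f: "polynomial_mat_function n f" and g: "polynomial_mat_function n g"
    and "\<exists>A\<in>X. f A \<noteq> 0" "\<exists>A\<in>X. g A \<noteq> 0"
  then obtain A A' where A: "A \<in> X" "f A \<noteq> 0" "A' \<in> X" "g A' \<noteq> 0" by blast
  obtain W D where W: "W \<in> carrier_mat n n" "poly D 0 \<noteq> 0" "poly D 1 \<noteq> 0"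
      "(1 / poly D 0) \<cdot>\<^sub>m eval_mat 0 W = A" "(1 / poly D 1) \<cdot>\<^sub>m eval_mat 1 W = A'"
      "\<forall>t. poly D t \<noteq> 0 \<longrightarrow> (1 / poly D t) \<cdot>\<^sub>m eval_mat t W \<in> X" using curve[OF A(1,3)] by blast
  obtain F N where F: "\<forall>t. poly D t \<noteq> 0 \<longrightarrow> f ((1 / poly D t) \<cdot>\<^sub>m eval_mat t W) * poly D t ^ N = poly F t"
    using polynomial_along_curve[OF W(1) f] by blast
  obtain G M where G: "\<forall>t. poly D t \<noteq> 0 \<longrightarrow> g ((1 / poly D t) \<cdot>\<^sub>m eval_mat t W) * poly D t ^ M = poly G t"
    using polynomial_along_curve[OF W(1) g] by blast
  have "poly F 0 = f A * poly D 0 ^ N" using F W(2,4) by metis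
  hence "F \<noteq> 0" using A(2) W(2) by auto
  have "poly G 1 = g A' * poly D 1 ^ M" using G W(3,5) by metis
  hence "G \<noteq> 0" using A(4) W(3) by auto
  have "D \<noteq> 0" using W(2) by auto
  obtain t where t: "poly (F * G * D) t \<noteq> 0"
    using exists_nonroot[OF inf, of "F * G * D"] \<open>F \<noteq> 0\<close> \<open>G \<noteq> 0\<close> \<open>D \<noteq> 0\<close> by auto
  let ?Y = "(1 / poly D t) \<cdot>\<^sub>m eval_mat t W"
  have Dt: "poly D t \<noteq> 0" using t by auto
  have "f ?Y * poly D t ^ N \<noteq> 0" "g ?Y * poly D t ^ M \<noteq> 0" using F G Dt t by auto
  hence "f ?Y \<noteq> 0" "g ?Y \<noteq> 0" by auto
  thus "\<exists>A\<in>X. f A \<noteq> 0 \<and> g A \<noteq> 0" using W(6) Dt by blast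
qed

definition line_mat :: "nat \<Rightarrow> 'a::comm_ring_1 mat \<Rightarrow> 'a mat \<Rightarrow> 'a poly mat" where
  "line_mat n A A' = mat n n (\<lambda>(i, j). [:A $$ (i, j), A' $$ (i, j) - A $$ (i, j):])"

lemma line_mat_carrier [simp]: "line_mat n A A' \<in> carrier_mat n n"
  by (simp add: line_mat_def)

lemma eval_line_mat:
  assumes "A \<in> carrier_mat n n" "A' \<in> carrier_mat n n"
  shows "eval_mat t (line_mat n A A') = (1 - t) \<cdot>\<^sub>m A + t \<cdot>\<^sub>m A'"
  using assms by (intro eq_matI) (auto simp: line_mat_def algebra_simps)

lemma eval_line_mat_ends:
  assumes "A \<in> carrier_mat n n" "A' \<in> carrier_mat n n"
  shows "eval_mat 0 (line_mat n A A') = A" "eval_mat 1 (line_mat n A A') = A'"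
  using assms by (auto intro!: eq_matI simp: line_mat_def)

context jordan_coords begin

lemma strict_irreducible:
  assumes "infinite (UNIV :: 'a set)"
  shows "poly_irreducible n strict"
proof (rule poly_irreducible_by_curves[OF assms])
  have "0\<^sub>m n n \<in> strict" by (auto simp: strict_def ent_zero)
  thus "strict \<noteq> {}" by blast
  show "strict \<subseteq> carrier_mat n n" by (auto simp: strict_def)
  have one: "(1::'a) \<cdot>\<^sub>m M = M" for M :: "'a mat" by (intro eq_matI) auto
  fix A A' assume A: "A \<in> strict" "A' \<in> strict"
  hence c: "A \<in> carrier_mat n n" "A' \<in> carrier_mat n n" by (auto simp: strict_def)
  show "\<exists>W D. W \<in> carrier_mat n n \<and> poly D 0 \<noteq> 0 \<and> poly D 1 \<noteq> 0 \<and>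
      (1 / poly D 0) \<cdot>\<^sub>m eval_mat 0 W = A \<and> (1 / poly D 1) \<cdot>\<^sub>m eval_mat 1 W = A' \<and>
      (\<forall>t. poly D t \<noteq> 0 \<longrightarrow> (1 / poly D t) \<cdot>\<^sub>m eval_mat t W \<in> strict)"
  proof (intro exI[of _ "line_mat n A A'"] exI[of _ 1] conjI allI impI)
    fix t :: 'a
    show "(1 / poly 1 t) \<cdot>\<^sub>m eval_mat t (line_mat n A A') \<in> strict"
      using strict_line[OF A, of "1 - t" t] by (simp add: eval_line_mat[OF c] one)
  qed (simp_all add: eval_line_mat_ends[OF c] one)
qed

lemma comm_add: "A \<in> comm \<Longrightarrow> A' \<in> comm \<Longrightarrow> A + A' \<in> comm"
  unfolding comm_def using B by (auto simp: add_mult_distrib_mat[of _ n n _ _ n] mult_add_distrib_mat[of _ n n _ n])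

lemma comm_smult: "A \<in> comm \<Longrightarrow> c \<cdot>\<^sub>m A \<in> comm"
  unfolding comm_def using B by (auto simp: mult_smult_assoc_mat[of _ n n _ n] mult_smult_distrib[of _ n n _ n])

lemma comm_mult: "A \<in> comm \<Longrightarrow> A' \<in> comm \<Longrightarrow> A * A' \<in> comm"
proof -
  assume A: "A \<in> comm" and A': "A' \<in> comm"
  note c = comm_carrier[OF A] comm_carrier[OF A']
  have "A * A' * B = A * (A' * B)" by (rule assoc_mult_mat[OF c B])
  also have "\<dots> = A * (B * A')" using A' by (simp add: comm_def)
  also have "\<dots> = A * B * A'" by (rule assoc_mult_mat[symmetric, OF c(1) B c(2)])
  also have "\<dots> = B * A * A'" using A by (simp add: comm_def)
  also have "\<dots> = B * (A * A')" by (rule assoc_mult_mat[OF B c])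
  finally show ?thesis using mult_carrier_mat[OF c] by (simp add: comm_def)
qed

lemma comm_inverse:
  assumes M: "M \<in> comm" and R: "R \<in> carrier_mat n n" and i: "M * R = 1\<^sub>m n" "R * M = 1\<^sub>m n"
  shows "R \<in> comm"
proof -
  note c = comm_carrier[OF M]
  have "R * B = R * B * (M * R)" using R B i by simp
  also have "\<dots> = R * (B * M) * R"
    using R B c by (simp add: assoc_mult_mat[of _ n n _ n _ n])
  also have "\<dots> = R * (M * B) * R" using M by (simp add: comm_def)
  also have "\<dots> = (R * M) * B * R"
    using R B c by (simp add: assoc_mult_mat[of _ n n _ n _ n])
  also have "\<dots> = B * R" using R B i by simp
  finally show ?thesis using R by (simp add: comm_def)
qed

lemma comm_one: "1\<^sub>m n \<in> comm" using B by (simp add: comm_def)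

lemma comm_pow: "A \<in> comm \<Longrightarrow> A ^\<^sub>m m \<in> comm"
  by (induction m) (auto simp: comm_one comm_mult dest: comm_carrier)

subsection \<open>The diagonal blocks\<close>

text \<open>
  The scalar action of a commuting matrix on the first elements of all rows of length \<open>p\<close>, that is, its
  image in the semisimple quotient of the commutator.
\<close>

definition blk :: "'a mat \<Rightarrow> nat \<Rightarrow> 'a mat" where
  "blk A p = mat (count P p) (count P p) (\<lambda>(k, l). ent A (1, p, Suc k) (1, p, Suc l))"

lemma blk_carrier [simp]: "blk A p \<in> carrier_mat (count P p) (count P p)"
  by (simp add: blk_def)

lemma blk_mult:
  assumes A: "A \<in> comm" and A': "A' \<in> comm" and p: "1 \<le> p"
  shows "blk (A * A') p = blk A p * blk A' p"
proof (rule eq_matI)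
  fix k l assume "k < dim_row (blk A p * blk A' p)" "l < dim_col (blk A p * blk A' p)"
  hence kl: "k < count P p" "l < count P p" by (auto simp: blk_def)
  have el: "(1, p, Suc j) \<in> D" if "j < count P p" for j using p that by (simp add: poset_elems_iff)
  let ?f = "\<lambda>z. ent A (1, p, Suc k) z * ent A' z (1, p, Suc l)"
  have "ent (A * A') (1, p, Suc k) (1, p, Suc l) = (\<Sum>z\<in>D. ?f z)"
    by (rule ent_mult[OF comm_carrier[OF A] comm_carrier[OF A'] el[OF kl(1)] el[OF kl(2)]])
  also have "\<dots> = (\<Sum>z\<in>(\<lambda>j. (1, p, Suc j)) ` {..<count P p}. ?f z)"
  proof (rule sum.mono_neutral_right)
    show "\<forall>z\<in>D - (\<lambda>j. (1, p, Suc j)) ` {..<count P p}. ?f z = 0"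
    proof
      fix z assume z: "z \<in> D - (\<lambda>j. (1, p, Suc j)) ` {..<count P p}"
      obtain v q j where e: "z = (v, q, j)" by (metis prod_cases3)
      have zD: "(v, q, j) \<in> D" using z e by simp
      show "?f z = 0"
      proof (rule ccontr)
        assume "?f z \<noteq> 0"
        hence nz: "ent A (1, p, Suc k) (v, q, j) \<noteq> 0" "ent A' (v, q, j) (1, p, Suc l) \<noteq> 0"
          by (auto simp: e)
        have "1 \<le> v" "1 + q \<le> v + p" "v \<le> 1" "v + p \<le> 1 + q"
          using comm_support[OF A el[OF kl(1)] zD nz(1)] comm_support[OF A' zD el[OF kl(2)] nz(2)] by auto
        hence "v = 1" "q = p" by auto
        hence "z = (1, p, Suc (j - 1))" "j - 1 < count P p" using zD e by (auto simp: poset_elems_iff)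
        thus False using z by blast
      qed
    qed
  qed (use el in auto)
  also have "\<dots> = (\<Sum>j<count P p. ?f (1, p, Suc j))"
    by (subst sum.reindex) (auto simp: inj_on_def)
  also have "\<dots> = (blk A p * blk A' p) $$ (k, l)"
    using kl by (simp add: blk_def scalar_prod_def atLeast0LessThan)
  finally show "blk (A * A') p $$ (k, l) = (blk A p * blk A' p) $$ (k, l)"
    using kl by (simp add: blk_def)
qed (simp_all add: blk_def)

lemma blk_pow:
  assumes A: "A \<in> comm" and p: "1 \<le> p"
  shows "blk (A ^\<^sub>m m) p = blk A p ^\<^sub>m m"
proof (induction m)
  case 0
  have "dim_row A = n" using comm_carrier[OF A] by simp
  moreover have "blk (1\<^sub>m n) p = 1\<^sub>m (count P p)"
    using p by (intro eq_matI) (auto simp: blk_def ent_one poset_elems_iff)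
  ultimately show ?case by (simp add: blk_def)
next
  case (Suc m)
  show ?case using blk_mult[OF comm_pow[OF A] A p, of m] Suc by simp
qed

text \<open>
  A block-diagonal section of \<open>blk\<close>.
\<close>

definition lift :: "(nat \<Rightarrow> 'a mat) \<Rightarrow> 'a mat" where
  "lift M = mk (\<lambda>(u, p, k) (v, q, l). if p = q \<and> u = v then M p $$ (k - 1, l - 1) else 0)"

lemma lift_carrier [simp]: "lift M \<in> carrier_mat n n"
  by (simp add: lift_def)

lemma ent_lift:
  "(u, p, k) \<in> D \<Longrightarrow> (v, q, l) \<in> D \<Longrightarrow>
   ent (lift M) (u, p, k) (v, q, l) = (if p = q \<and> u = v then M p $$ (k - 1, l - 1) else 0)"
  by (simp add: lift_def ent_mk)

lemma lift_comm: "lift M \<in> comm"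
  unfolding comm_iff
proof (intro conjI allI impI)
  fix u p k v q l assume x: "(u, p, k) \<in> D" "(v, q, l) \<in> D"
  have "1 < v \<Longrightarrow> (v - 1, q, l) \<in> D" "u < p \<Longrightarrow> (Suc u, p, k) \<in> D" using x by (auto simp: poset_elems_iff)
  moreover have "u \<le> p" "1 \<le> v" "v \<le> q" "1 \<le> u" using x by (auto simp: poset_elems_iff)
  ultimately show "(if 1 < v then ent (lift M) (u, p, k) (v - 1, q, l) else 0) =
     (if u < p then ent (lift M) (Suc u, p, k) (v, q, l) else 0)"
    using x by (cases "1 < v"; cases "u < p") (auto simp: ent_lift)
qed simp

lemma sum_copies:
  assumes "(u, p, k) \<in> D" "\<And>z. z \<in> D \<Longrightarrow> (\<And>j. z \<noteq> (u, p, j)) \<Longrightarrow> f z = 0"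
  shows "(\<Sum>z\<in>D. f z) = (\<Sum>j<count P p. f (u, p, Suc j))"
proof -
  have "(\<Sum>z\<in>D. f z) = (\<Sum>z\<in>(\<lambda>j. (u, p, Suc j)) ` {..<count P p}. f z)"
  proof (rule sum.mono_neutral_right)
    show "\<forall>z\<in>D - (\<lambda>j. (u, p, Suc j)) ` {..<count P p}. f z = 0"
    proof
      fix z assume z: "z \<in> D - (\<lambda>j. (u, p, Suc j)) ` {..<count P p}"
      have "z \<noteq> (u, p, j)" for j
      proof
        assume e: "z = (u, p, j)"
        hence "z = (u, p, Suc (j - 1))" "j - 1 < count P p" using z by (auto simp: poset_elems_iff)
        thus False using z by blast
      qed
      thus "f z = 0" using assms(2)[of z] z by blast
    qed
  qed (use assms(1) in \<open>auto simp: poset_elems_iff\<close>)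
  also have "\<dots> = (\<Sum>j<count P p. f (u, p, Suc j))"
    by (subst sum.reindex) (auto simp: inj_on_def)
  finally show ?thesis .
qed

lemma ent_lift_mult:
  assumes A: "A \<in> carrier_mat n n" and x: "(u, p, k) \<in> D" and y: "y \<in> D"
  shows "ent (lift M * A) (u, p, k) y = (\<Sum>j<count P p. M p $$ (k - 1, j) * ent A (u, p, Suc j) y)"
proof -
  have "ent (lift M * A) (u, p, k) y = (\<Sum>z\<in>D. ent (lift M) (u, p, k) z * ent A z y)"
    by (rule ent_mult[OF lift_carrier A x y])
  also have "\<dots> = (\<Sum>j<count P p. ent (lift M) (u, p, k) (u, p, Suc j) * ent A (u, p, Suc j) y)"
  proof (rule sum_copies[OF x])
    fix z assume z: "z \<in> D" "\<And>j. z \<noteq> (u, p, j)"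
    obtain v q j where e: "z = (v, q, j)" by (metis prod_cases3)
    thus "ent (lift M) (u, p, k) z * ent A z y = 0" using z ent_lift[OF x, of v q j M] by auto
  qed
  also have "\<dots> = (\<Sum>j<count P p. M p $$ (k - 1, j) * ent A (u, p, Suc j) y)"
    using x by (intro sum.cong) (auto simp: ent_lift poset_elems_iff)
  finally show ?thesis .
qed

lemma ent_mult_lift:
  assumes A: "A \<in> carrier_mat n n" and x: "x \<in> D" and y: "(v, q, l) \<in> D"
  shows "ent (A * lift M) x (v, q, l) = (\<Sum>j<count P q. ent A x (v, q, Suc j) * M q $$ (j, l - 1))"
proof -
  have "ent (A * lift M) x (v, q, l) = (\<Sum>z\<in>D. ent A x z * ent (lift M) z (v, q, l))"
    by (rule ent_mult[OF A lift_carrier x y])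
  also have "\<dots> = (\<Sum>j<count P q. ent A x (v, q, Suc j) * ent (lift M) (v, q, Suc j) (v, q, l))"
  proof (rule sum_copies[OF y])
    fix z assume z: "z \<in> D" "\<And>j. z \<noteq> (v, q, j)"
    obtain u p j where e: "z = (u, p, j)" by (metis prod_cases3)
    thus "ent A x z * ent (lift M) z (v, q, l) = 0" using z ent_lift[OF _ y, of u p j M] by auto
  qed
  also have "\<dots> = (\<Sum>j<count P q. ent A x (v, q, Suc j) * M q $$ (j, l - 1))"
    using y by (intro sum.cong) (auto simp: ent_lift poset_elems_iff)
  finally show ?thesis .
qed

lemma lift_mult_one:
  assumes "\<And>p. 1 \<le> p \<Longrightarrow> M p \<in> carrier_mat (count P p) (count P p) \<and> M' p \<in> carrier_mat (count P p) (count P p) \<and>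
     M p * M' p = 1\<^sub>m (count P p)"
  shows "lift M * lift M' = 1\<^sub>m n"
proof (rule ent_eqI)
  fix x y assume xy: "x \<in> D" "y \<in> D"
  obtain u p k v q l where e: "x = (u, p, k)" "y = (v, q, l)" by (metis prod_cases3)
  have x: "(u, p, k) \<in> D" "(v, q, l) \<in> D" using xy e by auto
  have p: "1 \<le> p" "1 \<le> k" "k \<le> count P p" "1 \<le> l" "l \<le> count P q" using x by (auto simp: poset_elems_iff)
  have el: "(u, p, Suc j) \<in> D" if "j < count P p" for j using x that by (auto simp: poset_elems_iff)
  have "ent (lift M * lift M') x y = (\<Sum>j<count P p. M p $$ (k - 1, j) * ent (lift M') (u, p, Suc j) (v, q, l))"
    unfolding e by (rule ent_lift_mult[OF lift_carrier x])
  also have "\<dots> = (\<Sum>j<count P p. if p = q \<and> u = v then M p $$ (k - 1, j) * M' p $$ (j, l - 1) else 0)"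
    using el x by (intro sum.cong) (auto simp: ent_lift)
  also have "\<dots> = (if p = q \<and> u = v then (M p * M' p) $$ (k - 1, l - 1) else 0)"
  proof (cases "p = q \<and> u = v")
    case True
    have "M p \<in> carrier_mat (count P p) (count P p)" "M' p \<in> carrier_mat (count P p) (count P p)"
      using assms[OF p(1)] by auto
    hence "(M p * M' p) $$ (k - 1, l - 1) = (\<Sum>j<count P p. M p $$ (k - 1, j) * M' p $$ (j, l - 1))"
      using p True by (simp add: scalar_prod_def atLeast0LessThan)
    thus ?thesis unfolding if_P[OF True] by (rule sym)
  next
    case False
    show ?thesis unfolding if_not_P[OF False] by simp
  qed
  also have "\<dots> = (if p = q \<and> u = v \<and> k = l then 1 else 0)"
    using assms[OF p(1)] p by auto
  also have "\<dots> = ent (1\<^sub>m n) x y" using ent_one[OF xy] by (auto simp: e)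
  finally show "ent (lift M * lift M') x y = ent (1\<^sub>m n) x y" .
qed (auto intro: mult_carrier_mat[of _ n n])

definition nilcomm :: "'a mat set" where "nilcomm = {A \<in> comm. A ^\<^sub>m n = 0\<^sub>m n n}"

text \<open>
  The diagonal blocks of a nilpotent commuting matrix are nilpotent, hence triangularizable; the lifts of the
  base changes conjugate the matrix into the strict incidence algebra without leaving the
  commutator.
\<close>

lemma nilcomm_conj_strict:
  assumes X: "X \<in> nilcomm"
  obtains G H A where "G \<in> comm" "H \<in> comm" "G * H = 1\<^sub>m n" "H * G = 1\<^sub>m n" "A \<in> comm" "A \<in> strict" "X = G * A * H"
proof -
  have Xc: "X \<in> comm" and Xn: "X ^\<^sub>m n = 0\<^sub>m n n" using X by (auto simp: nilcomm_def)
  note Xm = comm_carrier[OF Xc]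
  have "\<exists>TPQ. similar_mat_wit (blk X p) (fst TPQ) (fst (snd TPQ)) (snd (snd TPQ)) \<and> strictly_upper (fst TPQ)" if p: "1 \<le> p" for p
  proof -
    have "blk X p ^\<^sub>m n = blk (0\<^sub>m n n) p" using blk_pow[OF Xc p, of n] Xn by simp
    also have "\<dots> = 0\<^sub>m (count P p) (count P p)"
      using p by (intro eq_matI) (auto simp: blk_def ent_zero poset_elems_iff)
    finally obtain T Q R where "similar_mat_wit (blk X p) T Q R" "strictly_upper T"
      using nilpotent_triangularizable[OF blk_carrier] by blast
    thus ?thesis by (intro exI[of _ "(T, Q, R)"]) simp
  qed
  then obtain f where f: "\<And>p. 1 \<le> p \<Longrightarrow> similar_mat_wit (blk X p) (fst (f p)) (fst (snd (f p))) (snd (snd (f p))) \<and> strictly_upper (fst (f p))"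
    by metis
  define T where "T p = fst (f p)" for p
  define M where "M p = fst (snd (f p))" for p
  define R where "R p = snd (snd (f p))" for p
  have wit: "similar_mat_wit (blk X p) (T p) (M p) (R p)" "strictly_upper (T p)" if "1 \<le> p" for p
    using f[OF that] by (auto simp: T_def M_def R_def)
  have w: "M p * R p = 1\<^sub>m (count P p)" "R p * M p = 1\<^sub>m (count P p)" "blk X p = M p * T p * R p"
    "T p \<in> carrier_mat (count P p) (count P p)" "M p \<in> carrier_mat (count P p) (count P p)"
    "R p \<in> carrier_mat (count P p) (count P p)" if "1 \<le> p" for p
    using similar_mat_witD2[OF blk_carrier wit(1)[OF that]] by auto
  define G where "G = lift M"
  define H where "H = lift R"
  define A where "A = H * X * G"
  have GH: "G * H = 1\<^sub>m n" "H * G = 1\<^sub>m n" unfolding G_def H_def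
    by (rule lift_mult_one, use w in blast)+
  have GHc: "G \<in> comm" "H \<in> comm" by (auto simp: G_def H_def lift_comm)
  note c = comm_carrier[OF GHc(1)] comm_carrier[OF GHc(2)]
  have Ac: "A \<in> comm" unfolding A_def by (intro comm_mult GHc Xc)
  have "A \<in> strict"
  proof (rule comm_strictI[OF Ac])
    fix p k l assume x: "(1, p, k) \<in> D" "(1, p, l) \<in> D" and lk: "l \<le> k"
    have p: "1 \<le> p" "1 \<le> k" "k \<le> count P p" "1 \<le> l" "l \<le> count P p" using x by (auto simp: poset_elems_iff)
    have el: "(1, p, Suc j) \<in> D" if "j < count P p" for j using p that by (auto simp: poset_elems_iff)
    have HX: "H * X \<in> carrier_mat n n" using c Xm by (intro mult_carrier_mat)
    have "ent A (1, p, k) (1, p, l) = (\<Sum>j<count P p. ent (H * X) (1, p, k) (1, p, Suc j) * M p $$ (j, l - 1))"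
      unfolding A_def G_def by (rule ent_mult_lift[OF HX x])
    also have "\<dots> = (\<Sum>j<count P p. (\<Sum>i<count P p. R p $$ (k - 1, i) * blk X p $$ (i, j)) * M p $$ (j, l - 1))"
    proof (rule sum.cong[OF refl])
      fix j assume "j \<in> {..<count P p}"
      hence j: "j < count P p" by simp
      have "ent (H * X) (1, p, k) (1, p, Suc j) = (\<Sum>i<count P p. R p $$ (k - 1, i) * ent X (1, p, Suc i) (1, p, Suc j))"
        unfolding H_def by (rule ent_lift_mult[OF Xm x(1) el[OF j]])
      also have "\<dots> = (\<Sum>i<count P p. R p $$ (k - 1, i) * blk X p $$ (i, j))"
        using j by (intro sum.cong) (auto simp: blk_def)
      finally show "ent (H * X) (1, p, k) (1, p, Suc j) * M p $$ (j, l - 1) =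
         (\<Sum>i<count P p. R p $$ (k - 1, i) * blk X p $$ (i, j)) * M p $$ (j, l - 1)" by simp
    qed
    also have "\<dots> = (R p * blk X p * M p) $$ (k - 1, l - 1)"
      using p w[OF p(1)] blk_carrier[of X p] by (simp add: scalar_prod_def atLeast0LessThan)
    also have "R p * blk X p * M p = T p"
    proof -
      note ww = w(4-6)[OF p(1)]
      have "R p * blk X p * M p = (R p * M p) * T p * (R p * M p)"
        unfolding w(3)[OF p(1)] using ww
        by (simp add: assoc_mult_mat[of _ "count P p" "count P p" _ "count P p" _ "count P p"])
      thus ?thesis using w(2)[OF p(1)] ww by simp
    qed
    also have "T p $$ (k - 1, l - 1) = 0"
      using wit(2)[OF p(1)] w(4)[OF p(1)] p lk by (auto simp: strictly_upper_def)
    finally show "ent A (1, p, k) (1, p, l) = 0" .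
  qed
  moreover have "G * A * H = X"
  proof -
    have "G * A * H = (G * H) * X * (G * H)"
      unfolding A_def using c Xm by (simp add: assoc_mult_mat[of _ n n _ n _ n])
    thus ?thesis using GH Xm by simp
  qed
  ultimately show ?thesis using that GHc GH Ac by blast
qed

lemma nilcomm_similar_strict:
  assumes "X \<in> nilcomm"
  obtains A where "A \<in> strict" "similar_mat X A"
proof -
  obtain G H A where g: "G \<in> comm" "H \<in> comm" "G * H = 1\<^sub>m n" "H * G = 1\<^sub>m n" "A \<in> comm" "A \<in> strict" "X = G * A * H"
    by (rule nilcomm_conj_strict[OF assms])
  have "similar_mat X A"
    using g assms comm_carrier by (intro similar_matI[of _ _ G H n]) (auto simp: nilcomm_def)
  thus ?thesis using that g by blast
qed

lemma comm_strict_nilcomm: "A \<in> comm \<Longrightarrow> A \<in> strict \<Longrightarrow> A \<in> nilcomm"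
  using strict_nilpotent by (auto simp: nilcomm_def)

text \<open>
  Join two elements \<open>G * A * H\<close> and \<open>G' * A' * H'\<close> by conjugating a line between \<open>A\<close> and \<open>A'\<close> by a line
  between \<open>G\<close> and \<open>G'\<close>.  The adjugate in place of the inverse makes this curve polynomial up to the
  denominator \<open>det\<close>, and elements of the curve are again nilpotent.
\<close>

lemma nilcomm_irreducible:
  assumes "infinite (UNIV :: 'a set)"
  shows "poly_irreducible n nilcomm"
proof (rule poly_irreducible_by_curves[OF assms])
  have "0\<^sub>m n n \<in> comm" using B by (simp add: comm_def)
  moreover have "0\<^sub>m n n \<in> strict" by (auto simp: strict_def ent_zero)
  ultimately show "nilcomm \<noteq> {}" using comm_strict_nilcomm by blast
  show "nilcomm \<subseteq> carrier_mat n n" using comm_carrier by (auto simp: nilcomm_def)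
  fix X X' assume X: "X \<in> nilcomm" "X' \<in> nilcomm"
  obtain G H A where g: "G \<in> comm" "H \<in> comm" "G * H = 1\<^sub>m n" "H * G = 1\<^sub>m n" "A \<in> comm" "A \<in> strict" "X = G * A * H"
    by (rule nilcomm_conj_strict[OF X(1)])
  obtain G' H' A' where g': "G' \<in> comm" "H' \<in> comm" "G' * H' = 1\<^sub>m n" "H' * G' = 1\<^sub>m n" "A' \<in> comm" "A' \<in> strict" "X' = G' * A' * H'"
    by (rule nilcomm_conj_strict[OF X(2)])
  note c = comm_carrier[OF g(1)] comm_carrier[OF g(2)] comm_carrier[OF g(5)]
    comm_carrier[OF g'(1)] comm_carrier[OF g'(2)] comm_carrier[OF g'(5)]
  define Mp where "Mp = line_mat n G G'"
  define Zp where "Zp = line_mat n A A'"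
  define Rp where "Rp = adj_mat Mp"
  define d where "d = det Mp"
  define W where "W = Mp * Zp * Rp"
  have pc: "Mp \<in> carrier_mat n n" "Zp \<in> carrier_mat n n" by (auto simp: Mp_def Zp_def)
  have Rc: "Rp \<in> carrier_mat n n" unfolding Rp_def by (rule adj_mat(1)[OF pc(1)])
  have MR: "Mp * Rp = d \<cdot>\<^sub>m 1\<^sub>m n" "Rp * Mp = d \<cdot>\<^sub>m 1\<^sub>m n"
    unfolding Rp_def d_def using adj_mat(2,3)[OF pc(1)] by auto
  have Wc: "W \<in> carrier_mat n n" unfolding W_def using pc Rc by (intro mult_carrier_mat)
  let ?M = "\<lambda>t. eval_mat t Mp" and ?Z = "\<lambda>t. eval_mat t Zp"
    and ?R = "\<lambda>t. (1 / poly d t) \<cdot>\<^sub>m eval_mat t Rp"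
  have ev: "eval_mat t (U * V) = eval_mat t U * eval_mat t V"
    if "U \<in> carrier_mat n n" "V \<in> carrier_mat n n" for U V :: "'a poly mat" and t
    using comm_ring_hom.axioms(1)[OF poly_comm_ring_hom] that
    by (intro semiring_hom.mat_hom_mult[OF ring_hom.axioms(1)[OF comm_ring_hom.axioms(1)[OF poly_comm_ring_hom]]])
  have Yt: "(1 / poly d t) \<cdot>\<^sub>m eval_mat t W = ?M t * ?Z t * ?R t" for t
    unfolding W_def ev[OF mult_carrier_mat[OF pc] Rc] ev[OF pc] using pc Rc
    by (simp add: mult_smult_distrib[of _ n n _ n])
  have MRt: "?M t * ?R t = 1\<^sub>m n" "?R t * ?M t = 1\<^sub>m n" if "poly d t \<noteq> 0" for t
  proof -
    have e: "eval_mat t (d \<cdot>\<^sub>m 1\<^sub>m n) = poly d t \<cdot>\<^sub>m 1\<^sub>m n" by (intro eq_matI) auto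
    have m: "eval_mat t Mp \<in> carrier_mat n n" "eval_mat t Rp \<in> carrier_mat n n" using pc Rc by auto
    have "?M t * ?R t = (1 / poly d t) \<cdot>\<^sub>m (eval_mat t (Mp * Rp))"
      unfolding ev[OF pc(1) Rc] by (rule mult_smult_distrib[OF m])
    thus "?M t * ?R t = 1\<^sub>m n" unfolding MR e using that by (intro eq_matI) auto
    have "?R t * ?M t = (1 / poly d t) \<cdot>\<^sub>m (eval_mat t (Rp * Mp))"
      unfolding ev[OF Rc pc(1)] by (rule mult_smult_assoc_mat[OF m(2,1)])
    thus "?R t * ?M t = 1\<^sub>m n" unfolding MR e using that by (intro eq_matI) auto
  qed
  have Rtc: "?R t \<in> carrier_mat n n" for t using Rc by auto
  have d_eval: "poly d t = det (eval_mat t Mp)" for t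
    unfolding d_def using comm_ring_hom.hom_det[OF poly_comm_ring_hom, of t Mp] by simp
  have ends: "eval_mat 0 Mp = G" "eval_mat 1 Mp = G'" "eval_mat 0 Zp = A" "eval_mat 1 Zp = A'"
    unfolding Mp_def Zp_def using eval_line_mat_ends c by auto
  have det_ne: "det U \<noteq> 0" if "U \<in> carrier_mat n n" "V \<in> carrier_mat n n" "U * V = 1\<^sub>m n" for U V :: "'a mat"
    using det_mult[OF that(1,2)] that(3) by auto
  have d0: "poly d 0 \<noteq> 0" unfolding d_eval ends by (rule det_ne[OF c(1,2) g(3)])
  have d1: "poly d 1 \<noteq> 0" unfolding d_eval ends by (rule det_ne[OF c(4,5) g'(3)])
  have uniq: "V = V'" if "U \<in> carrier_mat n n" "V \<in> carrier_mat n n" "V' \<in> carrier_mat n n" "V * U = 1\<^sub>m n" "U * V' = 1\<^sub>m n" for U V V' :: "'a mat"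
  proof -
    have "V = V * (U * V')" using that by simp
    also have "\<dots> = (V * U) * V'" by (rule assoc_mult_mat[symmetric, OF that(2,1,3)])
    finally show ?thesis using that by simp
  qed
  have R0: "?R 0 = H" by (rule uniq[OF c(1) Rtc c(2)]) (use MRt(2)[OF d0] g ends in auto)
  have R1: "?R 1 = H'" by (rule uniq[OF c(4) Rtc c(5)]) (use MRt(2)[OF d1] g' ends in auto)
  have "?M t * ?Z t * ?R t \<in> nilcomm" if t: "poly d t \<noteq> 0" for t
  proof -
    have M: "?M t \<in> comm" unfolding Mp_def eval_line_mat[OF c(1,4)] by (intro comm_add comm_smult g g')
    have Z: "?Z t \<in> comm" "?Z t \<in> strict" unfolding Zp_def eval_line_mat[OF c(3,6)]
      by (intro comm_add comm_smult strict_line g g')+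
    have R: "?R t \<in> comm" by (rule comm_inverse[OF M Rtc MRt[OF t]])
    have Yc: "?M t * ?Z t * ?R t \<in> comm" by (intro comm_mult M Z R)
    have "similar_mat_wit (?M t * ?Z t * ?R t) (?Z t) (?M t) (?R t)"
      by (rule similar_mat_witI[OF MRt[OF t] refl comm_carrier[OF Yc] comm_carrier[OF Z(1)] comm_carrier[OF M] Rtc])
    from similar_mat_wit_pow_id[OF this, of n]
    have "(?M t * ?Z t * ?R t) ^\<^sub>m n = ?M t * 0\<^sub>m n n * ?R t" unfolding strict_nilpotent[OF Z(2)] .
    also have "\<dots> = 0\<^sub>m n n" 
      unfolding right_mult_zero_mat[OF comm_carrier[OF M]] by (rule left_mult_zero_mat[OF Rtc])
    finally show ?thesis using Yc by (simp add: nilcomm_def)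
  qed
  thus "\<exists>W D. W \<in> carrier_mat n n \<and> poly D 0 \<noteq> 0 \<and> poly D 1 \<noteq> 0 \<and>
      (1 / poly D 0) \<cdot>\<^sub>m eval_mat 0 W = X \<and> (1 / poly D 1) \<cdot>\<^sub>m eval_mat 1 W = X' \<and>
      (\<forall>t. poly D t \<noteq> 0 \<longrightarrow> (1 / poly D t) \<cdot>\<^sub>m eval_mat t W \<in> nilcomm)"
    by (intro exI[of _ W] exI[of _ d] conjI allI impI Wc d0 d1)
       (simp_all only: Yt R0 R1 ends g(7) g'(7))
qed

end

section \<open>Paths sweeping out a U-chain\<close>

lemma next_part_functional: "next_part P p q \<Longrightarrow> next_part P p q' \<Longrightarrow> q = q'"
  unfolding next_part_def by (metis linorder_neqE_nat)

lemma next_part_injective: "next_part P p q \<Longrightarrow> next_part P p' q \<Longrightarrow> p = p'"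
  unfolding next_part_def by (metis linorder_neqE_nat)

lemma next_part_less: "next_part P p q \<Longrightarrow> p < q" by (simp add: next_part_def)

lemma next_part_mem: "next_part P p q \<Longrightarrow> p \<in># P" "next_part P p q \<Longrightarrow> q \<in># P" by (simp_all add: next_part_def)

lemma next_part_le: "next_part P p q \<Longrightarrow> r \<in># P \<Longrightarrow> r < q \<Longrightarrow> r \<le> p"
  unfolding next_part_def by (metis not_le)

lemma next_part_exists_above:
  assumes "p \<in># P" "q \<in># P" "p < q"
  shows "\<exists>p'. next_part P p p'"
proof -
  let ?S = "{r \<in> set_mset P. p < r}"
  have f: "finite ?S" "?S \<noteq> {}" using assms by auto
  have "Min ?S \<in> ?S" by (rule Min_in[OF f])
  moreover have "Min ?S \<le> r" if "r \<in> ?S" for r by (rule Min_le[OF f(1) that])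
  ultimately have "next_part P p (Min ?S)" using assms(1) unfolding next_part_def by fastforce
  thus ?thesis ..
qed

lemma next_part_exists_below:
  assumes "p \<in># P" "q \<in># P" "q < p"
  shows "\<exists>p'. next_part P p' p"
proof -
  let ?S = "{r \<in> set_mset P. r < p}"
  have f: "finite ?S" "?S \<noteq> {}" using assms by auto
  have "Max ?S \<in> ?S" by (rule Max_in[OF f])
  moreover have "r \<le> Max ?S" if "r \<in> ?S" for r by (rule Max_ge[OF f(1) that])
  ultimately have "next_part P (Max ?S) p" using assms(1) unfolding next_part_def by fastforce
  thus ?thesis ..
qed

text \<open>
  A U-chain whose pairs each meet \<open>P\<close>.  Level \<open>t\<close> is swept out by one path that enters at the largest part in
  row \<open>t\<close>, descends to the pair, zigzags through its rows, and climbs back to the largest part.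
\<close>

locale level_pairs =
  fixes P :: "nat multiset" and m :: nat and b :: "nat \<Rightarrow> nat"
  assumes sp: "spaced m b"
    and meets: "\<And>t. 1 \<le> t \<Longrightarrow> t \<le> m \<Longrightarrow> b t \<in># P \<or> b t + 1 \<in># P"
    and low: "\<And>t. 1 \<le> t \<Longrightarrow> t \<le> m \<Longrightarrow> 2 * t \<le> b t + 1"
    and parts_pos: "0 \<notin># P"
begin

definition lo :: "nat \<Rightarrow> nat" where "lo t = (if b t \<in># P then b t else b t + 1)"
definition hi :: "nat \<Rightarrow> nat" where "hi t = (if b t + 1 \<in># P then b t + 1 else b t)"
definition top :: nat where "top = Max (set_mset P)"
definition nxt :: "nat \<Rightarrow> nat" where "nxt p = (SOME q. next_part P p q)"
definition prv :: "nat \<Rightarrow> nat" where "prv p = (SOME q. next_part P q p)"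

lemma nxt_eq: "next_part P p q \<Longrightarrow> nxt p = q"
  unfolding nxt_def by (rule some_equality) (auto dest: next_part_functional)

lemma prv_eq: "next_part P q p \<Longrightarrow> prv p = q"
  unfolding prv_def by (rule some_equality) (auto dest: next_part_injective)

lemma le_top: "p \<in># P \<Longrightarrow> p \<le> top" by (simp add: top_def)

lemma top_in: "p \<in># P \<Longrightarrow> top \<in># P"
  unfolding top_def by (metis Max_in empty_iff finite_set_mset)

lemma next_nxt: "p \<in># P \<Longrightarrow> p \<noteq> top \<Longrightarrow> next_part P p (nxt p)"
  using next_part_exists_above[of p P top] le_top[of p] top_in[of p] nxt_eq by (metis le_neq_implies_less)

lemma lohi:
  assumes "1 \<le> t" "t \<le> m"
  shows "lo t \<in># P" "hi t \<in># P" "b t \<le> lo t" "lo t \<le> hi t" "hi t \<le> b t + 1"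
    "lo t < hi t \<Longrightarrow> lo t = b t \<and> hi t = b t + 1"
    "p \<in># P \<Longrightarrow> p = b t \<or> p = b t + 1 \<Longrightarrow> p = lo t \<or> p = hi t"
    "p \<in># P \<Longrightarrow> hi t < p \<Longrightarrow> b t + 1 < p"
    "p \<in># P \<Longrightarrow> p < lo t \<Longrightarrow> p < b t"
    "2 * t \<le> lo t + 1"
proof -
  show "lo t \<in># P" "hi t \<in># P" "b t \<le> lo t" "lo t \<le> hi t" "hi t \<le> b t + 1"
    "lo t < hi t \<Longrightarrow> lo t = b t \<and> hi t = b t + 1"
    using meets[OF assms] by (auto simp: lo_def hi_def split: if_splits)
  show "p \<in># P \<Longrightarrow> p = b t \<or> p = b t + 1 \<Longrightarrow> p = lo t \<or> p = hi t" by (auto simp: lo_def hi_def)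
  show "b t + 1 < p" if "p \<in># P" "hi t < p"
    using that by (cases "p = b t + 1") (auto simp: hi_def split: if_splits)
  show "p < b t" if "p \<in># P" "p < lo t"
    using that by (cases "p = b t") (auto simp: lo_def split: if_splits)
  show "2 * t \<le> lo t + 1" using low[OF assms] by (auto simp: lo_def)
qed

lemma next_lo_hi: "1 \<le> t \<Longrightarrow> t \<le> m \<Longrightarrow> lo t < hi t \<Longrightarrow> next_part P (lo t) (hi t)"
  using lohi(1,2,6)[of t] by (auto simp: next_part_def)

lemma pair_unique:
  assumes "1 \<le> t" "t \<le> m" "p = b t \<or> p = b t + 1" "1 \<le> t'" "t' \<le> m" "p = b t' \<or> p = b t' + 1"
  shows "t = t'"
  using assms spaced_less[OF sp, of t t'] spaced_less[OF sp, of t' t]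
  by (cases t t' rule: linorder_cases) auto

abbreviation "E \<equiv> poset_elems P"

text \<open>
  The vertices \<open>(0, 0, t)\<close> stand for the rows and columns of the border.
\<close>

definition V :: "(nat \<times> nat \<times> nat) set" where
  "V = E \<union> (\<lambda>t. (0, 0, t)) ` {1..m}"

lemma finite_V: "finite V" by (simp add: V_def)

lemma elemD:
  assumes "(u, p, k) \<in> E"
  shows "1 \<le> u" "u \<le> p" "1 \<le> k" "k \<le> count P p" "p \<in># P" "0 < p"
  using assms poset_elems_part[OF assms] by (auto simp: poset_elems_iff)

lemma last_copy: "p \<in># P \<Longrightarrow> 1 \<le> count P p" by (simp add: Suc_le_eq)

text \<open>
  The degenerate pair consisting of a single part \<open>2 * t - 1\<close>, of which only the middle row remains at level
  \<open>t\<close>.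
\<close>

definition isC :: "nat \<Rightarrow> bool" where "isC t \<longleftrightarrow> lo t = hi t \<and> hi t + 1 = 2 * t"

text \<open>
  A pair with only one part is traversed by steps \<open>u \<mapsto> u + 1\<close> within that part.
\<close>

definition loop :: "nat \<Rightarrow> bool" where
  "loop p \<longleftrightarrow> (\<exists>t. 1 \<le> t \<and> t \<le> m \<and> lo t = hi t \<and> p = hi t \<and> \<not> isC t)"

text \<open>
  Nonzero entries of the matrix to be constructed.  They are invariant under shifts of both rows, so that
  the matrix commutes with \<open>B\<close>.
\<close>

fun edge :: "nat \<times> nat \<times> nat \<Rightarrow> nat \<times> nat \<times> nat \<Rightarrow> bool" where
  "edge (u, p, k) (v, q, l) \<longleftrightarrow> q = p \<and> v = u \<and> l = k + 1 \<or>
     k = count P p \<and> l = 1 \<and> (next_part P q p \<and> v = u \<or> next_part P p q \<and> v = u + (q - p) \<or>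
       q = p \<and> v = u + 1 \<and> loop p)"

text \<open>
  The edges along which level \<open>t\<close> moves upwards inside its pair, or enters it in the degenerate case.  Giving
  them a variable weight makes the number of their uses visible in the determinant.
\<close>

fun special :: "nat \<Rightarrow> nat \<times> nat \<times> nat \<Rightarrow> nat \<times> nat \<times> nat \<Rightarrow> bool" where
  "special t (u, p, k) (v, q, l) \<longleftrightarrow> k = count P p \<and> l = 1 \<and> q = hi t \<and>
     (if isC t then next_part P q p \<and> v = u else p = lo t \<and> v = u + 1)"

lemma edge_less: "edge x y \<Longrightarrow> elem_less x y"
  by (cases x; cases y) (auto simp: next_part_def)

definition arc :: "nat \<times> nat \<times> nat \<Rightarrow> nat \<times> nat \<times> nat \<Rightarrow> bool" where
  "arc x y \<longleftrightarrow> x \<in> E \<and> y \<in> E \<and> edge x y \<or>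
     (\<exists>t\<in>{1..m}. x = (0, 0, t) \<and> y = (t, top, 1) \<and> y \<in> E) \<or>
     (\<exists>t\<in>{1..m}. x = (top + 1 - t, top, count P top) \<and> x \<in> E \<and> y = (0, 0, t))"

text \<open>
  Rows passed on the way down, on the way up, and inside a pair.
\<close>

definition headrow :: "nat \<Rightarrow> nat \<Rightarrow> bool" where
  "headrow u p \<longleftrightarrow> u \<le> m \<and> b u + 1 < p"

definition tailrow :: "nat \<Rightarrow> nat \<Rightarrow> bool" where
  "tailrow u p \<longleftrightarrow> p + 1 - u \<le> m \<and> b (p + 1 - u) + 1 < p"

definition midrow :: "nat \<Rightarrow> nat \<Rightarrow> nat \<Rightarrow> bool" where
  "midrow t u p \<longleftrightarrow> 1 \<le> t \<and> t \<le> m \<and> (p = lo t \<or> p = hi t) \<and> t \<le> u \<and> u + t \<le> p + 1"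

text \<open>
  Rows from which the path continues upwards to the next larger part.
\<close>

definition endrow :: "nat \<Rightarrow> nat \<Rightarrow> bool" where
  "endrow u p \<longleftrightarrow> tailrow u p \<or> (\<exists>t. midrow t u p \<and> p = hi t \<and> u + t = p + 1)"

definition covrow :: "nat \<Rightarrow> nat \<Rightarrow> bool" where
  "covrow u p \<longleftrightarrow> headrow u p \<or> tailrow u p \<or> (\<exists>t. midrow t u p)"

fun step :: "nat \<times> nat \<times> nat \<Rightarrow> nat \<times> nat \<times> nat" where
  "step (u, p, k) = (if p = 0 then (k, top, 1)
     else if \<not> covrow u p then (u, p, k)
     else if k < count P p then (u, p, k + 1)
     else if headrow u p then (u, prv p, 1)
     else if endrow u p then (if p = top then (0, 0, p + 1 - u) else (u + (nxt p - p), nxt p, 1))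
     else if (\<exists>t. midrow t u p \<and> p = hi t \<and> lo t < hi t) then (u, p - 1, 1)
     else (u + 1, hi (SOME t. midrow t u p), 1))"

lemma midrow_unique: "midrow t u p \<Longrightarrow> midrow t' u' p \<Longrightarrow> t = t'"
proof -
  assume a: "midrow t u p" "midrow t' u' p"
  have "p = b s \<or> p = b s + 1" if "midrow s v p" for s v
    using that by (auto simp: midrow_def lo_def hi_def split: if_splits)
  thus "t = t'" using pair_unique[of t p t'] a by (auto simp: midrow_def)
qed

lemma some_midrow: "midrow t u p \<Longrightarrow> (SOME t. midrow t u p) = t"
  by (rule some_equality) (auto dest: midrow_unique)

lemma head_low:
  assumes "headrow u p" "1 \<le> u"
  shows "2 * u + 1 \<le> p"
  using assms low[of u] by (auto simp: headrow_def)

lemma tail_low: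
  assumes "tailrow u p" "u \<le> p"
  shows "2 * (p + 1 - u) + 1 \<le> p"
proof -
  have "1 \<le> p + 1 - u" using assms(2) by simp
  thus ?thesis using assms low[of "p + 1 - u"] by (simp add: tailrow_def)
qed

lemma not_head_tail: "1 \<le> u \<Longrightarrow> u \<le> p \<Longrightarrow> headrow u p \<Longrightarrow> \<not> tailrow u p"
  using head_low[of u p] tail_low[of u p] by auto

lemma not_head_mid: "1 \<le> u \<Longrightarrow> headrow u p \<Longrightarrow> \<not> midrow t u p"
proof
  assume u: "1 \<le> u" "headrow u p" "midrow t u p"
  hence t: "1 \<le> t" "t \<le> u" "u \<le> m" by (auto simp: midrow_def headrow_def)
  have "b t \<le> b u" by (rule spaced_mono[OF sp t(1,2,3)])
  moreover have "p \<le> b t + 1" using u(3) lohi(4,5)[of t] by (auto simp: midrow_def)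
  ultimately show False using u(2) by (auto simp: headrow_def)
qed

lemma not_tail_mid: "u \<le> p \<Longrightarrow> tailrow u p \<Longrightarrow> \<not> midrow t u p"
proof
  assume u: "u \<le> p" "tailrow u p" "midrow t u p"
  hence t: "1 \<le> t" "t \<le> p + 1 - u" "p + 1 - u \<le> m" by (auto simp: midrow_def tailrow_def)
  have "b t \<le> b (p + 1 - u)" by (rule spaced_mono[OF sp t(1,2,3)])
  moreover have "p \<le> b t + 1" using u(3) lohi(4,5)[of t] by (auto simp: midrow_def)
  ultimately show False using u(2) by (auto simp: tailrow_def)
qed

lemma step_border: "step (0, 0, t) = (t, top, 1)" by simp

lemma step_fixed: "0 < p \<Longrightarrow> \<not> covrow u p \<Longrightarrow> step (u, p, k) = (u, p, k)" by simp

lemma step_copy: "0 < p \<Longrightarrow> covrow u p \<Longrightarrow> k < count P p \<Longrightarrow> step (u, p, k) = (u, p, k + 1)" by simp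

lemma step_head: "0 < p \<Longrightarrow> headrow u p \<Longrightarrow> step (u, p, count P p) = (u, prv p, 1)"
  by (simp add: covrow_def)

lemma step_end:
  assumes "0 < p" "1 \<le> u" "u \<le> p" "endrow u p"
  shows "step (u, p, count P p) = (if p = top then (0, 0, p + 1 - u) else (u + (nxt p - p), nxt p, 1))"
proof -
  have "\<not> headrow u p" using assms not_head_tail[of u p] not_head_mid[of u p] by (auto simp: endrow_def)
  moreover have "covrow u p" using assms(4) by (auto simp: endrow_def covrow_def)
  ultimately show ?thesis using assms by simp
qed

lemma mid_not_end: "1 \<le> u \<Longrightarrow> u \<le> p \<Longrightarrow> midrow t u p \<Longrightarrow> \<not> (p = hi t \<and> u + t = p + 1) \<Longrightarrow> \<not> endrow u p"
  using midrow_unique not_tail_mid unfolding endrow_def by metis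

lemma step_mid_down:
  assumes "1 \<le> u" "u \<le> p" "midrow t u p" "p = hi t" "lo t < hi t" "u + t \<noteq> p + 1"
  shows "step (u, p, count P p) = (u, lo t, 1)"
proof -
  have "\<not> headrow u p" using assms not_head_mid by blast
  moreover have "\<not> endrow u p" using mid_not_end assms by blast
  moreover have "covrow u p" using assms(3) by (auto simp: covrow_def)
  moreover have "\<exists>t. midrow t u p \<and> p = hi t \<and> lo t < hi t" using assms by blast
  moreover have "p - 1 = lo t" using lohi(6)[of t] assms by (auto simp: midrow_def)
  ultimately show ?thesis using assms(1,2) by simp
qed

lemma step_mid_up:
  assumes "1 \<le> u" "u \<le> p" "midrow t u p" "p = lo t" "u + t \<le> hi t"
  shows "step (u, p, count P p) = (u + 1, hi t, 1)"
proof -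
  have "\<not> headrow u p" using assms not_head_mid by blast
  moreover have "\<not> endrow u p" by (rule mid_not_end[OF assms(1-3)]) (use assms(4,5) in auto)
  moreover have "covrow u p" using assms(3) by (auto simp: covrow_def)
  moreover have "\<not> (\<exists>t. midrow t u p \<and> p = hi t \<and> lo t < hi t)"
    using midrow_unique[OF assms(3)] assms(4) by fastforce
  moreover have "(SOME t. midrow t u p) = t" by (rule some_midrow[OF assms(3)])
  ultimately show ?thesis using assms(1,2) by simp
qed

lemma head_above:
  assumes "headrow u p" "p < q"
  shows "headrow u q"
  using assms by (auto simp: headrow_def)

lemma in_D: "p \<in># P \<Longrightarrow> 1 \<le> u \<Longrightarrow> u \<le> p \<Longrightarrow> 1 \<le> k \<Longrightarrow> k \<le> count P p \<Longrightarrow> (u, p, k) \<in> E"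
  by (simp add: poset_elems_iff)

text \<open>
  Running the paths backwards.  Bijectivity follows since the vertex set is finite.
\<close>

lemma step_surj:
  assumes "y \<in> V"
  shows "\<exists>x\<in>V. step x = y"
proof -
  have lastD: "(u, p, count P p) \<in> V" if "p \<in># P" "1 \<le> u" "u \<le> p" for u p
    using in_D[of p u "count P p"] last_copy[OF that(1)] that by (simp add: V_def)
  obtain v q l where e: "y = (v, q, l)" by (metis prod_cases3)
  show ?thesis
  proof (cases "y \<in> E")
    case False
    then obtain t where t: "y = (0, 0, t)" "1 \<le> t" "t \<le> m" using assms by (auto simp: V_def)
    have tp: "top \<in># P" using lohi(1)[OF t(2,3)] by (rule top_in)
    have ht: "hi t \<le> top" using lohi(2)[OF t(2,3)] by (rule le_top)
    have l2: "2 * t \<le> hi t + 1" using lohi(4,10)[OF t(2,3)] by linarith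
    have end1: "endrow (top + 1 - t) top"
    proof (cases "hi t = top")
      case True
      have "midrow t (top + 1 - t) top" unfolding midrow_def using t l2 True by auto
      moreover have "top + 1 - t + t = top + 1" using l2 True t by auto
      ultimately show ?thesis using True unfolding endrow_def by metis
    next
      case False
      hence "b t + 1 < top" using ht tp lohi(8)[OF t(2,3), of top] by simp
      moreover have "top + 1 - (top + 1 - t) = t" using l2 ht by simp
      ultimately show ?thesis using t by (simp add: endrow_def tailrow_def)
    qed
    have "0 < top" using tp parts_pos by (metis gr0I)
    hence "step (top + 1 - t, top, count P top) = (0, 0, t)"
      using step_end[OF _ _ _ end1] l2 ht t by auto
    moreover have "(top + 1 - t, top, count P top) \<in> V" using l2 ht t by (intro lastD tp) auto
    ultimately show ?thesis using t by metis
  next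
    case True
    note el = elemD[OF True[unfolded e]]
    show ?thesis
    proof (cases "covrow v q")
      case False
      thus ?thesis using step_fixed[OF el(6) False, of l] assms e by metis
    next
      case cov: True
      show ?thesis
      proof (cases "l = 1")
        case False
        have "(v, q, l - 1) \<in> V" using el False by (auto simp: V_def poset_elems_iff)
        moreover have "step (v, q, l - 1) = y"
          using step_copy[OF el(6) cov, of "l - 1"] el False by (auto simp: e)
        ultimately show ?thesis by blast
      next
        case l1: True
        consider "headrow v q" | "tailrow v q" | t where "midrow t v q" using cov by (auto simp: covrow_def)
        thus ?thesis
        proof cases
          case 1
          show ?thesis
          proof (cases "q = top")
            case True
            have "(0, 0, v) \<in> V" using 1 el by (auto simp: V_def headrow_def)
            moreover have "step (0, 0, v) = y" using True by (simp add: e l1)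
            ultimately show ?thesis by blast
          next
            case False
            have n: "next_part P q (nxt q)" using next_nxt[OF el(5) False] .
            have "step (v, nxt q, count P (nxt q)) = (v, prv (nxt q), 1)"
              using next_part_less[OF n] by (intro step_head head_above[OF 1]) auto
            hence "step (v, nxt q, count P (nxt q)) = y" using prv_eq[OF n] by (simp add: e l1)
            moreover have "(v, nxt q, count P (nxt q)) \<in> V"
              using next_part_mem[OF n] next_part_less[OF n] el by (intro lastD) auto
            ultimately show ?thesis by blast
          qed
        next
          case 2
          define i where "i = q + 1 - v"
          have i: "1 \<le> i" "i \<le> m" "b i + 1 < q" using 2 el by (auto simp: i_def tailrow_def)
          have hq: "hi i < q" using lohi(5)[OF i(1,2)] i(3) by simp
          obtain p where n: "next_part P p q"
            using next_part_exists_below[OF el(5) lohi(2)[OF i(1,2)] hq] by blast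
          have hp: "hi i \<le> p" by (rule next_part_le[OF n lohi(2)[OF i(1,2)] hq])
          have l2: "2 * i \<le> hi i + 1" using lohi(4,10)[OF i(1,2)] by linarith
          have vq: "v = q + 1 - i" using el by (simp add: i_def)
          have end1: "endrow (p + 1 - i) p"
          proof (cases "hi i = p")
            case True
            have "midrow i (p + 1 - i) p" unfolding midrow_def using i l2 True by auto
            moreover have "p + 1 - i + i = p + 1" using l2 True i by auto
            ultimately show ?thesis using True unfolding endrow_def by metis
          next
            case False
            hence "b i + 1 < p" using hp next_part_mem[OF n] lohi(8)[OF i(1,2), of p] by simp
            moreover have "p + 1 - (p + 1 - i) = i" using l2 hp by simp
            ultimately show ?thesis using i by (simp add: endrow_def tailrow_def)
          qed
          have pt: "p \<noteq> top" using next_part_less[OF n] le_top[OF el(5)] by simp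
          have "step (p + 1 - i, p, count P p) = (p + 1 - i + (nxt p - p), nxt p, 1)"
            using step_end[OF _ _ _ end1] l2 hp i pt by auto
          also have "\<dots> = y"
          proof -
            have "p < q" by (rule next_part_less[OF n])
            hence "p + 1 - i + (q - p) = v" using vq l2 hp i(1) by linarith
            thus ?thesis using nxt_eq[OF n] by (simp add: e l1)
          qed
          finally have s: "step (p + 1 - i, p, count P p) = y" .
          have "(p + 1 - i, p, count P p) \<in> V"
            by (rule lastD[OF next_part_mem(1)[OF n]]) (use l2 hp i(1) in linarith)+
          thus ?thesis using s by blast
        next
          case (3 t)
          have t: "1 \<le> t" "t \<le> m" "t \<le> v" "v + t \<le> q + 1" "q = lo t \<or> q = hi t"
            using 3 by (auto simp: midrow_def)
          show ?thesis
          proof (cases "q = hi t")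
            case qhi: True
            show ?thesis
            proof (cases "v = t")
              case vt: True
              show ?thesis
              proof (cases "q = top")
                case True
                have "(0, 0, t) \<in> V" using t by (auto simp: V_def)
                moreover have "step (0, 0, t) = y" using True vt by (simp add: e l1)
                ultimately show ?thesis by blast
              next
                case False
                have n: "next_part P q (nxt q)" using next_nxt[OF el(5) False] .
                have "b t + 1 < nxt q" using lohi(8)[OF t(1,2), of "nxt q"] next_part_mem[OF n] next_part_less[OF n] qhi by simp
                hence "headrow t (nxt q)" using t by (simp add: headrow_def)
                hence "step (v, nxt q, count P (nxt q)) = (v, prv (nxt q), 1)"
                  using next_part_less[OF n] vt by (intro step_head) auto
                hence "step (v, nxt q, count P (nxt q)) = y" using prv_eq[OF n] by (simp add: e l1)
                moreover have "(v, nxt q, count P (nxt q)) \<in> V"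
                  using next_part_mem[OF n] next_part_less[OF n] el by (intro lastD) auto
                ultimately show ?thesis by blast
              qed
            next
              case False
              have hl: "hi t \<le> lo t + 1" using lohi(3,5)[OF t(1,2)] by simp
              have mr: "midrow t (v - 1) (lo t)" unfolding midrow_def using t False qhi hl by auto
              have "step (v - 1, lo t, count P (lo t)) = (v - 1 + 1, hi t, 1)"
                by (rule step_mid_up[OF _ _ mr refl]) (use t False qhi hl in auto)
              moreover have "(v - 1, lo t, count P (lo t)) \<in> V"
                using t False qhi hl lohi(1)[OF t(1,2)] by (intro lastD) auto
              ultimately show ?thesis using t False qhi by (intro bexI[of _ "(v - 1, lo t, count P (lo t))"]) (auto simp: e l1)
            qed
          next
            case False
            hence ql: "q = lo t" "lo t < hi t" using t lohi(4)[OF t(1,2)] by auto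
            have h: "hi t = lo t + 1" using lohi(6)[OF t(1,2) ql(2)] by simp
            have mr: "midrow t v (hi t)" unfolding midrow_def using t ql by auto
            have "step (v, hi t, count P (hi t)) = (v, lo t, 1)"
              by (rule step_mid_down[OF _ _ mr refl ql(2)]) (use t ql el h in auto)
            moreover have "(v, hi t, count P (hi t)) \<in> V"
              using el ql lohi(2)[OF t(1,2)] by (intro lastD) auto
            ultimately show ?thesis using ql by (intro bexI[of _ "(v, hi t, count P (hi t))"]) (auto simp: e l1)
          qed
        qed
      qed
    qed
  qed
qed

lemma step_bij: "bij_betw step V V"
proof -
  have sub: "V \<subseteq> step ` V" using step_surj by blast
  have "card (step ` V) \<le> card V" by (rule card_image_le[OF finite_V])
  hence eq: "step ` V = V" using card_subset_eq[of "step ` V" V] sub finite_V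
    by (metis card_mono card_subset_eq finite_imageI le_antisym)
  hence "inj_on step V" using finite_V by (metis eq_card_imp_inj_on)
  thus ?thesis using eq by (simp add: bij_betw_def)
qed

lemma step_arc:
  assumes "x \<in> V"
  shows "x \<in> E \<and> step x = x \<or> arc x (step x)"
proof -
  have sV: "step x \<in> V" using step_bij assms by (rule bij_betw_apply)
  have DV: "z \<in> E" if "z \<in> V" "z = (u, p, k)" "0 < p" for z u p k using that by (auto simp: V_def)
  show ?thesis
  proof (cases "x \<in> E")
    case False
    then obtain t where t: "x = (0, 0, t)" "1 \<le> t" "t \<le> m" using assms by (auto simp: V_def)
    have "top \<in># P" using lohi(1)[OF t(2,3)] by (rule top_in)
    hence "0 < top" using parts_pos by (metis gr0I)
    hence "step x \<in> E" using DV[OF sV, of t top 1] t by simp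
    thus ?thesis using t by (auto simp: arc_def)
  next
    case xD: True
    obtain u p k where e: "x = (u, p, k)" by (metis prod_cases3)
    note el = elemD[OF xD[unfolded e]]
    have arcI: "arc x (step x)" if "step x = (v, q, l)" "0 < q" "edge x (v, q, l)" for v q l
      using that DV[OF sV, of v q l] xD by (auto simp: arc_def)
    show ?thesis
    proof (cases "covrow u p")
      case False
      thus ?thesis using step_fixed[OF el(6) False, of k] xD e by metis
    next
      case cov: True
      show ?thesis
      proof (cases "k < count P p")
        case True
        thus ?thesis using arcI[of u p "k + 1"] step_copy[OF el(6) cov True] el by (simp add: e)
      next
        case False
        hence k: "k = count P p" using el by simp
        consider "headrow u p" | "endrow u p"
          | t where "midrow t u p" "\<not> (p = hi t \<and> u + t = p + 1)"
          using cov unfolding covrow_def endrow_def by blast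
        thus ?thesis
        proof cases
          case 1
          have u: "1 \<le> u" "u \<le> m" using el 1 by (auto simp: headrow_def)
          have "hi u < p" using lohi(5)[OF u] 1 by (auto simp: headrow_def)
          then obtain q where n: "next_part P q p"
            using next_part_exists_below[OF el(5) lohi(2)[OF u]] by blast
          have "0 < q" using next_part_mem(1)[OF n] parts_pos by (metis gr0I)
          thus ?thesis using arcI[of u q 1] step_head[OF el(6) 1] prv_eq[OF n] n by (simp add: e k)
        next
          case 2
          note s = step_end[OF el(6,1,2) 2]
          show ?thesis
          proof (cases "p = top")
            case True
            hence "step x = (0, 0, top + 1 - u)" using s by (simp add: e k)
            moreover have "top + 1 - u \<in> {1..m}"
            proof -
              have "step x \<in> V" by (rule sV)
              thus ?thesis using calculation by (auto simp: V_def poset_elems_iff)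
            qed
            moreover have "x = (top + 1 - (top + 1 - u), top, count P top)" using el True by (simp add: e k)
            ultimately show ?thesis using xD by (auto simp: arc_def)
          next
            case False
            have n: "next_part P p (nxt p)" using next_nxt[OF el(5) False] .
            have "0 < nxt p" using next_part_less[OF n] by simp
            thus ?thesis using arcI[of "u + (nxt p - p)" "nxt p" 1] s False n by (simp add: e k)
          qed
        next
          case (3 t)
          have t: "1 \<le> t" "t \<le> m" "t \<le> u" "u + t \<le> p + 1" "p = lo t \<or> p = hi t"
            using 3 by (auto simp: midrow_def)
          have lpos: "0 < lo t" "0 < hi t" using lohi(1,2)[OF t(1,2)] parts_pos by (metis gr0I)+
          show ?thesis
          proof (cases "p = hi t \<and> lo t < hi t")
            case True
            have s: "step x = (u, lo t, 1)" unfolding e k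
              by (rule step_mid_down[OF el(1,2) 3(1)]) (use True 3(2) in auto)
            thus ?thesis using arcI[of u "lo t" 1] next_lo_hi[OF t(1,2)] True lpos by (simp add: e k)
          next
            case False
            hence pl: "p = lo t" using t lohi(4)[OF t(1,2)] by auto
            have ut: "u + t \<le> hi t" 
              using 3(2) t pl lohi(3,4,5,6)[OF t(1,2)] by (cases "lo t = hi t") auto
            have s: "step x = (u + 1, hi t, 1)" unfolding e k
              by (rule step_mid_up[OF el(1,2) 3(1) pl ut])
            show ?thesis
            proof (cases "lo t < hi t")
              case True
              have "hi t = lo t + 1" using lohi(6)[OF t(1,2) True] by simp
              thus ?thesis using arcI[OF s] next_lo_hi[OF t(1,2) True] lpos pl by (simp add: e k)
            next
              case f: False
              hence lh: "lo t = hi t" using lohi(4)[OF t(1,2)] by simp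
              have "\<not> isC t" using ut t lh by (auto simp: isC_def)
              hence "loop (hi t)" unfolding loop_def using t lh by blast
              thus ?thesis using arcI[OF s] lpos pl lh by (simp add: e k)
            qed
          qed
        qed
      qed
    qed
  qed
qed

end

section \<open>Rigidity of the paths\<close>

text \<open>
  A competitor of \<open>step\<close>: another permutation along the same arcs that uses each kind of special edge
  equally often.  It turns out to be \<open>step\<close> itself.
\<close>

locale rerouting = level_pairs +
  fixes \<pi> :: "nat \<times> nat \<times> nat \<Rightarrow> nat \<times> nat \<times> nat"
  assumes bij: "bij_betw \<pi> V V"
    and arcs: "\<And>x. x \<in> V \<Longrightarrow> x \<in> E \<and> \<pi> x = x \<or> arc x (\<pi> x)"
    and counts: "\<And>t. 1 \<le> t \<Longrightarrow> t \<le> m \<Longrightarrow>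
      card {x \<in> V. special t x (\<pi> x)} = card {x \<in> V. special t x (step x)}"
begin

text \<open>
  The vertices that levels below \<open>t\<close> decide: everything up to the pair \<open>t - 1\<close>, and the outermost
  \<open>t - 1\<close> rows at either end of the larger parts.
\<close>

fun settled :: "nat \<Rightarrow> nat \<times> nat \<times> nat \<Rightarrow> bool" where
  "settled t (u, p, k) \<longleftrightarrow> (if p = 0 then k < t else 2 \<le> t \<and> p \<le> b (t - 1) + 1 \<or> u < t \<or> p + 1 < u + t)"

declare step.simps[simp del] settled.simps[simp del]

definition live :: "nat \<Rightarrow> nat \<Rightarrow> bool" where
  "live u p \<longleftrightarrow> \<pi> (u, p, 1) \<noteq> (u, p, 1)"

lemma pi_V: "x \<in> V \<Longrightarrow> \<pi> x \<in> V" using bij by (rule bij_betw_apply)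

lemma pi_inj: "x \<in> V \<Longrightarrow> y \<in> V \<Longrightarrow> \<pi> x = \<pi> y \<Longrightarrow> x = y"
  using bij by (meson bij_betw_def inj_onD)

lemma pi_pre: "y \<in> V \<Longrightarrow> \<exists>x\<in>V. \<pi> x = y"
  using bij by (metis bij_betw_def image_iff)

text \<open>
  Arcs inside the poset increase the height, while a permutation preserves the sum of the
  heights.
\<close>

lemma pi_fixed_invariant:
  assumes W: "W \<subseteq> E" and inv: "\<pi> ` W \<subseteq> W" and x: "x \<in> W"
  shows "\<pi> x = x"
proof (rule ccontr)
  assume ne: "\<pi> x \<noteq> x"
  have fin: "finite W" by (rule finite_subset[OF W]) simp
  have WV: "W \<subseteq> V" using W by (auto simp: V_def)
  have nb: "0 < p" if "(u, p, k) \<in> W" for u p k using W that elemD(6) by blast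
  have less: "\<pi> y = y \<or> elem_less y (\<pi> y)" if y: "y \<in> W" for y
  proof -
    have yV: "y \<in> V" and nz: "\<And>i. y \<noteq> (0, 0, i)" using y WV nb[of 0 0] by auto
    have "\<pi> y \<in> W" using inv y by blast
    hence nz': "\<And>i. \<pi> y \<noteq> (0, 0, i)" using nb[of 0 0] by auto
    from arcs[OF yV] show ?thesis
    proof
      assume "arc y (\<pi> y)"
      hence "edge y (\<pi> y)" using nz nz' unfolding arc_def by blast
      thus ?thesis by (simp add: edge_less)
    qed simp
  qed
  have h: "elem_height P y \<le> elem_height P (\<pi> y)" if y: "y \<in> W" for y
    using less[OF y] elem_height_less[of y P "\<pi> y"] y inv W
    by (metis image_subset_iff less_imp_le_nat order_refl subsetD)
  have "elem_less x (\<pi> x)" using less[OF x] ne by simp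
  hence "elem_height P x < elem_height P (\<pi> x)"
    using elem_height_less[of x P "\<pi> x"] x inv W by blast
  hence "sum (elem_height P) W < sum (\<lambda>y. elem_height P (\<pi> y)) W"
    using h x fin by (meson sum_strict_mono_ex1)
  also have "\<dots> = sum (elem_height P) (\<pi> ` W)"
  proof -
    have "inj_on \<pi> W" using pi_inj WV by (meson inj_onI subsetD)
    thus ?thesis by (simp add: sum.reindex)
  qed
  also have "\<dots> \<le> sum (elem_height P) W" by (rule sum_mono2[OF fin inv]) simp
  finally show False by simp
qed

lemma settled_border: "settled t (0, 0, k) \<longleftrightarrow> k < t" by (simp add: settled.simps)

lemma settled_iff: "0 < p \<Longrightarrow> settled t (u, p, k) \<longleftrightarrow> 2 \<le> t \<and> p \<le> b (t - 1) + 1 \<or> u < t \<or> p + 1 < u + t"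
  by (simp add: settled.simps)

lemma spaced_lt: "1 \<le> s \<Longrightarrow> s \<le> m \<Longrightarrow> 2 \<le> t \<Longrightarrow> t \<le> m + 1 \<Longrightarrow> b s \<le> b (t - 1) + 1 \<Longrightarrow> s < t"
proof (rule ccontr)
  assume a: "1 \<le> s" "s \<le> m" "2 \<le> t" "t \<le> m + 1" "b s \<le> b (t - 1) + 1" "\<not> s < t"
  have "1 \<le> t - 1" "t - 1 < s" using a by linarith+
  hence "b (t - 1) + 1 < b s" using spaced_less[OF sp, of "t - 1" s] a(2) by blast
  thus False using a(5) by linarith
qed

lemma spaced_ge: "1 \<le> s \<Longrightarrow> s < t \<Longrightarrow> t \<le> m + 1 \<Longrightarrow> 2 \<le> t \<and> b s \<le> b (t - 1)"
  using spaced_mono[OF sp, of s "t - 1"] by simp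

lemma midrow_settled:
  assumes "midrow s u p" "t \<le> m + 1" "s < t" "0 < q" "q \<le> b s + 1"
  shows "settled t (v, q, l)"
proof -
  have "2 \<le> t \<and> b s \<le> b (t - 1)" using assms spaced_ge[of s t] by (simp add: midrow_def)
  thus ?thesis using assms(4,5) by (simp add: settled_iff)
qed

text \<open>
  A path below level \<open>t\<close> stays in the settled region, so unsettled vertices are permuted among
  themselves.
\<close>

lemma step_settled:
  assumes t: "1 \<le> t" "t \<le> m + 1" and x: "x \<in> V" and dn: "settled t x"
  shows "settled t (step x)"
proof -
  obtain u p k where e: "x = (u, p, k)" by (metis prod_cases3)
  show ?thesis
  proof (cases "x \<in> E")
    case False
    then obtain i where i: "x = (0, 0, i)" "1 \<le> i" "i \<le> m" using x by (auto simp: V_def)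
    have "top \<in># P" using lohi(1)[OF i(2,3)] by (rule top_in)
    hence "0 < top" using parts_pos by (metis gr0I)
    moreover have "i < t" using dn i(1) by (simp add: settled_border)
    ultimately show ?thesis by (simp add: i(1) step_border settled_iff)
  next
    case True
    note el = elemD[OF True[unfolded e]]
    have d: "2 \<le> t \<and> p \<le> b (t - 1) + 1 \<or> u < t \<or> p + 1 < u + t" using dn settled_iff[OF el(6)] by (simp add: e)
    show ?thesis
    proof (cases "covrow u p \<and> k = count P p")
      case False
      hence "\<not> covrow u p \<or> k < count P p" using el by auto
      hence "\<exists>l. step x = (u, p, l)" using step_fixed[OF el(6), of u k] step_copy[OF el(6), of u k] by (metis e)
      thus ?thesis using d by (auto simp: settled_iff[OF el(6)])
    next
      case c: True
      consider "headrow u p" | "endrow u p"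
        | s where "midrow s u p" "\<not> (p = hi s \<and> u + s = p + 1)"
        using c unfolding covrow_def endrow_def by blast
      thus ?thesis
      proof cases
        case 1
        have u: "1 \<le> u" "u \<le> m" using el 1 by (auto simp: headrow_def)
        have "hi u < p" using lohi(5)[OF u] 1 by (auto simp: headrow_def)
        then obtain q where n: "next_part P q p"
          using next_part_exists_below[OF el(5) lohi(2)[OF u]] by blast
        have s: "step x = (u, q, 1)" using step_head[OF el(6) 1] c prv_eq[OF n] by (simp add: e)
        have "u < t" if "p + 1 < u + t" using that head_low[OF 1 u(1)] by linarith
        hence "2 \<le> t \<and> q \<le> b (t - 1) + 1 \<or> u < t" using d next_part_less[OF n] by auto
        moreover have "0 < q" using next_part_mem(1)[OF n] parts_pos by (metis gr0I)
        ultimately show ?thesis unfolding s by (auto simp: settled_iff)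
      next
        case 2
        define i where "i = p + 1 - u"
        have i: "i \<le> m" "1 \<le> i" "b i \<le> p" "2 * i \<le> p + 1"
        proof -
          have "i \<le> m \<and> b i \<le> p \<and> 2 * i \<le> p + 1"
          proof (cases "tailrow u p")
            case True
            thus ?thesis using tail_low[OF True el(2)] by (auto simp: tailrow_def i_def)
          next
            case False
            then obtain s where s: "midrow s u p" "p = hi s" "u + s = p + 1" using 2 by (auto simp: endrow_def)
            hence eq: "i = s" by (simp add: i_def)
            have st: "1 \<le> s" "s \<le> m" using s(1) by (auto simp: midrow_def)
            show ?thesis using lohi(3,4,10)[OF st] st s(2) unfolding eq by linarith
          qed
          thus "i \<le> m" "1 \<le> i" "b i \<le> p" "2 * i \<le> p + 1" using el by (auto simp: i_def)
        qed
        have it: "i < t"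
        proof -
          consider "2 \<le> t \<and> p \<le> b (t - 1) + 1" | "u < t" | "p + 1 < u + t" using d by blast
          thus ?thesis
          proof cases
            case 1
            thus ?thesis using spaced_lt[OF i(2,1), of t] t i(3) by simp
          next
            case 2
            thus ?thesis using i(4) el by (simp add: i_def)
          next
            case 3
            thus ?thesis using el by (simp add: i_def)
          qed
        qed
        note s = step_end[OF el(6,1,2) 2]
        show ?thesis
        proof (cases "p = top")
          case True
          hence "step x = (0, 0, i)" using s c by (simp add: e i_def)
          thus ?thesis using it by (simp add: settled_border)
        next
          case False
          have n: "p < nxt p" using next_part_less[OF next_nxt[OF el(5) False]] .
          have "step x = (u + (nxt p - p), nxt p, 1)" using s False c by (simp add: e)
          moreover have "nxt p + 1 < u + (nxt p - p) + t" using it n el by (simp add: i_def)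
          ultimately show ?thesis using n by (simp add: settled_iff)
        qed
      next
        case (3 s)
        have st: "1 \<le> s" "s \<le> m" "s \<le> u" "u + s \<le> p + 1" "p = lo s \<or> p = hi s"
          using 3 by (auto simp: midrow_def)
        have lpos: "0 < lo s" "0 < hi s" using lohi(1,2)[OF st(1,2)] parts_pos by (metis gr0I)+
        show ?thesis
        proof (cases "p = hi s \<and> lo s < hi s")
          case True
          have "step (u, p, count P p) = (u, lo s, 1)"
            by (rule step_mid_down[OF el(1,2) 3(1)]) (use True 3(2) in auto)
          hence "step x = (u, lo s, 1)" using c by (simp add: e)
          moreover have "2 \<le> t \<and> lo s \<le> b (t - 1) + 1 \<or> u < t \<or> lo s + 1 < u + t" using d True by auto
          ultimately show ?thesis using lpos by (simp add: settled_iff)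
        next
          case False
          hence pl: "p = lo s" using st lohi(4)[OF st(1,2)] by auto
          have ut: "u + s \<le> hi s" 
            using 3(2) st pl lohi(3,4,5,6)[OF st(1,2)] by (cases "lo s = hi s") auto
          have "step (u, p, count P p) = (u + 1, hi s, 1)"
            by (rule step_mid_up[OF el(1,2) 3(1) pl ut])
          hence sx: "step x = (u + 1, hi s, 1)" using c by (simp add: e)
          have "s < t"
          proof -
            consider "2 \<le> t \<and> p \<le> b (t - 1) + 1" | "u < t" | "p + 1 < u + t" using d by blast
            thus ?thesis
            proof cases
              case 1
              thus ?thesis using spaced_lt[OF st(1,2), of t] t lohi(3)[OF st(1,2)] pl by simp
            next
              case 2
              thus ?thesis using st by simp
            next
              case 3
              thus ?thesis using ut lohi(3,5)[OF st(1,2)] pl by linarith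
            qed
          qed
          thus ?thesis unfolding sx by (rule midrow_settled[OF 3(1) t(2) _ lpos(2) lohi(5)[OF st(1,2)]])
        qed
      qed
    qed
  qed
qed

end

text \<open>
  The induction step: \<open>\<pi>\<close> agrees with \<open>step\<close> on the region settled so far.
\<close>

locale rerouting_step = rerouting +
  fixes t :: nat
  assumes t: "1 \<le> t" "t \<le> m + 1"
    and IH: "\<And>x. x \<in> V \<Longrightarrow> settled t x \<Longrightarrow> \<pi> x = step x"
begin

lemma pi_settled: 
  assumes x: "x \<in> V"
  shows "settled t (\<pi> x) \<longleftrightarrow> settled t x"
proof
  show "settled t (\<pi> x)" if "settled t x" using step_settled[OF t x that] IH[OF x that] by simp
next
  assume a: "settled t (\<pi> x)"
  let ?W = "{y \<in> V. settled t y}"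
  have fin: "finite ?W" using finite_V by simp
  have sub: "step ` ?W \<subseteq> ?W" using step_settled[OF t] step_bij by (auto intro: bij_betw_apply)
  have "inj_on step ?W" using step_bij by (auto simp: bij_betw_def intro: inj_on_subset)
  hence "step ` ?W = ?W" using sub fin by (simp add: endo_inj_surj)
  moreover have "\<pi> x \<in> ?W" using a pi_V[OF x] by simp
  ultimately obtain y where y: "y \<in> V" "settled t y" "\<pi> x = step y" by (smt (verit) image_iff mem_Collect_eq)
  hence "\<pi> x = \<pi> y" using IH by simp
  hence "x = y" using pi_inj[OF x y(1)] by simp
  thus "settled t x" using y by simp
qed

lemma unsettled_iff: "0 < p \<Longrightarrow> \<not> settled t (u, p, k) \<longleftrightarrow> (2 \<le> t \<longrightarrow> b (t - 1) + 1 < p) \<and> t \<le> u \<and> u + t \<le> p + 1"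
  by (auto simp: settled_iff)

lemma unsettled_high:
  assumes "t \<le> m" "p \<in># P" "lo t \<le> p" "t \<le> u" "u + t \<le> p + 1"
  shows "\<not> settled t (u, p, k)"
proof -
  have p0: "0 < p" using assms(2) parts_pos by (metis gr0I)
  have "b (t - 1) + 1 < p" if "2 \<le> t"
  proof -
    have "1 \<le> t - 1" "t - 1 < t" using that by linarith+
    hence "b (t - 1) + 1 < b t" using spaced_less[OF sp _ _ assms(1), of "t - 1"] by blast
    thus ?thesis using assms(3) lohi(3)[OF t(1) assms(1)] by linarith
  qed
  thus ?thesis using assms p0 by (simp add: unsettled_iff)
qed

text \<open>
  Special edges of kind \<open>t\<close> in the unsettled region are among those used by \<open>step\<close>.  As \<open>\<pi>\<close> uses equally
  many, it uses them all.
\<close>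

lemma special_settles:
  assumes tm: "t \<le> m" and x: "x \<in> V" and s: "special t x (step x)"
  shows "\<pi> x = step x"
proof -
  let ?A = "{x \<in> V. special t x (\<pi> x)}" and ?B = "{x \<in> V. special t x (step x)}"
  have sub: "?A \<subseteq> ?B"
  proof
    fix x assume "x \<in> ?A"
    hence x: "x \<in> V" "special t x (\<pi> x)" by auto
    have "\<pi> x = step x"
    proof (cases "settled t x")
      case True thus ?thesis using IH x by simp
    next
      case False
      obtain u p k where e: "x = (u, p, k)" by (metis prod_cases3)
      obtain v q l where e': "\<pi> x = (v, q, l)" by (metis prod_cases3)
      have nd: "\<not> settled t (v, q, l)" using pi_settled[OF x(1)] False e' by simp
      have hpos: "0 < hi t" "0 < lo t" using lohi(1,2)[OF t(1) tm] parts_pos by (metis gr0I)+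
      have sx: "special t (u, p, k) (v, q, l)" using x(2)[unfolded e'] unfolding e .
      have q: "q = hi t" "l = 1" "k = count P p" using sx by auto
      have nq: "t \<le> v" "v + t \<le> hi t + 1" using nd hpos q unsettled_iff[of q v l] by auto
      show ?thesis
      proof (cases "isC t")
        case True
        hence n: "next_part P (hi t) p" "v = u" using sx True unfolding special.simps q(1) by simp_all
        have "u = t" using nq n True by (simp add: isC_def)
        moreover have "b t + 1 < p" using lohi(8)[OF t(1) tm next_part_mem(2)[OF n(1)] next_part_less[OF n(1)]] .
        ultimately have "headrow u p" using tm by (simp add: headrow_def)
        moreover have "0 < p" using next_part_less[OF n(1)] by simp
        ultimately have "step x = (u, prv p, 1)" using step_head[of p u] q e by simp
        thus ?thesis using prv_eq[OF n(1)] e' n q by simp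
      next
        case False
        hence n: "p = lo t" "v = u + 1" using sx False unfolding special.simps by simp_all
        have xD: "(u, p, k) \<in> E" using x(1) hpos n by (auto simp: V_def e)
        note el = elemD[OF xD]
        have tu: "t \<le> u" using False \<open>\<not> settled t x\<close> unsettled_iff[OF el(6), of u k] by (simp add: e)
        have ut: "u + t \<le> hi t" using nq n by simp
        have "midrow t u p" unfolding midrow_def using t tm n tu ut lohi(3,5)[OF t(1) tm] by auto
        hence "step (u, p, count P p) = (u + 1, hi t, 1)"
          using step_mid_up[OF el(1,2) _ n(1) ut] by simp
        thus ?thesis using e e' n q by simp
      qed
    qed
    thus "x \<in> ?B" using x by simp
  qed
  have "finite ?B" using finite_V by simp
  hence "?A = ?B" using card_subset_eq[of ?B ?A] sub counts[OF t(1) tm] by simp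
  hence "special t x (\<pi> x)" using x s by blast
  thus ?thesis using s by (cases x; cases "step x"; cases "\<pi> x") (auto split: if_splits)
qed

text \<open>
  The only arc from the pair to a smaller part within the unsettled region starts where the special edge is
  already in use.
\<close>

lemma stays_high:
  assumes tm: "t \<le> m" and x: "(u, p, k) \<in> E" "\<not> settled t (u, p, k)" "lo t \<le> p"
    and y: "\<pi> (u, p, k) = (v, q, l)" "0 < q"
  shows "lo t \<le> q"
proof (rule ccontr)
  assume ql: "\<not> lo t \<le> q"
  have xV: "(u, p, k) \<in> V" using x by (simp add: V_def)
  have "arc (u, p, k) (v, q, l)" using arcs[OF xV] y x(3) ql by auto
  hence ed: "edge (u, p, k) (v, q, l)" using y(2) elemD(6)[OF x(1)] by (auto simp: arc_def)
  hence n: "next_part P q p" "v = u" "k = count P p"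
    using ql x(3) next_part_less[of P p q] by auto
  have p: "p = lo t" using next_part_le[OF n(1) lohi(1)[OF t(1) tm]] ql x(3) by linarith
  have "\<not> settled t (v, q, l)" using pi_settled[OF xV] x(2) y(1) by simp
  hence b: "t \<le> u" "u + t \<le> q + 1" using unsettled_iff[OF y(2)] n by auto
  have ut: "u + t \<le> hi t" using b ql lohi(4)[OF t(1) tm] by linarith
  have nC: "\<not> isC t" using ut b lohi(4)[OF t(1) tm] by (auto simp: isC_def)
  note el = elemD[OF x(1)]
  have "midrow t u p" unfolding midrow_def using t tm p b ql by auto
  hence st: "step (u, p, k) = (u + 1, hi t, 1)"
    using step_mid_up[OF el(1,2) _ p ut] n by simp
  have "special t (u, p, k) (u + 1, hi t, 1)" using nC n p by simp
  hence "special t (u, p, k) (step (u, p, k))" unfolding st .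
  hence "\<pi> (u, p, k) = (u + 1, hi t, 1)" using special_settles[OF tm xV] unfolding st by blast
  thus False using y ql lohi(4)[OF t(1) tm] by simp
qed

text \<open>
  By the previous lemma nothing enters the unsettled region below the pair from outside, so it is
  invariant, and heights apply.
\<close>

lemma low_fixed:
  assumes tm: "t \<le> m" and x: "(u, p, k) \<in> E" "\<not> settled t (u, p, k)" "p < lo t"
  shows "\<pi> (u, p, k) = (u, p, k)"
proof -
  define Z where "Z = {z \<in> E. \<not> settled t z \<and> fst (snd z) < lo t}"
  have fin: "finite Z" by (rule finite_subset[of _ E]) (auto simp: Z_def)
  have ZV: "Z \<subseteq> V" "Z \<subseteq> E" by (auto simp: V_def Z_def)
  have "Z \<subseteq> \<pi> ` Z"
  proof
    fix z assume z: "z \<in> Z"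
    obtain v q l where e: "z = (v, q, l)" by (metis prod_cases3)
    have zz: "(v, q, l) \<in> E" "\<not> settled t (v, q, l)" "q < lo t" using z unfolding Z_def e by simp_all
    obtain y where y: "y \<in> V" "\<pi> y = z" using pi_pre[of z] z ZV by blast
    have nd: "\<not> settled t y" using pi_settled[OF y(1)] y(2) zz by (simp add: e)
    have yD: "y \<in> E"
    proof (rule ccontr)
      assume "y \<notin> E"
      hence "arc y z" using arcs[OF y(1)] y(2) by simp
      hence "\<exists>t\<in>{1..m}. z = (t, top, 1)" using \<open>y \<notin> E\<close> elemD(6)[OF zz(1)] unfolding arc_def e by blast
      hence "q = top" unfolding e by blast
      thus False using zz(3) le_top[OF lohi(1)[OF t(1) tm]] by simp
    qed
    obtain u p k where e': "y = (u, p, k)" by (metis prod_cases3)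
    have "lo t \<le> q" if "lo t \<le> p"
      by (rule stays_high[OF tm yD[unfolded e'] nd[unfolded e'] that y(2)[unfolded e' e] elemD(6)[OF zz(1)]])
    hence "p < lo t" using zz(3) by linarith
    hence "y \<in> Z" using yD nd by (simp add: e' Z_def)
    thus "z \<in> \<pi> ` Z" using y by blast
  qed
  hence eq: "Z = \<pi> ` Z" by (rule card_seteq[OF finite_imageI[OF fin] _ card_image_le[OF fin]])
  have xZ: "(u, p, k) \<in> Z" using x by (simp add: Z_def)
  have sub: "\<pi> ` Z \<subseteq> Z" by (rule equalityD2[OF eq])
  show ?thesis by (rule pi_fixed_invariant[OF ZV(2) sub xZ])
qed

lemma pred_arc:
  assumes "y \<in> E" "\<pi> y \<noteq> y"
  obtains x where "x \<in> V" "\<pi> x = y" "x \<noteq> y" "arc x y"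
proof -
  have yV: "y \<in> V" using assms(1) by (simp add: V_def)
  obtain x where x: "x \<in> V" "\<pi> x = y" using pi_pre[OF yV] by blast
  have ne: "x \<noteq> y" using x assms(2) by auto
  have "arc x y" using arcs[OF x(1)] x(2) ne by auto
  thus ?thesis using that x ne by blast
qed

lemma row_down:
  assumes d: "(u, p, k + 1) \<in> E" "1 \<le> k" and ne: "\<pi> (u, p, k + 1) \<noteq> (u, p, k + 1)"
  shows "\<pi> (u, p, k) = (u, p, k + 1)"
proof -
  obtain x where x: "x \<in> V" "\<pi> x = (u, p, k + 1)" "arc x (u, p, k + 1)" using pred_arc[OF d(1) ne] by metis
  have "edge x (u, p, k + 1)" using x(3) d(2) elemD(6)[OF d(1)] by (auto simp: arc_def)
  hence "x = (u, p, k)" using d(2) by (cases x) auto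
  thus ?thesis using x(2) by simp
qed

text \<open>
  Copies of a row are traversed in order: the only arc out of a copy that is not the last leads to the next
  one.
\<close>

lemma row_up:
  assumes d: "(u, p, k) \<in> E" "k < count P p" and ne: "\<pi> (u, p, k) \<noteq> (u, p, k)"
  shows "\<pi> (u, p, k) = (u, p, k + 1)"
proof -
  have xV: "(u, p, k) \<in> V" using d(1) by (simp add: V_def)
  have "arc (u, p, k) (\<pi> (u, p, k))" using arcs[OF xV] ne by simp
  moreover obtain v q l where e: "\<pi> (u, p, k) = (v, q, l)" by (metis prod_cases3)
  ultimately have "edge (u, p, k) (v, q, l)" using d(2) elemD(6)[OF d(1)] unfolding arc_def by auto
  thus ?thesis using d(2) by (simp add: e)
qed

lemma live_all:
  assumes "live u p" "p \<in># P" "1 \<le> u" "u \<le> p" "1 \<le> k" "k \<le> count P p"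
  shows "\<pi> (u, p, k) \<noteq> (u, p, k)"
  using assms(5,6)
proof (induction k rule: nat_induct_at_least)
  case base
  show ?case using assms(1) by (simp add: live_def)
next
  case (Suc k)
  have d: "(u, p, k) \<in> E" "(u, p, Suc k) \<in> E" using Suc assms(2-4) by (auto intro: in_D)
  hence V: "(u, p, k) \<in> V" "(u, p, Suc k) \<in> V" by (auto simp: V_def)
  have "\<pi> (u, p, k) = (u, p, Suc k)" using row_up[OF d(1)] Suc by simp
  thus ?case using pi_inj[OF V] by auto
qed

lemma liveI:
  assumes "\<pi> (u, p, k) \<noteq> (u, p, k)" "p \<in># P" "1 \<le> u" "u \<le> p" "1 \<le> k" "k \<le> count P p"
  shows "live u p"
  using assms(5,1,6)
proof (induction k rule: nat_induct_at_least)
  case base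
  thus ?case by (simp add: live_def)
next
  case (Suc k)
  have d: "(u, p, Suc k) \<in> E" using Suc assms(2-4) by (auto intro: in_D)
  have "\<pi> (u, p, k) = (u, p, k + 1)" using row_down[of u p k] d Suc by simp
  thus ?case using Suc by simp
qed

lemma live_copy:
  assumes "live u p" "p \<in># P" "1 \<le> u" "u \<le> p" "1 \<le> k" "k < count P p"
  shows "\<pi> (u, p, k) = (u, p, k + 1)"
  by (rule row_up[OF in_D]) (use assms live_all[OF assms(1-5)] in auto)

text \<open>
  How the first copy of a moved row can be reached once fixed vertices below the pair are discarded.
\<close>

lemma row_entry:
  assumes tm: "t \<le> m" and l: "live v q" and q: "q \<in># P" "1 \<le> v" "v \<le> q" and hq: "lo t \<le> q"
    and nd: "\<not> settled t (v, q, 1)"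
  obtains "\<exists>i. \<pi> (0, 0, i) = (v, q, 1)" "q = top"
  | u p where "\<pi> (u, p, count P p) = (v, q, 1)" "t \<le> u" "u + t \<le> p + 1" "p \<in># P" "lo t \<le> p"
      "next_part P q p \<and> v = u \<or> next_part P p q \<and> v = u + (q - p) \<or> q = p \<and> v = u + 1 \<and> loop p"
proof -
  have yD: "(v, q, 1) \<in> E" using q by (intro in_D) (auto simp: Suc_le_eq)
  obtain x where x: "x \<in> V" "\<pi> x = (v, q, 1)" "x \<noteq> (v, q, 1)" "arc x (v, q, 1)"
    using pred_arc[OF yD l[unfolded live_def]] by metis
  have ndx: "\<not> settled t x" using pi_settled[OF x(1)] x(2) nd by simp
  show ?thesis
  proof (cases "x \<in> E")
    case False
    hence "\<exists>i. x = (0, 0, i)" "q = top" using x(4) elemD(6)[OF yD] by (auto simp: arc_def)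
    thus ?thesis using that(1) x(2) by blast
  next
    case True
    obtain u p k where e: "x = (u, p, k)" by (metis prod_cases3)
    note el = elemD[OF True[unfolded e]]
    have ed: "edge (u, p, k) (v, q, 1)" using x(4) el(6) elemD(6)[OF yD] by (auto simp: arc_def e)
    hence k: "k = count P p" "next_part P q p \<and> v = u \<or> next_part P p q \<and> v = u + (q - p) \<or> q = p \<and> v = u + 1 \<and> loop p"
      using el by auto
    have lp: "lo t \<le> p"
    proof (rule ccontr)
      assume "\<not> lo t \<le> p"
      hence "\<pi> x = x" using low_fixed[OF tm, of u p k] True ndx by (simp add: e)
      thus False using x by simp
    qed
    have ut: "t \<le> u" "u + t \<le> p + 1" using ndx unsettled_iff[OF el(6), of u k] by (simp_all add: e)
    have "\<pi> (u, p, count P p) = (v, q, 1)" using x(2) unfolding e k(1) .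
    thus ?thesis by (rule that(2)[OF _ ut el(5) lp k(2)])
  qed
qed

lemma no_loop:
  assumes "t \<le> m" "lo t < hi t" "p = lo t \<or> p = hi t"
  shows "\<not> loop p"
proof
  assume "loop p"
  then obtain s where s: "1 \<le> s" "s \<le> m" "lo s = hi s" "p = hi s" by (auto simp: loop_def)
  have "p = b t \<or> p = b t + 1" using lohi(6)[OF t(1) assms(1,2)] assms(3) by auto
  moreover have "p = b s \<or> p = b s + 1" using s(4) by (auto simp: hi_def)
  ultimately have "s = t" using pair_unique[OF s(1,2) _ t(1) assms(1)] by blast
  thus False using s assms(2) by simp
qed

lemma mid_up:
  assumes tm: "t \<le> m" and u: "t \<le> u" "u + t \<le> hi t"
  shows "\<pi> (u, lo t, count P (lo t)) = (u + 1, hi t, 1)" "live u (lo t)" "live (u + 1) (hi t)"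
proof -
  have hl: "hi t \<le> lo t + 1" using lohi(3,5)[OF t(1) tm] by simp
  have lp: "lo t \<in># P" and hp: "hi t \<in># P" using lohi(1,2)[OF t(1) tm] .
  have el: "1 \<le> u" "u \<le> lo t" using t u hl by linarith+
  have mr: "midrow t u (lo t)" using u t tm hl by (simp add: midrow_def)
  have st: "step (u, lo t, count P (lo t)) = (u + 1, hi t, 1)" by (rule step_mid_up[OF el mr refl u(2)])
  have xD: "(u, lo t, count P (lo t)) \<in> E" using el lp last_copy[OF lp] by (intro in_D) auto
  hence xV: "(u, lo t, count P (lo t)) \<in> V" by (simp add: V_def)
  have nC: "\<not> isC t" using u by (auto simp: isC_def)
  have "special t (u, lo t, count P (lo t)) (u + 1, hi t, 1)" using nC by simp
  hence p: "\<pi> (u, lo t, count P (lo t)) = (u + 1, hi t, 1)" using special_settles[OF tm xV] unfolding st by blast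
  thus "\<pi> (u, lo t, count P (lo t)) = (u + 1, hi t, 1)" .
  show "live u (lo t)" by (rule liveI[OF _ lp el, of "count P (lo t)"]) (use p last_copy[OF lp] in auto)
  have "(u + 1, hi t, 1) \<in> E" using u t hp by (intro in_D) (auto simp: Suc_le_eq)
  hence yV: "(u + 1, hi t, 1) \<in> V" by (simp add: V_def)
  show "live (u + 1) (hi t)" unfolding live_def
  proof
    assume "\<pi> (u + 1, hi t, 1) = (u + 1, hi t, 1)"
    hence "(u + 1, hi t, 1) = (u, lo t, count P (lo t))" using pi_inj[OF yV xV] p by simp
    thus False by simp
  qed
qed

text \<open>
  The row of the lower part is moved, and its only possible predecessor lies in the upper part.
\<close>

lemma mid_down:
  assumes tm: "t \<le> m" and lh: "lo t < hi t" and u: "t \<le> u" "u + t \<le> hi t"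
  shows "\<pi> (u, hi t, count P (hi t)) = (u, lo t, 1)" "live u (hi t)"
proof -
  have h: "hi t = lo t + 1" using lohi(6)[OF t(1) tm lh] by simp
  have lp: "lo t \<in># P" and hp: "hi t \<in># P" using lohi(1,2)[OF t(1) tm] .
  have el: "1 \<le> u" "u \<le> lo t" using t u h by linarith+
  have nd: "\<not> settled t (u, lo t, 1)" by (rule unsettled_high[OF tm lp]) (use u h in auto)
  have nt: "lo t \<noteq> top" using le_top[OF hp] lh by simp
  have nh: "next_part P (lo t) (hi t)" by (rule next_lo_hi[OF t(1) tm lh])
  have p: "\<pi> (u, hi t, count P (hi t)) = (u, lo t, 1)"
  proof (rule row_entry[OF tm mid_up(2)[OF tm u] lp el order_refl nd])
    show ?thesis if "lo t = top" using that nt by simp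
    fix v p
    assume a: "\<pi> (v, p, count P p) = (u, lo t, 1)" "lo t \<le> p"
      "next_part P (lo t) p \<and> u = v \<or> next_part P p (lo t) \<and> u = v + (lo t - p) \<or> lo t = p \<and> u = v + 1 \<and> loop p"
    have "next_part P (lo t) p \<and> u = v"
      using a(2,3) no_loop[OF tm lh, of p] next_part_less[of P p "lo t"] by auto
    thus ?thesis using next_part_functional[OF _ nh] a(1) by blast
  qed
  thus "\<pi> (u, hi t, count P (hi t)) = (u, lo t, 1)" .
  have "\<pi> (u, hi t, count P (hi t)) \<noteq> (u, hi t, count P (hi t))" using p lh by simp
  moreover have "u \<le> hi t" using el lh by linarith
  ultimately show "live u (hi t)" by (rule liveI[OF _ hp el(1) _ last_copy[OF hp] order_refl])
qed

lemma border_out: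
  assumes "1 \<le> i" "i \<le> m"
  shows "\<pi> (0, 0, i) = (i, top, 1)"
proof -
  have "(0, 0, i) \<in> V" using assms by (simp add: V_def)
  moreover have "(0, 0, i) \<notin> E" by (simp add: poset_elems_iff)
  ultimately have "arc (0, 0, i) (\<pi> (0, 0, i))" using arcs by blast
  thus ?thesis by (auto simp: arc_def poset_elems_iff)
qed

text \<open>
  Inside the pair the special edges touch every row, except for the degenerate pair, where the row is entered
  either by its special edge or from the border.
\<close>

lemma mid_live:
  assumes tm: "t \<le> m" and mr: "midrow t u p"
  shows "live u p"
proof -
  have u: "t \<le> u" "u + t \<le> p + 1" "p = lo t \<or> p = hi t" using mr by (auto simp: midrow_def)
  have hl: "hi t \<le> lo t + 1" using lohi(3,5)[OF t(1) tm] by simp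
  have lp: "lo t \<in># P" and hp: "hi t \<in># P" using lohi(1,2)[OF t(1) tm] .
  show ?thesis
  proof (cases "lo t < hi t")
    case lh: True
    show ?thesis
    proof (cases "u + t \<le> hi t")
      case True
      thus ?thesis using mid_up(2)[OF tm u(1) True] mid_down(2)[OF tm lh u(1) True] u(3) by auto
    next
      case False
      hence e: "p = hi t" "u + t = hi t + 1" using u hl lh by auto
      have "t \<le> u - 1" "u - 1 + t \<le> hi t" using e lh lohi(10)[OF t(1) tm] u by linarith+
      hence "live (u - 1 + 1) (hi t)" by (rule mid_up(3)[OF tm])
      thus ?thesis using e u t by simp
    qed
  next
    case False
    hence eq: "lo t = hi t" using lohi(4)[OF t(1) tm] by simp
    hence p: "p = hi t" using u by auto
    show ?thesis
    proof (cases "isC t")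
      case C: True
      hence ut: "u = t" using u p by (simp add: isC_def)
      have yD: "(t, hi t, 1) \<in> E" using hp u t ut p by (intro in_D) (auto simp: Suc_le_eq)
      hence yV: "(t, hi t, 1) \<in> V" by (simp add: V_def)
      have "\<exists>x\<in>V. \<pi> x = (t, hi t, 1) \<and> x \<noteq> (t, hi t, 1)"
      proof (cases "hi t = top")
        case True
        have "(0, 0, t) \<in> V" using t tm by (simp add: V_def)
        thus ?thesis using border_out[OF t(1) tm] True t by (intro bexI[of _ "(0, 0, t)"]) auto
      next
        case False
        have n: "next_part P (hi t) (nxt (hi t))" by (rule next_nxt[OF hp False])
        let ?q = "nxt (hi t)" let ?x = "(t, ?q, count P ?q)"
        have qp: "?q \<in># P" "hi t < ?q" using next_part_mem(2)[OF n] next_part_less[OF n] .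
        have "?x \<in> E" using qp u t ut p last_copy[OF qp(1)] by (intro in_D) auto
        hence xV: "?x \<in> V" by (simp add: V_def)
        have "headrow t ?q" using lohi(8)[OF t(1) tm qp] tm by (simp add: headrow_def)
        hence st: "step ?x = (t, hi t, 1)" using step_head[of ?q t] qp prv_eq[OF n] by simp
        have "special t ?x (t, hi t, 1)" using C n by simp
        hence "\<pi> ?x = (t, hi t, 1)" using special_settles[OF tm xV] unfolding st by blast
        thus ?thesis using xV qp by (intro bexI[OF _ xV]) auto
      qed
      thus ?thesis unfolding ut p live_def using pi_inj[OF _ yV] by auto
    next
      case C: False
      hence h: "2 * t \<le> hi t" using eq lohi(10)[OF t(1) tm] by (simp add: isC_def)
      show ?thesis
      proof (cases "u + t \<le> hi t")
        case True
        thus ?thesis using mid_up(2)[OF tm u(1) True] p eq by simp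
      next
        case False
        hence "t \<le> u - 1" "u - 1 + t \<le> hi t" using u p h by linarith+
        hence "live (u - 1 + 1) (hi t)" by (rule mid_up(3)[OF tm])
        thus ?thesis using p u t by simp
      qed
    qed
  qed
qed

text \<open>
  A moved row \<open>t\<close> of a part must be entered from row \<open>t\<close> of the next larger part, as other arcs would come
  from settled rows.  This propagates up to the largest part.
\<close>

lemma head_pred:
  assumes tm: "t \<le> m" and n: "next_part P q p" and hq: "hi t \<le> q" and l: "live t q"
  shows "\<pi> (t, p, count P p) = (t, q, 1)" "live t p"
proof -
  have qp: "q \<in># P" "p \<in># P" "q < p" using next_part_mem[OF n] next_part_less[OF n] .
  have l2: "2 * t \<le> q + 1" "lo t \<le> q" using lohi(4,10)[OF t(1) tm] hq by linarith+
  have nd: "\<not> settled t (t, q, 1)" by (rule unsettled_high[OF tm qp(1) l2(2)]) (use l2 in auto)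
  have tq: "t \<le> q" using l2 t by linarith
  have p: "\<pi> (t, p, count P p) = (t, q, 1)"
  proof (rule row_entry[OF tm l qp(1) t(1) tq l2(2) nd])
    show ?thesis if "q = top" using that le_top[OF qp(2)] qp(3) by simp
    fix v r
    assume a: "\<pi> (v, r, count P r) = (t, q, 1)" "t \<le> v"
      "next_part P q r \<and> t = v \<or> next_part P r q \<and> t = v + (q - r) \<or> q = r \<and> t = v + 1 \<and> loop r"
    have "next_part P q r \<and> t = v"
      using a(2,3) next_part_less[of P r q] by auto
    thus ?thesis using next_part_functional[OF _ n] a(1) by blast
  qed
  thus "\<pi> (t, p, count P p) = (t, q, 1)" .
  have "\<pi> (t, p, count P p) \<noteq> (t, p, count P p)" using p qp by simp
  moreover have "t \<le> p" using tq qp by linarith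
  ultimately show "live t p" by (rule liveI[OF _ qp(2) t(1) _ last_copy[OF qp(2)] order_refl])
qed

lemma head_live:
  assumes tm: "t \<le> m" and p: "p \<in># P" "hi t \<le> p"
  shows "live t p"
  using p
proof (induction p rule: less_induct)
  case (less p)
  have hp: "hi t \<in># P" using lohi(2)[OF t(1) tm] .
  show ?case
  proof (cases "p = hi t")
    case True
    have "midrow t t (hi t)" using t tm lohi(4,10)[OF t(1) tm] by (auto simp: midrow_def)
    thus ?thesis using mid_live[OF tm] True by simp
  next
    case False
    hence lt: "hi t < p" using less by simp
    obtain q where n: "next_part P q p" using next_part_exists_below[OF less(2) hp lt] by blast
    have hq: "hi t \<le> q" using next_part_le[OF n hp lt] .
    have "live t q" by (rule less.IH[OF next_part_less[OF n] next_part_mem(1)[OF n] hq])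
    thus ?thesis by (rule head_pred(2)[OF tm n hq])
  qed
qed

lemma head_out:
  assumes tm: "t \<le> m" and p: "p \<in># P" "hi t < p"
  shows "\<pi> (t, p, count P p) = (t, prv p, 1)"
proof -
  have hp: "hi t \<in># P" using lohi(2)[OF t(1) tm] .
  obtain q where n: "next_part P q p" using next_part_exists_below[OF p(1) hp p(2)] by blast
  have hq: "hi t \<le> q" using next_part_le[OF n hp p(2)] .
  have "live t q" by (rule head_live[OF tm next_part_mem(1)[OF n] hq])
  thus ?thesis using head_pred(1)[OF tm n hq] prv_eq[OF n] by simp
qed

text \<open>
  From the last unsettled row of a part the only way out within the unsettled region leads to the next larger
  part, and from the largest part to the border.
\<close>

lemma tail_out:
  assumes tm: "t \<le> m" and p: "p \<in># P" "hi t \<le> p" and l: "live (p + 1 - t) p"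
  shows "\<pi> (p + 1 - t, p, count P p) = (if p = top then (0, 0, t) else (nxt p + 1 - t, nxt p, 1))"
    "p \<noteq> top \<Longrightarrow> live (nxt p + 1 - t) (nxt p)"
proof -
  have l2: "2 * t \<le> p + 1" "lo t \<le> p" using lohi(4,10)[OF t(1) tm] p by linarith+
  let ?x = "(p + 1 - t, p, count P p)"
  have tp: "1 \<le> p + 1 - t" "p + 1 - t \<le> p" using l2 t by linarith+
  have xD: "?x \<in> E" using tp p last_copy[OF p(1)] by (intro in_D) auto
  hence xV: "?x \<in> V" by (simp add: V_def)
  have nd: "\<not> settled t ?x" by (rule unsettled_high[OF tm p(1) l2(2)]) (use l2 in auto)
  have p0: "0 < p" using p(1) parts_pos by (metis gr0I)
  have ne: "\<pi> ?x \<noteq> ?x" by (rule live_all[OF l p(1) tp]) (use last_copy[OF p(1)] in auto)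
  have ar: "arc ?x (\<pi> ?x)" using arcs[OF xV] ne by simp
  obtain v q l where e: "\<pi> ?x = (v, q, l)" by (metis prod_cases3)
  have nd': "\<not> settled t (v, q, l)" using pi_settled[OF xV] nd e by simp
  have out: "\<pi> ?x = (if p = top then (0, 0, t) else (nxt p + 1 - t, nxt p, 1))"
  proof (cases "q = 0")
    case True
    then obtain i where i: "p = top" "p + 1 - t = top + 1 - i" "(v, q, l) = (0, 0, i)" "i \<in> {1..m}" "top + 1 - i \<ge> 1"
      using ar[unfolded e] elemD(6)[of v q l] elemD(1)[OF xD] by (auto simp: arc_def)
    have "i = t" using i l2 t by auto
    thus ?thesis using i e by simp
  next
    case False
    hence q0: "0 < q" by simp
    have ed: "edge ?x (v, q, l)" using ar[unfolded e] q0 p0 by (auto simp: arc_def)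
    have b: "t \<le> v" "v + t \<le> q + 1" using nd' unsettled_iff[OF q0, of v l] by auto
    have "(v, q, l) \<in> E" using ar[unfolded e] q0 p0 by (auto simp: arc_def)
    hence "l \<le> count P q" by (rule elemD(4))
    hence "next_part P p q \<and> v = p + 1 - t + (q - p) \<and> l = 1"
      using ed b l2 next_part_less[of P q p] by auto
    moreover have "p < q" using calculation next_part_less by blast
    moreover have "q \<le> top" using calculation(1) next_part_mem(2)[of P p q] le_top by blast
    ultimately show ?thesis using nxt_eq[of p q] e l2 t by auto
  qed
  show "\<pi> ?x = (if p = top then (0, 0, t) else (nxt p + 1 - t, nxt p, 1))" by (rule out)
  show "live (nxt p + 1 - t) (nxt p)" if nt: "p \<noteq> top"
  proof -
    have o: "\<pi> ?x = (nxt p + 1 - t, nxt p, 1)" using out nt by simp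
    have "p < nxt p" using next_part_less[OF next_nxt[OF p(1) nt]] .
    hence yx: "(nxt p + 1 - t, nxt p, 1) \<noteq> ?x" by simp
    have yV: "(nxt p + 1 - t, nxt p, 1) \<in> V" using pi_V[OF xV] o by simp
    show ?thesis unfolding live_def
    proof
      assume "\<pi> (nxt p + 1 - t, nxt p, 1) = (nxt p + 1 - t, nxt p, 1)"
      hence "\<pi> (nxt p + 1 - t, nxt p, 1) = \<pi> ?x" using o by simp
      thus False using pi_inj[OF yV xV] yx by blast
    qed
  qed
qed

lemma tail_live:
  assumes tm: "t \<le> m" and p: "p \<in># P" "hi t \<le> p"
  shows "live (p + 1 - t) p"
  using p
proof (induction p rule: less_induct)
  case (less p)
  have hp: "hi t \<in># P" using lohi(2)[OF t(1) tm] .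
  show ?case
  proof (cases "p = hi t")
    case True
    have "midrow t (hi t + 1 - t) (hi t)" using t tm lohi(4,10)[OF t(1) tm] by (auto simp: midrow_def)
    thus ?thesis using mid_live[OF tm] True by simp
  next
    case False
    hence lt: "hi t < p" using less by simp
    obtain q where n: "next_part P q p" using next_part_exists_below[OF less(2) hp lt] by blast
    have hq: "hi t \<le> q" using next_part_le[OF n hp lt] .
    have qp: "q \<in># P" "q < p" using next_part_mem(1)[OF n] next_part_less[OF n] .
    have nt: "q \<noteq> top" using le_top[OF less(2)] qp by simp
    have "live (q + 1 - t) q" by (rule less.IH[OF qp(2) qp(1) hq])
    hence "live (nxt q + 1 - t) (nxt q)" by (rule tail_out(2)[OF tm qp(1) hq _ nt])
    thus ?thesis unfolding nxt_eq[OF n] .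
  qed
qed

end

context level_pairs begin

lemma rerouting_self: "rerouting P m b step"
  by unfold_locales (use step_bij step_arc in auto)

end

context rerouting_step begin

lemma step_low_fixed:
  assumes tm: "t \<le> m" and x: "(u, p, k) \<in> E" "\<not> settled t (u, p, k)" "p < lo t"
  shows "step (u, p, k) = (u, p, k)"
proof -
  interpret S: rerouting P m b step by (rule rerouting_self)
  interpret S: rerouting_step P m b step t by unfold_locales (use t in auto)
  show ?thesis by (rule S.low_fixed[OF assms])
qed

lemma tail_end:
  assumes tm: "t \<le> m" and p: "p \<in># P" "hi t \<le> p"
  shows "endrow (p + 1 - t) p"
proof (cases "p = hi t")
  case True
  have "midrow t (hi t + 1 - t) (hi t)" using t tm lohi(4,10)[OF t(1) tm] by (auto simp: midrow_def)
  moreover have "hi t + 1 - t + t = hi t + 1" using lohi(4,10)[OF t(1) tm] t by linarith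
  ultimately show ?thesis unfolding True endrow_def by metis
next
  case False
  hence "b t + 1 < p" using lohi(8)[OF t(1) tm p(1)] p by simp
  moreover have "p + 1 - (p + 1 - t) = t" using lohi(4,10)[OF t(1) tm] t p by linarith
  ultimately show ?thesis using tm unfolding endrow_def tailrow_def by simp
qed

lemma tail_step:
  assumes tm: "t \<le> m" and p: "p \<in># P" "hi t \<le> p"
  shows "\<pi> (p + 1 - t, p, count P p) = step (p + 1 - t, p, count P p)"
proof -
  have l2: "2 * t \<le> p + 1" using lohi(4,10)[OF t(1) tm] p by linarith
  have tp: "1 \<le> p + 1 - t" "p + 1 - t \<le> p" "0 < p" using l2 t by linarith+
  have st: "step (p + 1 - t, p, count P p) =
     (if p = top then (0, 0, p + 1 - (p + 1 - t)) else (p + 1 - t + (nxt p - p), nxt p, 1))"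
    by (rule step_end[OF tp(3,1,2) tail_end[OF tm p]])
  have o: "\<pi> (p + 1 - t, p, count P p) = (if p = top then (0, 0, t) else (nxt p + 1 - t, nxt p, 1))"
    by (rule tail_out(1)[OF tm p tail_live[OF tm p]])
  show ?thesis
  proof (cases "p = top")
    case True
    thus ?thesis using st o l2 t by simp
  next
    case False
    have "p < nxt p" by (rule next_part_less[OF next_nxt[OF p(1) False]])
    hence "p + 1 - t + (nxt p - p) = nxt p + 1 - t" using l2 t by linarith
    thus ?thesis using st o False by simp
  qed
qed

text \<open>
  Everything on level \<open>t\<close> and below its pair is now forced.
\<close>

lemma settled_Suc:
  assumes tm: "t \<le> m" and x: "x \<in> V" and s: "settled (t + 1) x"
  shows "\<pi> x = step x"
proof (cases "settled t x")
  case True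
  thus ?thesis by (rule IH[OF x])
next
  case ns: False
  show ?thesis
  proof (cases "x \<in> E")
    case False
    then obtain i where i: "x = (0, 0, i)" "1 \<le> i" "i \<le> m" using x by (auto simp: V_def)
    thus ?thesis using border_out[OF i(2,3)] step_border by simp
  next
    case True
    obtain u p k where e: "x = (u, p, k)" by (metis prod_cases3)
    note xD = True[unfolded e]
    note el = elemD[OF xD]
    have u: "t \<le> u" "u + t \<le> p + 1" using ns unsettled_iff[OF el(6), of u k] by (simp_all add: e)
    have d: "p \<le> b t + 1 \<or> u = t \<or> u + t = p + 1"
      using s settled_iff[OF el(6), of "t + 1" u k] u by (auto simp: e)
    have hl: "lo t \<le> hi t" "hi t \<le> lo t + 1" using lohi(3,4,5)[OF t(1) tm] by simp_all
    have copies: "\<pi> x = step x" if "live u p" "covrow u p" "k \<noteq> count P p"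
    proof -
      have k: "k < count P p" using that(3) el(4) by simp
      show ?thesis unfolding e
        using live_copy[OF that(1) el(5,1,2,3) k] step_copy[OF el(6) that(2) k] by simp
    qed
    consider "p < lo t" | "midrow t u p" | "hi t < p" "b t + 1 < p"
    proof -
      have "p < lo t \<or> p = lo t \<or> p = hi t \<or> hi t < p" using hl by linarith
      thus ?thesis using that lohi(8)[OF t(1) tm el(5)] u t tm unfolding midrow_def by blast
    qed
    thus ?thesis
    proof cases
      case 1
      thus ?thesis using low_fixed[OF tm xD _ 1] step_low_fixed[OF tm xD _ 1] ns by (simp add: e)
    next
      case 2
      have lv: "live u p" by (rule mid_live[OF tm 2])
      have cv: "covrow u p" using 2 by (auto simp: covrow_def)
      show ?thesis
      proof (cases "k = count P p")
        case False
        thus ?thesis by (rule copies[OF lv cv])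
      next
        case k: True
        consider "p = lo t" "u + t \<le> hi t" | "p = hi t" "lo t < hi t" "u + t \<le> hi t" | "p = hi t" "u = p + 1 - t"
          using 2 hl unfolding midrow_def by linarith
        thus ?thesis
        proof cases
          case a: 1
          show ?thesis using step_mid_up[OF el(1,2) 2 a] mid_up(1)[OF tm u(1) a(2)] unfolding e k a(1) by simp
        next
          case a: 2
          have "u + t \<noteq> p + 1" using a by simp
          thus ?thesis using step_mid_down[OF el(1,2) 2 a(1,2)] mid_down(1)[OF tm a(2) u(1) a(3)] unfolding e k a(1) by simp
        next
          case a: 3
          show ?thesis unfolding e k a(2) by (rule tail_step[OF tm el(5)]) (simp add: a(1))
        qed
      qed
    next
      case 3
      hence hp: "hi t \<le> p" by simp
      have "u = t \<or> u = p + 1 - t" using d 3 u by linarith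
      thus ?thesis
      proof
        assume ut: "u = t"
        have lv: "live u p" unfolding ut by (rule head_live[OF tm el(5) hp])
        have hr: "headrow u p" using 3 tm ut by (simp add: headrow_def)
        show ?thesis
        proof (cases "k = count P p")
          case False
          show ?thesis by (rule copies[OF lv _ False]) (simp add: covrow_def hr)
        next
          case k: True
          show ?thesis using step_head[OF el(6) hr] head_out[OF tm el(5) 3(1)] unfolding e k ut by simp
        qed
      next
        assume ut: "u = p + 1 - t"
        have lv: "live u p" unfolding ut by (rule tail_live[OF tm el(5) hp])
        have "endrow u p" unfolding ut by (rule tail_end[OF tm el(5) hp])
        hence cv: "covrow u p" by (auto simp: endrow_def covrow_def)
        show ?thesis
        proof (cases "k = count P p")
          case False
          thus ?thesis by (rule copies[OF lv cv])
        next
          case k: True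
          show ?thesis unfolding e k ut by (rule tail_step[OF tm el(5) hp])
        qed
      qed
    qed
  qed
qed

end

context rerouting begin

lemma settled_step:
  assumes "1 \<le> t" "t \<le> m + 1"
  shows "\<forall>x\<in>V. settled t x \<longrightarrow> \<pi> x = step x"
  using assms
proof (induction t rule: nat_induct_at_least)
  case base
  show ?case
  proof (intro ballI impI)
    fix x assume x: "x \<in> V" "settled 1 x"
    obtain u p k where e: "x = (u, p, k)" by (metis prod_cases3)
    show "\<pi> x = step x"
    proof (cases "x \<in> E")
      case True
      note el = elemD[OF True[unfolded e]]
      show ?thesis using x(2) settled_iff[OF el(6), of 1 u k] el by (simp add: e)
    next
      case False
      then obtain i where "x = (0, 0, i)" "1 \<le> i" using x by (auto simp: V_def)
      thus ?thesis using x(2) by (simp add: settled_border)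
    qed
  qed
next
  case (Suc t)
  interpret rerouting_step P m b \<pi> t by unfold_locales (use Suc in auto)
  show ?case using settled_Suc Suc(3) by simp
qed

lemma unsettled_fixed:
  assumes x: "x \<in> V" "\<not> settled (m + 1) x"
  shows "\<pi> x = x"
proof -
  interpret rerouting_step P m b \<pi> "m + 1" by unfold_locales (use settled_step[of "m + 1"] in auto)
  define W where "W = {z \<in> V. \<not> settled (m + 1) z}"
  have W: "W \<subseteq> E" 
  proof
    fix z assume z: "z \<in> W"
    show "z \<in> E"
    proof (rule ccontr)
      assume "z \<notin> E"
      then obtain i where "z = (0, 0, i)" "i \<le> m" using z by (auto simp: W_def V_def)
      thus False using z by (simp add: W_def settled_border)
    qed
  qed
  have inv: "\<pi> ` W \<subseteq> W"
  proof
    fix y assume "y \<in> \<pi> ` W"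
    then obtain z where z: "z \<in> W" "y = \<pi> z" by blast
    hence "z \<in> V" "\<not> settled (m + 1) z" by (simp_all add: W_def)
    thus "y \<in> W" using pi_V[of z] pi_settled[of z] z(2) by (simp add: W_def)
  qed
  have "x \<in> W" using x by (simp add: W_def)
  thus ?thesis by (rule pi_fixed_invariant[OF W inv])
qed

text \<open>
  After all levels, the unsettled vertices form an invariant set without border vertices, and there
  heights apply once more.
\<close>

lemma rerouting_unique:
  assumes x: "x \<in> V"
  shows "\<pi> x = step x"
proof (cases "settled (m + 1) x")
  case True
  thus ?thesis using settled_step[of "m + 1"] x by simp
next
  case False
  interpret S: rerouting P m b step by (rule rerouting_self)
  have "step x = x" by (rule S.unsettled_fixed[OF x False])
  thus ?thesis using unsettled_fixed[OF x False] by simp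
qed

end

context level_pairs begin

lemma step_fixed_iff:
  assumes x: "x \<in> E"
  shows "step x = x \<longleftrightarrow> x \<notin> U_chain P m b"
proof -
  obtain u p k where e: "x = (u, p, k)" by (metis prod_cases3)
  note el = elemD[OF x[unfolded e]]
  have "covrow u p \<longleftrightarrow> x \<in> U_chain P m b"
  proof
    assume "covrow u p"
    then consider "headrow u p" | "tailrow u p" | t where "midrow t u p" by (auto simp: covrow_def)
    thus "x \<in> U_chain P m b"
    proof cases
      case 1
      hence "x \<in> U_chain_level P b u" "u \<in> {1..m}" using x el by (auto simp: U_chain_level_def headrow_def e)
      thus ?thesis unfolding U_chain_def by blast
    next
      case 2
      hence "x \<in> U_chain_level P b (p + 1 - u)" "p + 1 - u \<in> {1..m}" using x el by (auto simp: U_chain_level_def tailrow_def e)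
      thus ?thesis unfolding U_chain_def by blast
    next
      case (3 t)
      hence t: "1 \<le> t" "t \<le> m" "t \<le> u" "u + t \<le> p + 1" "p = lo t \<or> p = hi t" by (auto simp: midrow_def)
      have "p = b t \<or> p = b t + 1" using lohi(3,4,5)[OF t(1,2)] t(5) by linarith
      hence "x \<in> U_chain_level P b t" using x t by (auto simp: U_chain_level_def e)
      thus ?thesis unfolding U_chain_def using t by auto
    qed
  next
    assume "x \<in> U_chain P m b"
    then obtain t where t: "1 \<le> t" "t \<le> m" "x \<in> U_chain_level P b t" by (auto simp: U_chain_def)
    have "(p = b t \<or> p = b t + 1) \<and> t \<le> u \<and> u + t \<le> p + 1 \<or> b t + 1 < p \<and> (u = t \<or> u + t = p + 1)"
      using t(3) by (auto simp: U_chain_level_def e)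
    thus "covrow u p"
    proof
      assume a: "(p = b t \<or> p = b t + 1) \<and> t \<le> u \<and> u + t \<le> p + 1"
      hence "midrow t u p" unfolding midrow_def using lohi(7)[OF t(1,2) el(5)] t by blast
      thus ?thesis by (auto simp: covrow_def)
    next
      assume a: "b t + 1 < p \<and> (u = t \<or> u + t = p + 1)"
      show ?thesis
      proof (cases "u = t")
        case True
        thus ?thesis using a t by (simp add: covrow_def headrow_def)
      next
        case False
        hence "p + 1 - u = t" using a by linarith
        thus ?thesis using a t by (simp add: covrow_def tailrow_def)
      qed
    qed
  qed
  moreover have "step x \<noteq> x" if cv: "covrow u p"
  proof (cases "k < count P p")
    case True
    thus ?thesis using step_copy[OF el(6) cv True] by (simp add: e)
  next
    case False
    hence k: "k = count P p" using el by simp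
    consider "headrow u p" | "endrow u p" | t where "midrow t u p" "\<not> (p = hi t \<and> u + t = p + 1)"
      using cv unfolding covrow_def endrow_def by blast
    thus ?thesis
    proof cases
      case 1
      have u: "1 \<le> u" "u \<le> m" using el 1 by (auto simp: headrow_def)
      have "hi u < p" using lohi(5)[OF u] 1 by (auto simp: headrow_def)
      then obtain q where n: "next_part P q p"
        using next_part_exists_below[OF el(5) lohi(2)[OF u]] by blast
      show ?thesis using step_head[OF el(6) 1] prv_eq[OF n] next_part_less[OF n] by (simp add: e k)
    next
      case 2
      note s = step_end[OF el(6,1,2) 2]
      show ?thesis
      proof (cases "p = top")
        case True
        thus ?thesis using s el by (simp add: e k)
      next
        case False
        have "p < nxt p" by (rule next_part_less[OF next_nxt[OF el(5) False]])
        thus ?thesis using s False by (simp add: e k)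
      qed
    next
      case (3 t)
      have t: "1 \<le> t" "t \<le> m" "t \<le> u" "u + t \<le> p + 1" "p = lo t \<or> p = hi t"
        using 3 by (auto simp: midrow_def)
      show ?thesis
      proof (cases "p = hi t \<and> lo t < hi t")
        case True
        have "step x = (u, lo t, 1)" unfolding e k
          by (rule step_mid_down[OF el(1,2) 3(1)]) (use True 3(2) in auto)
        thus ?thesis using True by (simp add: e)
      next
        case False
        hence pl: "p = lo t" using t lohi(4)[OF t(1,2)] by auto
        have ut: "u + t \<le> hi t" 
          using 3(2) t pl lohi(3,4,5,6)[OF t(1,2)] by (cases "lo t = hi t") auto
        have "step x = (u + 1, hi t, 1)" unfolding e k
          by (rule step_mid_up[OF el(1,2) 3(1) pl ut])
        thus ?thesis by (simp add: e)
      qed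
    qed
  qed
  ultimately show ?thesis using step_fixed[OF el(6), of u k] by (auto simp: e)
qed

end

section \<open>A commuting matrix from a U-chain\<close>

text \<open>
  Monomials with different exponents do not cancel for a suitable choice of weights; one variable is
  treated at a time by counting roots.
\<close>

lemma weighted_sum_nonzero:
  fixes C :: "'i \<Rightarrow> 'a::field" and e :: "nat \<Rightarrow> 'i \<Rightarrow> nat" and \<epsilon> :: "nat \<Rightarrow> nat"
  assumes inf: "infinite (UNIV :: 'a set)" and T: "finite T"
    and Ps: "finite Ps" "(\<Sum>p | p \<in> Ps \<and> (\<forall>t\<in>T. e t p = \<epsilon> t). C p) \<noteq> 0"
  shows "\<exists>w. (\<Sum>p\<in>Ps. C p * (\<Prod>t\<in>T. w t ^ e t p)) \<noteq> 0"
  using T Ps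
proof (induction T arbitrary: Ps rule: finite_induct)
  case empty
  thus ?case by simp
next
  case (insert s T)
  let ?R = "{p \<in> Ps. e s p = \<epsilon> s}"
  have "{p. p \<in> ?R \<and> (\<forall>t\<in>T. e t p = \<epsilon> t)} = {p. p \<in> Ps \<and> (\<forall>t\<in>insert s T. e t p = \<epsilon> t)}" by auto
  hence "(\<Sum>p | p \<in> ?R \<and> (\<forall>t\<in>T. e t p = \<epsilon> t). C p) \<noteq> 0" using insert.prems(2) by simp
  then obtain w where w: "(\<Sum>p\<in>?R. C p * (\<Prod>t\<in>T. w t ^ e t p)) \<noteq> 0"
    using insert.IH[of ?R] insert.prems(1) by auto
  define f where "f = (\<Sum>p\<in>Ps. monom (C p * (\<Prod>t\<in>T. w t ^ e t p)) (e s p))"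
  have "coeff f (\<epsilon> s) = (\<Sum>p\<in>Ps. if e s p = \<epsilon> s then C p * (\<Prod>t\<in>T. w t ^ e t p) else 0)"
    unfolding f_def coeff_sum by (intro sum.cong) auto
  also have "\<dots> = (\<Sum>p\<in>?R. C p * (\<Prod>t\<in>T. w t ^ e t p))"
    using insert.prems(1) by (simp add: sum.If_cases Int_def)
  finally have "f \<noteq> 0" using w by auto
  hence "finite {x. poly f x = 0}" by (rule poly_roots_finite)
  hence "{x. poly f x = 0} \<noteq> UNIV" using inf by metis
  then obtain x where x: "poly f x \<noteq> 0" by blast
  have "poly f x = (\<Sum>p\<in>Ps. C p * (\<Prod>t\<in>insert s T. (w(s := x)) t ^ e t p))"
  proof -
    have "(\<Prod>t\<in>T. (w(s := x)) t ^ e t p) = (\<Prod>t\<in>T. w t ^ e t p)" for p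
      using insert.hyps(2) by (intro prod.cong) auto
    thus ?thesis using insert.hyps by (simp add: f_def poly_sum poly_monom algebra_simps)
  qed
  thus ?case using x by metis
qed

locale level_matrix = jordan_coords P n \<phi> B + level_pairs P m b
  for P n and \<phi> :: "nat \<Rightarrow> nat \<times> nat \<times> nat" and B :: "'a::field mat" and m b
begin

definition weight :: "(nat \<Rightarrow> 'a) \<Rightarrow> nat \<times> nat \<times> nat \<Rightarrow> nat \<times> nat \<times> nat \<Rightarrow> 'a" where
  "weight w x y = (\<Prod>t\<in>{1..m}. if special t x y then w t else 1)"

definition level_mat :: "(nat \<Rightarrow> 'a) \<Rightarrow> 'a mat" where
  "level_mat w = mk (\<lambda>x y. if edge x y then weight w x y else 0)"

lemma edge_shift:
  assumes "1 < v"
  shows "edge (u, p, k) (v - 1, q, l) \<longleftrightarrow> edge (Suc u, p, k) (v, q, l)"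
    "special t (u, p, k) (v - 1, q, l) \<longleftrightarrow> special t (Suc u, p, k) (v, q, l)"
  using assms by auto

lemma level_mat_comm: "level_mat w \<in> comm"
  unfolding comm_iff
proof (intro conjI allI impI)
  show "level_mat w \<in> carrier_mat n n" by (simp add: level_mat_def)
  fix u p k v q l assume x: "(u, p, k) \<in> D" and y: "(v, q, l) \<in> D"
  have bx: "1 \<le> u" "u \<le> p" and bv: "1 \<le> v" "v \<le> q" using elemD(1,2)[OF x] elemD(1,2)[OF y] by auto
  let ?f = "\<lambda>x y. if edge x y then weight w x y else 0"
  have dn: "1 < v \<Longrightarrow> (v - 1, q, l) \<in> D" using y by (auto simp: poset_elems_iff)
  have up: "u < p \<Longrightarrow> (Suc u, p, k) \<in> D" using x by (auto simp: poset_elems_iff)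
  have "(if 1 < v then ?f (u, p, k) (v - 1, q, l) else 0) = (if u < p then ?f (Suc u, p, k) (v, q, l) else 0)"
  proof (cases "1 < v")
    case v: True
    show ?thesis
    proof (cases "u < p")
      case True
      thus ?thesis unfolding weight_def edge_shift[OF v] using v by (simp del: edge.simps special.simps)
    next
      case False
      hence "u = p" using bx by simp
      hence "\<not> edge (u, p, k) (v - 1, q, l)" using bv v next_part_less[of P p q] next_part_less[of P q p] by auto
      thus ?thesis using False by (simp del: edge.simps)
    qed
  next
    case False
    hence "\<not> edge (Suc u, p, k) (v, q, l)" using bv bx by auto
    thus ?thesis using False by (simp del: edge.simps)
  qed
  thus "(if 1 < v then ent (level_mat w) (u, p, k) (v - 1, q, l) else 0) =
     (if u < p then ent (level_mat w) (Suc u, p, k) (v, q, l) else 0)"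
    unfolding level_mat_def using ent_mk[OF x dn] ent_mk[OF up y] by presburger
qed

lemma level_mat_strict: "level_mat w \<in> strict"
  unfolding strict_def
proof (intro CollectI conjI ballI impI)
  show "level_mat w \<in> carrier_mat n n" by (simp add: level_mat_def)
  fix x y assume xy: "x \<in> D" "y \<in> D" "ent (level_mat w) x y \<noteq> 0"
  have "ent (level_mat w) x y = (if edge x y then weight w x y else 0)"
    unfolding level_mat_def by (rule ent_mk[OF xy(1,2)])
  hence "edge x y" using xy(3) by (simp only: split: if_splits) blast
  thus "elem_less x y" by (rule edge_less)
qed

declare special.simps [simp del] edge.simps [simp del] step.simps [simp del]

definition \<xi> :: "nat \<Rightarrow> nat \<times> nat \<times> nat" where
  "\<xi> i = (if i < n then \<phi> i else (0, 0, i - n + 1))"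

lemma border_notin: "(0, 0, t) \<notin> D" by (simp add: poset_elems_iff)

lemma xi_bij: "bij_betw \<xi> {..<n + m} V"
proof -
  have "bij_betw \<xi> {..<n} D" using bij bij_betw_cong[of "{..<n}" \<phi> \<xi> D] by (auto simp: \<xi>_def)
  moreover have "bij_betw \<xi> {n..<n + m} ((\<lambda>t. (0, 0, t)) ` {1..m})"
  proof (rule bij_betw_byWitness[where f' = "\<lambda>(u, p, k). n + k - 1"])
    show "\<xi> ` {n..<n + m} \<subseteq> (\<lambda>t. (0, 0, t)) ` {1..m}"
      by (auto simp: \<xi>_def intro!: image_eqI)
    show "(\<lambda>(u, p, k). n + k - 1) ` (\<lambda>t. (0, 0, t)) ` {1..m} \<subseteq> {n..<n + m}" by auto
  qed (auto simp: \<xi>_def)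
  moreover have "D \<inter> (\<lambda>t. (0, 0, t)) ` {1..m} = {}" using border_notin by auto
  ultimately have "bij_betw \<xi> ({..<n} \<union> {n..<n + m}) V" unfolding V_def by (rule bij_betw_combine)
  moreover have "{..<n} \<union> {n..<n + m} = {..<n + m}" by auto
  ultimately show ?thesis by simp
qed

definition \<chi> :: "nat \<times> nat \<times> nat \<Rightarrow> nat" where "\<chi> = the_inv_into {..<n + m} \<xi>"

lemma xi_V: "i < n + m \<Longrightarrow> \<xi> i \<in> V" using xi_bij by (meson bij_betwE lessThan_iff)

lemma chi_xi: "i < n + m \<Longrightarrow> \<chi> (\<xi> i) = i"
  unfolding \<chi>_def using xi_bij by (intro the_inv_into_f_f) (auto simp: bij_betw_def)

lemma xi_chi: "x \<in> V \<Longrightarrow> \<xi> (\<chi> x) = x"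
  unfolding \<chi>_def using xi_bij by (intro f_the_inv_into_f) (auto simp: bij_betw_def)

lemma chi_less: "x \<in> V \<Longrightarrow> \<chi> x < n + m"
  using the_inv_into_into[of \<xi> "{..<n + m}" x "{..<n + m}"] xi_bij by (auto simp: \<chi>_def bij_betw_def)

lemma chi_bij: "bij_betw \<chi> V {..<n + m}"
  unfolding \<chi>_def by (rule bij_betw_the_inv_into[OF xi_bij])

lemma xi_D: "i < n + m \<Longrightarrow> \<xi> i \<in> D \<longleftrightarrow> i < n"
  using phi_in border_notin by (auto simp: \<xi>_def)

lemma special_D:
  assumes "1 \<le> t" "t \<le> m" "x \<in> V" "y \<in> V" "special t x y"
  shows "x \<in> D" "y \<in> D" "x \<noteq> y"
proof -
  have h0: "0 < hi t" using lohi(2)[OF assms(1,2)] parts_pos by (metis gr0I)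
  have c0: "count P 0 = 0" using parts_pos by (simp add: count_eq_zero_iff)
  obtain u p k v q l where e: "x = (u, p, k)" "y = (v, q, l)" by (metis prod_cases3)
  have s: "k = count P p" "q = hi t" using assms(5) by (auto simp: e special.simps)
  show "y \<in> D" using assms(4) s h0 by (auto simp: V_def e)
  show "x \<in> D" using assms(3) s c0 by (auto simp: V_def e)
  show "x \<noteq> y" using assms(5) next_part_less[of P q p] by (auto simp: e special.simps split: if_splits)
qed

text \<open>
  The sign from \<open>- A\<close> in the corner; border entries are 1.
\<close>

definition sg :: "nat \<times> nat \<times> nat \<Rightarrow> nat \<times> nat \<times> nat \<Rightarrow> 'a" where
  "sg x y = (if arc x y then (if x \<in> D \<and> y \<in> D then - 1 else 1) else 0)"

text \<open>
  On border entries the weight is 1, since special edges do not touch the border.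
\<close>

definition bordered :: "(nat \<Rightarrow> 'a) \<Rightarrow> 'a mat" where
  "bordered w = mat (n + m) (n + m) (\<lambda>(i, j). sg (\<xi> i) (\<xi> j) * weight w (\<xi> i) (\<xi> j))"

lemma bordered_carrier [simp]: "bordered w \<in> carrier_mat (n + m) (n + m)" by (simp add: bordered_def)

lemma arc_edge: "x \<in> D \<Longrightarrow> y \<in> D \<Longrightarrow> arc x y \<longleftrightarrow> edge x y"
  using border_notin by (auto simp: arc_def)

lemma bordered_entry:
  assumes "i < n" "j < n"
  shows "bordered w $$ (i, j) = - level_mat w $$ (i, j)"
proof -
  have d: "\<phi> i \<in> D" "\<phi> j \<in> D" using phi_in assms by auto
  have "bordered w $$ (i, j) = sg (\<phi> i) (\<phi> j) * weight w (\<phi> i) (\<phi> j)"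
    using assms by (simp add: bordered_def \<xi>_def)
  also have "\<dots> = - (if edge (\<phi> i) (\<phi> j) then weight w (\<phi> i) (\<phi> j) else 0)"
    using d arc_edge[OF d] by (simp add: sg_def)
  finally show ?thesis using assms by (simp add: level_mat_def mk_def)
qed

lemma bordered_diag: "i < n \<Longrightarrow> bordered w $$ (i, i) = 0"
proof -
  assume i: "i < n"
  have "\<not> edge (\<phi> i) (\<phi> i)" using edge_less elem_less_irrefl by blast
  thus ?thesis using bordered_entry[OF i i] i by (simp add: level_mat_def mk_def)
qed

definition perm_on :: "(nat \<Rightarrow> nat) \<Rightarrow> nat \<times> nat \<times> nat \<Rightarrow> nat \<times> nat \<times> nat" where
  "perm_on p x = \<xi> (p (\<chi> x))"

definition moved :: "(nat \<Rightarrow> nat) \<Rightarrow> nat set" where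
  "moved p = {i. i < n + m \<and> \<not> (i < n \<and> p i = i)}"

text \<open>
  The exponent of the weight \<open>w t\<close> in the term of the permutation \<open>p\<close>.
\<close>

definition expo :: "nat \<Rightarrow> (nat \<Rightarrow> nat) \<Rightarrow> nat" where
  "expo t p = card {x \<in> V. special t x (perm_on p x)}"

lemma perm_on_bij:
  assumes "p permutes {0..<n + m}"
  shows "bij_betw (perm_on p) V V"
proof -
  have "bij_betw p {..<n + m} {..<n + m}" using permutes_imp_bij[OF assms] by (simp add: atLeast0LessThan)
  hence "bij_betw (\<xi> \<circ> (p \<circ> \<chi>)) V V" using bij_betw_trans[OF bij_betw_trans[OF chi_bij] xi_bij] by simp
  moreover have "\<xi> \<circ> (p \<circ> \<chi>) = perm_on p" by (auto simp: perm_on_def)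
  ultimately show ?thesis by simp
qed

lemma expo_moved:
  assumes p: "p permutes {0..<n + m}" and t: "t \<in> {1..m}"
  shows "card {i \<in> moved p. special t (\<xi> i) (\<xi> (p i))} = expo t p"
proof -
  have pl: "i < n + m \<Longrightarrow> p i < n + m" for i using permutes_in_image[OF p, of i] by simp
  have eq: "\<xi> ` {i \<in> moved p. special t (\<xi> i) (\<xi> (p i))} = {x \<in> V. special t x (perm_on p x)}"
  proof (intro equalityI subsetI)
    fix x assume "x \<in> \<xi> ` {i \<in> moved p. special t (\<xi> i) (\<xi> (p i))}"
    then obtain i where i: "x = \<xi> i" "i < n + m" "special t (\<xi> i) (\<xi> (p i))" by (auto simp: moved_def)
    thus "x \<in> {x \<in> V. special t x (perm_on p x)}" using xi_V chi_xi by (simp add: perm_on_def)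
  next
    fix x assume "x \<in> {x \<in> V. special t x (perm_on p x)}"
    hence x: "x \<in> V" "special t x (\<xi> (p (\<chi> x)))" by (auto simp: perm_on_def)
    have l: "\<chi> x < n + m" by (rule chi_less[OF x(1)])
    have "x \<noteq> \<xi> (p (\<chi> x))" using special_D(3)[OF _ _ x(1) xi_V[OF pl[OF l]] x(2)] t by simp
    hence "p (\<chi> x) \<noteq> \<chi> x" using xi_chi[OF x(1)] by metis
    hence "\<chi> x \<in> moved p" using l by (simp add: moved_def)
    moreover have "special t (\<xi> (\<chi> x)) (\<xi> (p (\<chi> x)))" using x xi_chi[OF x(1)] by simp
    ultimately show "x \<in> \<xi> ` {i \<in> moved p. special t (\<xi> i) (\<xi> (p i))}"
      using xi_chi[OF x(1)] by (intro image_eqI[of _ _ "\<chi> x"]) auto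
  qed
  have inj: "inj_on \<xi> {i \<in> moved p. special t (\<xi> i) (\<xi> (p i))}"
    by (rule inj_on_subset[OF bij_betw_imp_inj_on[OF xi_bij]]) (auto simp: moved_def)
  show ?thesis unfolding expo_def eq[symmetric] by (rule card_image[OF inj, symmetric])
qed

lemma moved_product:
  assumes p: "p permutes {0..<n + m}"
  shows "(\<Prod>i\<in>moved p. bordered w $$ (i, p i)) =
    (\<Prod>i\<in>moved p. sg (\<xi> i) (\<xi> (p i))) * (\<Prod>t\<in>{1..m}. w t ^ expo t p)"
proof -
  have pl: "i < n + m \<Longrightarrow> p i < n + m" for i using permutes_in_image[OF p, of i] by simp
  have fin: "finite (moved p)" by (simp add: moved_def)
  have "(\<Prod>i\<in>moved p. bordered w $$ (i, p i)) =
     (\<Prod>i\<in>moved p. sg (\<xi> i) (\<xi> (p i)) * weight w (\<xi> i) (\<xi> (p i)))"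
    by (rule prod.cong[OF refl]) (simp add: bordered_def moved_def pl)
  also have "\<dots> = (\<Prod>i\<in>moved p. sg (\<xi> i) (\<xi> (p i))) * (\<Prod>i\<in>moved p. weight w (\<xi> i) (\<xi> (p i)))"
    by (rule prod.distrib)
  also have "(\<Prod>i\<in>moved p. weight w (\<xi> i) (\<xi> (p i))) =
     (\<Prod>t\<in>{1..m}. \<Prod>i\<in>moved p. if special t (\<xi> i) (\<xi> (p i)) then w t else 1)"
    unfolding weight_def by (rule prod.swap)
  also have "\<dots> = (\<Prod>t\<in>{1..m}. w t ^ expo t p)"
  proof (rule prod.cong[OF refl])
    fix t assume t: "t \<in> {1..m}"
    have "(\<Prod>i\<in>moved p. if special t (\<xi> i) (\<xi> (p i)) then w t else 1) =
       (\<Prod>i\<in>{i \<in> moved p. special t (\<xi> i) (\<xi> (p i))}. w t)"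
      by (rule prod.inter_filter[OF fin, symmetric])
    also have "\<dots> = w t ^ expo t p" by (simp only: prod_constant expo_moved[OF p t])
    finally show "(\<Prod>i\<in>moved p. if special t (\<xi> i) (\<xi> (p i)) then w t else 1) = w t ^ expo t p" .
  qed
  finally show ?thesis .
qed

definition step_perm :: "nat \<Rightarrow> nat" where
  "step_perm i = (if i < n + m then \<chi> (step (\<xi> i)) else i)"

lemma step_V: "x \<in> V \<Longrightarrow> step x \<in> V" using step_bij by (rule bij_betw_apply)

lemma step_perm_permutes: "step_perm permutes {0..<n + m}"
proof (rule bij_imp_permutes)
  have "bij_betw (\<chi> \<circ> (step \<circ> \<xi>)) {..<n + m} {..<n + m}"
    by (rule bij_betw_trans[OF bij_betw_trans[OF xi_bij step_bij] chi_bij])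
  moreover have "bij_betw step_perm {..<n + m} {..<n + m} \<longleftrightarrow> bij_betw (\<chi> \<circ> (step \<circ> \<xi>)) {..<n + m} {..<n + m}"
    by (rule bij_betw_cong) (simp add: step_perm_def)
  ultimately show "bij_betw step_perm {0..<n + m} {0..<n + m}" by (simp add: atLeast0LessThan)
qed (simp add: step_perm_def)

lemma perm_on_step: "x \<in> V \<Longrightarrow> perm_on step_perm x = step x"
  using chi_less xi_chi step_V by (simp add: perm_on_def step_perm_def)

lemma step_perm_arc:
  assumes "i \<in> moved step_perm"
  shows "arc (\<xi> i) (\<xi> (step_perm i))"
proof -
  have i: "i < n + m" "\<not> (i < n \<and> step_perm i = i)" using assms by (auto simp: moved_def)
  have V: "\<xi> i \<in> V" by (rule xi_V[OF i(1)])
  have e: "\<xi> (step_perm i) = step (\<xi> i)" using xi_chi[OF step_V[OF V]] i by (simp add: step_perm_def)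
  have nf: "\<not> (\<xi> i \<in> D \<and> step (\<xi> i) = \<xi> i)"
  proof
    assume "\<xi> i \<in> D \<and> step (\<xi> i) = \<xi> i"
    hence "i < n" "step_perm i = i" using xi_D[OF i(1)] chi_xi[OF i(1)] i by (auto simp: step_perm_def)
    thus False using i by simp
  qed
  show ?thesis unfolding e using step_arc[OF V] nf by blast
qed

lemma step_perm_fixed: "card {i. i < n \<and> step_perm i = i} = n - card (U_chain P m b)"
proof -
  have eq: "\<phi> ` {i. i < n \<and> step_perm i = i} = D - U_chain P m b"
  proof (intro equalityI subsetI)
    fix x assume "x \<in> \<phi> ` {i. i < n \<and> step_perm i = i}"
    then obtain i where i: "i < n" "step_perm i = i" "x = \<phi> i" by blast
    have "\<xi> i = x" "i < n + m" using i by (simp_all add: \<xi>_def)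
    have xD: "x \<in> D" using i phi_in by simp
    hence "x \<in> V" by (simp add: V_def)
    have "\<chi> (step x) = i" using i \<open>\<xi> i = x\<close> by (simp add: step_perm_def)
    hence "step x = x" using xi_chi[OF step_V[OF \<open>x \<in> V\<close>]] \<open>\<xi> i = x\<close> by metis
    thus "x \<in> D - U_chain P m b" using step_fixed_iff[OF xD] xD by simp
  next
    fix x assume x: "x \<in> D - U_chain P m b"
    hence xD: "x \<in> D" and xV: "x \<in> V" by (auto simp: V_def)
    have s: "step x = x" using step_fixed_iff[OF xD] x by simp
    have l: "\<chi> x < n" using xi_D[OF chi_less[OF xV]] xi_chi[OF xV] xD by simp
    have "\<phi> (\<chi> x) = x" using xi_chi[OF xV] l by (simp add: \<xi>_def)
    moreover have "step_perm (\<chi> x) = \<chi> x" using s xi_chi[OF xV] by (simp add: step_perm_def)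
    ultimately show "x \<in> \<phi> ` {i. i < n \<and> step_perm i = i}" using l by (metis (mono_tags, lifting) image_eqI mem_Collect_eq)
  qed
  have inj: "inj_on \<phi> {i. i < n \<and> step_perm i = i}"
    by (rule inj_on_subset[OF bij_betw_imp_inj_on[OF bij]]) auto
  have "card {i. i < n \<and> step_perm i = i} = card (D - U_chain P m b)"
    unfolding eq[symmetric] by (rule card_image[OF inj, symmetric])
  also have "\<dots> = n - card (U_chain P m b)"
    using card_Diff_subset[of "U_chain P m b" D] U_chain_subset[of P m b] card_D finite_subset[OF U_chain_subset[of P m b]] by simp
  finally show ?thesis .
qed

text \<open>
  A contributing permutation with the exponents of \<open>step\<close> is a rerouting.
\<close>

lemma step_perm_unique:
  assumes p: "p permutes {0..<n + m}" and a: "\<And>i. i \<in> moved p \<Longrightarrow> arc (\<xi> i) (\<xi> (p i))"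
    and c: "\<And>t. t \<in> {1..m} \<Longrightarrow> expo t p = expo t step_perm"
  shows "p = step_perm"
proof -
  have cs: "expo t step_perm = card {x \<in> V. special t x (step x)}" for t
    unfolding expo_def by (rule arg_cong[where f = card]) (auto simp: perm_on_step)
  interpret rerouting P m b "perm_on p"
  proof unfold_locales
    show "bij_betw (perm_on p) V V" by (rule perm_on_bij[OF p])
    show "x \<in> D \<and> perm_on p x = x \<or> arc x (perm_on p x)" if x: "x \<in> V" for x
    proof (cases "\<chi> x \<in> moved p")
      case True
      thus ?thesis using a[OF True] xi_chi[OF x] by (simp add: perm_on_def)
    next
      case False
      hence "\<chi> x < n" "p (\<chi> x) = \<chi> x" using chi_less[OF x] by (auto simp: moved_def)
      thus ?thesis using xi_D[OF chi_less[OF x]] xi_chi[OF x] by (simp add: perm_on_def)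
    qed
    show "card {x \<in> V. special t x (perm_on p x)} = card {x \<in> V. special t x (step x)}"
      if "1 \<le> t" "t \<le> m" for t
      using c[of t] that cs[of t] by (simp add: expo_def)
  qed
  show ?thesis
  proof
    fix i
    show "p i = step_perm i"
    proof (cases "i < n + m")
      case True
      have "\<xi> (p i) = step (\<xi> i)" using rerouting_unique[OF xi_V[OF True]] chi_xi[OF True] by (simp add: perm_on_def)
      moreover have "p i < n + m" using permutes_in_image[OF p, of i] True by simp
      ultimately show ?thesis using chi_xi[of "p i"] True by (simp add: step_perm_def)
    next
      case False
      thus ?thesis using permutes_not_in[OF p, of i] by (simp add: step_perm_def)
    qed
  qed
qed

text \<open>
  The coefficient is a polynomial in the weights in which the monomial of \<open>step\<close> comes from one permutation
  only.  The fixed points of \<open>step\<close> are the elements outside the U-chain.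
\<close>

lemma level_defect:
  assumes inf: "infinite (UNIV :: 'a set)"
  shows "\<exists>A\<in>comm \<inter> strict. defect A m (n - card (U_chain P m b))"
proof -
  let ?d = "n - card (U_chain P m b)"
  define Ps where "Ps = {p. p permutes {0..<n + m} \<and> card {i. i < n \<and> p i = i} = ?d}"
  define C :: "(nat \<Rightarrow> nat) \<Rightarrow> 'a" where "C p = signof p * (\<Prod>i\<in>moved p. sg (\<xi> i) (\<xi> (p i)))" for p
  have fin: "finite Ps" unfolding Ps_def by (rule finite_subset[OF _ finite_permutations[of "{0..<n + m}"]]) auto
  have finm: "finite (moved p)" for p by (simp add: moved_def)
  have co: "coeff (det (zdiag n (bordered w))) ?d = (\<Sum>p\<in>Ps. C p * (\<Prod>t\<in>{1..m}. w t ^ expo t p))" for w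
  proof -
    have "coeff (det (zdiag n (bordered w))) ?d =
      (\<Sum>p\<in>Ps. signof p * (\<Prod>i\<in>moved p. bordered w $$ (i, p i)))"
      unfolding Ps_def moved_def by (rule coeff_det_zdiag[OF bordered_carrier bordered_diag]) auto
    also have "\<dots> = (\<Sum>p\<in>Ps. C p * (\<Prod>t\<in>{1..m}. w t ^ expo t p))"
      by (rule sum.cong[OF refl]) (simp add: Ps_def moved_product C_def mult.assoc)
    finally show ?thesis .
  qed
  have p0: "step_perm \<in> Ps" using step_perm_permutes step_perm_fixed by (simp add: Ps_def)
  have C0: "C step_perm \<noteq> 0"
  proof -
    have "sg (\<xi> i) (\<xi> (step_perm i)) \<noteq> 0" if "i \<in> moved step_perm" for i
      using step_perm_arc[OF that] by (simp add: sg_def)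
    hence "(\<Prod>i\<in>moved step_perm. sg (\<xi> i) (\<xi> (step_perm i))) \<noteq> 0" using finm by simp
    thus ?thesis by (simp add: C_def sign_def)
  qed
  have z: "C p = 0" if p: "p \<in> Ps" "\<forall>t\<in>{1..m}. expo t p = expo t step_perm" "p \<noteq> step_perm" for p
  proof (rule ccontr)
    assume "C p \<noteq> 0"
    hence "(\<Prod>i\<in>moved p. sg (\<xi> i) (\<xi> (p i))) \<noteq> 0" by (auto simp: C_def)
    hence "sg (\<xi> i) (\<xi> (p i)) \<noteq> 0" if "i \<in> moved p" for i using that finm by simp
    hence "arc (\<xi> i) (\<xi> (p i))" if "i \<in> moved p" for i using that unfolding sg_def by metis
    hence "p = step_perm" using step_perm_unique[of p] p by (simp add: Ps_def)
    thus False using p by simp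
  qed
  let ?S = "{p. p \<in> Ps \<and> (\<forall>t\<in>{1..m}. expo t p = expo t step_perm)}"
  have "(\<Sum>p\<in>?S. C p) = (\<Sum>p\<in>{step_perm}. C p)"
    by (rule sum.mono_neutral_right) (use fin p0 z in auto)
  hence "(\<Sum>p\<in>?S. C p) \<noteq> 0" using C0 by simp
  then obtain w where w: "(\<Sum>p\<in>Ps. C p * (\<Prod>t\<in>{1..m}. w t ^ expo t p)) \<noteq> 0"
    using weighted_sum_nonzero[OF inf finite_atLeastAtMost fin, where C = C and e = expo and \<epsilon> = "\<lambda>t. expo t step_perm"]
    by blast
  have dim: "dim_row (level_mat w) = n" by (simp add: level_mat_def mk_def)
  have "defect (level_mat w) m ?d"
    unfolding defect_def dim using w bordered_entry co[of w]
    by (intro bexI[of _ "bordered w"]) auto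
  thus ?thesis using level_mat_comm level_mat_strict by blast
qed

end

section \<open>The smallest parts of the generic Jordan types\<close>

text \<open>
  In each class order the elements by \<open>h\<close> and send each to the next one; only the first element of a class
  is not a successor.
\<close>

lemma class_successors:
  fixes h :: "'b \<Rightarrow> nat" and c :: "'b \<Rightarrow> 'c"
  assumes fin: "finite K" and inj: "\<And>x y. x \<in> K \<Longrightarrow> y \<in> K \<Longrightarrow> c x = c y \<Longrightarrow> h x = h y \<Longrightarrow> x = y"
  obtains S s where "S \<subseteq> K" "s ` S \<subseteq> K" "inj_on s S"
    "\<And>x. x \<in> S \<Longrightarrow> c (s x) = c x \<and> h x < h (s x)" "inj_on c (K - s ` S)"
proof -
  define R where "R x = {y \<in> K. c y = c x \<and> h x < h y}" for x
  define S where "S = {x \<in> K. R x \<noteq> {}}"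
  define s where "s x = arg_min_on h (R x)" for x
  have finR: "finite (R x)" for x using fin by (simp add: R_def)
  have sR: "s x \<in> R x" if "x \<in> S" for x
    unfolding s_def by (rule arg_min_if_finite(1)[OF finR]) (use that in \<open>simp add: S_def\<close>)
  have smin: "h (s x) \<le> h y" if "y \<in> R x" for x y
    using arg_min_if_finite(2)[OF finR[of x], of h] that unfolding s_def by fastforce
  have inj_s: "inj_on s S"
  proof (rule inj_onI)
    have no: "\<not> h x < h x'" if "x \<in> S" "x' \<in> S" "s x = s x'" for x x'
    proof
      assume "h x < h x'"
      moreover have "c x = c x'" using sR[OF that(1)] sR[OF that(2)] that(3) by (simp add: R_def)
      ultimately have "x' \<in> R x" using that(2) by (simp add: R_def S_def)
      hence "h (s x) \<le> h x'" by (rule smin)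
      moreover have "h x' < h (s x')" using sR[OF that(2)] by (simp add: R_def)
      ultimately show False using that(3) by simp
    qed
    fix x x' assume x: "x \<in> S" "x' \<in> S" "s x = s x'"
    have "c x = c x'" using sR[OF x(1)] sR[OF x(2)] x(3) by (simp add: R_def)
    moreover have "h x = h x'" using no[OF x] no[OF x(2,1) x(3)[symmetric]] by simp
    ultimately show "x = x'" using inj[of x x'] x by (simp add: S_def)
  qed
  have inj_c: "inj_on c (K - s ` S)"
  proof (rule inj_onI)
    have no: "\<not> h x < h y" if "x \<in> K" "y \<in> K - s ` S" "c x = c y" for x y
    proof
      assume lt: "h x < h y"
      let ?L = "{z \<in> K. c z = c y \<and> h z < h y}"
      have "finite ?L" "?L \<noteq> {}" using fin that lt by auto
      hence "Max (h ` ?L) \<in> h ` ?L" by (intro Max_in) auto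
      then obtain z where z: "z \<in> ?L" "h z = Max (h ` ?L)" by force
      have "y \<in> R z" using z that by (simp add: R_def)
      hence zS: "z \<in> S" using z by (auto simp: S_def)
      have w: "s z \<in> K" "c (s z) = c y" "h z < h (s z)" using sR[OF zS] z by (auto simp: R_def)
      have "h (s z) \<le> h y" by (rule smin[OF \<open>y \<in> R z\<close>])
      moreover have "\<not> h (s z) < h y"
      proof
        assume "h (s z) < h y"
        hence "s z \<in> ?L" using w by simp
        hence "h (s z) \<le> h z" unfolding z(2) using \<open>finite ?L\<close> by (intro Max_ge) auto
        thus False using w by simp
      qed
      ultimately have "s z = y" using inj[of "s z" y] w that by simp
      thus False using zS that by blast
    qed
    fix x y assume xy: "x \<in> K - s ` S" "y \<in> K - s ` S" "c x = c y"
    have K: "x \<in> K" "y \<in> K" using xy by blast+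
    have "h x = h y" using no[OF K(1) xy(2,3)] no[OF K(2) xy(1) xy(3)[symmetric]] by linarith
    thus "x = y" by (rule inj[OF K xy(3)])
  qed
  show ?thesis
    by (rule that[of S s]) (use inj_s inj_c sR in \<open>auto simp: R_def S_def\<close>)
qed

context jordan_coords
begin

text \<open>
  The 0-1 matrix that follows an optimal family of chains, made disjoint by assigning each element to the
  first chain containing it.
\<close>

lemma chains_defect: "\<exists>A\<in>strict. defect A m (n - max_chain_union P m)"
proof -
  obtain C where C: "\<And>i. i < m \<Longrightarrow> C i \<in> Chains (poset_order P)" "max_chain_union P m = card (\<Union>i<m. C i)"
    by (rule max_chain_union_attained[of m P]) blast
  define K where "K = (\<Union>i<m. C i)"
  define c where "c x = (LEAST i. i < m \<and> x \<in> C i)" for x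
  have KD: "K \<subseteq> D" using C(1) by (auto simp: K_def Chains_poset_order)
  have finK: "finite K" by (rule finite_subset[OF KD]) simp
  have cx: "c x < m \<and> x \<in> C (c x)" if x: "x \<in> K" for x
  proof -
    obtain i where "i < m \<and> x \<in> C i" using x by (auto simp: K_def)
    thus ?thesis unfolding c_def by (rule LeastI)
  qed
  have comp: "x = y \<or> elem_less x y \<or> elem_less y x" if "x \<in> K" "y \<in> K" "c x = c y" for x y
    using cx[OF that(1)] cx[OF that(2)] C(1)[of "c x"] that(3) by (auto simp: Chains_poset_order)
  have hl: "elem_height P x < elem_height P y" if "x \<in> K" "elem_less x y" for x y
    by (rule elem_height_less) (use that KD in auto)
  have injh: "x = y" if "x \<in> K" "y \<in> K" "c x = c y" "elem_height P x = elem_height P y" for x y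
    using comp[OF that(1-3)] hl[OF that(1), of y] hl[OF that(2), of x] that(4) by auto
  obtain T s where s: "T \<subseteq> K" "s ` T \<subseteq> K" "inj_on s T"
    "\<And>x. x \<in> T \<Longrightarrow> c (s x) = c x \<and> elem_height P x < elem_height P (s x)" "inj_on c (K - s ` T)"
    using class_successors[OF finK, of c "elem_height P"] injh by metis
  have lt: "elem_less x (s x)" if "x \<in> T" for x
  proof -
    have "x \<in> K" "s x \<in> K" using that s by auto
    thus ?thesis using comp[of x "s x"] s(4)[OF that] hl[of "s x" x] by auto
  qed
  define A where "A = mk (\<lambda>x y. if x \<in> T \<and> y = s x then 1 else 0)"
  have Ac: "A \<in> carrier_mat n n" by (simp add: A_def)
  have "A \<in> strict" unfolding strict_def
  proof (intro CollectI conjI ballI impI)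
    fix x y assume xy: "x \<in> D" "y \<in> D" "ent A x y \<noteq> 0"
    have "ent A x y = (if x \<in> T \<and> y = s x then 1 else 0)" unfolding A_def by (rule ent_mk[OF xy(1,2)])
    hence "x \<in> T \<and> y = s x" using xy(3) by presburger
    thus "elem_less x y" using lt by simp
  qed (rule Ac)
  moreover have "defect A m (n - card {i. i < n \<and> \<phi> i \<in> K})"
  proof (rule defect_partial_injection[OF Ac, where S = "{i. i < n \<and> \<phi> i \<in> T}" and s = "\<lambda>i. \<psi> (s (\<phi> i))"
        and h = "\<lambda>i. elem_height P (\<phi> i)"])
    have sD: "s (\<phi> i) \<in> D" if "\<phi> i \<in> T" for i using that s(2) KD by auto
    show "A $$ (i, j) = (if i \<in> {i. i < n \<and> \<phi> i \<in> T} \<and> j = \<psi> (s (\<phi> i)) then 1 else 0)"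
      if "i < n" "j < n" for i j
    proof -
      have "\<phi> i \<in> T \<Longrightarrow> \<phi> j = s (\<phi> i) \<longleftrightarrow> j = \<psi> (s (\<phi> i))"
        using psi_phi[OF that(2)] phi_psi[OF sD[of i]] by metis
      thus ?thesis using that by (auto simp: A_def mk_def)
    qed
    show "(\<lambda>i. \<psi> (s (\<phi> i))) ` {i. i < n \<and> \<phi> i \<in> T} \<subseteq> {..<n}" using psi_less[OF sD] by auto
    show "inj_on (\<lambda>i. \<psi> (s (\<phi> i))) {i. i < n \<and> \<phi> i \<in> T}"
    proof (rule inj_onI)
      fix i j assume ij: "i \<in> {i. i < n \<and> \<phi> i \<in> T}" "j \<in> {i. i < n \<and> \<phi> i \<in> T}" "\<psi> (s (\<phi> i)) = \<psi> (s (\<phi> j))"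
      hence "s (\<phi> i) = s (\<phi> j)" using psi_eq_iff[OF sD[of i] sD[of j]] by simp
      hence "\<phi> i = \<phi> j" using s(3) ij by (auto simp: inj_on_def)
      thus "i = j" using phi_eq_iff ij by simp
    qed
    show "elem_height P (\<phi> i) < elem_height P (\<phi> (\<psi> (s (\<phi> i))))" if "i \<in> {i. i < n \<and> \<phi> i \<in> T}" for i
      using phi_psi[OF sD[of i]] s(4)[of "\<phi> i"] that by simp
    show "i \<in> {i. i < n \<and> \<phi> i \<in> K} \<longleftrightarrow> \<psi> (s (\<phi> i)) \<in> {i. i < n \<and> \<phi> i \<in> K}"
      if "i \<in> {i. i < n \<and> \<phi> i \<in> T}" for i
    proof -
      have i: "i < n" "\<phi> i \<in> T" using that by auto
      have "s (\<phi> i) \<in> K" "\<phi> i \<in> K" using i s(1,2) by auto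
      thus ?thesis using phi_psi[OF sD[OF i(2)]] psi_less[OF sD[OF i(2)]] i by simp
    qed
    let ?R = "{i. i < n \<and> \<phi> i \<in> K} - (\<lambda>i. \<psi> (s (\<phi> i))) ` {i. i < n \<and> \<phi> i \<in> T}"
    have "\<phi> ` ?R \<subseteq> K - s ` T"
    proof
      fix x assume "x \<in> \<phi> ` ?R"
      then obtain i where i: "x = \<phi> i" "i < n" "\<phi> i \<in> K" "i \<notin> (\<lambda>i. \<psi> (s (\<phi> i))) ` {i. i < n \<and> \<phi> i \<in> T}" by auto
      have "x \<notin> s ` T"
      proof
        assume "x \<in> s ` T"
        then obtain y where y: "y \<in> T" "x = s y" by blast
        have yD: "y \<in> D" using y s(1) KD by auto
        have "i = \<psi> (s (\<phi> (\<psi> y)))" using y i psi_phi[OF i(2)] phi_psi[OF yD] by simp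
        moreover have "\<psi> y \<in> {i. i < n \<and> \<phi> i \<in> T}" using psi_less[OF yD] phi_psi[OF yD] y by simp
        ultimately show False using i(4) by blast
      qed
      thus "x \<in> K - s ` T" using i by simp
    qed
    moreover have "inj_on \<phi> ?R" using bij by (auto simp: bij_betw_def intro: inj_on_subset)
    moreover have "card (K - s ` T) \<le> card {..<m}"
    proof (rule card_inj_on_le[OF s(5)])
      show "c ` (K - s ` T) \<subseteq> {..<m}" using cx by auto
    qed simp
    ultimately show "card ?R \<le> m" using card_inj_on_le[of \<phi> ?R "K - s ` T"] finK by simp
  qed (use phi_in in auto)
  moreover have "card {i. i < n \<and> \<phi> i \<in> K} = max_chain_union P m"
  proof -
    have "\<phi> ` {i. i < n \<and> \<phi> i \<in> K} = K"
    proof (intro equalityI subsetI)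
      fix x assume x: "x \<in> K"
      hence "x \<in> D" using KD by auto
      thus "x \<in> \<phi> ` {i. i < n \<and> \<phi> i \<in> K}" using x phi_psi psi_less by (intro image_eqI[of _ _ "\<psi> x"]) auto
    qed auto
    moreover have "inj_on \<phi> {i. i < n \<and> \<phi> i \<in> K}" using bij by (auto simp: bij_betw_def intro: inj_on_subset)
    ultimately show ?thesis unfolding C(2) K_def[symmetric] by (metis card_image)
  qed
  ultimately show ?thesis by metis
qed

lemma min_defect_strict: "min_defect strict m = n - max_chain_union P m"
  unfolding min_defect_def
proof (rule Least_equality)
  show "\<exists>A\<in>strict. defect A m (n - max_chain_union P m)" by (rule chains_defect)
  show "n - max_chain_union P m \<le> d" if "\<exists>A\<in>strict. defect A m d" for d
    using that strict_defect_chains card_D by fastforce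
qed

text \<open>
  The numbers \<open>\<lambda>\<^sub>k\<close> are the parts of the generic Jordan type of the strict incidence algebra, so
  they are decreasing.
\<close>

lemma lambda_part_sorted:
  assumes "infinite (UNIV :: 'a set)"
  obtains qs where "sorted_wrt (\<ge>) qs"
    "\<And>k. 1 \<le> k \<Longrightarrow> lambda_part P k = (if k \<le> length qs then qs ! (k - 1) else 0)"
proof -
  have jt: "\<exists>Q. has_jordan_type A Q" if "A \<in> strict" for A
    using nilpotent_has_jordan_type[OF _ strict_nilpotent[OF that]] that by (auto simp: strict_def)
  obtain qs where qs: "sorted_wrt (\<ge>) qs" "\<And>m. tail_sum qs m = min_defect strict m"
    by (rule generic_jordan_type[OF strict_irreducible[OF assms] jt]) blast+
  have t: "tail_sum qs k = n - max_chain_union P k" for k using qs(2) min_defect_strict by simp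
  have mc: "max_chain_union P k = n - tail_sum qs k" for k
    using t[of k] max_chain_union_le[of P k] card_D by simp
  have le: "tail_sum qs k \<le> n" for k using t[of k] by simp
  have "lambda_part P k = (if k \<le> length qs then qs ! (k - 1) else 0)" if k: "1 \<le> k" for k
  proof (cases "k \<le> length qs")
    case True
    have "drop (k - 1) qs = qs ! (k - 1) # drop k qs"
      using Cons_nth_drop_Suc[of "k - 1" qs] True k by simp
    hence "tail_sum qs (k - 1) = qs ! (k - 1) + tail_sum qs k" by (simp add: tail_sum_def)
    thus ?thesis using True le[of "k - 1"] by (simp add: lambda_part_def mc)
  next
    case False
    hence "tail_sum qs (k - 1) = 0" "tail_sum qs k = 0" by (simp_all add: tail_sum_def)
    thus ?thesis using False by (simp add: lambda_part_def mc)
  qed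
  thus ?thesis using that qs(1) by blast
qed

text \<open>
  The sequence decreases, vanishes beyond \<open>r\<close>, and has the value \<open>min_cut\<close> at \<open>r\<close>.
\<close>

lemma min_lambda:
  assumes inf: "infinite (UNIV :: 'a set)" and g: "greedy_cover P a r"
  shows "min_part_seq (lambda_part P) = greedy_cover.min_cut P a r"
proof -
  interpret G: greedy_cover P a r by (rule g)
  obtain qs where qs: "sorted_wrt (\<ge>) qs"
    "\<And>k. 1 \<le> k \<Longrightarrow> lambda_part P k = (if k \<le> length qs then qs ! (k - 1) else 0)"
    by (rule lambda_part_sorted[OF inf]) blast
  have lr: "lambda_part P r = G.min_cut"
    using G.max_union_last(1) G.max_chain_union_full[of r] by (simp add: lambda_part_def)
  hence rl: "r \<le> length qs" "qs ! (r - 1) = G.min_cut"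
    using qs(2)[OF G.r_pos] G.min_cut_pos by (auto split: if_splits)
  show ?thesis
  proof (rule min_part_seqI[of r])
    show "G.min_cut \<le> lambda_part P k" if k: "1 \<le> k" "k \<le> r" for k
    proof (cases "k = r")
      case True
      thus ?thesis using lr by simp
    next
      case False
      hence "qs ! (r - 1) \<le> qs ! (k - 1)"
        using sorted_wrt_nth_less[OF qs(1), of "k - 1" "r - 1"] k rl by simp
      thus ?thesis using qs(2)[OF k(1)] k rl by simp
    qed
    show "lambda_part P k = 0" if "r < k" for k
      using that G.max_chain_union_full[of k] G.max_chain_union_full[of "k - 1"] by (simp add: lambda_part_def)
  qed (use lr G.min_cut_pos G.r_pos in auto)
qed

lemma level_defect_nilcomm:
  assumes inf: "infinite (UNIV :: 'a set)" and "level_pairs P m b"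
  shows "\<exists>A\<in>nilcomm. defect A m (n - card (U_chain P m b))"
proof -
  interpret L: level_pairs P m b by fact
  interpret level_matrix P n \<phi> B m b ..
  show ?thesis using level_defect[OF inf] comm_strict_nilcomm by blast
qed

text \<open>
  The least defects for \<open>r\<close> and \<open>r - 1\<close> determine the number of parts and the last one.  Upper bounds come from
  matrices that sweep out the U-chain of all levels and the one missing a minimal cut; lower bounds hold
  as every nilpotent commuting matrix is similar to one supported on the strict order.
\<close>

lemma min_generic_part:
  assumes inf: "infinite (UNIV :: 'a set)" and g: "greedy_cover P a r"
  obtains Q U where "zariski_open_in n nilcomm U" "U \<noteq> {}" "\<And>A. A \<in> U \<Longrightarrow> has_jordan_type A Q"
    "\<And>U' Q'. zariski_open_in n nilcomm U' \<Longrightarrow> U' \<noteq> {} \<Longrightarrow> (\<And>A. A \<in> U' \<Longrightarrow> has_jordan_type A Q') \<Longrightarrow> Q' = Q"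
    "min_part Q = greedy_cover.min_cut P a r"
proof -
  interpret G: greedy_cover P a r by (rule g)
  have jt: "\<exists>Q. has_jordan_type A Q" if "A \<in> nilcomm" for A
    using nilpotent_has_jordan_type[of A n n] that comm_carrier by (auto simp: nilcomm_def)
  obtain qs U where qs: "sorted_wrt (\<ge>) qs" "0 \<notin> set qs" "\<And>m. tail_sum qs m = min_defect nilcomm m"
    "zariski_open_in n nilcomm U" "U \<noteq> {}" "\<And>A. A \<in> U \<Longrightarrow> jordan_list A qs"
    "\<And>U' Q. zariski_open_in n nilcomm U' \<Longrightarrow> U' \<noteq> {} \<Longrightarrow> (\<And>A. A \<in> U' \<Longrightarrow> has_jordan_type A Q) \<Longrightarrow> Q = mset qs"
    by (rule generic_jordan_type[OF nilcomm_irreducible[OF inf] jt]) blast+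
  have low: "n \<le> d + max_chain_union P m" if X: "A \<in> nilcomm" "defect A m d" for A m d
  proof -
    obtain A' where A': "A' \<in> strict" "similar_mat A A'" by (rule nilcomm_similar_strict[OF X(1)])
    hence "defect A' m d" using X(2) defect_similar[OF A'(2)] by blast
    thus ?thesis using strict_defect_chains[OF A'(1)] card_D by simp
  qed
  have r0: "tail_sum qs r = 0"
  proof -
    have "level_pairs P r a"
      by unfold_locales (use G.spaced_a G.a_part G.a_lower G.parts_pos in auto)
    hence "\<exists>A\<in>nilcomm. defect A r 0"
      using level_defect_nilcomm[OF inf] G.U_chain_a card_D by fastforce
    thus ?thesis unfolding qs(3) min_defect_def by (intro Least_eq_0)
  qed
  have r1: "tail_sum qs (r - 1) = G.min_cut"
  proof -
    obtain t t' where t: "1 \<le> t" "t \<le> t'" "t' \<le> r" "G.lanes t = G.lanes t'" "G.min_cut = G.cut_value t t'"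
      by (rule G.min_cut_attained)
    obtain b where b: "spaced (r - 1) b" "D \<subseteq> U_chain P (r - 1) b \<union> G.cut_elems t t'"
      "\<forall>i. 1 \<le> i \<and> i \<le> r - 1 \<longrightarrow> (b i \<in># P \<or> b i + 1 \<in># P) \<and> 2 * i \<le> b i + 1"
      using G.U_chain_missing_cut[OF t(1-4)] by blast
    have "level_pairs P (r - 1) b" by unfold_locales (use b G.parts_pos in auto)
    then obtain A where A: "A \<in> nilcomm" "defect A (r - 1) (n - card (U_chain P (r - 1) b))"
      using level_defect_nilcomm[OF inf] by blast
    have "finite (U_chain P (r - 1) b)" by (rule finite_subset[OF U_chain_subset]) simp
    hence "n \<le> card (U_chain P (r - 1) b) + card (G.cut_elems t t')"
      using card_mono[OF _ b(2)] card_Un_le[of "U_chain P (r - 1) b" "G.cut_elems t t'"] G.finite_cut_elems card_D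
      by (metis finite_UnI le_trans)
    hence le: "n - card (U_chain P (r - 1) b) \<le> G.min_cut" using G.card_cut_elems[OF t(1-4)] t(5) by simp
    have "min_defect nilcomm (r - 1) = G.min_cut" unfolding min_defect_def
    proof (rule Least_equality)
      have ge: "G.min_cut \<le> d" if "\<exists>A\<in>nilcomm. defect A (r - 1) d" for d
        using that low G.max_union_last(1) card_D by fastforce
      have "n - card (U_chain P (r - 1) b) = G.min_cut" using le ge A by (meson le_antisym)
      thus "\<exists>A\<in>nilcomm. defect A (r - 1) G.min_cut" using A by metis
      show "G.min_cut \<le> d" if "\<exists>A\<in>nilcomm. defect A (r - 1) d" for d by (rule ge[OF that])
    qed
    thus ?thesis using qs(3) by simp
  qed
  have "drop r qs = []"
  proof (rule ccontr)
    assume "drop r qs \<noteq> []"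
    then obtain x xs where x: "drop r qs = x # xs" by (cases "drop r qs") auto
    hence "x = 0" using r0 by (simp add: tail_sum_def)
    moreover have "x \<in> set qs" using x by (metis in_set_dropD list.set_intros(1))
    ultimately show False using qs(2) by simp
  qed
  moreover have "r - 1 < length qs"
  proof (rule ccontr)
    assume "\<not> r - 1 < length qs"
    thus False using r1 G.min_cut_pos by (simp add: tail_sum_def)
  qed
  ultimately have len: "length qs = r" using G.r_pos by simp
  have last: "qs ! (r - 1) = G.min_cut"
  proof -
    have "drop (r - 1) qs = qs ! (r - 1) # drop r qs"
      using Cons_nth_drop_Suc[of "r - 1" qs] len G.r_pos by simp
    thus ?thesis using r1 \<open>drop r qs = []\<close> by (simp add: tail_sum_def)
  qed
  have "Min (set qs) = G.min_cut"
  proof (rule Min_eqI)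
    have "qs ! (r - 1) \<in> set qs" using len G.r_pos by (intro nth_mem) simp
    thus "G.min_cut \<in> set qs" unfolding last .
    fix y assume "y \<in> set qs"
    then obtain i where i: "i < r" "y = qs ! i" using len by (metis in_set_conv_nth)
    show "G.min_cut \<le> y"
    proof (cases "i = r - 1")
      case True
      thus ?thesis using i last by simp
    next
      case False
      thus ?thesis using sorted_wrt_nth_less[OF qs(1), of i "r - 1"] i len last by simp
    qed
  qed simp
  hence mp: "min_part (mset qs) = G.min_cut" by (simp add: min_part_def)
  have hj: "has_jordan_type A (mset qs)" if "A \<in> U" for A using qs(6)[OF that] by (simp add: jordan_list_def)
  show ?thesis
  proof (rule that[OF qs(4,5) hj])
    fix U' Q'
    assume "zariski_open_in n nilcomm U'" "U' \<noteq> {}" "\<And>A. A \<in> U' \<Longrightarrow> has_jordan_type A Q'"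
    thus "Q' = mset qs" by (rule qs(7))
  qed (assumption, rule mp)
qed

end

lemma min_generic_partition:
  assumes inf: "infinite (UNIV :: 'a::field set)" and g: "greedy_cover P a r"
  shows "min_part (generic_partition TYPE('a) P) = greedy_cover.min_cut P a r"
    and "min_part_seq (lambda_part P) = greedy_cover.min_cut P a r"
proof -
  define ps where "ps = rev (sorted_list_of_multiset P)"
  have ps: "mset ps = P" by (simp add: ps_def)
  define B :: "'a mat" where "B = nil_jordan ps"
  have sum: "sum_list ps = sum_mset P" using ps by (metis sum_mset_sum_list)
  have Bc: "B \<in> carrier_mat (sum_mset P) (sum_mset P)"
    unfolding B_def sum[symmetric] by (rule nil_jordan_carrier)
  interpret jordan_coords P "sum_mset P" "coord ps" B
  proof unfold_locales
    show "bij_betw (coord ps) {..<sum_mset P} (poset_elems P)" using coord_bij[of ps] by (simp only: ps sum)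
    show "B \<in> carrier_mat (sum_mset P) (sum_mset P)" by (rule Bc)
    show "B $$ (i, j) = (if coord ps j = up (coord ps i) then 1 else 0)" if "i < sum_mset P" "j < sum_mset P" for i j
      unfolding B_def by (rule nil_jordan_coord) (use that sum in simp_all)
  qed
  have B: "(nilpotent_jordan_matrix P :: 'a mat) = B" by (simp only: nilpotent_jordan_matrix_def B_def ps_def)
  have "dim_row B = sum_mset P" using Bc by blast
  hence X: "nilpotent_commutator (nilpotent_jordan_matrix P :: 'a mat) = nilcomm"
    unfolding B nilpotent_commutator_def commutator_mats_def nilcomm_def comm_def by simp
  obtain Q U where Q: "zariski_open_in (sum_mset P) nilcomm U" "U \<noteq> {}" "\<And>A. A \<in> U \<Longrightarrow> has_jordan_type A Q"
    "\<And>U' Q'. zariski_open_in (sum_mset P) nilcomm U' \<Longrightarrow> U' \<noteq> {} \<Longrightarrow> (\<And>A. A \<in> U' \<Longrightarrow> has_jordan_type A Q') \<Longrightarrow> Q' = Q"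
    "min_part Q = greedy_cover.min_cut P a r"
    by (rule min_generic_part[OF inf g]) blast+
  have "generic_partition TYPE('a) P = Q"
    unfolding generic_partition_def X
  proof (rule the_equality)
    show "\<exists>U. zariski_open_in (sum_mset P) nilcomm U \<and> U \<noteq> {} \<and> (\<forall>A\<in>U. has_jordan_type A Q)" using Q by blast
  qed (use Q(4) in blast)
  thus "min_part (generic_partition TYPE('a) P) = greedy_cover.min_cut P a r" using Q(5) by simp
  show "min_part_seq (lambda_part P) = greedy_cover.min_cut P a r" by (rule min_lambda[OF inf g])
qed

section \<open>Equality of the four minimal parts\<close>

theorem theorem4p1:
  fixes B :: "'k::field mat" and n :: nat and P :: "nat multiset"
  assumes "infinite (UNIV :: 'k set)"
    and "1 \<le> n"
    and "B \<in> carrier_mat n n"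
    and "nilpotent_mat B"
    and "has_jordan_type B P"
  shows "min_part (generic_partition TYPE('k) P) = min_part_seq (lambda_U_part P) \<and>
         min_part_seq (lambda_U_part P) = min_part_seq (lambda_part P) \<and>
         min_part_seq (lambda_part P) = mu P"
proof -
  obtain ps where ps: "mset ps = P" "jordan_nf B (map (\<lambda>p. (p, 0)) ps)"
    using assms(5) by (auto simp: has_jordan_type_def)
  have sim: "similar_mat B (nil_jordan ps)" and "0 \<notin> fst ` set (map (\<lambda>p. (p, 0 :: 'k)) ps)"
    using ps(2) by (simp_all add: jordan_nf_def)
  hence pos: "0 \<notin># P" using ps(1) by force
  have "P \<noteq> {#}"
  proof
    assume "P = {#}"
    hence empty: "ps = []" using ps(1) by simp
    hence "dim_row (nil_jordan ps :: 'k mat) = 0" using nil_jordan_carrier[of ps, where ?'a = 'k] by auto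
    moreover have "dim_row B = dim_row (nil_jordan ps :: 'k mat)"
      using similar_matD[OF sim] by (metis carrier_matD(1) insert_subset)
    ultimately show False using assms(2,3) empty by simp
  qed
  then obtain a r where g: "greedy_cover P a r" "greedy_cover.min_cut P a r = mu P"
    using greedy_cover_mu[OF pos] by blast
  show ?thesis
    using min_generic_partition[OF assms(1) g(1)] greedy_cover.min_lambda_U[OF g(1)] g(2) by simp
qed

end
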